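(* Let $G$ be a discrete countable group, let $\boldsymbol{\sigma}$ be an $\boldsymbol{\ell}$-stochastic sequence on $G$ such that $\sigma^{(0)}_{0,j}$ is supported on all of $G$ for every $j\in[\ell_0]$ and such that no $\sigma^{(n)}$ has a zero column, and let $\mathcal{U}$ be an ultrafilter on $(\frac12,1)$ with $\mathcal{U}\lim_a a=1$. Then the Poisson boundary $\mathcal{B}(G,\boldsymbol{\sigma})$ of $\boldsymbol{\sigma}$ is isomorphic (as a $\boldsymbol{\sigma}$-system) to $\mathfrak{B}_{\mathcal{U}}(\boldsymbol{\sigma})_{RN}$.
   Context: Stochastic sequences. $[\ell]=\{0,\dots,\ell-1\}$. Let $\boldsymbol{\ell}=(\ell_n)_{n\ge0}$ be positive integers, $\ell_{-1}=1$. An $\boldsymbol{\ell}$-stochastic sequence is $\boldsymbol{\sigma}=(\sigma^{(n)})_{n\ge0}$, $\sigma^{(n)}=(\sigma^{(n)}_{i,j})_{i\in[\ell_{n-1}],j\in[\ell_n]}$ a matrix of non-negative measures on $G$ with $\sum_j\sigma^{(n)}_{i,j}(G)=1$ for each $i$. No zero column: for all $n$, $j\in[\ell_n]$ there is $i$ with $\sigma^{(n)}_{i,j}(G)>0$. For $\mu$ on $G$ and $\nu$ on a $G$-space, $\mu*\nu=\sum_g\mu(g)\,g\nu$; matrices of measures are convolved by $(\sigma*\tau)_{i,k}=\sum_j\sigma_{i,j}*\tau_{j,k}$. $\boldsymbol{\sigma}$-systems. A $\boldsymbol{\sigma}$-system (or $\boldsymbol{\sigma}$-stationary space) $(X,\boldsymbol{\nu})$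 is a measurable space $X$ with a measurable $G$-action and $\boldsymbol{\nu}=(\nu^{(n)})_{n\ge-1}$, $\nu^{(n)}=(\nu^{(n)}_j)_{j\in[\ell_n]}$ columns of probability measures on $X$ with $\sigma^{(n)}*\nu^{(n)}=\nu^{(n-1)}$ for $n\ge0$. $L^\infty$ and null sets refer to $\nu^{(-1)}$. A factor $\pi:(X,\boldsymbol{\nu})\to(Y,\boldsymbol{m})$ is a measurable $G$-map with $\pi_*\nu^{(n)}_j=m^{(n)}_j$; it is a measure preserving extension if $\frac{dg\nu^{(n)}_i}{d\nu^{(-1)}}=\frac{dg m^{(n)}_i}{dm^{(-1)}}\circ\pi$ for all $n,i,g$. The Radon–Nikodym factor $\mathcal{X}_{RN}$ of a $\boldsymbol{\sigma}$-system is the measure preserving factor $\mathcal{X}\to\mathcal{X}_{RN}$ through which every... more precisely, such that for every measure preserving extension $p:\mathcal{X}\to\mathcal{Y}$ the map $\mathcal{X}\to\mathcal{X}_{RN}$ is $q\circ p$ for a measure preserving extension $q:\mathcal{Y}\to\mathcal{X}_{RN}$ (it exists, is unique, and is realized on a standard Borel space modelling the $\sigma$-algebra generated by the functions $\frac{dg\nu^{(n)}_i}{d\nu^{(-1)}}$). Poisson boundary. $V_n=[\ell_n]\times G$ with $G$ acting by left translation on the second coordinate, $\Omega=\prod_{n\ge0}V_n$ with coordinates $X_n$, and $\mathbb{P}$ the Markov measure on $\Omega$ with initial distribution $\sigma^{(0)}$ and transition probabilities $(i,g)\to(j,h)$ from $V_{n-1}$ to $V_n$ equal to $\sigma^{(n)}_{i,j}(g^{-1}h)$.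 $\mathcal{A}_\Omega=\bigcap_m\sigma(X_k:k\ge m)$. $\mathbb{P}^{(m)}_{j}$ is the law (on $\sigma(X_k:k\ge m)$) of the same walk started at $(j,e)\in V_m$ at time $m$, and $\mathbb{P}^{(-1)}=\mathbb{P}$; then $(\Omega,\mathcal{A}_\Omega,(\mathbb{P}^{(m)})_m)$ is a $\boldsymbol{\sigma}$-system. $\mathcal{B}(G,\boldsymbol{\sigma})$ is the (unique up to isomorphism) $\boldsymbol{\sigma}$-system $(B,\boldsymbol{\nu})$ on a standard Borel space with a $G$-equivariant isomorphism $L^\infty(B,\nu^{(-1)})\cong L^\infty(\Omega,\mathcal{A}_\Omega,\mathbb{P})$ under which $\nu^{(m)}_j$ corresponds to $\mathbb{P}^{(m)}_j$. Ultralimit system. $E=\coprod_{n\ge0}\{n\}\times[\ell_n]\times G$ with $G$ acting by left multiplication on each copy of $G$. For $0<a<1$, $t\ge-1$, $r\in[\ell_t]$ define the probability measure on $E$ $$\nu^{(t)}_{r,a;0}(n,j,g)=\frac{1-a}{a^{t+1}}\,\mathbf{1}_{n\ge t+1}\,a^n\,(\sigma^{(t+1)}*\cdots*\sigma^{(n)})_{r,j}(g).$$ $\mathcal{U}\lim_aE$ is the set of classes $[x_a]$ of families in $E$ modulo equality on a set in $\mathcal{U}$, with the $\sigma$-algebra generated by the sets $\mathcal{U}\lim A_a=\{[x_a]:\{a:x_a\in A_a\}\in\mathcal{U}\}$ and the action $g[x_a]=[gx_a]$; for probability measures $\eta_a$ on $E$, $\mathcal{U}\lim\eta_a$ is the unique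 probability measure with $(\mathcal{U}\lim\eta_a)(\mathcal{U}\lim A_a)=\mathcal{U}\lim\eta_a(A_a)$. $\mathfrak{B}_{\mathcal{U}}(\boldsymbol{\sigma})$ is the $\boldsymbol{\sigma}$-system $\mathcal{U}\lim_aE$ with measures $\nu^{(t)}_r=\mathcal{U}\lim_a\nu^{(t)}_{r,a;0}$. *)

theory Defs
  imports "HOL-Probability.Probability"
begin

(* Levels are shifted by one throughout, so that they start at 0: level 0 is the index -1 of
   the mathematics and level (Suc n) is the index n. The discrete group is a type of class
   group_add, which is written additively but is not assumed commutative. A measure on the
   group is its mass function. *)

primrec ldim :: "(nat \<Rightarrow> nat) \<Rightarrow> nat \<Rightarrow> nat" where
  "ldim l 0 = 1"
| "ldim l (Suc n) = l n"

(* \<sigma> n i j has row index i < ldim l n and column index j < l n = ldim l (Suc n);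
   values of \<sigma> outside these ranges are irrelevant. *)
type_synonym 'g mseq = "nat \<Rightarrow> nat \<Rightarrow> nat \<Rightarrow> 'g \<Rightarrow> ennreal"

definition stochastic_sequence :: "(nat \<Rightarrow> nat) \<Rightarrow> 'g mseq \<Rightarrow> bool" where
  "stochastic_sequence l \<sigma> \<longleftrightarrow> (\<forall>n. 0 < l n) \<and>
     (\<forall>n. \<forall>i<ldim l n. (\<Sum>j<l n. \<integral>\<^sup>+g. \<sigma> n i j g \<partial>count_space UNIV) = 1)"

definition no_zero_column :: "(nat \<Rightarrow> nat) \<Rightarrow> 'g mseq \<Rightarrow> bool" where
  "no_zero_column l \<sigma> \<longleftrightarrow>
     (\<forall>n. \<forall>j<l n. \<exists>i<ldim l n. 0 < (\<integral>\<^sup>+g. \<sigma> n i j g \<partial>count_space UNIV))"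

definition mconv :: "nat \<Rightarrow> (nat \<Rightarrow> nat \<Rightarrow> 'g \<Rightarrow> ennreal) \<Rightarrow> (nat \<Rightarrow> nat \<Rightarrow> 'g \<Rightarrow> ennreal) \<Rightarrow>
    nat \<Rightarrow> nat \<Rightarrow> 'g::group_add \<Rightarrow> ennreal" where
  "mconv d S T i k g = (\<Sum>j<d. \<integral>\<^sup>+h. S i j h * T j k (- h + g) \<partial>count_space UNIV)"

(* mprod l \<sigma> s k = \<sigma> s * ... * \<sigma> (s + k), a product of k + 1 matrices *)
primrec mprod :: "(nat \<Rightarrow> nat) \<Rightarrow> 'g::group_add mseq \<Rightarrow> nat \<Rightarrow> nat \<Rightarrow>
    nat \<Rightarrow> nat \<Rightarrow> 'g \<Rightarrow> ennreal" where
  "mprod l \<sigma> s 0 = \<sigma> s"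
| "mprod l \<sigma> s (Suc k) = mconv (l (s + k)) (mprod l \<sigma> s k) (\<sigma> (s + Suc k))"


section \<open>Stationary systems and their factors\<close>

(* nu X s j is the j-th measure at level s, for j < ldim l s. The underlying measurable space
   is that of the single measure at level 0. *)
record ('g, 'x) gsystem =
  act :: "'g \<Rightarrow> 'x \<Rightarrow> 'x"
  nu :: "nat \<Rightarrow> nat \<Rightarrow> 'x measure"

abbreviation base :: "('g, 'x) gsystem \<Rightarrow> 'x measure" where
  "base X \<equiv> nu X 0 0"

definition translate :: "('g, 'x) gsystem \<Rightarrow> 'g \<Rightarrow> 'x measure \<Rightarrow> 'x measure" where
  "translate X g M = distr M (base X) (act X g)"

definition sigma_system :: "(nat \<Rightarrow> nat) \<Rightarrow> 'g::group_add mseq \<Rightarrow> ('g, 'x) gsystem \<Rightarrow> bool" where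
  "sigma_system l \<sigma> X \<longleftrightarrow>
     (\<forall>s. \<forall>j<ldim l s. prob_space (nu X s j) \<and> sets (nu X s j) = sets (base X)) \<and>
     (\<forall>g. act X g \<in> base X \<rightarrow>\<^sub>M base X) \<and>
     (\<forall>x\<in>space (base X). act X 0 x = x) \<and>
     (\<forall>g h. \<forall>x\<in>space (base X). act X (g + h) x = act X g (act X h x)) \<and>
     (\<forall>n. \<forall>i<ldim l n. \<forall>A\<in>sets (base X).
        emeasure (nu X n i) A =
        (\<Sum>j<l n. \<integral>\<^sup>+g. \<sigma> n i j g * emeasure (translate X g (nu X (Suc n) j)) A
           \<partial>count_space UNIV))"

(* As everything is taken modulo null sets of the base measure, equivariance is required
   almost everywhere. *)
definition factor_map :: "(nat \<Rightarrow> nat) \<Rightarrow> 'g::group_add mseq \<Rightarrow>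
    ('g, 'x) gsystem \<Rightarrow> ('g, 'y) gsystem \<Rightarrow> ('x \<Rightarrow> 'y) \<Rightarrow> bool" where
  "factor_map l \<sigma> X Y \<pi> \<longleftrightarrow>
     sigma_system l \<sigma> X \<and> sigma_system l \<sigma> Y \<and>
     \<pi> \<in> base X \<rightarrow>\<^sub>M base Y \<and>
     (\<forall>g. AE x in base X. \<pi> (act X g x) = act Y g (\<pi> x)) \<and>
     (\<forall>s. \<forall>j<ldim l s. distr (nu X s j) (base Y) \<pi> = nu Y s j)"

definition mp_extension :: "(nat \<Rightarrow> nat) \<Rightarrow> 'g::group_add mseq \<Rightarrow>
    ('g, 'x) gsystem \<Rightarrow> ('g, 'y) gsystem \<Rightarrow> ('x \<Rightarrow> 'y) \<Rightarrow> bool" where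
  "mp_extension l \<sigma> X Y \<pi> \<longleftrightarrow>
     factor_map l \<sigma> X Y \<pi> \<and>
     (\<forall>s. \<forall>i<ldim l s. \<forall>g. AE x in base X.
        RN_deriv (base X) (translate X g (nu X s i)) x =
        RN_deriv (base Y) (translate Y g (nu Y s i)) (\<pi> x))"

definition system_iso :: "(nat \<Rightarrow> nat) \<Rightarrow> 'g::group_add mseq \<Rightarrow>
    ('g, 'x) gsystem \<Rightarrow> ('g, 'y) gsystem \<Rightarrow> bool" where
  "system_iso l \<sigma> X Y \<longleftrightarrow>
     (\<exists>\<phi> \<psi>. factor_map l \<sigma> X Y \<phi> \<and> factor_map l \<sigma> Y X \<psi> \<and>
        (AE x in base X. \<psi> (\<phi> x) = x) \<and> (AE y in base Y. \<phi> (\<psi> y) = y))"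

definition standard_borel :: "'a measure \<Rightarrow> bool" where
  "standard_borel M \<longleftrightarrow>
     (\<exists>T. topspace T = space M \<and> completely_metrizable_space T \<and> second_countable T \<and>
        sets M = sigma_sets (space M) {U. openin T U})"

(* Y ranges over systems carried by the type of X, since a predicate cannot quantify over types.
   This loses nothing: for p from X to some other Y, restrict p to an invariant conull set where
   it is equivariant and transport its image, which has full outer measure, to a set of
   representatives of the fibres of p; the resulting q extends to Y because Z is standard. *)
definition rn_factor :: "(nat \<Rightarrow> nat) \<Rightarrow> 'g::group_add mseq \<Rightarrow>
    ('g, 'x) gsystem \<Rightarrow> ('g, 'z) gsystem \<Rightarrow> bool" where
  "rn_factor l \<sigma> X Z \<longleftrightarrow>
     standard_borel (base Z) \<and>
     (\<exists>\<pi>. mp_extension l \<sigma> X Z \<pi> \<and>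
        (\<forall>(Y :: ('g, 'x) gsystem) p. mp_extension l \<sigma> X Y p \<longrightarrow>
           (\<exists>q. mp_extension l \<sigma> Y Z q \<and> (AE x in base X. \<pi> x = q (p x)))))"


section \<open>Poisson boundary\<close>

definition Vset :: "(nat \<Rightarrow> nat) \<Rightarrow> nat \<Rightarrow> (nat \<times> 'g) set" where
  "Vset l n = {..<l n} \<times> UNIV"

definition step :: "(nat \<Rightarrow> nat) \<Rightarrow> 'g::group_add mseq \<Rightarrow> nat \<Rightarrow> nat \<times> 'g \<Rightarrow> (nat \<times> 'g) measure" where
  "step l \<sigma> n = (\<lambda>(i, g). density (count_space (Vset l n)) (\<lambda>(j, h). \<sigma> n i j (- g + h)))"

(* The walk started at (j, 0) at level s, that is, at time s - 1; for s = 0 and j = 0 its first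
   step has distribution \<sigma> 0. The coordinates before the starting time are given a dummy value;
   they are not seen by the tail events, to which the law is restricted below. *)
definition walk_kernel :: "(nat \<Rightarrow> nat) \<Rightarrow> 'g::group_add mseq \<Rightarrow> nat \<Rightarrow> nat \<Rightarrow>
    nat \<Rightarrow> (nat \<Rightarrow> nat \<times> 'g) \<Rightarrow> (nat \<times> 'g) measure" where
  "walk_kernel l \<sigma> s j n \<omega> =
     (if Suc n < s then return (count_space (Vset l n)) (0, 0)
      else if Suc n = s then return (count_space (Vset l n)) (j, 0)
      else step l \<sigma> n (if n = s then (j, 0) else \<omega> (n - 1)))"

(* the measure on the path space given by the Ionescu-Tulcea theorem *)
definition walk :: "(nat \<Rightarrow> nat) \<Rightarrow> 'g::group_add mseq \<Rightarrow> nat \<Rightarrow> nat \<Rightarrow>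
    (nat \<Rightarrow> nat \<times> 'g) measure" where
  "walk l \<sigma> s j =
     projective_family.lim UNIV
       (Ionescu_Tulcea.CI (walk_kernel l \<sigma> s j) (\<lambda>n. count_space (Vset l n)))
       (\<lambda>n. count_space (Vset l n))"

definition path_space :: "(nat \<Rightarrow> nat) \<Rightarrow> (nat \<Rightarrow> nat \<times> 'g) set" where
  "path_space l = (\<Pi>\<^sub>E n\<in>UNIV. Vset l n)"

definition tail_sets :: "(nat \<Rightarrow> nat) \<Rightarrow> (nat \<Rightarrow> nat \<times> 'g) set set" where
  "tail_sets l =
     (\<Inter>m. sigma_sets (path_space l)
        {{\<omega> \<in> path_space l. \<omega> k \<in> A} | k A. m \<le> k \<and> A \<subseteq> Vset l k})"

definition tail_system :: "(nat \<Rightarrow> nat) \<Rightarrow> 'g::group_add mseq \<Rightarrow>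
    ('g, nat \<Rightarrow> nat \<times> 'g) gsystem" where
  "tail_system l \<sigma> =
     \<lparr> act = (\<lambda>g \<omega> n. (fst (\<omega> n), g + snd (\<omega> n))),
       nu = (\<lambda>s j. restr_to_subalg (walk l \<sigma> s j) (sigma (path_space l) (tail_sets l))) \<rparr>"

definition Linf :: "'x measure \<Rightarrow> ('x \<Rightarrow> complex) set" where
  "Linf M = {f \<in> borel_measurable M. \<exists>C. AE x in M. norm (f x) \<le> C}"

(* A *-isomorphism of the L-infinity algebras of classes modulo null functions, acting on
   representatives; (g f)(x) = f (g^{-1} x), and the last clause says that the measures
   correspond. *)
definition Linf_iso :: "(nat \<Rightarrow> nat) \<Rightarrow> ('g::group_add, 'x) gsystem \<Rightarrow> ('g, 'y) gsystem \<Rightarrow>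
    (('x \<Rightarrow> complex) \<Rightarrow> ('y \<Rightarrow> complex)) \<Rightarrow> bool" where
  "Linf_iso l X Y \<Phi> \<longleftrightarrow>
     (\<forall>f\<in>Linf (base X). \<Phi> f \<in> Linf (base Y)) \<and>
     (\<forall>f\<in>Linf (base X). \<forall>f'\<in>Linf (base X).
        (AE x in base X. f x = f' x) \<longleftrightarrow> (AE y in base Y. \<Phi> f y = \<Phi> f' y)) \<and>
     (\<forall>h\<in>Linf (base Y). \<exists>f\<in>Linf (base X). AE y in base Y. \<Phi> f y = h y) \<and>
     (\<forall>f\<in>Linf (base X). \<forall>f'\<in>Linf (base X).
        (AE y in base Y. \<Phi> (\<lambda>x. f x + f' x) y = \<Phi> f y + \<Phi> f' y) \<and>
        (AE y in base Y. \<Phi> (\<lambda>x. f x * f' x) y = \<Phi> f y * \<Phi> f' y)) \<and>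
     (\<forall>f\<in>Linf (base X).
        (\<forall>c. AE y in base Y. \<Phi> (\<lambda>x. c * f x) y = c * \<Phi> f y) \<and>
        (AE y in base Y. \<Phi> (\<lambda>x. cnj (f x)) y = cnj (\<Phi> f y))) \<and>
     (\<forall>f\<in>Linf (base X). \<forall>g.
        AE y in base Y. \<Phi> (\<lambda>x. f (act X (- g) x)) y = \<Phi> f (act Y (- g) y)) \<and>
     (\<forall>f\<in>Linf (base X). \<forall>s. \<forall>j<ldim l s. (\<integral>x. f x \<partial>nu X s j) = (\<integral>y. \<Phi> f y \<partial>nu Y s j))"

definition poisson_boundary :: "(nat \<Rightarrow> nat) \<Rightarrow> 'g::group_add mseq \<Rightarrow> ('g, 'b) gsystem \<Rightarrow> bool" where
  "poisson_boundary l \<sigma> B \<longleftrightarrow>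
     sigma_system l \<sigma> B \<and> standard_borel (base B) \<and> (\<exists>\<Phi>. Linf_iso l B (tail_system l \<sigma>) \<Phi>)"


section \<open>Ultralimit system\<close>

definition ultrafilter :: "'a filter \<Rightarrow> bool" where
  "ultrafilter F \<longleftrightarrow> F \<noteq> bot \<and> (\<forall>P. eventually P F \<or> eventually (\<lambda>a. \<not> P a) F)"

definition Eset :: "(nat \<Rightarrow> nat) \<Rightarrow> (nat \<times> nat \<times> 'g) set" where
  "Eset l = {(n, j, g). j < l n}"

definition Eact :: "'g::group_add \<Rightarrow> nat \<times> nat \<times> 'g \<Rightarrow> nat \<times> nat \<times> 'g" where
  "Eact g = (\<lambda>(n, j, h). (n, j, g + h))"

(* the measure \<nu>^(t)_{r,a;0} with t = s - 1 *)
definition abel_measure :: "(nat \<Rightarrow> nat) \<Rightarrow> 'g::group_add mseq \<Rightarrow> nat \<Rightarrow> nat \<Rightarrow> real \<Rightarrow>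
    (nat \<times> nat \<times> 'g) measure" where
  "abel_measure l \<sigma> s r a =
     density (count_space (Eset l))
       (\<lambda>(n, j, g). if s \<le> n
          then ennreal ((1 - a) / a ^ s * a ^ n) * mprod l \<sigma> s (n - s) r j g else 0)"

abbreviation params :: "real set" where
  "params \<equiv> {1/2<..<1}"

(* The ultrafilter on the interval is represented by a filter on the reals that contains it. *)
definition ul_eq :: "real filter \<Rightarrow> 'e set \<Rightarrow> ((real \<Rightarrow> 'e) \<times> (real \<Rightarrow> 'e)) set" where
  "ul_eq U E = {(x, y). x \<in> params \<rightarrow>\<^sub>E E \<and> y \<in> params \<rightarrow>\<^sub>E E \<and> eventually (\<lambda>a. x a = y a) U}"

definition ul_points :: "real filter \<Rightarrow> 'e set \<Rightarrow> (real \<Rightarrow> 'e) set set" where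
  "ul_points U E = (params \<rightarrow>\<^sub>E E) // ul_eq U E"

definition ul_set :: "real filter \<Rightarrow> 'e set \<Rightarrow> (real \<Rightarrow> 'e set) \<Rightarrow> (real \<Rightarrow> 'e) set set" where
  "ul_set U E A = {c \<in> ul_points U E. \<exists>x\<in>c. eventually (\<lambda>a. x a \<in> A a) U}"

definition ul_measure :: "real filter \<Rightarrow> 'e set \<Rightarrow> (real \<Rightarrow> 'e measure) \<Rightarrow>
    (real \<Rightarrow> 'e) set measure" where
  "ul_measure U E \<eta> =
     extend_measure (ul_points U E) {A. \<forall>a. A a \<subseteq> E} (ul_set U E)
       (\<lambda>A. Lim U (\<lambda>a. emeasure (\<eta> a) (A a)))"

definition ul_system :: "real filter \<Rightarrow> (nat \<Rightarrow> nat) \<Rightarrow> 'g::group_add mseq \<Rightarrow>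
    ('g, (real \<Rightarrow> nat \<times> nat \<times> 'g) set) gsystem" where
  "ul_system U l \<sigma> =
     \<lparr> act = (\<lambda>g c. ul_eq U (Eset l) `` ((\<lambda>x. \<lambda>a\<in>params. Eact g (x a)) ` c)),
       nu = (\<lambda>s r. ul_measure U (Eset l) (abel_measure l \<sigma> s r)) \<rparr>"

end

theory Submission
  imports Defs
begin

text \<open>Both systems have the same Radon--Nikodym model, and the Poisson boundary is that
  model.

  Let a \<sigma>-system have base measure \<nu>. The hypotheses on \<sigma> make every translate
  of every measure of the system absolutely continuous with respect to \<nu>, and the list of all
  the derivatives maps the system to the space of real sequences. The group acts there through the
  cocycle identity, so the image is again a system, \<open>rn_model\<close>; the map is a measure
  preserving extension, and the model is the Radon--Nikodym factor
  (\<open>rn_factor_rn_model\<close>, \<open>rn_factor_unique\<close>). The model depends only on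
  the law of the derivatives under \<nu>.

  Fix g, a positive level and a column index, and consider the ratios of the transition
  probabilities of the walk with this start, translated by g, to those of the walk that defines
  the base measure. They are bounded uniformly in time, because the latter walk reaches any given
  state with positive probability. On the ultralimit, the ratio of the two Abel averages at a
  point is this ratio up to a factor tending to 1, so the derivative is the ultralimit of the
  ratios (\<open>rn_ul\<close>). On the tail, the ratios along the walk form a reverse martingale,
  which converges in mean to the derivative (\<open>martin_tendsto_rn\<close>). A bounded
  continuous function of finitely many ratios therefore has expectations along the walk that
  converge to the expectation for the tail; the integral against the Abel average is the Abel mean
  of these expectations, so the ultralimit has the same expectation. Thus the derivatives have the
  same law in both systems (\<open>law_rn_map_pos\<close>, \<open>tail_mp_extension\<close>), and
  the models agree.

  Finally, the derivatives generate the tail sets modulo null sets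
  (\<open>tail_sets_generated_by_rn\<close>): by the Markov property, the conditional expectation
  of a cylinder given the tail is a multiple of one of them. So the algebra of bounded functions
  on the model is that of the tail, and an isomorphism from another standard Borel system is
  induced by a point map (\<open>Linf_iso_point_map\<close>); the model is the Poisson boundary,
  up to isomorphism.\<close>


section \<open>Standard Borel spaces\<close>

lemma (in Metric_space) geometric_dist_le:
  assumes s: "\<And>n. s n \<in> M" and step: "\<And>n. d (s n) (s (Suc n)) < 2 * (1/2)^n"
  shows "d (s n) (s (n + m)) \<le> 4 * (1/2)^n - 4 * (1/2)^(n+m)"
proof (induction m)
  case 0
  then show ?case using s by simp
next
  case (Suc m)
  have "d (s n) (s (n + Suc m)) \<le> d (s n) (s (n + m)) + d (s (n+m)) (s (Suc (n+m)))"
    using triangle[OF s s s] by simp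
  also have "\<dots> \<le> (4 * (1/2)^n - 4 * (1/2)^(n+m)) + 2 * (1/2)^(n+m)"
    using Suc step[of "n+m"] by simp
  finally show ?case by simp
qed

lemma (in Metric_space) geometric_MCauchy:
  assumes s: "\<And>n. s n \<in> M" and step: "\<And>n. d (s n) (s (Suc n)) < 2 * (1/2)^n"
  shows "MCauchy s"
  unfolding MCauchy_def
proof (intro conjI allI impI)
  show "range s \<subseteq> M" using s by auto
  fix e :: real assume "e > 0"
  then obtain N where N: "(1/2::real)^N < e/8"
    using real_arch_pow_inv[of "e/8" "1/2"] by auto
  have *: "d (s N) (s n) \<le> 4 * (1/2)^N" if "N \<le> n" for n
  proof -
    have "d (s N) (s (N + (n - N))) \<le> 4 * (1/2)^N - 4 * (1/2)^(N + (n-N))"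
      by (rule geometric_dist_le[OF s step])
    also have "\<dots> \<le> 4 * (1/2)^N" by simp
    finally show ?thesis using that by simp
  qed
  show "\<exists>N. \<forall>n n'. N \<le> n \<longrightarrow> N \<le> n' \<longrightarrow> d (s n) (s n') < e"
  proof (intro exI[of _ N] allI impI)
    fix n n' assume n: "N \<le> n" "N \<le> n'"
    have "d (s n) (s n') \<le> d (s n) (s N) + d (s N) (s n')" using triangle s by auto
    also have "\<dots> \<le> 4 * (1/2)^N + 4 * (1/2)^N"
      using *[OF n(1)] *[OF n(2)] commute[of "s n" "s N"] by linarith
    finally show "d (s n) (s n') < e" using N by linarith
  qed
qed

lemma (in Metric_space) geometric_limit_dist:
  assumes s: "\<And>n. s n \<in> M" and step: "\<And>n. d (s n) (s (Suc n)) < 2 * (1/2)^n"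
    and lim: "limitin mtopology s x sequentially"
  shows "d (s n) x \<le> 5 * (1/2)^n"
proof -
  have x: "x \<in> M" using lim limitin_mspace by blast
  have "eventually (\<lambda>m. d (s m) x < (1/2)^n) sequentially"
    using lim unfolding limitin_metric by (auto elim!: allE[of _ "(1/2)^n"] eventually_mono)
  then obtain m where m: "m \<ge> n" "d (s m) x < (1/2)^n"
    unfolding eventually_sequentially by (metis nle_le)
  have "d (s n) x \<le> d (s n) (s m) + d (s m) x" using triangle s x by auto
  moreover have "d (s n) (s m) \<le> 4 * (1/2)^n - 4 * (1/2)^m"
    using geometric_dist_le[OF s step, of n "m - n"] m by simp
  ultimately show ?thesis using m(2) zero_le_power[of "1/2::real" m] by linarith
qed

text \<open>A point of a standard Borel space is coded by the sequence of truth values of its membership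
  in countably many balls; the decoding map picks for each scale a centre of a ball
  that contains the point, and passes to the limit.\<close>

lemma standard_borel_coding:
  assumes "standard_borel M" and "space M \<noteq> {}"
  shows "\<exists>(A :: nat \<Rightarrow> 'a set) \<kappa>. (\<forall>n. A n \<in> sets M) \<and>
    \<kappa> \<in> (\<Pi>\<^sub>M n\<in>UNIV. count_space (UNIV :: bool set)) \<rightarrow>\<^sub>M M \<and>
    (\<forall>x\<in>space M. \<kappa> (\<lambda>n. x \<in> A n) = x)"
proof -
  obtain T where T: "topspace T = space M" "completely_metrizable_space T" "second_countable T"
    "sets M = sigma_sets (space M) {U. openin T U}"
    using assms unfolding standard_borel_def by auto
  obtain X d where X: "Metric_space X d" "Metric_space.mcomplete X d" "T = Metric_space.mtopology X d"
    using T(2) unfolding completely_metrizable_space_def by auto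
  interpret Metric_space X d by fact
  have sp: "space M = X" using T(1) X(3) by simp
  obtain D where D: "countable D" "D \<subseteq> X" "T closure_of D = X"
    using second_countable_imp_separable_space[OF T(3)] unfolding separable_space_def
    using X(3) by auto
  have "D \<noteq> {}"
    using D(3) sp assms(2) by auto
  define c where "c = from_nat_into D"
  have c: "c n \<in> X" for n
    using from_nat_into[OF \<open>D \<noteq> {}\<close>] D(2) unfolding c_def by auto
  have dense: "\<exists>k. d (c k) x < e" if "x \<in> X" "e > 0" for x e
  proof -
    have "openin T (mball x e)" using X(3) by simp
    moreover have "x \<in> mball x e" using that by simp
    ultimately have "mball x e \<inter> D \<noteq> {}"
      using D(3) that(1)
      by (metis Int_iff empty_iff in_closure_of)
    then obtain y where "y \<in> D" "d x y < e" by auto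
    then show ?thesis
      using from_nat_into_surj[OF D(1)] commute unfolding c_def by metis
  qed
  define B where "B n k = mball (c k) ((1/2)^n)" for n k
  define A where "A m = (case prod_decode m of (n, k) \<Rightarrow> B n k)" for m
  have A_sets: "A m \<in> sets M" for m
    unfolding T(4) A_def B_def by (auto split: prod.split intro!: sigma_sets.Basic simp: X(3))
  let ?P = "(\<Pi>\<^sub>M n\<in>(UNIV::nat set). count_space (UNIV :: bool set))"
  \<comment> \<open>At scale n the code picks the first centre whose ball contains the point; a sequence of truth
    values whose centres do not close up geometrically is decoded arbitrarily.\<close>
  define s where "s b n = (LEAST k. b (prod_encode (n, k)))" for b :: "nat \<Rightarrow> bool" and n
  have s_meas[measurable]: "(\<lambda>b. s b n) \<in> ?P \<rightarrow>\<^sub>M count_space UNIV" for n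
    unfolding s_def by measurable
  define good where "good b \<longleftrightarrow> (\<forall>n. d (c (s b n)) (c (s b (Suc n))) < 2 * (1/2)^n)" for b
  have good_meas[measurable]: "Measurable.pred ?P good"
  proof -
    have "(\<lambda>b. (s b n, s b (Suc n))) \<in> ?P \<rightarrow>\<^sub>M count_space UNIV" for n
      by (rule measurable_compose_countable'[where g="\<lambda>b. s b n" and I=UNIV and f="\<lambda>i b. (i, s b (Suc n))"])
         (auto intro!: measurable_compose[OF s_meas])
    then have "Measurable.pred ?P (\<lambda>b. (\<lambda>(k,k'). d (c k) (c k') < 2 * (1/2)^n) (s b n, s b (Suc n)))" for n
      by (rule measurable_compose) simp
    then show ?thesis unfolding good_def by (simp, measurable)
  qed
  obtain z where z: "z \<in> X" using assms(2) sp by auto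
  define lm where "lm b = (SOME x. limitin mtopology (\<lambda>n. c (s b n)) x sequentially)" for b
  define \<kappa> where "\<kappa> b = (if good b then lm b else z)" for b
  have lm: "limitin mtopology (\<lambda>n. c (s b n)) (lm b) sequentially" if "good b" for b
  proof -
    have "MCauchy (\<lambda>n. c (s b n))"
      by (rule geometric_MCauchy) (use that c in \<open>auto simp: good_def\<close>)
    then show ?thesis using X(2) unfolding mcomplete_def lm_def by (metis someI_ex)
  qed
  have lmX: "lm b \<in> X" if "good b" for b using lm[OF that] limitin_mspace by blast
  have lm_d: "d (c (s b n)) (lm b) \<le> 5 * (1/2)^n" if "good b" for b n
    by (rule geometric_limit_dist[where s="\<lambda>n. c (s b n)"]) (use that c lm in \<open>auto simp: good_def\<close>)
  have \<kappa>_meas: "\<kappa> \<in> ?P \<rightarrow>\<^sub>M M"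
  proof (rule measurable_sigma_sets[OF T(4)])
    show "{U. openin T U} \<subseteq> Pow (space M)" using openin_subset T(1) by auto
    show "\<kappa> \<in> space ?P \<rightarrow> space M" using lmX z sp by (auto simp: \<kappa>_def)
    fix U assume "U \<in> {U. openin T U}"
    then have U: "openin mtopology U" using X(3) by simp
    \<comment> \<open>The limit lies within 5 / 2^n of the n-th centre, so the factor 10 works in both directions.\<close>
    have "lm b \<in> U \<longleftrightarrow> (\<exists>n. mball (c (s b n)) (10 * (1/2)^n) \<subseteq> U)" if g: "good b" for b
    proof
      assume "lm b \<in> U"
      then obtain e where e: "e > 0" "mball (lm b) e \<subseteq> U"
        using U unfolding openin_mtopology by auto
      obtain n where n: "(1/2::real)^n < e/15"
        using real_arch_pow_inv[of "e/15" "1/2"] e by auto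
      have "mball (c (s b n)) (10 * (1/2)^n) \<subseteq> mball (lm b) e"
      proof
        fix y assume y: "y \<in> mball (c (s b n)) (10 * (1/2)^n)"
        then have "d (lm b) y \<le> d (lm b) (c (s b n)) + d (c (s b n)) y"
          using triangle lmX[OF g] c by auto
        also have "\<dots> < 5 * (1/2)^n + 10 * (1/2)^n"
          using lm_d[OF g, of n] y commute[of "lm b"] by auto
        finally show "y \<in> mball (lm b) e" using n y lmX[OF g] by auto
      qed
      then show "\<exists>n. mball (c (s b n)) (10 * (1/2)^n) \<subseteq> U" using e by blast
    next
      assume "\<exists>n. mball (c (s b n)) (10 * (1/2)^n) \<subseteq> U"
      then obtain n where n: "mball (c (s b n)) (10 * (1/2)^n) \<subseteq> U" ..
      have "d (c (s b n)) (lm b) < 10 * (1/2)^n"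
        using lm_d[OF g, of n] zero_less_power[of "1/2::real" n] by linarith
      then show "lm b \<in> U" using n lmX[OF g] c by auto
    qed
    then have "\<kappa> b \<in> U \<longleftrightarrow> (if good b then \<exists>n. mball (c (s b n)) (10 * (1/2)^n) \<subseteq> U else z \<in> U)" for b
      by (simp add: \<kappa>_def)
    then have *: "\<kappa> -` U \<inter> space ?P =
      {b\<in>space ?P. if good b then \<exists>n. mball (c (s b n)) (10 * (1/2)^n) \<subseteq> U else z \<in> U}"
      by blast
    have "Measurable.pred ?P (\<lambda>b. mball (c (s b n)) (10 * (1/2)^n) \<subseteq> U)" for n
      by (rule measurable_compose[OF s_meas]) simp
    then have "Measurable.pred ?P (\<lambda>b. if good b then \<exists>n. mball (c (s b n)) (10 * (1/2)^n) \<subseteq> U else z \<in> U)"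
      by measurable
    then show "\<kappa> -` U \<inter> space ?P \<in> sets ?P"
      unfolding * by (simp add: pred_def)
  qed
  have "\<kappa> (\<lambda>n. x \<in> A n) = x" if x: "x \<in> X" for x
  proof -
    define b where "b = (\<lambda>n. x \<in> A n)"
    have "d (c (s b n)) x < (1/2)^n" for n
    proof -
      have bk: "b (prod_encode (n, k)) \<longleftrightarrow> d (c k) x < (1/2)^n" for k
        using x c by (auto simp: b_def A_def B_def)
      show ?thesis unfolding bk[symmetric] s_def
        by (rule LeastI_ex) (use dense[OF x, of "(1/2)^n"] bk in auto)
    qed note dx = this
    have "good b" unfolding good_def
    proof
      fix n
      have "d (c (s b n)) (c (s b (Suc n))) \<le> d (c (s b n)) x + d x (c (s b (Suc n)))"
        using triangle c x by auto
      also have "\<dots> < (1/2)^n + (1/2)^(Suc n)"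
        using dx[of n] dx[of "Suc n"] commute[of x] by (intro add_strict_mono) auto
      also have "\<dots> \<le> 2 * (1/2)^n" by simp
      finally show "d (c (s b n)) (c (s b (Suc n))) < 2 * (1/2)^n" .
    qed
    have "limitin mtopology (\<lambda>n. c (s b n)) x sequentially"
      unfolding limitin_metric
    proof (intro conjI allI impI)
      fix e :: real assume "e > 0"
      then obtain N where N: "(1/2::real)^N < e" using real_arch_pow_inv[of e "1/2"] by auto
      show "\<forall>\<^sub>F n in sequentially. c (s b n) \<in> X \<and> d (c (s b n)) x < e"
      proof (rule eventually_sequentiallyI[of N], intro conjI)
        fix n assume "N \<le> n"
        then have "(1/2::real)^n \<le> (1/2)^N" by (intro power_decreasing) auto
        then show "d (c (s b n)) x < e" using dx[of n] N by linarith
      qed (use c in auto)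
    qed (use x in auto)
    then have "lm b = x"
      using lm[OF \<open>good b\<close>] limitin_metric_unique by (metis trivial_limit_sequentially)
    then show ?thesis using \<open>good b\<close> by (simp add: \<kappa>_def b_def)
  qed
  then show ?thesis using A_sets \<kappa>_meas sp by blast
qed

lemma standard_borel_borel:
  "standard_borel (borel :: 'a::polish_space measure)"
  unfolding standard_borel_def
proof (intro exI conjI)
  show "topspace euclidean = space (borel :: 'a measure)" by simp
  show "completely_metrizable_space (euclidean :: 'a topology)"
    by (rule completely_metrizable_space_euclidean)
  show "sets borel = sigma_sets (space borel) {U::'a set. openin euclidean U}"
    by (simp add: borel_def)
  obtain B :: "'a set set" where B: "countable B" "topological_basis B"
    using ex_countable_basis by auto
  have "\<exists>V\<in>B. x \<in> V \<and> V \<subseteq> U" if "open U" "x \<in> U" for U x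
    using topological_basisE[OF B(2) that] by metis
  then show "second_countable (euclidean :: 'a topology)"
    unfolding second_countable_def
    using B topological_basis_open[OF B(2)] by (intro exI[of _ B]) simp
qed

text \<open>A map into a standard Borel space factors through another map, up to a null set, as soon as
  the preimages of measurable sets do.\<close>

lemma AE_factorization:
  assumes Z: "standard_borel Z" "space Z \<noteq> {}"
    and p: "p \<in> M \<rightarrow>\<^sub>M Z" and \<Phi>: "\<Phi> \<in> M \<rightarrow>\<^sub>M N"
    and sets: "\<And>A. A \<in> sets Z \<Longrightarrow> \<exists>C\<in>sets N. AE x in M. p x \<in> A \<longleftrightarrow> \<Phi> x \<in> C"
  obtains r where "r \<in> N \<rightarrow>\<^sub>M Z" "AE x in M. r (\<Phi> x) = p x"
proof -
  obtain A :: "nat \<Rightarrow> _ set" and \<kappa> where A: "\<forall>n. A n \<in> sets Z"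
    "\<kappa> \<in> (\<Pi>\<^sub>M n\<in>UNIV. count_space (UNIV :: bool set)) \<rightarrow>\<^sub>M Z"
    "\<forall>x\<in>space Z. \<kappa> (\<lambda>n. x \<in> A n) = x"
    using standard_borel_coding[OF Z] by blast
  have "\<forall>n. \<exists>C\<in>sets N. AE x in M. p x \<in> A n \<longleftrightarrow> \<Phi> x \<in> C" using sets A(1) by auto
  then obtain C where C: "\<And>n. C n \<in> sets N" "\<And>n. AE x in M. p x \<in> A n \<longleftrightarrow> \<Phi> x \<in> C n"
    by metis
  have 1: "(\<lambda>z. \<kappa> (\<lambda>n. z \<in> C n)) \<in> N \<rightarrow>\<^sub>M Z"
    by (rule measurable_compose[OF _ A(2)], rule measurable_PiM_single')
       (use C(1) in \<open>auto simp: pred_sets2\<close>)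
  have "AE x in M. \<forall>n. p x \<in> A n \<longleftrightarrow> \<Phi> x \<in> C n" using C(2) by (simp add: AE_all_countable)
  then have "AE x in M. \<kappa> (\<lambda>n. \<Phi> x \<in> C n) = p x"
  proof (rule AE_mp, intro AE_I2 impI)
    fix x assume x: "x \<in> space M" "\<forall>n. p x \<in> A n \<longleftrightarrow> \<Phi> x \<in> C n"
    then have "(\<lambda>n. \<Phi> x \<in> C n) = (\<lambda>n. p x \<in> A n)" by auto
    then show "\<kappa> (\<lambda>n. \<Phi> x \<in> C n) = p x" using A(3) p x(1) by (simp add: measurable_space)
  qed
  then show ?thesis using that[OF 1] by simp
qed

lemma standard_borel_separating:
  assumes "standard_borel M" and "space M \<noteq> {}"
  shows "\<exists>A :: nat \<Rightarrow> 'a set. (\<forall>n. A n \<in> sets M) \<and>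
    (\<forall>x\<in>space M. \<forall>y\<in>space M. (\<forall>n. x \<in> A n \<longleftrightarrow> y \<in> A n) \<longrightarrow> x = y)"
proof -
  obtain A :: "nat \<Rightarrow> 'a set" and \<kappa> where A: "\<forall>n. A n \<in> sets M"
    "\<kappa> \<in> (\<Pi>\<^sub>M n\<in>UNIV. count_space (UNIV :: bool set)) \<rightarrow>\<^sub>M M" "\<forall>x\<in>space M. \<kappa> (\<lambda>n. x \<in> A n) = x"
    using standard_borel_coding[OF assms] by blast
  have "x = y" if "x \<in> space M" "y \<in> space M" "\<forall>n. x \<in> A n \<longleftrightarrow> y \<in> A n" for x y
    proof -
    have "(\<lambda>n. x \<in> A n) = (\<lambda>n. y \<in> A n)" using that by auto
    then show ?thesis using A(3) that(1,2) by metis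
  qed
  then show ?thesis using A(1) by (intro exI[of _ A] conjI ballI impI)
qed

lemma measurable_eq_standard_borel:
  assumes "standard_borel Z" and f: "f \<in> M \<rightarrow>\<^sub>M Z" and g: "g \<in> M \<rightarrow>\<^sub>M Z"
  shows "{x \<in> space M. f x = g x} \<in> sets M"
proof (cases "space Z = {}")
  case True
  then have "space M = {}" using measurable_space[OF f] by auto
  then show ?thesis by auto
next
  case False
  obtain A :: "nat \<Rightarrow> _ set" where A: "\<forall>n. A n \<in> sets Z"
    "\<forall>x\<in>space Z. \<forall>y\<in>space Z. (\<forall>n. x \<in> A n \<longleftrightarrow> y \<in> A n) \<longrightarrow> x = y"
    using standard_borel_separating[OF assms(1) False] by blast
  have "f x = g x \<longleftrightarrow> (\<forall>n. f x \<in> A n \<longleftrightarrow> g x \<in> A n)" if "x \<in> space M" for x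
    using A(2)[rule_format, OF measurable_space[OF f that] measurable_space[OF g that]]
    by metis
  then have "{x \<in> space M. f x = g x} = {x \<in> space M. \<forall>n. f x \<in> A n \<longleftrightarrow> g x \<in> A n}"
    by (intro Collect_cong conj_cong[OF refl])
  also have "\<dots> \<in> sets M"
  proof (rule sets.sets_Collect_countable_All)
    fix n
    have "{x \<in> space M. f x \<in> A n \<longleftrightarrow> g x \<in> A n} =
      (f -` A n \<inter> space M) \<inter> (g -` A n \<inter> space M) \<union> (space M - f -` A n \<inter> space M) \<inter> (space M - g -` A n \<inter> space M)"
      by blast
    also have "\<dots> \<in> sets M"
      using A(1) by (intro sets.Un sets.Int sets.compl_sets measurable_sets[OF f] measurable_sets[OF g]) auto
    finally show "{x \<in> space M. f x \<in> A n \<longleftrightarrow> g x \<in> A n} \<in> sets M" .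
  qed
  finally show ?thesis .
qed

section \<open>Generalities on stationary systems\<close>

lemma sigma_systemD:
  assumes "sigma_system l \<sigma> X"
  shows sys_prob: "\<And>s j. j < ldim l s \<Longrightarrow> prob_space (nu X s j)"
    and sys_sets: "\<And>s j. j < ldim l s \<Longrightarrow> sets (nu X s j) = sets (base X)"
    and sys_act: "\<And>g. act X g \<in> base X \<rightarrow>\<^sub>M base X"
    and sys_act0: "\<And>x. x \<in> space (base X) \<Longrightarrow> act X 0 x = x"
    and sys_act_add: "\<And>g h x. x \<in> space (base X) \<Longrightarrow> act X (g + h) x = act X g (act X h x)"
    and sys_stat: "\<And>n i A. i < ldim l n \<Longrightarrow> A \<in> sets (base X) \<Longrightarrow> emeasure (nu X n i) A =
        (\<Sum>j<l n. \<integral>\<^sup>+g. \<sigma> n i j g * emeasure (translate X g (nu X (Suc n) j)) A \<partial>count_space UNIV)"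
  using assms unfolding sigma_system_def by blast+

lemma sys_prob_base: "sigma_system l \<sigma> X \<Longrightarrow> prob_space (base X)"
  using sys_prob[of l \<sigma> X 0 0] by simp

lemma sys_space: "sigma_system l \<sigma> X \<Longrightarrow> j < ldim l s \<Longrightarrow> space (nu X s j) = space (base X)"
  by (rule sets_eq_imp_space_eq) (rule sys_sets)

lemma sys_nonempty: "sigma_system l \<sigma> X \<Longrightarrow> space (base X) \<noteq> {}"
  by (rule prob_space.not_empty[OF sys_prob_base])

lemma sets_translate [simp]: "sets (translate X g M) = sets (base X)"
  by (simp add: translate_def)

lemma space_translate [simp]: "space (translate X g M) = space (base X)"
  by (simp add: translate_def)

lemma emeasure_translate:
  assumes "sigma_system l \<sigma> X" "sets M = sets (base X)" "A \<in> sets (base X)"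
  shows "emeasure (translate X g M) A = emeasure M (act X g -` A \<inter> space (base X))"
  using assms sets_eq_imp_space_eq[OF assms(2)] unfolding translate_def
  by (subst emeasure_distr) (auto simp: measurable_cong_sets[OF assms(2) refl] intro: sys_act)

lemma translate_translate:
  assumes X: "sigma_system l \<sigma> X" and M: "sets M = sets (base X)"
  shows "translate X g (translate X h M) = translate X (g + h) M"
proof -
  have a: "act X g \<in> base X \<rightarrow>\<^sub>M base X" for g using X by (rule sys_act)
  have sp: "space M = space (base X)" using M by (rule sets_eq_imp_space_eq)
  have "translate X g (translate X h M) = distr M (base X) (act X g \<circ> act X h)"
    unfolding translate_def by (rule distr_distr) (use a M in \<open>auto simp: measurable_cong_sets[OF M refl]\<close>)
  also have "\<dots> = distr M (base X) (act X (g + h))"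
    by (rule distr_cong) (use sys_act_add[OF X] sp in auto)
  finally show ?thesis by (simp add: translate_def)
qed

lemma translate_0:
  assumes X: "sigma_system l \<sigma> X" and M: "sets M = sets (base X)"
  shows "translate X 0 M = M"
proof -
  have sp: "space M = space (base X)" using M by (rule sets_eq_imp_space_eq)
  have "translate X 0 M = distr M M (\<lambda>x. x)"
    unfolding translate_def by (rule distr_cong) (use M sys_act0[OF X] sp in auto)
  then show ?thesis by (simp add: distr_id)
qed

lemma prob_space_translate:
  assumes X: "sigma_system l \<sigma> X" and "prob_space M" and M: "sets M = sets (base X)"
  shows "prob_space (translate X g M)"
  unfolding translate_def
  by (rule prob_space.prob_space_distr[OF assms(2)])
     (use sys_act[OF X] in \<open>simp add: measurable_cong_sets[OF M refl]\<close>)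

lemma stationary_translate:
  assumes X: "sigma_system l \<sigma> X" and i: "i < ldim l n" and A: "A \<in> sets (base X)"
  shows "emeasure (translate X h (nu X n i)) A =
    (\<Sum>j<l n. \<integral>\<^sup>+g. \<sigma> n i j g * emeasure (translate X (h + g) (nu X (Suc n) j)) A \<partial>count_space UNIV)"
proof -
  let ?A = "act X h -` A \<inter> space (base X)"
  have A': "?A \<in> sets (base X)" using sys_act[OF X] A by (rule measurable_sets)
  have "emeasure (translate X g (nu X (Suc n) j)) ?A = emeasure (translate X (h + g) (nu X (Suc n) j)) A"
    if "j < l n" for g j
  proof -
    have s: "sets (nu X (Suc n) j) = sets (base X)" using that by (intro sys_sets[OF X]) simp
    show ?thesis
      using emeasure_translate[OF X sets_translate A] translate_translate[OF X s] by metis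
  qed
  then show ?thesis
    using emeasure_translate[OF X sys_sets[OF X i] A] sys_stat[OF X i A'] by simp
qed

text \<open>The condition that makes every measure of the system, with all its translates, absolutely
  continuous with respect to the base measure.\<close>

definition spread :: "(nat \<Rightarrow> nat) \<Rightarrow> 'g mseq \<Rightarrow> bool" where
  "spread l \<sigma> \<longleftrightarrow> (\<forall>j<l 0. \<forall>g. 0 < \<sigma> 0 0 j g) \<and> no_zero_column l \<sigma>"

text \<open>A null set of the base measure is null for every translate of every measure of level 1, because
  these occur with positive coefficients in the stationarity equation of the base measure; the
  levels above follow by induction, since no column vanishes. Stationarity then leads back to level 0.\<close>

lemma spread_null_translate:
  assumes X: "sigma_system l (\<sigma> :: ('g::{group_add,countable}) mseq) X" and sp: "spread l \<sigma>"
    and A: "A \<in> sets (base X)" and null: "emeasure (base X) A = 0"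
  shows "j < ldim l s \<Longrightarrow> emeasure (translate X g (nu X s j)) A = 0"
proof -
  have zero: "emeasure (translate X (h + g) (nu X (Suc n) j)) A = 0"
    if "emeasure (translate X h (nu X n i)) A = 0" "i < ldim l n" "j < l n" "0 < \<sigma> n i j g" for n i j g h
  proof -
    have "(\<integral>\<^sup>+g. \<sigma> n i j g * emeasure (translate X (h + g) (nu X (Suc n) j)) A \<partial>count_space UNIV) = 0"
      using that(1,3) stationary_translate[OF X that(2) A, of h] by simp
    then show ?thesis using that(4)
      by (auto simp: nn_integral_0_iff_AE AE_count_space zero_less_iff_neq_zero)
  qed
  have one: "emeasure (translate X g (nu X (Suc 0) j)) A = 0" if "j < l 0" for g j
    using zero[of 0 0 0 j g] that sp null by (simp add: spread_def translate_0[OF X])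
  have "j < ldim l (Suc n) \<Longrightarrow> emeasure (translate X g (nu X (Suc n) j)) A = 0" for n j g
  proof (induction n arbitrary: j g)
    case 0
    then show ?case using one by simp
  next
    case (Suc n)
    then have "j < l (Suc n)" by simp
    then obtain i where i: "i < ldim l (Suc n)" "0 < (\<integral>\<^sup>+g. \<sigma> (Suc n) i j g \<partial>count_space UNIV)"
      using sp unfolding spread_def no_zero_column_def by blast
    have "\<exists>k. 0 < \<sigma> (Suc n) i j k"
    proof (rule ccontr)
      assume "\<not> ?thesis"
      then have "\<sigma> (Suc n) i j k = 0" for k by (simp add: zero_less_iff_neq_zero)
      then show False using i(2) by simp
    qed
    then obtain k where k: "0 < \<sigma> (Suc n) i j k" ..
    show ?case using zero[OF Suc.IH[OF i(1), of "g - k"] i(1) \<open>j < l (Suc n)\<close> k] by simp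
  qed note suc = this
  show "emeasure (translate X g (nu X s j)) A = 0" if j: "j < ldim l s"
  proof (cases s)
    case (Suc n)
    then show ?thesis using suc j by blast
  next
    case 0
    then have "j = 0" using j by simp
    then show ?thesis unfolding 0
      using stationary_translate[OF X _ A, of 0 0 g] one by simp
  qed
qed

lemma spread_absolutely_continuous:
  assumes X: "sigma_system l (\<sigma> :: ('g::{group_add,countable}) mseq) X" and sp: "spread l \<sigma>" and j: "j < ldim l s"
  shows "absolutely_continuous (base X) (translate X g (nu X s j))"
  unfolding absolutely_continuous_def
  using spread_null_translate[OF X sp _ _ j] by (auto intro!: null_setsI dest: null_setsD1)

lemma sys_AE_translate:
  assumes X: "sigma_system l (\<sigma> :: ('g::{group_add,countable}) mseq) X" and sp: "spread l \<sigma>" and j: "j < ldim l s"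
    and "AE x in base X. P x"
  shows "AE x in translate X g (nu X s j). P x"
  by (rule absolutely_continuous_AE[OF _ spread_absolutely_continuous[OF X sp j] assms(4)]) simp

lemma sys_AE_nu:
  assumes X: "sigma_system l (\<sigma> :: ('g::{group_add,countable}) mseq) X" and sp: "spread l \<sigma>" and j: "j < ldim l s"
    and "AE x in base X. P x"
  shows "AE x in nu X s j. P x"
  using sys_AE_translate[OF assms, of 0] unfolding translate_0[OF X sys_sets[OF X j]] .

lemma sys_AE_act:
  assumes X: "sigma_system l (\<sigma> :: ('g::{group_add,countable}) mseq) X" and sp: "spread l \<sigma>"
    and "AE x in base X. P x"
  shows "AE x in base X. P (act X g x)"
proof -
  have "AE x in translate X g (nu X 0 0). P x"
    by (rule sys_AE_translate[OF X sp _ assms(3)]) simp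
  then show ?thesis unfolding translate_def by (rule AE_distrD[OF sys_act[OF X]])
qed

section \<open>Radon--Nikodym derivatives\<close>

text \<open>The derivative of the i-th measure of level s, translated by g, with respect to the base measure.\<close>

definition rn :: "('g, 'x) gsystem \<Rightarrow> 'g \<Rightarrow> nat \<Rightarrow> nat \<Rightarrow> 'x \<Rightarrow> ennreal" where
  "rn X g s i = RN_deriv (base X) (translate X g (nu X s i))"

lemma measurable_rn [measurable]: "rn X g s i \<in> borel_measurable (base X)"
  unfolding rn_def by (rule borel_measurable_RN_deriv)

context
  fixes l :: "nat \<Rightarrow> nat" and \<sigma> :: "('g::{group_add,countable}) mseq" and X :: "('g, 'x) gsystem"
  assumes X: "sigma_system l \<sigma> X" and sp: "spread l \<sigma>"
begin

lemma sigma_finite_base: "sigma_finite_measure (base X)"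
  using sys_prob_base[OF X] by (simp add: prob_space_imp_sigma_finite)

lemma density_rn:
  assumes i: "i < ldim l s"
  shows "density (base X) (rn X g s i) = translate X g (nu X s i)"
  unfolding rn_def
  by (rule sigma_finite_measure.density_RN_deriv[OF sigma_finite_base
        spread_absolutely_continuous[OF X sp i]]) simp

lemma emeasure_translate_rn:
  assumes i: "i < ldim l s" and A: "A \<in> sets (base X)"
  shows "emeasure (translate X g (nu X s i)) A = (\<integral>\<^sup>+x\<in>A. rn X g s i x \<partial>base X)"
  using emeasure_density[OF measurable_rn A] density_rn[OF i] by metis

lemma rn_unique:
  assumes i: "i < ldim l s" and f: "f \<in> borel_measurable (base X)"
    and eq: "\<And>A. A \<in> sets (base X) \<Longrightarrow> emeasure (translate X g (nu X s i)) A = (\<integral>\<^sup>+x\<in>A. f x \<partial>base X)"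
  shows "AE x in base X. f x = rn X g s i x"
  unfolding rn_def
proof (rule sigma_finite_measure.RN_deriv_unique[OF sigma_finite_base f])
  show "density (base X) f = translate X g (nu X s i)"
    by (rule measure_eqI) (auto simp: emeasure_density[OF f] eq)
qed

lemma rn_finite:
  assumes i: "i < ldim l s"
  shows "AE x in base X. rn X g s i x \<noteq> \<infinity>"
  unfolding rn_def
  by (rule sigma_finite_measure.RN_deriv_finite[OF sigma_finite_base _
        spread_absolutely_continuous[OF X sp i]])
     (auto intro!: prob_space_imp_sigma_finite prob_space_translate[OF X sys_prob[OF X i] sys_sets[OF X i]])

lemma rn_zero: "AE x in base X. rn X 0 0 0 x = 1"
proof -
  have "AE x in base X. (\<lambda>_. 1) x = rn X 0 0 0 x"
    by (rule rn_unique) (simp_all add: translate_0[OF X])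
  then show ?thesis by eventually_elim simp
qed

text \<open>The derivatives at a translated point are determined by those at the point itself.\<close>

lemma rn_cocycle:
  assumes i: "i < ldim l s"
  shows "AE x in base X. rn X g s i (act X h x) * rn X (- h) 0 0 x = rn X (- h + g) s i x"
proof (rule rn_unique[OF i])
  note [measurable] = sys_act[OF X]
  show "(\<lambda>x. rn X g s i (act X h x) * rn X (- h) 0 0 x) \<in> borel_measurable (base X)"
    by measurable
  fix A assume A [measurable]: "A \<in> sets (base X)"
  let ?A = "act X (- h) -` A \<inter> space (base X)"
  have A': "?A \<in> sets (base X)" by measurable
  have "(\<integral>\<^sup>+x\<in>A. (rn X g s i (act X h x) * rn X (- h) 0 0 x) \<partial>base X) =
      (\<integral>\<^sup>+x. rn X (- h) 0 0 x * (rn X g s i (act X h x) * indicator A x) \<partial>base X)"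
    by (intro nn_integral_cong) (simp add: ac_simps)
  also have "\<dots> = (\<integral>\<^sup>+x. rn X g s i (act X h x) * indicator A x \<partial>density (base X) (rn X (- h) 0 0))"
    by (rule nn_integral_density[symmetric]) measurable
  also have "\<dots> = (\<integral>\<^sup>+x. rn X g s i (act X h x) * indicator A x \<partial>distr (base X) (base X) (act X (- h)))"
    by (subst density_rn) (auto simp: translate_def)
  also have "\<dots> = (\<integral>\<^sup>+x. rn X g s i (act X h (act X (- h) x)) * indicator A (act X (- h) x) \<partial>base X)"
    by (rule nn_integral_distr) measurable
  also have "\<dots> = (\<integral>\<^sup>+x\<in>?A. rn X g s i x \<partial>base X)"
    by (intro nn_integral_cong)
       (auto simp: sys_act_add[OF X, symmetric] sys_act0[OF X] split: split_indicator)
  also have "\<dots> = emeasure (translate X g (nu X s i)) ?A"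
    by (rule emeasure_translate_rn[OF i A', symmetric])
  also have "\<dots> = emeasure (translate X (- h) (translate X g (nu X s i))) A"
    by (rule emeasure_translate[OF X _ A, symmetric]) simp
  also have "\<dots> = emeasure (translate X (- h + g) (nu X s i)) A"
    by (simp add: translate_translate[OF X sys_sets[OF X i]])
  finally show "emeasure (translate X (- h + g) (nu X s i)) A =
    (\<integral>\<^sup>+x\<in>A. (rn X g s i (act X h x) * rn X (- h) 0 0 x) \<partial>base X)" by simp
qed

lemma rn_pos: "AE x in base X. rn X g 0 0 x \<noteq> 0"
proof -
  have "AE x in base X. rn X (- g) 0 0 (act X (- g) x) * rn X (- (- g)) 0 0 x = rn X (- (- g) + - g) 0 0 x"
    by (rule rn_cocycle) simp
  then show ?thesis using rn_zero by eventually_elim auto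
qed

end

section \<open>The canonical model of the Radon--Nikodym factor\<close>

text \<open>A point of the canonical model is a sequence of real numbers that lists the derivatives of
  the translates of the measures. The group acts by the cocycle identity on the sequences that
  satisfy the normalization and positivity below, and trivially on all other sequences.\<close>

text \<open>The coordinate of a model sequence that holds the derivative for g, s, i.\<close>

definition rn_index :: "'g::countable \<Rightarrow> nat \<Rightarrow> nat \<Rightarrow> nat" where
  "rn_index g s i = to_nat (g, s, i)"

text \<open>The coordinates without a corresponding measure are 0.\<close>

definition rn_map :: "(nat \<Rightarrow> nat) \<Rightarrow> ('g::countable, 'x) gsystem \<Rightarrow> 'x \<Rightarrow> nat \<Rightarrow> real" where
  "rn_map l X x n = (case from_nat n of (g, s, i) \<Rightarrow>
     if i < ldim l s then enn2real (rn X g s i x) else 0)"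

text \<open>The first condition makes a sequence a function of the triples g, s, i alone: numbers
  that code no triple repeat the value of the triple they decode to.\<close>

definition cocycle_good :: "'g::{group_add,countable} itself \<Rightarrow> (nat \<Rightarrow> real) set" where
  "cocycle_good T = {z. (\<forall>n. z n = z (to_nat (from_nat n :: 'g \<times> nat \<times> nat))) \<and>
     (\<forall>g::'g. 0 < z (rn_index g 0 0)) \<and> z (rn_index (0::'g) 0 0) = 1}"

definition cocycle_act :: "'g::{group_add,countable} \<Rightarrow> (nat \<Rightarrow> real) \<Rightarrow> nat \<Rightarrow> real" where
  "cocycle_act h z = (if z \<in> cocycle_good TYPE('g)
     then (\<lambda>n. case from_nat n of (g, s, i) \<Rightarrow> z (rn_index (- h + g) s i) / z (rn_index (- h) 0 0))
     else z)"

lemma rn_map_index: "rn_map l X x (rn_index g s i) = (if i < ldim l s then enn2real (rn X g s i x) else 0)"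
  by (simp add: rn_map_def rn_index_def)

lemma cocycle_act_index: "z \<in> cocycle_good TYPE('g::{group_add,countable}) \<Longrightarrow>
    cocycle_act h z (rn_index g s i) = z (rn_index (- h + g) s i) / z (rn_index (- (h::'g)) 0 0)"
  by (simp add: cocycle_act_def rn_index_def)

lemma cocycle_act_good:
  assumes z: "z \<in> cocycle_good TYPE('g::{group_add,countable})"
  shows "cocycle_act (h::'g) z \<in> cocycle_good TYPE('g)"
proof -
  have p: "0 < z (rn_index g 0 0)" for g :: 'g using z by (simp add: cocycle_good_def)
  show ?thesis
    unfolding cocycle_good_def
    using p[of "- h"] by (auto simp: cocycle_act_index[OF z] p less_imp_neq[THEN not_sym])
       (simp add: cocycle_act_def z)
qed

lemma cocycle_act_0: "cocycle_act (0::'g::{group_add,countable}) z = z"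
proof (cases "z \<in> cocycle_good TYPE('g)")
  case True
  show ?thesis
  proof
    fix n
    obtain g :: 'g and s i :: nat where n: "from_nat n = (g, s, i)" by (cases "from_nat n :: 'g \<times> nat \<times> nat") auto
    have "z n = z (to_nat (g, s, i))" "z (rn_index (0::'g) 0 0) = 1"
      using True n unfolding cocycle_good_def by (auto, metis n)
    then show "cocycle_act (0::'g) z n = z n"
      using n True by (simp add: cocycle_act_def rn_index_def)
  qed
qed (simp add: cocycle_act_def)

lemma cocycle_act_add: "cocycle_act (g + h) z = cocycle_act g (cocycle_act (h::'g::{group_add,countable}) z)"
proof (cases "z \<in> cocycle_good TYPE('g)")
  case True
  have p: "z (rn_index g 0 0) \<noteq> 0" for g :: 'g
    using True by (simp add: cocycle_good_def less_imp_neq[THEN not_sym])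
  show ?thesis
  proof
    fix n
    obtain k :: 'g and s i :: nat where n: "from_nat n = (k, s, i)" by (cases "from_nat n :: 'g \<times> nat \<times> nat") auto
    have e: "- h - g + k = - h + (- g + k)"
      by (simp only: diff_conv_add_uminus add.assoc)
    show "cocycle_act (g + h) z n = cocycle_act g (cocycle_act h z) n"
      using cocycle_act_good[OF True, of h] True p[of "- h"] p[of "- h - g"] e
      by (simp add: cocycle_act_def[of g] cocycle_act_def[of "g + h"] n cocycle_act_index minus_add)
  qed
qed (simp add: cocycle_act_def)

lemma cocycle_good_borel: "cocycle_good TYPE('g::{group_add,countable}) \<in> sets borel"
proof -
  have c: "(\<lambda>z::nat \<Rightarrow> real. z m) \<in> borel_measurable borel" for m
    by (rule measurable_product_coordinates)
  have eq: "{z::nat \<Rightarrow> real. z n = z m} \<in> sets borel" for n m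
    using borel_measurable_eq[OF c[of n] c[of m]] by simp
  have pos: "{z::nat \<Rightarrow> real. 0 < z m} \<in> sets borel" for m
    using borel_measurable_less[OF borel_measurable_const c[of m], of 0] by simp
  have one: "{z::nat \<Rightarrow> real. z m = 1} \<in> sets borel" for m
    using borel_measurable_eq[OF c[of m] borel_measurable_const, of 1] by simp
  have "cocycle_good TYPE('g) = (\<Inter>n. {z. z n = z (to_nat (from_nat n :: 'g \<times> nat \<times> nat))}) \<inter>
      (\<Inter>g::'g. {z. 0 < z (rn_index g 0 0)}) \<inter> {z. z (rn_index (0::'g) 0 0) = 1}"
    by (auto simp: cocycle_good_def)
  also have "\<dots> \<in> sets borel"
    by (intro sets.Int sets.countable_INT'' eq pos one) auto
  finally show ?thesis .
qed

lemma measurable_cocycle_act: "cocycle_act (h::'g::{group_add,countable}) \<in> borel \<rightarrow>\<^sub>M borel"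
proof -
  have c: "(\<lambda>z::nat \<Rightarrow> real. z m) \<in> borel_measurable borel" for m
    by (rule measurable_product_coordinates)
  show ?thesis
  proof (rule measurable_coordinatewise_then_product)
    fix n
    obtain k :: 'g and s i :: nat where n: "from_nat n = (k, s, i)" by (cases "from_nat n :: 'g \<times> nat \<times> nat") auto
    have "(\<lambda>z. cocycle_act h z n) = (\<lambda>z. if z \<in> cocycle_good TYPE('g)
        then z (rn_index (- h + k) s i) / z (rn_index (- h) 0 0) else z n)"
      by (auto simp: cocycle_act_def n)
    also have "\<dots> \<in> borel_measurable borel"
      by (intro measurable_If borel_measurable_divide c) (use cocycle_good_borel in simp)
    finally show "(\<lambda>z. cocycle_act h z n) \<in> borel_measurable borel" .
  qed
qed

lemma measurable_rn_map:
  fixes X :: "('g::countable, 'x) gsystem"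
  shows "rn_map l X \<in> base X \<rightarrow>\<^sub>M borel"
proof (rule measurable_coordinatewise_then_product)
  fix n
  obtain k :: 'g and s i :: nat where n: "from_nat n = (k, s, i)" by (cases "from_nat n :: 'g \<times> nat \<times> nat") auto
  show "(\<lambda>x. rn_map l X x n) \<in> borel_measurable (base X)"
    by (simp add: rn_map_def n)
qed

context
  fixes l :: "nat \<Rightarrow> nat" and \<sigma> :: "('g::{group_add,countable}) mseq" and X :: "('g, 'x) gsystem"
  assumes X: "sigma_system l \<sigma> X" and sp: "spread l \<sigma>"
begin

lemma rn_map_good: "AE x in base X. rn_map l X x \<in> cocycle_good TYPE('g)"
proof -
  have 1: "AE x in base X. \<forall>g::'g. rn X g 0 0 x \<noteq> 0 \<and> rn X g 0 0 x \<noteq> \<infinity>"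
    unfolding AE_all_countable
    by (intro allI AE_conjI rn_pos[OF X sp] rn_finite[OF X sp]) simp
  show ?thesis
    using rn_zero[OF X sp] 1
  proof eventually_elim
    case (elim x)
    have "0 < enn2real (rn X g 0 0 x)" for g
      using elim by (simp add: enn2real_positive_iff top.not_eq_extremum zero_less_iff_neq_zero)
    moreover have "rn_map l X x n = rn_map l X x (to_nat (from_nat n :: 'g \<times> nat \<times> nat))" for n
      by (simp add: rn_map_def)
    ultimately show ?case using elim by (auto simp: cocycle_good_def rn_map_index)
  qed
qed

lemma rn_map_act: "AE x in base X. rn_map l X (act X h x) = cocycle_act h (rn_map l X x)"
proof -
  have 1: "AE x in base X. \<forall>g. \<forall>s. \<forall>i. i < ldim l s \<longrightarrow>
      rn X g s i (act X h x) * rn X (- h) 0 0 x = rn X (- h + g) s i x"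
    unfolding AE_all_countable by (intro allI AE_impI rn_cocycle[OF X sp])
  have 2: "AE x in base X. rn X (- h) 0 0 x \<noteq> \<infinity>"
    by (rule rn_finite[OF X sp]) simp
  show ?thesis
    using 1 2 rn_pos[OF X sp, of "- h"] rn_map_good
  proof eventually_elim
    case (elim x)
    have "rn_map l X (act X h x) n = cocycle_act h (rn_map l X x) n" for n
    proof -
      obtain k :: 'g and s i :: nat where n: "from_nat n = (k, s, i)" by (cases "from_nat n :: 'g \<times> nat \<times> nat") auto
      show ?thesis
      proof (cases "i < ldim l s")
        case True
        then have "enn2real (rn X (- h + k) s i x) = enn2real (rn X k s i (act X h x)) * enn2real (rn X (- h) 0 0 x)"
          using elim(1) enn2real_mult by metis
        moreover have "enn2real (rn X (- h) 0 0 x) \<noteq> 0"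
          using elim(2,3) by (simp add: enn2real_eq_0_iff)
        ultimately show ?thesis using True elim(4)
          by (simp add: cocycle_act_def n rn_map_index) (simp add: rn_map_def n)
      next
        case False
        then show ?thesis using elim(4)
          by (simp add: cocycle_act_def n rn_map_index) (simp add: rn_map_def n)
      qed
    qed
    then show ?case by auto
  qed
qed

end

text \<open>The image of a system under the map to the lists of its derivatives.\<close>

definition rn_model :: "(nat \<Rightarrow> nat) \<Rightarrow> ('g::{group_add,countable}, 'x) gsystem \<Rightarrow> ('g, nat \<Rightarrow> real) gsystem" where
  "rn_model l X = \<lparr> act = cocycle_act, nu = (\<lambda>s j. distr (nu X s j) borel (rn_map l X)) \<rparr>"

section \<open>Factor maps and isomorphisms\<close>

lemma factor_mapD:
  assumes "factor_map l \<sigma> X Y \<pi>"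
  shows "sigma_system l \<sigma> X" "sigma_system l \<sigma> Y" "\<pi> \<in> base X \<rightarrow>\<^sub>M base Y"
    "\<And>g. AE x in base X. \<pi> (act X g x) = act Y g (\<pi> x)"
    "\<And>s j. j < ldim l s \<Longrightarrow> distr (nu X s j) (base Y) \<pi> = nu Y s j"
  using assms unfolding factor_map_def by auto

lemma measurable_sys_nu:
  assumes "sigma_system l \<sigma> X" "j < ldim l s"
  shows "measurable (nu X s j) N = measurable (base X) N"
  by (rule measurable_cong_sets[OF sys_sets[OF assms] refl])

lemma measurable_translate [simp]: "measurable (translate X g M) N = measurable (base X) N"
  by (rule measurable_cong_sets) simp_all

lemma translate_push:
  fixes \<sigma> :: "('g::{group_add,countable}) mseq"
  assumes X: "sigma_system l \<sigma> X" and sp: "spread l \<sigma>" and j: "j < ldim l s"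
    and aY: "act Y g \<in> base Y \<rightarrow>\<^sub>M base Y" and \<pi>: "\<pi> \<in> base X \<rightarrow>\<^sub>M base Y"
    and eqv: "AE x in base X. \<pi> (act X g x) = act Y g (\<pi> x)"
    and nuY: "nu Y s j = distr (nu X s j) (base Y) \<pi>"
  shows "translate Y g (nu Y s j) = distr (translate X g (nu X s j)) (base Y) \<pi>"
proof -
  note m = measurable_sys_nu[OF X j]
  have \<pi>': "\<pi> \<in> nu X s j \<rightarrow>\<^sub>M base Y" and aX: "act X g \<in> nu X s j \<rightarrow>\<^sub>M base X"
    using \<pi> sys_act[OF X] by (simp_all add: m)
  have "translate Y g (nu Y s j) = distr (nu X s j) (base Y) (act Y g \<circ> \<pi>)"
    unfolding translate_def nuY by (rule distr_distr[OF aY \<pi>'])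
  also have "\<dots> = distr (nu X s j) (base Y) (\<pi> \<circ> act X g)"
    using sys_AE_nu[OF X sp j eqv] \<pi>' aX aY \<pi>
    by (intro distr_cong_AE) (auto simp: measurable_comp)
  also have "\<dots> = distr (translate X g (nu X s j)) (base Y) \<pi>"
    unfolding translate_def by (rule distr_distr[OF \<pi> aX, symmetric])
  finally show ?thesis .
qed

lemma push_factor_map:
  fixes \<sigma> :: "('g::{group_add,countable}) mseq"
  assumes X: "sigma_system l \<sigma> X" and sp: "spread l \<sigma>"
    and aY: "\<And>g. act Y g \<in> base Y \<rightarrow>\<^sub>M base Y"
    and a0: "\<And>y. y \<in> space (base Y) \<Longrightarrow> act Y 0 y = y"
    and aadd: "\<And>g h y. y \<in> space (base Y) \<Longrightarrow> act Y (g + h) y = act Y g (act Y h y)"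
    and \<pi>: "\<pi> \<in> base X \<rightarrow>\<^sub>M base Y"
    and eqv: "\<And>g. AE x in base X. \<pi> (act X g x) = act Y g (\<pi> x)"
    and nuY: "\<And>s j. j < ldim l s \<Longrightarrow> nu Y s j = distr (nu X s j) (base Y) \<pi>"
  shows "factor_map l \<sigma> X Y \<pi>"
proof -
  note tp = translate_push[OF X sp _ aY \<pi> eqv nuY]
  have st: "emeasure (nu Y n i) A = (\<Sum>j<l n. \<integral>\<^sup>+g. \<sigma> n i j g * emeasure (translate Y g (nu Y (Suc n) j)) A
           \<partial>count_space UNIV)" if i: "i < ldim l n" and A: "A \<in> sets (base Y)" for n i A
  proof -
    let ?A = "\<pi> -` A \<inter> space (base X)"
    have A': "?A \<in> sets (base X)" using \<pi> A by (rule measurable_sets)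
    have "emeasure (translate Y g (nu Y (Suc n) j)) A = emeasure (translate X g (nu X (Suc n) j)) ?A"
      if "j < l n" for g j
      using that tp[of j "Suc n" g] \<pi> A by (simp add: emeasure_distr)
    moreover have "emeasure (nu Y n i) A = emeasure (nu X n i) ?A"
      unfolding nuY[OF i] using \<pi> A by (simp add: emeasure_distr measurable_sys_nu[OF X i] sys_space[OF X i])
    ultimately show ?thesis using sys_stat[OF X i A'] by simp
  qed
  have pr: "prob_space (nu Y s j)" "sets (nu Y s j) = sets (base Y)" if j: "j < ldim l s" for s j
  proof -
    have "\<pi> \<in> nu X s j \<rightarrow>\<^sub>M base Y" using \<pi> by (simp add: measurable_sys_nu[OF X j])
    then have "prob_space (distr (nu X s j) (base Y) \<pi>)"
      by (rule prob_space.prob_space_distr[OF sys_prob[OF X j]])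
    then show "prob_space (nu Y s j)" by (simp only: nuY[OF j])
    show "sets (nu Y s j) = sets (base Y)" by (subst nuY[OF j]) simp
  qed
  have "sigma_system l \<sigma> Y"
    unfolding sigma_system_def
    by (intro conjI allI impI ballI) (fact st pr aY a0 aadd | rule st pr aY a0 aadd, assumption+)+
  then show ?thesis
    unfolding factor_map_def by (intro conjI allI impI X \<pi> eqv nuY[symmetric])
qed

lemma factor_map_AE:
  assumes "factor_map l \<sigma> X Y \<pi>" and "AE y in base Y. P y"
  shows "AE x in base X. P (\<pi> x)"
proof -
  have "distr (base X) (base Y) \<pi> = base Y" using factor_mapD(5)[OF assms(1), of 0 0] by simp
  note eq = this
  show ?thesis
    by (rule AE_distrD[OF factor_mapD(3)[OF assms(1)]]) (unfold eq, rule assms(2))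
qed

lemma factor_map_translate:
  fixes \<sigma> :: "('g::{group_add,countable}) mseq"
  assumes f: "factor_map l \<sigma> X Y \<pi>" and sp: "spread l \<sigma>" and j: "j < ldim l s"
  shows "translate Y g (nu Y s j) = distr (translate X g (nu X s j)) (base Y) \<pi>"
  by (rule translate_push[OF factor_mapD(1)[OF f] sp j])
     (use factor_mapD[OF f] j in \<open>auto intro: sys_act\<close>)

text \<open>A factor map is a measure preserving extension if the derivatives upstairs factor through
  it, as they then are the derivatives downstairs.\<close>

lemma mp_extensionI:
  fixes \<sigma> :: "('g::{group_add,countable}) mseq" and X :: "('g, 'x) gsystem"
  assumes f: "factor_map l \<sigma> X Y \<pi>" and sp: "spread l \<sigma>"
    and u: "\<And>s i g. i < ldim l s \<Longrightarrow> u g s i \<in> borel_measurable (base Y)"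
    and eq: "\<And>s i g. i < ldim l s \<Longrightarrow> AE x in base X. rn X g s i x = u g s i (\<pi> x)"
  shows "mp_extension l \<sigma> X Y \<pi>"
proof -
  note X = factor_mapD(1)[OF f] and Y = factor_mapD(2)[OF f] and \<pi> = factor_mapD(3)[OF f]
  have "AE x in base X. rn X g s i x = rn Y g s i (\<pi> x)" if i: "i < ldim l s" for g s i
  proof -
    have "AE y in base Y. u g s i y = rn Y g s i y"
    proof (rule rn_unique[OF Y sp i u[OF i]])
      fix A assume A: "A \<in> sets (base Y)"
      let ?A = "\<pi> -` A \<inter> space (base X)"
      have A': "?A \<in> sets (base X)" using \<pi> A by (rule measurable_sets)
      have "emeasure (translate Y g (nu Y s i)) A = emeasure (translate X g (nu X s i)) ?A"
        using factor_map_translate[OF f sp i] \<pi> A by (simp add: emeasure_distr)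
      also have "\<dots> = (\<integral>\<^sup>+x\<in>?A. rn X g s i x \<partial>base X)"
        by (rule emeasure_translate_rn[OF X sp i A'])
      also have "\<dots> = (\<integral>\<^sup>+x. u g s i (\<pi> x) * indicator A (\<pi> x) \<partial>base X)"
      proof (rule nn_integral_cong_AE)
        show "AE x in base X. rn X g s i x * indicator ?A x = u g s i (\<pi> x) * indicator A (\<pi> x)"
          using eq[OF i, of g] AE_space by eventually_elim (auto split: split_indicator)
      qed
      also have "\<dots> = (\<integral>\<^sup>+y. u g s i y * indicator A y \<partial>distr (base X) (base Y) \<pi>)"
        using u[OF i] A \<pi> by (intro nn_integral_distr[symmetric]) auto
      also have "distr (base X) (base Y) \<pi> = base Y" using factor_mapD(5)[OF f, of 0 0] by simp
      finally show "emeasure (translate Y g (nu Y s i)) A = (\<integral>\<^sup>+x\<in>A. u g s i x \<partial>base Y)" .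
    qed
    from factor_map_AE[OF f this] eq[OF i, of g] show ?thesis by eventually_elim simp
  qed
  then show ?thesis using f unfolding mp_extension_def rn_def by blast
qed

lemma mp_extension_rn_map:
  fixes \<sigma> :: "('g::{group_add,countable}) mseq" and X :: "('g, 'x) gsystem"
  assumes "mp_extension l \<sigma> X Y p"
  shows "AE x in base X. rn_map l X x = rn_map l Y (p x)"
proof -
  have "AE x in base X. \<forall>s i g. i < ldim l s \<longrightarrow> rn X g s i x = rn Y g s i (p x)"
    unfolding AE_all_countable
    by (intro allI AE_impI) (use assms in \<open>auto simp: mp_extension_def rn_def\<close>)
  then show ?thesis
    by eventually_elim (auto simp: rn_map_def fun_eq_iff split: prod.split)
qed

lemma rn_map_mp_extension:
  fixes \<sigma> :: "('g::{group_add,countable}) mseq"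
  assumes X: "sigma_system l \<sigma> X" and sp: "spread l \<sigma>"
    and act: "act Z = cocycle_act"
    and nu: "\<And>s j. j < ldim l s \<Longrightarrow> nu Z s j = distr (nu X s j) borel (rn_map l X)"
  shows "mp_extension l \<sigma> X Z (rn_map l X)"
proof -
  have sZ: "sets (base Z) = sets borel" using nu[of 0 0] by simp
  have mZ1: "measurable M (base Z) = measurable M borel" and mZ2: "measurable (base Z) N = measurable borel N"
    for M :: "'x measure" and N :: "'y measure"
    by (rule measurable_cong_sets[OF refl sZ], rule measurable_cong_sets[OF sZ refl])
  have f: "factor_map l \<sigma> X Z (rn_map l X)"
  proof (rule push_factor_map[OF X sp])
    show "act Z g \<in> base Z \<rightarrow>\<^sub>M base Z" for g
      using measurable_cocycle_act[of g] measurable_cong_sets[OF sZ sZ] by (simp add: act)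
    show "act Z 0 y = y" for y by (simp add: act cocycle_act_0)
    show "act Z (g + h) y = act Z g (act Z h y)" for g h y by (simp add: act cocycle_act_add)
    show "rn_map l X \<in> base X \<rightarrow>\<^sub>M base Z" using measurable_rn_map[of l X] by (simp add: mZ1)
    show "AE x in base X. rn_map l X (act X g x) = act Z g (rn_map l X x)" for g
      unfolding act by (rule rn_map_act[OF X sp])
    show "nu Z s j = distr (nu X s j) (base Z) (rn_map l X)" if "j < ldim l s" for s j
      unfolding nu[OF that] by (rule distr_cong) (simp_all add: sZ)
  qed
  show ?thesis
  proof (rule mp_extensionI[OF f sp, where u="\<lambda>g s i z. ennreal (z (rn_index g s i))"])
    fix s i and g :: 'g assume i: "i < ldim l s"
    have "(\<lambda>z. z (rn_index g s i)) \<in> borel_measurable (borel :: (nat \<Rightarrow> real) measure)"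
      by (rule measurable_product_coordinates)
    then show "(\<lambda>z. ennreal (z (rn_index g s i))) \<in> borel_measurable (base Z)"
      unfolding mZ2 by measurable
    show "AE x in base X. rn X g s i x = ennreal (rn_map l X x (rn_index g s i))"
      using rn_finite[OF X sp i, of g] by eventually_elim (simp add: rn_map_index i less_top)
  qed
qed

lemma rn_map_mp_model:
  fixes \<sigma> :: "('g::{group_add,countable}) mseq"
  assumes "sigma_system l \<sigma> X" and "spread l \<sigma>"
  shows "mp_extension l \<sigma> X (rn_model l X) (rn_map l X)"
  by (rule rn_map_mp_extension[OF assms]) (simp_all add: rn_model_def)

lemma standard_borel_cong: "sets M = sets N \<Longrightarrow> standard_borel M \<longleftrightarrow> standard_borel N"
  using sets_eq_imp_space_eq[of M N] by (simp add: standard_borel_def)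

lemma standard_borel_rn_model: "standard_borel (base (rn_model l X))"
  by (subst standard_borel_cong[where N=borel]) (auto simp: rn_model_def standard_borel_borel)

theorem rn_factor_rn_model:
  fixes \<sigma> :: "('g::{group_add,countable}) mseq"
  assumes X: "sigma_system l \<sigma> X" and sp: "spread l \<sigma>"
  shows "rn_factor l \<sigma> X (rn_model l X)"
proof -
  have "\<exists>q. mp_extension l \<sigma> Y (rn_model l X) q \<and> (AE x in base X. rn_map l X x = q (p x))"
    if p: "mp_extension l \<sigma> X Y p" for Y :: "('g, 'b) gsystem" and p
  proof (intro exI conjI)
    have f: "factor_map l \<sigma> X Y p" using p by (simp add: mp_extension_def)
    show AE: "AE x in base X. rn_map l X x = rn_map l Y (p x)"
      by (rule mp_extension_rn_map[OF p])
    show "mp_extension l \<sigma> Y (rn_model l X) (rn_map l Y)"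
    proof (rule rn_map_mp_extension[OF factor_mapD(2)[OF f] sp])
      fix s j assume j: "j < ldim l s"
      note m = measurable_sys_nu[OF X j]
      have "distr (nu X s j) borel (rn_map l X) = distr (nu X s j) borel (rn_map l Y \<circ> p)"
        using sys_AE_nu[OF X sp j AE] measurable_rn_map[of l X]
          measurable_comp[OF factor_mapD(3)[OF f] measurable_rn_map[of l Y]]
        by (intro distr_cong_AE) (simp_all add: m)
      also have "\<dots> = distr (distr (nu X s j) (base Y) p) borel (rn_map l Y)"
        using factor_mapD(3)[OF f] by (intro distr_distr[symmetric]) (simp_all add: m measurable_rn_map)
      finally show "nu (rn_model l X) s j = distr (nu Y s j) borel (rn_map l Y)"
        by (simp add: rn_model_def factor_mapD(5)[OF f j])
    qed (simp add: rn_model_def)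
  qed
  then show ?thesis
    unfolding rn_factor_def using standard_borel_rn_model rn_map_mp_model[OF X sp] by blast
qed

text \<open>A measurable map through which one factor map factors over another is itself a factor map.\<close>

lemma factor_through:
  fixes \<sigma> :: "('g::{group_add,countable}) mseq"
  assumes p: "factor_map l \<sigma> X Z p" and \<Phi>: "factor_map l \<sigma> X W \<Phi>" and sp: "spread l \<sigma>"
    and Z: "standard_borel (base Z)"
    and r: "r \<in> base W \<rightarrow>\<^sub>M base Z" "AE x in base X. r (\<Phi> x) = p x"
  shows "factor_map l \<sigma> W Z r"
proof -
  note X = factor_mapD(1)[OF p] and W = factor_mapD(2)[OF \<Phi>] and Zs = factor_mapD(2)[OF p]
  have "AE w in base W. r (act W g w) = act Z g (r w)" for g
  proof -
    have "{w \<in> space (base W). r (act W g w) = act Z g (r w)} \<in> sets (base W)"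
      by (rule measurable_eq_standard_borel[OF Z])
         (use r sys_act[OF W] sys_act[OF Zs] in \<open>auto intro: measurable_compose\<close>)
    moreover have "AE x in base X. r (act W g (\<Phi> x)) = act Z g (r (\<Phi> x))"
      using r(2) sys_AE_act[OF X sp r(2), of g] factor_mapD(4)[OF p, of g] factor_mapD(4)[OF \<Phi>, of g]
      by eventually_elim simp
    ultimately have "AE w in distr (base X) (base W) \<Phi>. r (act W g w) = act Z g (r w)"
      using AE_distr_iff[OF factor_mapD(3)[OF \<Phi>], of "\<lambda>w. r (act W g w) = act Z g (r w)"] by simp
    moreover have "distr (base X) (base W) \<Phi> = base W" using factor_mapD(5)[OF \<Phi>, of 0 0] by simp
    ultimately show ?thesis by (rule back_subst[where P="\<lambda>M. AE w in M. r (act W g w) = act Z g (r w)"])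
  qed
  moreover have "distr (nu W s j) (base Z) r = nu Z s j" if j: "j < ldim l s" for s j
  proof -
    note m = measurable_sys_nu[OF X j]
    have "distr (nu W s j) (base Z) r = distr (distr (nu X s j) (base W) \<Phi>) (base Z) r"
      by (simp add: factor_mapD(5)[OF \<Phi> j])
    also have "\<dots> = distr (nu X s j) (base Z) (r \<circ> \<Phi>)"
      by (rule distr_distr[OF r(1)]) (use factor_mapD(3)[OF \<Phi>] in \<open>simp add: m\<close>)
    also have "\<dots> = distr (nu X s j) (base Z) p"
      using sys_AE_nu[OF X sp j r(2)] factor_mapD(3)[OF p] measurable_comp[OF factor_mapD(3)[OF \<Phi>] r(1)]
      by (intro distr_cong_AE) (simp_all add: m)
    finally show ?thesis by (simp add: factor_mapD(5)[OF p j])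
  qed
  ultimately show ?thesis
    using W Zs r(1) unfolding factor_map_def by blast
qed

text \<open>Two standard Borel factors of the same system that have the same measurable sets modulo null
  sets are isomorphic.\<close>

lemma system_iso_same_sets:
  fixes \<sigma> :: "('g::{group_add,countable}) mseq"
  assumes p: "factor_map l \<sigma> X Z p" and \<Phi>: "factor_map l \<sigma> X W \<Phi>" and sp: "spread l \<sigma>"
    and Z: "standard_borel (base Z)" and W: "standard_borel (base W)"
    and ZW: "\<And>A. A \<in> sets (base Z) \<Longrightarrow> \<exists>C\<in>sets (base W). AE x in base X. p x \<in> A \<longleftrightarrow> \<Phi> x \<in> C"
    and WZ: "\<And>C. C \<in> sets (base W) \<Longrightarrow> \<exists>A\<in>sets (base Z). AE x in base X. \<Phi> x \<in> C \<longleftrightarrow> p x \<in> A"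
  shows "system_iso l \<sigma> W Z"
proof -
  have ne: "space (base Z) \<noteq> {}" "space (base W) \<noteq> {}"
    using sys_nonempty factor_mapD(2)[OF p] factor_mapD(2)[OF \<Phi>] by blast+
  obtain r where r: "r \<in> base W \<rightarrow>\<^sub>M base Z" "AE x in base X. r (\<Phi> x) = p x"
    by (rule AE_factorization[OF Z ne(1) factor_mapD(3)[OF p] factor_mapD(3)[OF \<Phi>] ZW])
  obtain r' where r': "r' \<in> base Z \<rightarrow>\<^sub>M base W" "AE x in base X. r' (p x) = \<Phi> x"
    by (rule AE_factorization[OF W ne(2) factor_mapD(3)[OF \<Phi>] factor_mapD(3)[OF p] WZ])
  note f = factor_through[OF p \<Phi> sp Z r] and f' = factor_through[OF \<Phi> p sp W r']
  have pull: "AE y in base V. k y = y"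
    if h: "factor_map l \<sigma> X V h" and V: "standard_borel (base V)" and k: "k \<in> base V \<rightarrow>\<^sub>M base V"
      and AE: "AE x in base X. k (h x) = h x" for V :: "('g, 'v) gsystem" and h k
  proof -
    have "{y \<in> space (base V). k y = y} \<in> sets (base V)"
      by (rule measurable_eq_standard_borel[OF V k]) simp
    then have "AE y in distr (base X) (base V) h. k y = y"
      using AE AE_distr_iff[OF factor_mapD(3)[OF h], of "\<lambda>y. k y = y"] by simp
    moreover have "distr (base X) (base V) h = base V" using factor_mapD(5)[OF h, of 0 0] by simp
    ultimately show ?thesis by (rule back_subst[where P="\<lambda>M. AE y in M. k y = y"])
  qed
  have "AE x in base X. r' (r (\<Phi> x)) = \<Phi> x" "AE x in base X. r (r' (p x)) = p x"
    using r(2) r'(2) by (eventually_elim, simp)+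
  then have "AE w in base W. r' (r w) = w" "AE z in base Z. r (r' z) = z"
    using pull[OF \<Phi> W measurable_compose[OF r(1) r'(1)]] pull[OF p Z measurable_compose[OF r'(1) r(1)]] by auto
  then show ?thesis unfolding system_iso_def using f f' by blast
qed

lemma system_iso_sym: "system_iso l \<sigma> X Y \<Longrightarrow> system_iso l \<sigma> Y X"
  unfolding system_iso_def by blast

lemma factor_map_comp:
  fixes \<sigma> :: "('g::{group_add,countable}) mseq"
  assumes f: "factor_map l \<sigma> X Y f" and g: "factor_map l \<sigma> Y Z g"
  shows "factor_map l \<sigma> X Z (\<lambda>x. g (f x))"
proof -
  note X = factor_mapD(1)[OF f]
  have "AE x in base X. g (f (act X h x)) = act Z h (g (f x))" for h
    using factor_map_AE[OF f factor_mapD(4)[OF g, of h]] factor_mapD(4)[OF f, of h]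
    by eventually_elim simp
  moreover have "distr (nu X s j) (base Z) (\<lambda>x. g (f x)) = nu Z s j" if j: "j < ldim l s" for s j
    using distr_distr[OF factor_mapD(3)[OF g], of f "nu X s j"] factor_mapD(3)[OF f]
    by (simp add: measurable_sys_nu[OF X j] factor_mapD(5)[OF f j] factor_mapD(5)[OF g j] comp_def)
  moreover have "(\<lambda>x. g (f x)) \<in> base X \<rightarrow>\<^sub>M base Z"
    by (rule measurable_compose[OF factor_mapD(3)[OF f] factor_mapD(3)[OF g]])
  ultimately show ?thesis
    using X factor_mapD(2)[OF g] unfolding factor_map_def by blast
qed

lemma system_iso_trans:
  fixes \<sigma> :: "('g::{group_add,countable}) mseq"
  assumes "system_iso l \<sigma> X Y" and "system_iso l \<sigma> Y Z"
  shows "system_iso l \<sigma> X Z"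
proof -
  obtain f f' where f: "factor_map l \<sigma> X Y f" "factor_map l \<sigma> Y X f'"
    "AE x in base X. f' (f x) = x" "AE y in base Y. f (f' y) = y"
    using assms(1) unfolding system_iso_def by blast
  obtain g g' where g: "factor_map l \<sigma> Y Z g" "factor_map l \<sigma> Z Y g'"
    "AE y in base Y. g' (g y) = y" "AE z in base Z. g (g' z) = z"
    using assms(2) unfolding system_iso_def by blast
  have "AE x in base X. f' (g' (g (f x))) = x"
    using factor_map_AE[OF f(1) g(3)] f(3) by eventually_elim simp
  moreover have "AE z in base Z. g (f (f' (g' z))) = z"
    using factor_map_AE[OF g(2) f(4)] g(4) by eventually_elim simp
  ultimately show ?thesis
    unfolding system_iso_def
    using factor_map_comp[OF f(1) g(1)] factor_map_comp[OF g(2) f(2)] by blast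
qed

section \<open>Uniqueness of the Radon--Nikodym factor\<close>

text \<open>The sets of the system that agree, up to a null set, with preimages under a map. They form an
  invariant sub-sigma-algebra when the map is equivariant almost everywhere.\<close>

definition pullback_sets :: "'x measure \<Rightarrow> 'y measure \<Rightarrow> ('x \<Rightarrow> 'y) \<Rightarrow> 'x set set" where
  "pullback_sets M N \<Phi> = {S \<in> sets M. \<exists>C\<in>sets N. AE x in M. x \<in> S \<longleftrightarrow> \<Phi> x \<in> C}"

lemma sigma_algebra_pullback_sets:
  assumes \<Phi>: "\<Phi> \<in> M \<rightarrow>\<^sub>M N"
  shows "sigma_algebra (space M) (pullback_sets M N \<Phi>)"
proof (rule sigma_algebra_iff2[THEN iffD2], intro conjI ballI allI impI)
  show "pullback_sets M N \<Phi> \<subseteq> Pow (space M)"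
    using sets.sets_into_space by (auto simp: pullback_sets_def)
  show "{} \<in> pullback_sets M N \<Phi>" by (auto simp: pullback_sets_def intro!: bexI[of _ "{}"])
next
  fix S assume "S \<in> pullback_sets M N \<Phi>"
  then obtain C where C: "S \<in> sets M" "C \<in> sets N" "AE x in M. x \<in> S \<longleftrightarrow> \<Phi> x \<in> C"
    by (auto simp: pullback_sets_def)
  have "AE x in M. x \<in> space M - S \<longleftrightarrow> \<Phi> x \<in> space N - C"
    using C(3) AE_space by eventually_elim (use measurable_space[OF \<Phi>] in auto)
  then show "space M - S \<in> pullback_sets M N \<Phi>"
    using C(1,2) by (auto simp: pullback_sets_def intro!: bexI[of _ "space N - C"])
next
  fix A :: "nat \<Rightarrow> _" assume A: "range A \<subseteq> pullback_sets M N \<Phi>"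
  then have "\<forall>n. \<exists>C. A n \<in> sets M \<and> C \<in> sets N \<and> (AE x in M. x \<in> A n \<longleftrightarrow> \<Phi> x \<in> C)"
    by (auto simp: pullback_sets_def)
  then obtain C where C: "\<And>n. A n \<in> sets M" "\<And>n. C n \<in> sets N" "\<And>n. AE x in M. x \<in> A n \<longleftrightarrow> \<Phi> x \<in> C n"
    by metis
  have "AE x in M. \<forall>n. x \<in> A n \<longleftrightarrow> \<Phi> x \<in> C n" using C(3) by (simp add: AE_all_countable)
  then have "AE x in M. x \<in> (\<Union>n. A n) \<longleftrightarrow> \<Phi> x \<in> (\<Union>n. C n)" by eventually_elim simp
  then show "(\<Union>n. A n) \<in> pullback_sets M N \<Phi>"
    using C(1,2) by (auto simp: pullback_sets_def intro!: bexI[of _ "\<Union>n. C n"])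
qed

text \<open>The system with the same points and action in which only the sets that agree with preimages, up to
  null sets, are measurable.\<close>

definition pullback_system :: "('g, 'x) gsystem \<Rightarrow> 'y measure \<Rightarrow> ('x \<Rightarrow> 'y) \<Rightarrow> ('g, 'x) gsystem" where
  "pullback_system X N \<Phi> = \<lparr> act = act X,
     nu = (\<lambda>s j. distr (nu X s j) (sigma (space (base X)) (pullback_sets (base X) N \<Phi>)) (\<lambda>x. x)) \<rparr>"

text \<open>The universal property is applied to the coarsening of the system to the sets that the derivatives
  generate. Its underlying set is that of the given system, so the property as defined covers it.
  It shows that the factor is no finer than the canonical model; it is no coarser,
  since the derivatives factor through every measure preserving extension.\<close>

theorem rn_factor_unique:
  fixes \<sigma> :: "('g::{group_add,countable}) mseq" and X :: "('g, 'x) gsystem"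
  assumes X: "sigma_system l \<sigma> X" and sp: "spread l \<sigma>" and Z: "rn_factor l \<sigma> X Z"
  shows "system_iso l \<sigma> (rn_model l X) Z"
proof -
  let ?\<Phi> = "rn_map l X"
  let ?S = "pullback_sets (base X) borel ?\<Phi>"
  define Y where "Y = pullback_system X borel ?\<Phi>"
  interpret S: sigma_algebra "space (base X)" ?S
    by (rule sigma_algebra_pullback_sets[OF measurable_rn_map])
  have sY: "sets (base Y) = ?S" and spY: "space (base Y) = space (base X)"
    by (simp_all add: Y_def pullback_system_def S.sigma_sets_eq S.space_closed)
  have sub: "?S \<subseteq> sets (base X)" by (auto simp: pullback_sets_def)
  have id: "(\<lambda>x. x) \<in> base X \<rightarrow>\<^sub>M base Y"
    using sub by (intro measurableI) (auto simp: sY spY)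
  have \<Phi>Y: "?\<Phi> \<in> base Y \<rightarrow>\<^sub>M borel"
  proof (rule measurableI)
    fix C :: "(nat \<Rightarrow> real) set" assume C: "C \<in> sets borel"
    have "?\<Phi> -` C \<inter> space (base X) \<in> sets (base X)" using measurable_rn_map C by (rule measurable_sets)
    moreover have "AE x in base X. x \<in> ?\<Phi> -` C \<inter> space (base X) \<longleftrightarrow> ?\<Phi> x \<in> C"
      using AE_space by eventually_elim simp
    ultimately show "?\<Phi> -` C \<inter> space (base Y) \<in> sets (base Y)"
      using C unfolding sY spY pullback_sets_def by blast
  qed simp
  have aY: "act X g \<in> base Y \<rightarrow>\<^sub>M base Y" for g
  proof (rule measurableI)
    fix S assume "S \<in> sets (base Y)"
    then obtain C where C: "S \<in> sets (base X)" "C \<in> sets borel" "AE x in base X. x \<in> S \<longleftrightarrow> ?\<Phi> x \<in> C"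
      by (auto simp: sY pullback_sets_def)
    have "AE x in base X. x \<in> act X g -` S \<inter> space (base X) \<longleftrightarrow> ?\<Phi> x \<in> cocycle_act g -` C"
      using sys_AE_act[OF X sp C(3), of g] rn_map_act[OF X sp, of g] AE_space by eventually_elim simp
    moreover have "cocycle_act g -` C \<in> sets borel"
      using measurable_sets[OF measurable_cocycle_act[of g] C(2)] by simp
    moreover have "act X g -` S \<inter> space (base X) \<in> sets (base X)"
      using sys_act[OF X] C(1) by (rule measurable_sets)
    ultimately show "act X g -` S \<inter> space (base Y) \<in> sets (base Y)"
      unfolding sY spY pullback_sets_def by blast
  qed (use sys_act[OF X, of g] in \<open>auto simp: spY dest: measurable_space\<close>)
  have fY: "factor_map l \<sigma> X Y (\<lambda>x. x)"
  proof (rule push_factor_map[OF X sp _ _ _ id])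
    show "act Y g \<in> base Y \<rightarrow>\<^sub>M base Y" for g using aY by (simp add: Y_def pullback_system_def)
    show "act Y 0 y = y" if "y \<in> space (base Y)" for y
      using that sys_act0[OF X] unfolding spY by (simp add: Y_def pullback_system_def)
    show "act Y (g + h) y = act Y g (act Y h y)" if "y \<in> space (base Y)" for g h y
      using that sys_act_add[OF X] unfolding spY by (simp add: Y_def pullback_system_def)
    show "AE x in base X. act X g x = act Y g x" for g by (simp add: Y_def pullback_system_def)
    show "nu Y s j = distr (nu X s j) (base Y) (\<lambda>x. x)" if "j < ldim l s" for s j
    proof -
      have "nu Y s j = distr (nu X s j) (sigma (space (base X)) ?S) (\<lambda>x. x)"
        by (simp add: Y_def pullback_system_def)
      also have "\<dots> = distr (nu X s j) (base Y) (\<lambda>x. x)"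
        by (rule distr_cong) (simp_all add: sY S.sigma_sets_eq S.space_closed)
      finally show ?thesis .
    qed
  qed
  have mY: "mp_extension l \<sigma> X Y (\<lambda>x. x)"
  proof (rule mp_extensionI[OF fY sp, where u="\<lambda>g s i x. ennreal (?\<Phi> x (rn_index g s i))"])
    fix s i and g :: 'g assume i: "i < ldim l s"
    show "(\<lambda>x. ennreal (?\<Phi> x (rn_index g s i))) \<in> borel_measurable (base Y)"
      using measurable_compose[OF \<Phi>Y measurable_product_coordinates] by measurable
    show "AE x in base X. rn X g s i x = ennreal (?\<Phi> x (rn_index g s i))"
      using rn_finite[OF X sp i, of g] by eventually_elim (simp add: rn_map_index i less_top)
  qed
  obtain \<pi> where \<pi>: "mp_extension l \<sigma> X Z \<pi>" and univ: "\<And>(Y :: ('g, 'x) gsystem) p. mp_extension l \<sigma> X Y p \<Longrightarrow>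
      (\<exists>q. mp_extension l \<sigma> Y Z q \<and> (AE x in base X. \<pi> x = q (p x)))"
    using Z unfolding rn_factor_def by blast
  obtain q where q: "mp_extension l \<sigma> Y Z q" "AE x in base X. \<pi> x = q x"
    using univ[OF mY] by auto
  have f\<pi>: "factor_map l \<sigma> X Z \<pi>" using \<pi> by (simp add: mp_extension_def)
  have q_meas: "q \<in> base Y \<rightarrow>\<^sub>M base Z" using q(1) by (auto simp: mp_extension_def factor_map_def)
  have f\<Phi>: "factor_map l \<sigma> X (rn_model l X) ?\<Phi>" using rn_map_mp_model[OF X sp] by (simp add: mp_extension_def)
  have sb: "sets (base (rn_model l X)) = sets borel" by (simp add: rn_model_def)
  show ?thesis
  proof (rule system_iso_same_sets[OF f\<pi> f\<Phi> sp _ standard_borel_rn_model])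
    show "standard_borel (base Z)" using Z by (simp add: rn_factor_def)
    show "\<exists>C\<in>sets (base (rn_model l X)). AE x in base X. \<pi> x \<in> A \<longleftrightarrow> ?\<Phi> x \<in> C" if "A \<in> sets (base Z)" for A
    proof -
      have "q -` A \<inter> space (base X) \<in> ?S" using measurable_sets[OF q_meas that] by (simp add: sY spY)
      then obtain C where C: "C \<in> sets borel" "AE x in base X. x \<in> q -` A \<inter> space (base X) \<longleftrightarrow> ?\<Phi> x \<in> C"
        by (auto simp: pullback_sets_def)
      have "AE x in base X. \<pi> x \<in> A \<longleftrightarrow> ?\<Phi> x \<in> C"
        using C(2) q(2) AE_space by eventually_elim simp
      then show ?thesis using C(1) by (auto simp: sb)
    qed
    show "\<exists>A\<in>sets (base Z). AE x in base X. ?\<Phi> x \<in> C \<longleftrightarrow> \<pi> x \<in> A" if "C \<in> sets (base (rn_model l X))" for C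
    proof (rule bexI)
      show "rn_map l Z -` C \<inter> space (base Z) \<in> sets (base Z)"
        using measurable_rn_map that unfolding sb by (rule measurable_sets)
      show "AE x in base X. ?\<Phi> x \<in> C \<longleftrightarrow> \<pi> x \<in> rn_map l Z -` C \<inter> space (base Z)"
        using mp_extension_rn_map[OF \<pi>] AE_space
        by eventually_elim (use measurable_space[OF factor_mapD(3)[OF f\<pi>]] in auto)
    qed
  qed
qed

section \<open>Products of the transition matrices\<close>

lemma nn_integral_count_space_swap:
  "(\<integral>\<^sup>+x. \<integral>\<^sup>+y. f x y \<partial>count_space UNIV \<partial>count_space UNIV) =
   (\<integral>\<^sup>+y. \<integral>\<^sup>+x. f x y \<partial>count_space UNIV \<partial>count_space UNIV)"
  using nn_integral_fst_count_space[of "\<lambda>(x, y). f x y"] nn_integral_snd_count_space[of "\<lambda>(x, y). f x y"]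
  by simp

lemma nn_integral_translate:
  fixes f :: "'g::group_add \<Rightarrow> ennreal"
  shows "(\<integral>\<^sup>+x. f (g + x) \<partial>count_space UNIV) = (\<integral>\<^sup>+x. f x \<partial>count_space UNIV)"
proof -
  have "bij_betw ((+) g) UNIV UNIV"
    by (rule bij_betw_byWitness[where f'="\<lambda>x. - g + x"]) (auto simp: add.assoc[symmetric])
  then show ?thesis by (rule nn_integral_bij_count_space)
qed

text \<open>Associativity of convolution, in the form in which one factor may be any function.\<close>

lemma convolution_assoc:
  fixes a :: "nat \<Rightarrow> 'g::group_add \<Rightarrow> ennreal"
  shows "(\<Sum>k<d. \<integral>\<^sup>+h. a k h * (\<Sum>m<e. \<integral>\<^sup>+u. b k m u * F m (h + u) \<partial>count_space UNIV) \<partial>count_space UNIV) =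
    (\<Sum>m<e. \<integral>\<^sup>+v. (\<Sum>k<d. \<integral>\<^sup>+h. a k h * b k m (- h + v) \<partial>count_space UNIV) * F m v \<partial>count_space UNIV)"
proof -
  have 1: "(\<integral>\<^sup>+h. a k h * (\<Sum>m<e. \<integral>\<^sup>+u. b k m u * F m (h + u) \<partial>count_space UNIV) \<partial>count_space UNIV) =
     (\<Sum>m<e. \<integral>\<^sup>+v. (\<integral>\<^sup>+h. a k h * b k m (- h + v) \<partial>count_space UNIV) * F m v \<partial>count_space UNIV)" for k
  proof -
    have "(\<integral>\<^sup>+h. a k h * (\<Sum>m<e. \<integral>\<^sup>+u. b k m u * F m (h + u) \<partial>count_space UNIV) \<partial>count_space UNIV) =
      (\<Sum>m<e. \<integral>\<^sup>+h. \<integral>\<^sup>+u. a k h * (b k m u * F m (h + u)) \<partial>count_space UNIV \<partial>count_space UNIV)"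
      by (simp add: sum_distrib_left nn_integral_sum nn_integral_cmult)
    also have "\<dots> = (\<Sum>m<e. \<integral>\<^sup>+h. \<integral>\<^sup>+v. a k h * (b k m (- h + v) * F m v) \<partial>count_space UNIV \<partial>count_space UNIV)"
    proof (rule sum.cong[OF refl], rule nn_integral_cong)
      fix m h
      show "(\<integral>\<^sup>+u. a k h * (b k m u * F m (h + u)) \<partial>count_space UNIV) =
          (\<integral>\<^sup>+v. a k h * (b k m (- h + v) * F m v) \<partial>count_space UNIV)"
        using nn_integral_translate[of "\<lambda>v. a k h * (b k m (- h + v) * F m v)" h]
        by (simp add: add.assoc[symmetric])
    qed
    also have "\<dots> = (\<Sum>m<e. \<integral>\<^sup>+v. \<integral>\<^sup>+h. (a k h * b k m (- h + v)) * F m v \<partial>count_space UNIV \<partial>count_space UNIV)"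
      by (subst nn_integral_count_space_swap) (simp add: mult.assoc)
    also have "\<dots> = (\<Sum>m<e. \<integral>\<^sup>+v. (\<integral>\<^sup>+h. a k h * b k m (- h + v) \<partial>count_space UNIV) * F m v \<partial>count_space UNIV)"
      by (simp add: nn_integral_multc)
    finally show ?thesis .
  qed
  have "(\<Sum>k<d. \<Sum>m<e. \<integral>\<^sup>+v. (\<integral>\<^sup>+h. a k h * b k m (- h + v) \<partial>count_space UNIV) * F m v \<partial>count_space UNIV) =
    (\<Sum>m<e. \<integral>\<^sup>+v. (\<Sum>k<d. \<integral>\<^sup>+h. a k h * b k m (- h + v) \<partial>count_space UNIV) * F m v \<partial>count_space UNIV)"
    by (subst sum.swap) (simp add: sum_distrib_right nn_integral_sum)
  then show ?thesis by (simp add: 1)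
qed

lemma mconv_assoc: "mconv d S (mconv e T R) i k g = mconv e (mconv d S T) R i k g"
  unfolding mconv_def
  using convolution_assoc[where a="S i" and e=e and F="\<lambda>m v. R m k (- v + g)" and b=T and d=d]
  by (simp add: minus_add add.assoc diff_conv_add_uminus del: add_uminus_conv_diff)

text \<open>The product of the matrices with indices from s to n: the transition probabilities from
  level s to time n.\<close>

definition tprod :: "(nat \<Rightarrow> nat) \<Rightarrow> 'g::group_add mseq \<Rightarrow> nat \<Rightarrow> nat \<Rightarrow> nat \<Rightarrow> nat \<Rightarrow> 'g \<Rightarrow> ennreal" where
  "tprod l \<sigma> s n = mprod l \<sigma> s (n - s)"

lemma tprod_self [simp]: "tprod l \<sigma> s s = \<sigma> s"
  by (simp add: tprod_def)

lemma tprod_Suc: "s \<le> n \<Longrightarrow> tprod l \<sigma> s (Suc n) = mconv (l n) (tprod l \<sigma> s n) (\<sigma> (Suc n))"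
  by (simp add: tprod_def Suc_diff_le)

lemma tprod_split:
  assumes "s \<le> m" "m < n"
  shows "tprod l \<sigma> s n i k g = mconv (l m) (tprod l \<sigma> s m) (tprod l \<sigma> (Suc m) n) i k g"
  using assms(2)
proof (induction n arbitrary: k g)
  case (Suc n)
  show ?case
  proof (cases "m = n")
    case True
    then show ?thesis using assms(1) by (simp add: tprod_Suc)
  next
    case False
    then have "m < n" using Suc by simp
    have "tprod l \<sigma> s (Suc n) i k g = mconv (l n) (mconv (l m) (tprod l \<sigma> s m) (tprod l \<sigma> (Suc m) n)) (\<sigma> (Suc n)) i k g"
      using assms(1) \<open>m < n\<close> Suc.IH[OF \<open>m < n\<close>] by (simp add: tprod_Suc mconv_def)
    also have "\<dots> = mconv (l m) (tprod l \<sigma> s m) (mconv (l n) (tprod l \<sigma> (Suc m) n) (\<sigma> (Suc n))) i k g"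
      by (rule mconv_assoc[symmetric])
    also have "mconv (l n) (tprod l \<sigma> (Suc m) n) (\<sigma> (Suc n)) = tprod l \<sigma> (Suc m) (Suc n)"
      using \<open>m < n\<close> by (simp add: tprod_Suc)
    finally show ?thesis .
  qed
qed simp

lemma stochastic_sequenceD:
  assumes "stochastic_sequence l \<sigma>"
  shows "0 < l n" "i < ldim l n \<Longrightarrow> (\<Sum>j<l n. \<integral>\<^sup>+g. \<sigma> n i j g \<partial>count_space UNIV) = 1"
  using assms unfolding stochastic_sequence_def by auto

lemma tprod_total:
  assumes st: "stochastic_sequence l (\<sigma> :: 'g::group_add mseq)" and i: "i < ldim l s" and "s \<le> n"
  shows "(\<Sum>j<l n. \<integral>\<^sup>+g. tprod l \<sigma> s n i j g \<partial>count_space UNIV) = 1"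
  using \<open>s \<le> n\<close>
proof (induction n rule: dec_induct)
  case base
  then show ?case using stochastic_sequenceD(2)[OF st i] by simp
next
  case (step n)
  have "(\<Sum>j<l (Suc n). \<integral>\<^sup>+g. tprod l \<sigma> s (Suc n) i j g \<partial>count_space UNIV) =
    (\<Sum>k<l n. \<integral>\<^sup>+h. tprod l \<sigma> s n i k h * (\<Sum>m<l (Suc n). \<integral>\<^sup>+u. \<sigma> (Suc n) k m u * 1 \<partial>count_space UNIV) \<partial>count_space UNIV)"
    using step(1) unfolding convolution_assoc[where a="tprod l \<sigma> s n i" and e="l (Suc n)" and F="\<lambda>_ _. 1" and b="\<sigma> (Suc n)" and d="l n"]
    by (simp add: tprod_Suc mconv_def)
  also have "\<dots> = (\<Sum>k<l n. \<integral>\<^sup>+h. tprod l \<sigma> s n i k h \<partial>count_space UNIV)"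
    using stochastic_sequenceD(2)[OF st, of _ "Suc n"] by (intro sum.cong refl) simp
  finally show ?case using step by simp
qed

lemma tprod_le_1:
  assumes st: "stochastic_sequence l (\<sigma> :: 'g::group_add mseq)" and i: "i < ldim l s" and "s \<le> n" and "j < l n"
  shows "tprod l \<sigma> s n i j g \<le> 1"
proof -
  have "tprod l \<sigma> s n i j g \<le> (\<integral>\<^sup>+g. tprod l \<sigma> s n i j g \<partial>count_space UNIV)"
    by (rule nn_integral_ge_point) simp
  also have "\<dots> \<le> (\<Sum>j<l n. \<integral>\<^sup>+g. tprod l \<sigma> s n i j g \<partial>count_space UNIV)"
    by (rule member_le_sum) (use \<open>j < l n\<close> in auto)
  finally show ?thesis by (simp add: tprod_total[OF st i \<open>s \<le> n\<close>])
qed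

lemma mconv_ge:
  assumes "k < d"
  shows "S i k h * T k j (- h + g) \<le> mconv d S T i j g"
proof -
  have "S i k h * T k j (- h + g) \<le> (\<integral>\<^sup>+h. S i k h * T k j (- h + g) \<partial>count_space UNIV)"
    by (rule nn_integral_ge_point[of h UNIV "\<lambda>h. S i k h * T k j (- h + g)"]) simp
  also have "\<dots> \<le> mconv d S T i j g"
    unfolding mconv_def
    by (rule member_le_sum[where f="\<lambda>k. \<integral>\<^sup>+h. S i k h * T k j (- h + g) \<partial>count_space UNIV"]) (use assms in auto)
  finally show ?thesis .
qed

text \<open>Full support of the initial distribution and the absence of zero columns make every state
  accessible at every time.\<close>

lemma tprod_pos:
  assumes sp: "spread l (\<sigma> :: 'g::group_add mseq)" and "j < l n"
  shows "0 < tprod l \<sigma> 0 n 0 j g"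
  using \<open>j < l n\<close>
proof (induction n arbitrary: j g)
  case 0
  then show ?case using sp by (simp add: spread_def)
next
  case (Suc n)
  then obtain i where i: "i < l n" "0 < (\<integral>\<^sup>+g. \<sigma> (Suc n) i j g \<partial>count_space UNIV)"
    using sp unfolding spread_def no_zero_column_def by (metis ldim.simps(2))
  have "\<exists>k. 0 < \<sigma> (Suc n) i j k"
  proof (rule ccontr)
    assume "\<not> ?thesis"
    then have "\<sigma> (Suc n) i j k = 0" for k by (simp add: zero_less_iff_neq_zero)
    then show False using i(2) by simp
  qed
  then obtain k where k: "0 < \<sigma> (Suc n) i j k" ..
  have "0 < tprod l \<sigma> 0 n 0 i (g - k) * \<sigma> (Suc n) i j (- (g - k) + g)"
    using Suc.IH[OF i(1), of "g - k"] k by (simp add: ennreal_zero_less_mult_iff)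
  also have "\<dots> \<le> tprod l \<sigma> 0 (Suc n) 0 j g"
    unfolding tprod_Suc[OF le0] by (rule mconv_ge[OF i(1)])
  finally show ?case .
qed

lemma tprod_lower_bound:
  assumes "i < l s" and "s < n"
  shows "tprod l \<sigma> 0 s 0 i g * tprod l \<sigma> (Suc s) n i k (- g + h) \<le> tprod l \<sigma> 0 n 0 k h"
  by (subst tprod_split[of 0 s n]) (use assms in \<open>auto intro: mconv_ge\<close>)

section \<open>The random walk\<close>

lemma nn_integral_Vset:
  fixes f :: "nat \<times> 'g \<Rightarrow> ennreal"
  shows "(\<integral>\<^sup>+v. f v \<partial>count_space (Vset l n)) = (\<Sum>j<l n. \<integral>\<^sup>+h. f (j, h) \<partial>count_space UNIV)"
proof -
  have "(\<integral>\<^sup>+v. f v \<partial>count_space (Vset l n)) = (\<integral>\<^sup>+v. f v * indicator (Vset l n) v \<partial>count_space UNIV)"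
    by (rule nn_integral_count_space_indicator) simp
  also have "\<dots> = (\<integral>\<^sup>+j. \<integral>\<^sup>+h. f (j, h) * indicator (Vset l n) (j, h) \<partial>count_space UNIV \<partial>count_space UNIV)"
    by (rule nn_integral_fst_count_space[symmetric])
  also have "\<dots> = (\<integral>\<^sup>+j. (\<integral>\<^sup>+h. f (j, h) \<partial>count_space UNIV) * indicator {..<l n} j \<partial>count_space UNIV)"
    by (intro nn_integral_cong) (auto simp: Vset_def split: split_indicator)
  also have "\<dots> = (\<integral>\<^sup>+j. (\<integral>\<^sup>+h. f (j, h) \<partial>count_space UNIV) \<partial>count_space {..<l n})"
    by (rule nn_integral_count_space_indicator[symmetric]) simp
  also have "\<dots> = (\<Sum>j<l n. \<integral>\<^sup>+h. f (j, h) \<partial>count_space UNIV)"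
    by (rule nn_integral_count_space_finite) simp
  finally show ?thesis .
qed

lemma sets_step [simp]: "sets (step l \<sigma> n u) = Pow (Vset l n)"
  by (simp add: step_def split: prod.split)

lemma emeasure_step_single:
  assumes "v \<in> Vset l n"
  shows "emeasure (step l \<sigma> n u) {v} = \<sigma> n (fst u) (fst v) (- snd u + snd v)"
proof -
  have "emeasure (step l \<sigma> n u) {v} = (\<integral>\<^sup>+x. \<sigma> n (fst u) (fst x) (- snd u + snd x) * indicator {v} x \<partial>count_space (Vset l n))"
    unfolding step_def using assms by (cases u) (simp add: emeasure_density case_prod_beta)
  also have "\<dots> = \<sigma> n (fst u) (fst v) (- snd u + snd v)"
    using assms by (subst nn_integral_indicator_singleton) auto
  finally show ?thesis .
qed

lemma prob_space_step:
  assumes st: "stochastic_sequence l (\<sigma> :: 'g::group_add mseq)" and "fst u < ldim l n"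
  shows "prob_space (step l \<sigma> n u)"
proof
  have sp: "space (step l \<sigma> n u) = Vset l n" by (simp add: step_def split: prod.split)
  have "emeasure (step l \<sigma> n u) (Vset l n) =
      (\<integral>\<^sup>+x. \<sigma> n (fst u) (fst x) (- snd u + snd x) * indicator (Vset l n) x \<partial>count_space (Vset l n))"
    unfolding step_def by (cases u) (simp add: emeasure_density case_prod_beta)
  also have "\<dots> = (\<integral>\<^sup>+x. \<sigma> n (fst u) (fst x) (- snd u + snd x) \<partial>count_space (Vset l n))"
    by (intro nn_integral_cong) simp
  also have "\<dots> = (\<Sum>j<l n. \<integral>\<^sup>+h. \<sigma> n (fst u) j (- snd u + h) \<partial>count_space UNIV)"
    by (simp add: nn_integral_Vset)
  also have "\<dots> = 1"
    using nn_integral_translate[of "\<sigma> n (fst u) _" "- snd u"] stochastic_sequenceD(2)[OF st assms(2)] by simp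
  finally show "emeasure (step l \<sigma> n u) (space (step l \<sigma> n u)) = 1" by (simp add: sp)
qed

context
  fixes l :: "nat \<Rightarrow> nat" and \<sigma> :: "'g::{group_add,countable} mseq"
  assumes st: "stochastic_sequence l \<sigma>"
begin

lemma prob_space_walk_kernel:
  assumes j: "j < ldim l s" and \<omega>: "\<omega> \<in> space (PiM {0..<n} (\<lambda>n. count_space (Vset l n)))"
  shows "prob_space (walk_kernel l \<sigma> s j n \<omega>) \<and> sets (walk_kernel l \<sigma> s j n \<omega>) = Pow (Vset l n)"
proof -
  have z: "(0, 0) \<in> Vset l n" using stochastic_sequenceD(1)[OF st] by (simp add: Vset_def)
  have "fst (\<omega> (n - 1)) < ldim l n" if "s < n"
  proof -
    have "n - 1 \<in> {0..<n}" using that by auto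
    then have "\<omega> (n - 1) \<in> Vset l (n - 1)" using \<omega> by (auto simp: space_PiM PiE_iff)
    then show ?thesis using that by (cases n) (auto simp: Vset_def)
  qed
  moreover have "(j, 0) \<in> Vset l n" if "Suc n = s" using that j by (auto simp: Vset_def)
  ultimately show ?thesis
    using z j by (auto simp: walk_kernel_def intro!: prob_space_return prob_space_step[OF st])
qed

lemma Ionescu_Tulcea_walk:
  assumes j: "j < ldim l s"
  shows "Ionescu_Tulcea (walk_kernel l \<sigma> s j) (\<lambda>n. count_space (Vset l n))"
proof (rule Ionescu_Tulcea.intro)
  fix n
  let ?M = "\<lambda>n. count_space (Vset l n :: (nat \<times> 'g) set)"
  show "prob_space (walk_kernel l \<sigma> s j n \<omega>)" if "\<omega> \<in> space (PiM {0..<n} ?M)" for \<omega>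
    using prob_space_walk_kernel[OF j that] by simp
  have in_sub: "walk_kernel l \<sigma> s j n \<omega> \<in> space (subprob_algebra (?M n))" if "\<omega> \<in> space (PiM {0..<n} ?M)" for \<omega>
    using prob_space_walk_kernel[OF j that] by (auto simp: space_subprob_algebra intro: prob_space_imp_subprob_space)
  show "walk_kernel l \<sigma> s j n \<in> measurable (PiM {0..<n} ?M) (subprob_algebra (?M n))"
  proof (cases "s < n")
    case True
    then have n: "n - 1 \<in> {0..<n}" by auto
    have c: "(\<lambda>\<omega>. \<omega> (n - 1)) \<in> PiM {0..<n} ?M \<rightarrow>\<^sub>M ?M (n - 1)"
      by (rule measurable_component_singleton[OF n])
    have "(\<lambda>\<omega>. step l \<sigma> n (\<omega> (n - 1))) \<in> measurable (PiM {0..<n} ?M) (subprob_algebra (?M n))"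
    proof (rule measurable_compose[OF c])
      have "step l \<sigma> n v \<in> space (subprob_algebra (?M n))" if "v \<in> Vset l (n - 1)" for v
      proof -
        have "fst v < ldim l n" using that True by (cases n) (auto simp: Vset_def)
        then show ?thesis using prob_space_imp_subprob_space[OF prob_space_step[OF st, of v n]]
          by (simp add: space_subprob_algebra)
      qed
      then show "step l \<sigma> n \<in> ?M (n - 1) \<rightarrow>\<^sub>M subprob_algebra (?M n)" by simp
    qed
    then show ?thesis using True by (simp add: walk_kernel_def[abs_def])
  next
    case False
    then have "walk_kernel l \<sigma> s j n \<omega> = walk_kernel l \<sigma> s j n (\<lambda>_. undefined)" for \<omega>
      by (auto simp: walk_kernel_def)
    then have "walk_kernel l \<sigma> s j n = (\<lambda>_. walk_kernel l \<sigma> s j n (\<lambda>_. undefined))" by auto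
    moreover have "walk_kernel l \<sigma> s j n (\<lambda>_. undefined) \<in> space (subprob_algebra (?M n))"
    proof -
      have "space (PiM {0..<n} ?M) \<noteq> {}"
        using stochastic_sequenceD(1)[OF st] by (auto simp: space_PiM PiE_eq_empty_iff Vset_def)
      then show ?thesis using in_sub calculation by (metis ex_in_conv)
    qed
    ultimately show ?thesis by (metis measurable_const)
  qed
qed

end

text \<open>The paths that agree with a given path at the times from n to m - 1.\<close>

definition cyl :: "(nat \<Rightarrow> nat) \<Rightarrow> nat \<Rightarrow> nat \<Rightarrow> (nat \<Rightarrow> nat \<times> 'g) \<Rightarrow> (nat \<Rightarrow> nat \<times> 'g) set" where
  "cyl l n m x = {\<omega> \<in> path_space l. \<forall>k\<in>{n..<m}. \<omega> k = x k}"

text \<open>The events that depend only on the times from n on.\<close>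

definition future :: "(nat \<Rightarrow> nat) \<Rightarrow> nat \<Rightarrow> (nat \<Rightarrow> nat \<times> 'g) set set" where
  "future l n = sigma_sets (path_space l) {{\<omega> \<in> path_space l. \<omega> k \<in> A} | k A. n \<le> k \<and> A \<subseteq> Vset l k}"

text \<open>The action on paths, by left translation of all positions.\<close>

definition path_act :: "'g::group_add \<Rightarrow> (nat \<Rightarrow> nat \<times> 'g) \<Rightarrow> nat \<Rightarrow> nat \<times> 'g" where
  "path_act g \<omega> n = (fst (\<omega> n), g + snd (\<omega> n))"

text \<open>The transition probability from a state to another at time k.\<close>

definition weight :: "'g::group_add mseq \<Rightarrow> nat \<Rightarrow> nat \<times> 'g \<Rightarrow> nat \<times> 'g \<Rightarrow> ennreal" where
  "weight \<sigma> k u v = \<sigma> k (fst u) (fst v) (- snd u + snd v)"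

lemma path_act_space_iff [simp]: "path_act g \<omega> \<in> path_space l \<longleftrightarrow> \<omega> \<in> path_space l"
  by (simp add: path_space_def path_act_def Vset_def PiE_iff mem_Times_iff)

lemma path_act_add: "path_act (g + h) \<omega> = path_act g (path_act h \<omega>)"
  by (simp add: path_act_def fun_eq_iff add.assoc)

lemma path_act_0 [simp]: "path_act 0 \<omega> = \<omega>"
  by (simp add: path_act_def fun_eq_iff)

lemma path_spaceD: "\<omega> \<in> path_space l \<Longrightarrow> \<omega> k \<in> Vset l k"
  by (auto simp: path_space_def)

lemma path_spaceI: "(\<And>k. \<omega> k \<in> Vset l k) \<Longrightarrow> \<omega> \<in> path_space l"
  by (auto simp: path_space_def)

lemma weight_translate: "weight \<sigma> k (a, g + b) (c, g + d) = weight \<sigma> k (a, b) (c, d)"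
  by (simp add: weight_def minus_add add.assoc[symmetric])

abbreviation coord_space :: "(nat \<Rightarrow> nat) \<Rightarrow> nat \<Rightarrow> (nat \<times> 'g) measure" where
  "coord_space l n \<equiv> count_space (Vset l n)"

context
  fixes l :: "nat \<Rightarrow> nat" and \<sigma> :: "'g::{group_add,countable} mseq"
  assumes st: "stochastic_sequence l \<sigma>"
begin

context
  fixes s j assumes j: "j < ldim l s"
begin

interpretation IT: Ionescu_Tulcea "walk_kernel l \<sigma> s j" "coord_space l"
  by (rule Ionescu_Tulcea_walk[OF st j])

lemma walk_eq: "walk l \<sigma> s j = IT.PF.lim"
  by (simp add: walk_def)

lemma sets_walk: "sets (walk l \<sigma> s j) = sets (PiM UNIV (coord_space l))"
  by (simp add: walk_eq)

lemma space_walk: "space (walk l \<sigma> s j) = path_space l"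
  by (simp add: walk_eq space_PiM path_space_def)

lemma single_restrict_sets:
  assumes "x \<in> path_space l"
  shows "{restrict x {0..<n}} \<in> sets (PiM {0..<n} (coord_space l))"
proof -
  have "{restrict x {0..<n}} = (\<Pi>\<^sub>E i\<in>{0..<n}. {x i})" by (auto simp: PiE_iff extensional_def fun_eq_iff)
  also have "\<dots> \<in> sets (PiM {0..<n} (coord_space l))"
    by (rule sets_PiM_I_finite) (use path_spaceD[OF assms] in auto)
  finally show ?thesis .
qed

lemma emeasure_C_single:
  assumes x: "x \<in> path_space l"
  shows "emeasure (IT.C 0 n (\<lambda>_. undefined)) {restrict x {0..<n}} =
    (\<Prod>k<n. emeasure (walk_kernel l \<sigma> s j k x) {x k})"
proof (induction n)
  case 0
  have "restrict x {0..<0} = (\<lambda>_. undefined)" by auto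
  then show ?case using single_restrict_sets[OF x, of 0] by simp
next
  case (Suc n)
  let ?u = "\<lambda>_. undefined" and ?y = "restrict x {0..<n}" and ?y' = "restrict x {0..<Suc n}"
  have u: "?u \<in> space (PiM {0..<0} (coord_space l))" by (simp add: space_PiM)
  have spC: "space (IT.C 0 n ?u) = space (PiM {0..<n} (coord_space l))"
    using IT.space_C[OF u, of n] by simp
  have setsC: "sets (IT.C 0 n ?u) = sets (PiM {0..<n} (coord_space l))"
    using IT.sets_C[OF u, of n] by simp
  have y: "?y \<in> space (PiM {0..<n} (coord_space l))"
    using path_spaceD[OF x] by (auto simp: space_PiM)
  have ker: "walk_kernel l \<sigma> s j n ?y = walk_kernel l \<sigma> s j n x"
    by (cases n) (auto simp: walk_kernel_def)
  have "emeasure (IT.C 0 (Suc n) ?u) {?y'} = (\<integral>\<^sup>+\<omega>. emeasure (IT.eP n \<omega>) {?y'} \<partial>IT.C 0 n ?u)"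
  proof -
    have m: "IT.eP n \<in> IT.C 0 n ?u \<rightarrow>\<^sub>M subprob_algebra (PiM {0..<Suc n} (coord_space l))"
      using IT.measurable_eP[of n] by (simp add: measurable_cong_sets[OF setsC refl])
    show ?thesis
      using emeasure_bind[OF _ m single_restrict_sets[OF x, of "Suc n"]] y spC
      by (simp add: ex_in_conv[symmetric] del: space_PiM_empty_iff) blast
  qed
  also have "\<dots> = (\<integral>\<^sup>+\<omega>. emeasure (walk_kernel l \<sigma> s j n x) {x n} * indicator {?y} \<omega> \<partial>IT.C 0 n ?u)"
  proof (rule nn_integral_cong)
    fix \<omega> assume "\<omega> \<in> space (IT.C 0 n ?u)"
    then have \<omega>: "\<omega> \<in> space (PiM {0..<n} (coord_space l))" using spC by simp
    have ext: "\<omega> i = undefined" if "\<not> i < n" for i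
      using \<omega> that by (auto simp: space_PiM PiE_iff extensional_def)
    have eq: "fun_upd \<omega> n v = ?y' \<longleftrightarrow> \<omega> = ?y \<and> v = x n" for v
    proof
      assume a: "fun_upd \<omega> n v = ?y'"
      have "\<omega> i = ?y i" for i
        using fun_cong[OF a, of i] ext[of i] by (cases "i < n") (auto split: if_splits)
      moreover have "v = x n" using fun_cong[OF a, of n] by simp
      ultimately show "\<omega> = ?y \<and> v = x n" by auto
    next
      assume "\<omega> = ?y \<and> v = x n"
      then show "fun_upd \<omega> n v = ?y'" by (auto simp: fun_eq_iff)
    qed
    have "(\<lambda>v. fun_upd \<omega> n v) -` {?y'} \<inter> space (coord_space l n) =
        {v \<in> space (coord_space l n). fun_upd \<omega> n v = ?y'}" by blast
    also have "\<dots> = {v \<in> space (coord_space l n). \<omega> = ?y \<and> v = x n}" by (simp only: eq)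
    also have "\<dots> = (if \<omega> = ?y then {x n} else {})" using path_spaceD[OF x, of n] by auto
    finally have "(\<lambda>v. fun_upd \<omega> n v) -` {?y'} \<inter> space (coord_space l n) = (if \<omega> = ?y then {x n} else {})" .
    then show "emeasure (IT.eP n \<omega>) {?y'} = emeasure (walk_kernel l \<sigma> s j n x) {x n} * indicator {?y} \<omega>"
      using IT.emeasure_eP[OF \<omega> single_restrict_sets[OF x]] ker by (auto split: split_indicator)
  qed
  also have "\<dots> = emeasure (walk_kernel l \<sigma> s j n x) {x n} * emeasure (IT.C 0 n ?u) {?y}"
    by (rule nn_integral_cmult_indicator) (use single_restrict_sets[OF x] setsC in simp)
  finally show ?case by (simp only: Suc prod.lessThan_Suc mult.commute)
qed

lemma cyl_0_emb: "x \<in> path_space l \<Longrightarrow> cyl l 0 n x = prod_emb UNIV (coord_space l) {0..<n} {restrict x {0..<n}}"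
proof (intro equalityI subsetI)
  fix \<omega> assume "\<omega> \<in> prod_emb UNIV (coord_space l) {0..<n} {restrict x {0..<n}}"
  then have \<omega>: "\<omega> \<in> path_space l" "restrict \<omega> {0..<n} = restrict x {0..<n}"
    by (auto simp: prod_emb_def path_space_def)
  have "\<omega> k = x k" if "k \<in> {0..<n}" for k
    using fun_cong[OF \<omega>(2), of k] that by simp
  then show "\<omega> \<in> cyl l 0 n x" using \<omega>(1) by (auto simp: cyl_def)
qed (auto simp: cyl_def prod_emb_def path_space_def fun_eq_iff)

lemma emeasure_walk_cyl_0:
  assumes x: "x \<in> path_space l"
  shows "emeasure (walk l \<sigma> s j) (cyl l 0 n x) = (\<Prod>k<n. emeasure (walk_kernel l \<sigma> s j k x) {x k})"
proof -
  have "emeasure (walk l \<sigma> s j) (cyl l 0 n x) = emeasure (IT.CI {0..<n}) {restrict x {0..<n}}"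
    unfolding walk_eq cyl_0_emb[OF x] by (rule IT.lim) (use single_restrict_sets[OF x] in auto)
  also have "\<dots> = emeasure (IT.C 0 n (\<lambda>_. undefined)) (prod_emb {0..<n} (coord_space l) {0..<n} {restrict x {0..<n}})"
    by (rule IT.emeasure_CI) (use single_restrict_sets[OF x] in auto)
  also have "prod_emb {0..<n} (coord_space l) {0..<n} {restrict x {0..<n}} = {restrict x {0..<n}}"
    by (rule prod_emb_id) (use path_spaceD[OF x] in auto)
  finally show ?thesis by (simp add: emeasure_C_single[OF x])
qed

lemma prob_space_walk: "prob_space (walk l \<sigma> s j)"
proof
  have x: "(\<lambda>_. (0, 0)) \<in> path_space l"
    using stochastic_sequenceD(1)[OF st] by (auto simp: path_space_def Vset_def)
  have "emeasure (walk l \<sigma> s j) (cyl l 0 0 (\<lambda>_. (0, 0))) = 1" by (simp add: emeasure_walk_cyl_0[OF x])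
  then show "emeasure (walk l \<sigma> s j) (space (walk l \<sigma> s j)) = 1"
    by (simp add: cyl_def space_walk)
qed

lemma sets_cyl: "x \<in> path_space l \<Longrightarrow> cyl l n m x \<in> sets (walk l \<sigma> s j)"
proof -
  assume x: "x \<in> path_space l"
  have "cyl l n m x = {\<omega> \<in> space (PiM UNIV (coord_space l)). \<forall>k\<in>{n..<m}. \<omega> k \<in> {x k}}"
    by (auto simp: cyl_def space_PiM path_space_def)
  also have "\<dots> \<in> sets (PiM UNIV (coord_space l))"
  proof (rule sets.sets_Collect_finite_All)
    fix k
    have "(\<lambda>\<omega>. \<omega> k) \<in> PiM UNIV (coord_space l) \<rightarrow>\<^sub>M coord_space l k" by simp
    from measurable_sets[OF this, of "{x k}"] path_spaceD[OF x, of k]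
    have "(\<lambda>\<omega>. \<omega> k) -` {x k} \<inter> space (PiM UNIV (coord_space l)) \<in> sets (PiM UNIV (coord_space l))" by simp
    also have "(\<lambda>\<omega>. \<omega> k) -` {x k} \<inter> space (PiM UNIV (coord_space l)) = {\<omega> \<in> space (PiM UNIV (coord_space l)). \<omega> k \<in> {x k}}"
      by auto
    finally show "{\<omega> \<in> space (PiM UNIV (coord_space l)). \<omega> k \<in> {x k}} \<in> sets (PiM UNIV (coord_space l))" .
  qed simp
  finally show ?thesis by (simp add: sets_walk)
qed

text \<open>The second statement says that the walk started at level s is at its starting point at time s - 1.
  The dummy coordinates before are deterministic too, so they can be disregarded.\<close>

lemma emeasure_walk_cyl:
  assumes z: "z \<in> path_space l" and "s \<le> m"
  shows "emeasure (walk l \<sigma> s j) (cyl l s m z) =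
    (\<Prod>k\<in>{s..<m}. weight \<sigma> k (if k = s then (j, 0) else z (k - 1)) (z k))"
    and "s = Suc k \<Longrightarrow> AE \<omega> in walk l \<sigma> s j. \<omega> k = (j, 0)"
proof -
  interpret prob_space "walk l \<sigma> s j" by (rule prob_space_walk)
  \<comment> \<open>the path z with its coordinates before time s replaced by those that the walk takes almost surely\<close>
  define z' where "z' k = (if Suc k < s then (0, 0) else if Suc k = s then (j, 0) else z k)" for k
  have z': "z' \<in> path_space l"
    using path_spaceD[OF z] stochastic_sequenceD(1)[OF st] j
    by (intro path_spaceI) (auto simp: z'_def Vset_def)
  have early: "emeasure (walk_kernel l \<sigma> s j k z') {z' k} = 1" if "k < s" for k
    using that path_spaceD[OF z', of k] by (auto simp: walk_kernel_def z'_def)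
  have "emeasure (walk l \<sigma> s j) (cyl l 0 s z') = 1"
    unfolding emeasure_walk_cyl_0[OF z'] by (rule prod.neutral) (use early in auto)
  then have AE: "AE \<omega> in walk l \<sigma> s j. \<omega> \<in> cyl l 0 s z'"
    by (simp add: prob_eq_1[OF sets_cyl[OF z']] emeasure_eq_measure)
  show "AE \<omega> in walk l \<sigma> s j. \<omega> k = (j, 0)" if "s = Suc k"
    using AE by eventually_elim (use that in \<open>auto simp: cyl_def z'_def\<close>)
  have "emeasure (walk l \<sigma> s j) (cyl l s m z) = emeasure (walk l \<sigma> s j) (cyl l 0 m z')"
  proof (rule emeasure_eq_AE)
    show "AE \<omega> in walk l \<sigma> s j. \<omega> \<in> cyl l s m z \<longleftrightarrow> \<omega> \<in> cyl l 0 m z'"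
      using AE
    proof eventually_elim
      case (elim \<omega>)
      have e: "\<omega> k = z' k" if "k < s" for k using elim that by (auto simp: cyl_def)
      have "(\<forall>k\<in>{s..<m}. \<omega> k = z k) \<longleftrightarrow> (\<forall>k\<in>{0..<m}. \<omega> k = z' k)"
      proof (intro iffI ballI)
        fix k assume a: "\<forall>k\<in>{s..<m}. \<omega> k = z k" and k: "k \<in> {0..<m}"
        show "\<omega> k = z' k"
        proof (cases "k < s")
          case False
          then show ?thesis using a k by (simp add: z'_def)
        qed (rule e)
      next
        fix k assume "\<forall>k\<in>{0..<m}. \<omega> k = z' k" "k \<in> {s..<m}"
        then show "\<omega> k = z k" by (simp add: z'_def)
      qed
      then show ?case by (auto simp: cyl_def)
    qed
  qed (use sets_cyl z z' in auto)
  also have "\<dots> = (\<Prod>k\<in>{0..<m}. emeasure (walk_kernel l \<sigma> s j k z') {z' k})"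
    by (simp add: emeasure_walk_cyl_0[OF z'] atLeast0LessThan)
  also have "\<dots> = (\<Prod>k\<in>{0..<s}. emeasure (walk_kernel l \<sigma> s j k z') {z' k}) *
      (\<Prod>k\<in>{s..<m}. emeasure (walk_kernel l \<sigma> s j k z') {z' k})"
    by (rule prod.atLeastLessThan_concat[symmetric]) (use \<open>s \<le> m\<close> in auto)
  also have "(\<Prod>k\<in>{0..<s}. emeasure (walk_kernel l \<sigma> s j k z') {z' k}) = 1"
    by (rule prod.neutral) (use early in auto)
  also have "(\<Prod>k\<in>{s..<m}. emeasure (walk_kernel l \<sigma> s j k z') {z' k}) =
      (\<Prod>k\<in>{s..<m}. weight \<sigma> k (if k = s then (j, 0) else z (k - 1)) (z k))"
  proof (rule prod.cong[OF refl])
    fix k assume k: "k \<in> {s..<m}"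
    have "z' (k - 1) = z (k - 1)" if "k \<noteq> s" using k that by (auto simp: z'_def)
    then show "emeasure (walk_kernel l \<sigma> s j k z') {z' k} = weight \<sigma> k (if k = s then (j, 0) else z (k - 1)) (z k)"
      using k path_spaceD[OF z, of k] by (auto simp: walk_kernel_def emeasure_step_single weight_def z'_def)
  qed
  finally show "emeasure (walk l \<sigma> s j) (cyl l s m z) =
    (\<Prod>k\<in>{s..<m}. weight \<sigma> k (if k = s then (j, 0) else z (k - 1)) (z k))" by simp
qed

end

end

lemma sigma_algebra_future: "sigma_algebra (path_space l) (future l n)"
  unfolding future_def by (rule sigma_algebra_sigma_sets) auto

lemma future_sub: "T \<in> future l n \<Longrightarrow> T \<subseteq> path_space l"
  unfolding future_def by (rule sigma_sets_into_sp) auto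

lemma future_basic: "n \<le> k \<Longrightarrow> {\<omega> \<in> path_space l. \<omega> k \<in> A} \<in> future l n"
proof -
  assume "n \<le> k"
  have "{\<omega> \<in> path_space l. \<omega> k \<in> A} = {\<omega> \<in> path_space l. \<omega> k \<in> A \<inter> Vset l k}"
    using path_spaceD by blast
  moreover have "\<exists>k' A'. {\<omega> \<in> path_space l. \<omega> k \<in> A \<inter> Vset l k} = {\<omega> \<in> path_space l. \<omega> k' \<in> A'} \<and> n \<le> k' \<and> A' \<subseteq> Vset l k'"
    using \<open>n \<le> k\<close> by (intro exI[of _ k] exI[of _ "A \<inter> Vset l k"]) simp
  ultimately show ?thesis unfolding future_def by (intro sigma_sets.Basic) simp
qed

lemma future_mono: "n \<le> m \<Longrightarrow> future l m \<subseteq> future l n"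
  unfolding future_def by (rule sigma_sets_subseteq) (use order_trans in blast)

lemma cyl_future: "cyl l n m x \<in> future l n"
proof -
  interpret sigma_algebra "path_space l" "future l n" by (rule sigma_algebra_future)
  have "{\<omega> \<in> path_space l. \<omega> k = x k} \<in> future l n" if "k \<in> {n..<m}" for k
    using future_basic[of n k l "{x k}"] that by simp
  then have "{\<omega> \<in> path_space l. \<forall>k\<in>{n..<m}. \<omega> k = x k} \<in> future l n"
    by (rule sets_Collect_finite_All) auto
  then show ?thesis by (simp add: cyl_def)
qed

text \<open>The events from time n on are generated by the sets that fix finitely many positions; as
  those are countable in number for each end time, they suffice.\<close>

lemma future_eq_cyl:
  fixes l :: "nat \<Rightarrow> nat"
  assumes l: "\<And>n. 0 < l n"
  shows "future l n = sigma_sets (path_space l)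
    (insert {} {cyl l n m x | m x. n \<le> m \<and> (x :: nat \<Rightarrow> nat \<times> 'g::{zero,countable}) \<in> path_space l})" (is "_ = sigma_sets ?\<Omega> ?C")
proof
  interpret sigma_algebra "path_space l" "future l n" by (rule sigma_algebra_future)
  show "sigma_sets ?\<Omega> ?C \<subseteq> future l n"
    by (rule sigma_sets_subset) (auto intro: cyl_future)
  interpret C: sigma_algebra ?\<Omega> "sigma_sets ?\<Omega> ?C"
    by (rule sigma_algebra_sigma_sets) (auto simp: cyl_def)
  show "future l n \<subseteq> sigma_sets ?\<Omega> ?C"
    unfolding future_def
  proof (rule C.sigma_sets_subset, safe)
    fix k and A :: "(nat \<times> 'g) set" assume k: "n \<le> k" and A: "A \<subseteq> Vset l k"
    define D where "D = {y \<in> (\<Pi>\<^sub>E i\<in>{n..<Suc k}. Vset l i :: (nat \<times> 'g) set). y k \<in> A}"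
    define ext where "ext y = (\<lambda>i. if i \<in> {n..<Suc k} then y i else (0, 0))" for y :: "nat \<Rightarrow> nat \<times> 'g"
    have "countable (\<Pi>\<^sub>E i\<in>{n..<Suc k}. Vset l i :: (nat \<times> 'g) set)" by (intro countable_PiE) auto
    then have D: "countable D" unfolding D_def by (rule countable_subset[rotated]) auto
    have ext: "ext y \<in> path_space l" if "y \<in> D" for y
      using that l by (intro path_spaceI) (auto simp: ext_def D_def Vset_def PiE_iff)
    have "{\<omega> \<in> path_space l. \<omega> k \<in> A} = (\<Union>y\<in>D. cyl l n (Suc k) (ext y))"
    proof (intro equalityI subsetI)
      fix \<omega> assume "\<omega> \<in> {\<omega> \<in> path_space l. \<omega> k \<in> A}"
      then have "restrict \<omega> {n..<Suc k} \<in> D" "\<omega> \<in> cyl l n (Suc k) (ext (restrict \<omega> {n..<Suc k}))"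
        using k path_spaceD by (auto simp: D_def cyl_def ext_def)
      then show "\<omega> \<in> (\<Union>y\<in>D. cyl l n (Suc k) (ext y))" by blast
    next
      fix \<omega> assume "\<omega> \<in> (\<Union>y\<in>D. cyl l n (Suc k) (ext y))"
      then show "\<omega> \<in> {\<omega> \<in> path_space l. \<omega> k \<in> A}" using k by (auto simp: cyl_def ext_def D_def)
    qed
    also have "\<dots> \<in> sigma_sets ?\<Omega> ?C"
      by (rule C.countable_UN'[OF D]) (use ext k in \<open>blast intro: sigma_sets.Basic le_SucI\<close>)
    finally show "{\<omega> \<in> path_space l. \<omega> k \<in> A} \<in> sigma_sets ?\<Omega> ?C" .
  qed
qed

lemma cyl_Int_stable:
  "Int_stable (insert {} {cyl l n m x | m x. n \<le> m \<and> x \<in> path_space l})" (is "Int_stable ?C")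
proof (rule Int_stableI)
  have *: "cyl l n m x \<inter> cyl l n m' x' \<in> ?C" if "n \<le> m" "m \<le> m'" "x \<in> path_space l" "x' \<in> path_space l" for m m' x x'
  proof (cases "\<forall>k\<in>{n..<m}. x k = x' k")
    case True
    then have "cyl l n m x \<inter> cyl l n m' x' = cyl l n m' x'" using that by (auto simp: cyl_def)
    then show ?thesis using that by (blast intro: order_trans)
  next
    case False
    then have "cyl l n m x \<inter> cyl l n m' x' = {}" using that by (force simp: cyl_def)
    then show ?thesis by auto
  qed
  fix a b assume "a \<in> ?C" "b \<in> ?C"
  then consider "a = {} \<or> b = {}" | m x m' x' where "a = cyl l n m x" "b = cyl l n m' x'" "n \<le> m" "n \<le> m'"
      "x \<in> path_space l" "x' \<in> path_space l" by auto
  then show "a \<inter> b \<in> ?C"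
  proof cases
    case 2
    then show ?thesis
      using *[of m m' x x'] *[of m' m x' x] by (cases "m \<le> m'") (auto simp: Int_commute)
  qed auto
qed

lemma path_act_future:
  assumes "T \<in> future l n"
  shows "path_act g -` T \<inter> path_space l \<in> future l n"
  using assms unfolding future_def
proof (induction rule: sigma_sets.induct)
  case (Basic a)
  then obtain k and A :: "(nat \<times> 'a) set" where a: "a = {\<omega> \<in> path_space l. \<omega> k \<in> A}" "n \<le> k" by auto
  have "path_act g -` a \<inter> path_space l = {\<omega> \<in> path_space l. \<omega> k \<in> {v. (fst v, g + snd v) \<in> A}}"
    by (auto simp: a path_act_def[of g _ k])
  then show ?case using future_basic[OF a(2), of l "{v. (fst v, g + snd v) \<in> A}"] unfolding future_def by metis
next
  case Empty
  then show ?case by (simp add: sigma_sets.Empty)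
next
  case (Compl a)
  have "path_act g -` (path_space l - a) \<inter> path_space l = path_space l - (path_act g -` a \<inter> path_space l)" by auto
  then show ?case using Compl.IH by (simp add: sigma_sets.Compl)
next
  case (Union a)
  have eq: "path_act g -` (\<Union>i. a i) \<inter> path_space l = (\<Union>i. path_act g -` a i \<inter> path_space l)" by auto
  show ?case unfolding eq by (rule sigma_sets.Union) (rule Union.IH)
qed

lemma future_basicE:
  assumes "T \<in> future l n" "sigma_algebra (path_space l) S"
    "\<And>k A. n \<le> k \<Longrightarrow> {\<omega> \<in> path_space l. \<omega> k \<in> A} \<in> S"
  shows "T \<in> S"
proof -
  have "future l n \<subseteq> S"
    unfolding future_def by (rule sigma_algebra.sigma_sets_subset[OF assms(2)]) (use assms(3) in blast)
  then show ?thesis using assms(1) by blast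
qed

context
  fixes l :: "nat \<Rightarrow> nat" and \<sigma> :: "'g::{group_add,countable} mseq"
  assumes st: "stochastic_sequence l \<sigma>"
begin

lemma future_sets_walk:
  assumes j: "j < ldim l s" and T: "T \<in> future l n"
  shows "T \<in> sets (walk l \<sigma> s j)"
proof (rule future_basicE[OF T])
  show "sigma_algebra (path_space l) (sets (walk l \<sigma> s j))"
    using sets.sigma_algebra_axioms[of "walk l \<sigma> s j"] by (simp add: space_walk[OF st j])
  fix k and A :: "(nat \<times> 'g) set"
  have "(\<lambda>\<omega>. \<omega> k) \<in> PiM UNIV (coord_space l) \<rightarrow>\<^sub>M coord_space l k" by simp
  from measurable_sets[OF this, of "A \<inter> Vset l k"]
  have "(\<lambda>\<omega>. \<omega> k) -` (A \<inter> Vset l k) \<inter> space (PiM UNIV (coord_space l)) \<in> sets (PiM UNIV (coord_space l))" by simp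
  also have "(\<lambda>\<omega>. \<omega> k) -` (A \<inter> Vset l k) \<inter> space (PiM UNIV (coord_space l)) = {\<omega> \<in> path_space l. \<omega> k \<in> A}"
    by (auto simp: space_PiM path_space_def)
  finally show "{\<omega> \<in> path_space l. \<omega> k \<in> A} \<in> sets (walk l \<sigma> s j)" by (simp add: sets_walk[OF st j])
qed

lemma path_act_sets_walk:
  "j < ldim l s \<Longrightarrow> T \<in> future l n \<Longrightarrow> path_act g -` T \<inter> path_space l \<in> sets (walk l \<sigma> s j)"
  by (rule future_sets_walk[OF _ path_act_future])

lemma walk_markov_cyl:
  assumes j: "j < ldim l s" and n: "s \<le> n" "n \<le> m" and x: "x \<in> path_space l" and y: "y \<in> path_space l"
  shows "emeasure (walk l \<sigma> s j) (cyl l s (Suc n) x \<inter> cyl l n m y) =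
    emeasure (walk l \<sigma> s j) (cyl l s (Suc n) x) *
    emeasure (walk l \<sigma> (Suc n) (fst (x n))) (path_act (snd (x n)) -` cyl l n m y \<inter> path_space l)"
proof -
  define i g where "i = fst (x n)" and "g = snd (x n)"
  have xn: "x n = (i, g)" by (simp add: i_def g_def)
  have i: "i < ldim l (Suc n)" using path_spaceD[OF x, of n] by (simp add: i_def Vset_def mem_Times_iff)
  interpret W: prob_space "walk l \<sigma> (Suc n) i" by (rule prob_space_walk[OF st i])
  have start: "AE \<omega> in walk l \<sigma> (Suc n) i. \<omega> n = (i, 0)"
    by (rule emeasure_walk_cyl(2)[OF st i x le_refl refl])
  consider "m = n" | "n < m" "y n \<noteq> x n" | "n < m" "y n = x n" using n by fastforce
  then show ?thesis
    unfolding i_def[symmetric] g_def[symmetric]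
  proof cases
    case 1
    then have "cyl l s (Suc n) x \<inter> cyl l n m y = cyl l s (Suc n) x" "path_act g -` cyl l n m y \<inter> path_space l = path_space l"
      by (auto simp: cyl_def)
    then show "emeasure (walk l \<sigma> s j) (cyl l s (Suc n) x \<inter> cyl l n m y) =
      emeasure (walk l \<sigma> s j) (cyl l s (Suc n) x) *
      emeasure (walk l \<sigma> (Suc n) i) (path_act g -` cyl l n m y \<inter> path_space l)"
      using W.emeasure_space_1 by (simp add: space_walk[OF st i])
  next
    case 2
    then have "n \<in> {s..<Suc n}" "n \<in> {n..<m}" using n by auto
    then have e: "cyl l s (Suc n) x \<inter> cyl l n m y = {}" using 2 unfolding cyl_def by force
    have "emeasure (walk l \<sigma> (Suc n) i) (path_act g -` cyl l n m y \<inter> path_space l) = emeasure (walk l \<sigma> (Suc n) i) {}"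
    proof (rule emeasure_eq_AE)
      show "AE \<omega> in walk l \<sigma> (Suc n) i. \<omega> \<in> path_act g -` cyl l n m y \<inter> path_space l \<longleftrightarrow> \<omega> \<in> {}"
        using start
      proof eventually_elim
        case (elim \<omega>)
        have "path_act g \<omega> n \<noteq> y n" using elim 2 xn by (simp add: path_act_def)
        then show ?case using \<open>n \<in> {n..<m}\<close> by (auto simp: cyl_def)
      qed
    qed (use path_act_sets_walk[OF i cyl_future] in auto)
    then show "emeasure (walk l \<sigma> s j) (cyl l s (Suc n) x \<inter> cyl l n m y) =
      emeasure (walk l \<sigma> s j) (cyl l s (Suc n) x) *
      emeasure (walk l \<sigma> (Suc n) i) (path_act g -` cyl l n m y \<inter> path_space l)" by (simp add: e)
  next
    case 3
    define z where "z k = (if k \<le> n then x k else y k)" for k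
    have z: "z \<in> path_space l" using x y by (intro path_spaceI) (auto simp: z_def path_spaceD)
    have y': "path_act (- g) y \<in> path_space l" using y by simp
    have "cyl l s (Suc n) x \<inter> cyl l n m y = cyl l s m z"
    proof (intro set_eqI iffI)
      fix \<omega> assume "\<omega> \<in> cyl l s (Suc n) x \<inter> cyl l n m y"
      then show "\<omega> \<in> cyl l s m z" by (auto simp: cyl_def z_def)
    next
      fix \<omega> assume \<omega>: "\<omega> \<in> cyl l s m z"
      have "\<omega> k = x k" if "k \<in> {s..<Suc n}" for k using \<omega> that 3 by (auto simp: cyl_def z_def)
      moreover have "\<omega> k = y k" if "k \<in> {n..<m}" for k
      proof (cases "k = n")
        case True
        then show ?thesis using \<omega> 3 n by (auto simp: cyl_def z_def)
      next
        case False
        then show ?thesis using \<omega> that n by (auto simp: cyl_def z_def)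
      qed
      ultimately show "\<omega> \<in> cyl l s (Suc n) x \<inter> cyl l n m y" using \<omega> by (auto simp: cyl_def)
    qed
    then have "emeasure (walk l \<sigma> s j) (cyl l s (Suc n) x \<inter> cyl l n m y) =
        (\<Prod>k\<in>{s..<m}. weight \<sigma> k (if k = s then (j, 0) else z (k - 1)) (z k))"
      using n by (simp add: emeasure_walk_cyl(1)[OF st j z])
    also have "\<dots> = (\<Prod>k\<in>{s..<Suc n}. weight \<sigma> k (if k = s then (j, 0) else z (k - 1)) (z k)) *
        (\<Prod>k\<in>{Suc n..<m}. weight \<sigma> k (if k = s then (j, 0) else z (k - 1)) (z k))"
      by (rule prod.atLeastLessThan_concat[symmetric]) (use n 3 in auto)
    also have "(\<Prod>k\<in>{s..<Suc n}. weight \<sigma> k (if k = s then (j, 0) else z (k - 1)) (z k)) =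
        (\<Prod>k\<in>{s..<Suc n}. weight \<sigma> k (if k = s then (j, 0) else x (k - 1)) (x k))"
      by (rule prod.cong[OF refl]) (auto simp: z_def)
    also have "\<dots> = emeasure (walk l \<sigma> s j) (cyl l s (Suc n) x)"
      by (rule emeasure_walk_cyl(1)[OF st j x, symmetric]) (use n in simp)
    also have "(\<Prod>k\<in>{Suc n..<m}. weight \<sigma> k (if k = s then (j, 0) else z (k - 1)) (z k)) =
        (\<Prod>k\<in>{Suc n..<m}. weight \<sigma> k (if k = Suc n then (i, 0) else path_act (- g) y (k - 1)) (path_act (- g) y k))"
    proof (rule prod.cong[OF refl])
      fix k assume k: "k \<in> {Suc n..<m}"
      then have ks: "k \<noteq> s" using n by simp
      have zk: "z k = y k" using k by (simp add: z_def)
      show "weight \<sigma> k (if k = s then (j, 0) else z (k - 1)) (z k) =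
          weight \<sigma> k (if k = Suc n then (i, 0) else path_act (- g) y (k - 1)) (path_act (- g) y k)"
      proof (cases "k = Suc n")
        case True
        then have "z (k - 1) = (i, g)" using xn by (simp add: z_def)
        then show ?thesis using ks True zk by (simp add: weight_def path_act_def)
      next
        case False
        then have "z (k - 1) = y (k - 1)" using k by (auto simp: z_def)
        moreover have "weight \<sigma> k (y (k - 1)) (y k) = weight \<sigma> k (path_act (- g) y (k - 1)) (path_act (- g) y k)"
          using weight_translate[of \<sigma> k "fst (y (k - 1))" "- g" "snd (y (k - 1))" "fst (y k)" "snd (y k)"]
          by (simp add: path_act_def)
        ultimately show ?thesis using ks False zk by simp
      qed
    qed
    also have "\<dots> = emeasure (walk l \<sigma> (Suc n) i) (cyl l (Suc n) m (path_act (- g) y))"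
      using 3 by (subst emeasure_walk_cyl(1)[OF st i y']) auto
    also have "\<dots> = emeasure (walk l \<sigma> (Suc n) i) (path_act g -` cyl l n m y \<inter> path_space l)"
    proof (rule emeasure_eq_AE)
      show "AE \<omega> in walk l \<sigma> (Suc n) i. \<omega> \<in> cyl l (Suc n) m (path_act (- g) y) \<longleftrightarrow>
          \<omega> \<in> path_act g -` cyl l n m y \<inter> path_space l"
        using start
      proof eventually_elim
        case (elim \<omega>)
        have e: "path_act g \<omega> k = y k \<longleftrightarrow> \<omega> k = path_act (- g) y k" for k
          by (auto simp: path_act_def prod_eq_iff eq_neg_iff_add_eq_0 add.assoc[symmetric] dest: arg_cong[where f="\<lambda>u. - g + u"])
        have 0: "path_act g \<omega> n = y n" using elim 3 xn by (simp add: path_act_def)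
        have "(\<forall>k\<in>{n..<m}. path_act g \<omega> k = y k) \<longleftrightarrow> (\<forall>k\<in>{Suc n..<m}. path_act g \<omega> k = y k)"
        proof (intro iffI ballI)
          fix k assume a: "\<forall>k\<in>{Suc n..<m}. path_act g \<omega> k = y k" and k: "k \<in> {n..<m}"
          show "path_act g \<omega> k = y k" using a k 0 by (cases "k = n") auto
        qed auto
        then show ?case by (auto simp: cyl_def e)
      qed
    qed (use future_sets_walk[OF i cyl_future] path_act_sets_walk[OF i cyl_future] in auto)
    finally show "emeasure (walk l \<sigma> s j) (cyl l s (Suc n) x \<inter> cyl l n m y) =
      emeasure (walk l \<sigma> s j) (cyl l s (Suc n) x) *
      emeasure (walk l \<sigma> (Suc n) i) (path_act g -` cyl l n m y \<inter> path_space l)" .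
  qed
qed

text \<open>The Markov property: given the positions up to time n, the future is a translate of the walk
  that starts at the current position.\<close>

lemma walk_markov:
  assumes j: "j < ldim l s" and n: "s \<le> n" and x: "x \<in> path_space l" and T: "T \<in> future l n"
  shows "emeasure (walk l \<sigma> s j) (cyl l s (Suc n) x \<inter> T) =
    emeasure (walk l \<sigma> s j) (cyl l s (Suc n) x) *
    emeasure (walk l \<sigma> (Suc n) (fst (x n))) (path_act (snd (x n)) -` T \<inter> path_space l)"
proof -
  define i g where "i = fst (x n)" and "g = snd (x n)"
  have i: "i < ldim l (Suc n)" using path_spaceD[OF x, of n] by (simp add: i_def Vset_def mem_Times_iff)
  interpret P: prob_space "walk l \<sigma> s j" by (rule prob_space_walk[OF st j])
  interpret W: prob_space "walk l \<sigma> (Suc n) i" by (rule prob_space_walk[OF st i])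
  let ?C = "cyl l s (Suc n) x" and ?P = "measure (walk l \<sigma> s j)" and ?W = "measure (walk l \<sigma> (Suc n) i)"
  have C: "?C \<in> sets (walk l \<sigma> s j)" by (rule sets_cyl[OF st j x])
  have T': "T \<in> sigma_sets (path_space l) (insert {} {cyl l n m x | m x. n \<le> m \<and> x \<in> path_space l})"
    using T unfolding future_eq_cyl[OF stochastic_sequenceD(1)[OF st]] .
  have "?P (?C \<inter> T) = ?P ?C * ?W (path_act g -` T \<inter> path_space l)"
  proof (rule sigma_sets_induct_disjoint[OF cyl_Int_stable _ T'])
    show "insert {} {cyl l n m x | m x. n \<le> m \<and> x \<in> path_space l} \<subseteq> Pow (path_space l)"
      by (auto simp: cyl_def)
  next
    fix A :: "(nat \<Rightarrow> nat \<times> 'g) set"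
    assume "A \<in> insert {} {cyl l n m x | m x. n \<le> m \<and> x \<in> path_space l}"
    then consider "A = {}" | m y where "A = cyl l n m y" "n \<le> m" "y \<in> path_space l" by auto
    then show "?P (?C \<inter> A) = ?P ?C * ?W (path_act g -` A \<inter> path_space l)"
    proof cases
      case 2
      show ?thesis
        using walk_markov_cyl[OF j n 2(2) x 2(3)]
        unfolding i_def[symmetric] g_def[symmetric] 2(1) P.emeasure_eq_measure W.emeasure_eq_measure
        by (simp add: ennreal_mult[symmetric])
    qed simp
  next
    fix A assume "A \<in> sigma_sets (path_space l) (insert {} {cyl l n m x | m x. n \<le> m \<and> (x :: nat \<Rightarrow> nat \<times> 'g) \<in> path_space l})"
      and IH: "?P (?C \<inter> A) = ?P ?C * ?W (path_act g -` A \<inter> path_space l)"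
    then have A: "A \<in> future l n" unfolding future_eq_cyl[OF stochastic_sequenceD(1)[OF st]] by blast
    have "?P (?C \<inter> (path_space l - A)) = ?P ?C - ?P (?C \<inter> A)"
    proof -
      have "?C \<inter> (path_space l - A) = ?C - ?C \<inter> A" by (auto simp: cyl_def)
      then show ?thesis
        using P.finite_measure_Diff[OF C, of "?C \<inter> A"] C future_sets_walk[OF j A] by auto
    qed
    moreover have "?W (path_act g -` (path_space l - A) \<inter> path_space l) = 1 - ?W (path_act g -` A \<inter> path_space l)"
    proof -
      have "path_act g -` (path_space l - A) \<inter> path_space l = space (walk l \<sigma> (Suc n) i) - (path_act g -` A \<inter> path_space l)"
        by (auto simp: space_walk[OF st i])
      then show ?thesis using W.prob_compl[OF path_act_sets_walk[OF i A]] by simp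
    qed
    ultimately show "?P (?C \<inter> (path_space l - A)) = ?P ?C * ?W (path_act g -` (path_space l - A) \<inter> path_space l)"
      using IH by (simp only: right_diff_distrib mult_1_right)
  next
    fix A :: "nat \<Rightarrow> (nat \<Rightarrow> nat \<times> 'g) set"
    assume dis: "disjoint_family A"
      and "range A \<subseteq> sigma_sets (path_space l) (insert {} {cyl l n m x | m x. n \<le> m \<and> x \<in> path_space l})"
      and IH: "\<And>k. ?P (?C \<inter> A k) = ?P ?C * ?W (path_act g -` A k \<inter> path_space l)"
    then have A: "A k \<in> future l n" for k unfolding future_eq_cyl[OF stochastic_sequenceD(1)[OF st]] by blast
    have "(\<lambda>k. ?P (?C \<inter> A k)) sums ?P (\<Union>k. ?C \<inter> A k)"
      by (rule P.finite_measure_UNION) (use C future_sets_walk[OF j A] dis in \<open>auto simp: disjoint_family_on_def\<close>)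
    moreover have "(\<lambda>k. ?P ?C * ?W (path_act g -` A k \<inter> path_space l)) sums (?P ?C * ?W (\<Union>k. path_act g -` A k \<inter> path_space l))"
    proof (intro sums_mult W.finite_measure_UNION)
      show "disjoint_family (\<lambda>k. path_act g -` A k \<inter> path_space l)"
        using dis unfolding disjoint_family_on_def by blast
    qed (use path_act_sets_walk[OF i A] in auto)
    ultimately have "?P (\<Union>k. ?C \<inter> A k) = ?P ?C * ?W (\<Union>k. path_act g -` A k \<inter> path_space l)"
      unfolding IH by (rule sums_unique2)
    moreover have "(\<Union>k. ?C \<inter> A k) = ?C \<inter> (\<Union>k. A k)"
      "(\<Union>k. path_act g -` A k \<inter> path_space l) = path_act g -` (\<Union>k. A k) \<inter> path_space l" by auto
    ultimately show "?P (?C \<inter> \<Union> (range A)) = ?P ?C * ?W (path_act g -` \<Union> (range A) \<inter> path_space l)"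
      by simp
  qed simp_all
  then show ?thesis
    unfolding i_def[symmetric] g_def[symmetric] P.emeasure_eq_measure W.emeasure_eq_measure
    by (simp add: ennreal_mult)
qed

lemma walk_stationary:
  assumes i: "i < ldim l n" and T: "T \<in> future l n"
  shows "emeasure (walk l \<sigma> n i) T = (\<Sum>k<l n. \<integral>\<^sup>+h. \<sigma> n i k h *
    emeasure (walk l \<sigma> (Suc n) k) (path_act h -` T \<inter> path_space l) \<partial>count_space UNIV)"
proof -
  define x where "x v = (\<lambda>k. if k = n then v else (0, 0))" for v :: "nat \<times> 'g"
  have x: "x v \<in> path_space l" if "v \<in> Vset l n" for v
    using that stochastic_sequenceD(1)[OF st] by (intro path_spaceI) (auto simp: x_def Vset_def)
  have c: "cyl l n (Suc n) (x v) = {\<omega> \<in> path_space l. \<omega> n = v}" for v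
  proof -
    have "{n..<Suc n} = {n}" by auto
    then show ?thesis by (simp add: cyl_def x_def)
  qed
  have "T = (\<Union>v\<in>Vset l n. cyl l n (Suc n) (x v) \<inter> T)"
    using future_sub[OF T] path_spaceD unfolding c by blast
  then have "emeasure (walk l \<sigma> n i) T = emeasure (walk l \<sigma> n i) (\<Union>v\<in>Vset l n. cyl l n (Suc n) (x v) \<inter> T)" by simp
  also have "\<dots> = (\<integral>\<^sup>+v. emeasure (walk l \<sigma> n i) (cyl l n (Suc n) (x v) \<inter> T) \<partial>count_space (Vset l n))"
  proof (rule emeasure_UN_countable)
    show "cyl l n (Suc n) (x v) \<inter> T \<in> sets (walk l \<sigma> n i)" if "v \<in> Vset l n" for v :: "nat \<times> 'g"
      using sets_cyl[OF st i x[OF that]] future_sets_walk[OF i T] by (rule sets.Int)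
    show "disjoint_family_on (\<lambda>v. cyl l n (Suc n) (x v) \<inter> T) (Vset l n :: (nat \<times> 'g) set)"
      by (auto simp: c disjoint_family_on_def)
  qed simp
  also have "\<dots> = (\<integral>\<^sup>+v. \<sigma> n i (fst v) (snd v) *
      emeasure (walk l \<sigma> (Suc n) (fst v)) (path_act (snd v) -` T \<inter> path_space l) \<partial>count_space (Vset l n))"
  proof (rule nn_integral_cong)
    fix v :: "nat \<times> 'g" assume "v \<in> space (coord_space l n)"
    then have v: "v \<in> Vset l n" by simp
    have "{n..<Suc n} = {n}" by auto
    then have "emeasure (walk l \<sigma> n i) (cyl l n (Suc n) (x v)) = \<sigma> n i (fst v) (snd v)"
      using emeasure_walk_cyl(1)[OF st i x[OF v], of "Suc n"] by (simp add: weight_def x_def)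
    then show "emeasure (walk l \<sigma> n i) (cyl l n (Suc n) (x v) \<inter> T) = \<sigma> n i (fst v) (snd v) *
      emeasure (walk l \<sigma> (Suc n) (fst v)) (path_act (snd v) -` T \<inter> path_space l)"
      using walk_markov[OF i le_refl x[OF v] T] by (simp add: x_def)
  qed
  finally show ?thesis by (simp add: nn_integral_Vset)
qed

text \<open>The law of the future from time n on, by conditioning on the position at time n.\<close>

lemma walk_tprod:
  assumes i: "i < ldim l s" and "s \<le> n" and T: "T \<in> future l n"
  shows "emeasure (walk l \<sigma> s i) T = (\<Sum>k<l n. \<integral>\<^sup>+h. tprod l \<sigma> s n i k h *
    emeasure (walk l \<sigma> (Suc n) k) (path_act h -` T \<inter> path_space l) \<partial>count_space UNIV)"
  using \<open>s \<le> n\<close> T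
proof (induction n rule: dec_induct)
  case base
  then show ?case using walk_stationary[OF i] by simp
next
  case (step n)
  have T': "T \<in> future l n" using step(4) future_mono[of n "Suc n" l] by auto
  let ?F = "\<lambda>m v. emeasure (walk l \<sigma> (Suc (Suc n)) m) (path_act v -` T \<inter> path_space l)"
  have inner: "emeasure (walk l \<sigma> (Suc n) k) (path_act h -` T \<inter> path_space l) =
      (\<Sum>m<l (Suc n). \<integral>\<^sup>+u. \<sigma> (Suc n) k m u * ?F m (h + u) \<partial>count_space UNIV)" if "k < l n" for k h
  proof -
    have "path_act u -` (path_act h -` T \<inter> path_space l) \<inter> path_space l = path_act (h + u) -` T \<inter> path_space l" for u
      by (auto simp: path_act_add)
    then show ?thesis
      using walk_stationary[OF _ path_act_future[OF step(4)], of k h] that by simp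
  qed
  have "emeasure (walk l \<sigma> s i) T = (\<Sum>k<l n. \<integral>\<^sup>+h. tprod l \<sigma> s n i k h *
      (\<Sum>m<l (Suc n). \<integral>\<^sup>+u. \<sigma> (Suc n) k m u * ?F m (h + u) \<partial>count_space UNIV) \<partial>count_space UNIV)"
    using step.IH[OF T'] inner by simp
  also have "\<dots> = (\<Sum>m<l (Suc n). \<integral>\<^sup>+v. (\<Sum>k<l n. \<integral>\<^sup>+h. tprod l \<sigma> s n i k h * \<sigma> (Suc n) k m (- h + v) \<partial>count_space UNIV) *
      ?F m v \<partial>count_space UNIV)"
    by (rule convolution_assoc)
  finally show ?case using step(1) by (simp add: tprod_Suc mconv_def)
qed

lemma walk_tprod_at:
  assumes i: "i < ldim l s" and "s \<le> n" and T: "T \<in> future l n" and v: "v \<in> Vset l n"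
  shows "emeasure (walk l \<sigma> s i) ({\<omega> \<in> path_space l. \<omega> n = v} \<inter> T) = tprod l \<sigma> s n i (fst v) (snd v) *
    emeasure (walk l \<sigma> (Suc n) (fst v)) (path_act (snd v) -` T \<inter> path_space l)"
proof -
  interpret F: sigma_algebra "path_space l" "future l n" by (rule sigma_algebra_future)
  have B: "{\<omega> \<in> path_space l. \<omega> n = v} \<in> future l n" using future_basic[of n n l "{v}"] by simp
  then have T': "{\<omega> \<in> path_space l. \<omega> n = v} \<inter> T \<in> future l n" using T by blast
  let ?w = "\<lambda>u. emeasure (walk l \<sigma> (Suc n) (fst u)) (path_act (snd u) -` T \<inter> path_space l)"
  have "emeasure (walk l \<sigma> s i) ({\<omega> \<in> path_space l. \<omega> n = v} \<inter> T) =
      (\<integral>\<^sup>+u. tprod l \<sigma> s n i (fst u) (snd u) *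
        emeasure (walk l \<sigma> (Suc n) (fst u)) (path_act (snd u) -` ({\<omega> \<in> path_space l. \<omega> n = v} \<inter> T) \<inter> path_space l) \<partial>coord_space l n)"
    by (simp add: walk_tprod[OF i \<open>s \<le> n\<close> T'] nn_integral_Vset)
  also have "\<dots> = (\<integral>\<^sup>+u. (tprod l \<sigma> s n i (fst v) (snd v) * ?w v) * indicator {v} u \<partial>coord_space l n)"
  proof (rule nn_integral_cong)
    fix u :: "nat \<times> 'g" assume "u \<in> space (coord_space l n)"
    then have u: "fst u < ldim l (Suc n)" by (simp add: Vset_def mem_Times_iff)
    obtain x :: "nat \<Rightarrow> nat \<times> 'g" where x: "x \<in> path_space l"
      using stochastic_sequenceD(1)[OF st] that[of "\<lambda>_. (0, 0)"] by (auto simp: path_space_def Vset_def)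
    have "AE \<omega> in walk l \<sigma> (Suc n) (fst u). \<omega> n = (fst u, 0)"
      by (rule emeasure_walk_cyl(2)[OF st u x le_refl refl])
    then have "AE \<omega> in walk l \<sigma> (Suc n) (fst u). path_act (snd u) \<omega> n = u"
      by eventually_elim (simp add: path_act_def)
    then have "AE \<omega> in walk l \<sigma> (Suc n) (fst u). \<omega> \<in> path_act (snd u) -` ({\<omega> \<in> path_space l. \<omega> n = v} \<inter> T) \<inter> path_space l \<longleftrightarrow>
        \<omega> \<in> (if u = v then path_act (snd u) -` T \<inter> path_space l else {})"
      by eventually_elim auto
    then have "emeasure (walk l \<sigma> (Suc n) (fst u)) (path_act (snd u) -` ({\<omega> \<in> path_space l. \<omega> n = v} \<inter> T) \<inter> path_space l) =
        emeasure (walk l \<sigma> (Suc n) (fst u)) (if u = v then path_act (snd u) -` T \<inter> path_space l else {})"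
      by (rule emeasure_eq_AE) (use path_act_sets_walk[OF u T'] path_act_sets_walk[OF u T] in \<open>auto split: if_splits\<close>)
    then show "tprod l \<sigma> s n i (fst u) (snd u) *
        emeasure (walk l \<sigma> (Suc n) (fst u)) (path_act (snd u) -` ({\<omega> \<in> path_space l. \<omega> n = v} \<inter> T) \<inter> path_space l) =
        (tprod l \<sigma> s n i (fst v) (snd v) * ?w v) * indicator {v} u"
      by (auto split: split_indicator)
  qed
  also have "\<dots> = tprod l \<sigma> s n i (fst v) (snd v) * ?w v"
    using v by (subst nn_integral_indicator_singleton) auto
  finally show ?thesis .
qed

end

section \<open>The tail system\<close>

lemma tail_sets_future: "tail_sets l = (\<Inter>n. future l n)"
  by (simp add: tail_sets_def future_def)

lemma sigma_algebra_tail: "sigma_algebra (path_space l) (tail_sets l)"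
proof (rule sigma_algebra_iff2[THEN iffD2], intro conjI ballI allI impI)
  show "tail_sets l \<subseteq> Pow (path_space l)"
    using future_sub[of _ l 0] unfolding tail_sets_future by blast
  show "{} \<in> tail_sets l"
    by (auto simp: tail_sets_future future_def intro: sigma_sets.Empty)
  show "path_space l - T \<in> tail_sets l" if "T \<in> tail_sets l" for T
    using that by (auto simp: tail_sets_future future_def intro: sigma_sets.Compl)
  show "(\<Union>i. A i) \<in> tail_sets l" if "range A \<subseteq> tail_sets l" for A :: "nat \<Rightarrow> _"
    using that by (auto simp: tail_sets_future future_def subset_eq intro!: sigma_sets.Union)
qed

lemma act_tail [simp]: "act (tail_system l \<sigma>) = path_act"
  by (simp add: tail_system_def path_act_def fun_eq_iff)

context
  fixes l :: "nat \<Rightarrow> nat" and \<sigma> :: "'g::{group_add,countable} mseq"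
  assumes st: "stochastic_sequence l \<sigma>"
begin

lemma subalgebra_tail:
  assumes j: "j < ldim l s"
  shows "subalgebra (walk l \<sigma> s j) (sigma (path_space l) (tail_sets l))"
proof -
  interpret T: sigma_algebra "path_space l" "tail_sets l :: (nat \<Rightarrow> nat \<times> 'g) set set" by (rule sigma_algebra_tail)
  have "tail_sets l \<subseteq> sets (walk l \<sigma> s j)"
    using future_sets_walk[OF st j, of _ 0] unfolding tail_sets_future by blast
  then show ?thesis
    by (simp add: subalgebra_def space_walk[OF st j] T.space_closed T.sigma_sets_eq)
qed

lemma subalgebra_future:
  assumes j: "j < ldim l s"
  shows "subalgebra (walk l \<sigma> s j) (sigma (path_space l) (future l n))"
proof -
  interpret T: sigma_algebra "path_space l" "future l n :: (nat \<Rightarrow> nat \<times> 'g) set set" by (rule sigma_algebra_future)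
  show ?thesis
    using future_sets_walk[OF st j]
    by (auto simp: subalgebra_def space_walk[OF st j] T.space_closed T.sigma_sets_eq)
qed

lemma sets_tail:
  assumes j: "j < ldim l s"
  shows "sets (nu (tail_system l \<sigma>) s j) = tail_sets l"
    and "space (nu (tail_system l \<sigma>) s j) = path_space l"
    and "T \<in> tail_sets l \<Longrightarrow> emeasure (nu (tail_system l \<sigma>) s j) T = emeasure (walk l \<sigma> s j) T"
proof -
  interpret T: sigma_algebra "path_space l" "tail_sets l :: (nat \<Rightarrow> nat \<times> 'g) set set" by (rule sigma_algebra_tail)
  show 1: "sets (nu (tail_system l \<sigma>) s j) = tail_sets l"
    using sets_restr_to_subalg[OF subalgebra_tail[OF j]]
    by (simp add: tail_system_def T.space_closed T.sigma_sets_eq)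
  show "space (nu (tail_system l \<sigma>) s j) = path_space l"
    by (simp add: tail_system_def space_restr_to_subalg space_walk[OF st j])
  show "emeasure (nu (tail_system l \<sigma>) s j) T = emeasure (walk l \<sigma> s j) T" if "T \<in> tail_sets l"
    using emeasure_restr_to_subalg[OF subalgebra_tail[OF j], of T] that
    by (simp add: tail_system_def T.space_closed T.sigma_sets_eq)
qed

lemma path_act_tail:
  "T \<in> tail_sets l \<Longrightarrow> path_act g -` T \<inter> path_space l \<in> tail_sets l"
  unfolding tail_sets_future by (blast intro: path_act_future)

lemma measurable_path_act_tail: "path_act g \<in> base (tail_system l \<sigma>) \<rightarrow>\<^sub>M base (tail_system l \<sigma>)"
  by (rule measurableI) (simp_all add: sets_tail[of 0 0, simplified] path_act_tail)

lemma emeasure_translate_tail: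
  assumes j: "j < ldim l s" and T: "T \<in> tail_sets l"
  shows "emeasure (translate (tail_system l \<sigma>) g (nu (tail_system l \<sigma>) s j)) T =
    emeasure (walk l \<sigma> s j) (path_act g -` T \<inter> path_space l)"
proof -
  have "path_act g \<in> nu (tail_system l \<sigma>) s j \<rightarrow>\<^sub>M base (tail_system l \<sigma>)"
    by (rule measurableI) (use sets_tail[OF j] in \<open>simp_all add: sets_tail[of 0 0, simplified] path_act_tail\<close>)
  then show ?thesis
    unfolding translate_def using T sets_tail[OF j] path_act_tail[OF T]
    by (simp add: emeasure_distr sets_tail[of 0 0, simplified])
qed

theorem sigma_system_tail: "sigma_system l \<sigma> (tail_system l \<sigma>)"
  unfolding sigma_system_def
proof (intro conjI allI impI ballI)
  fix s j assume j: "j < ldim l s"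
  show "prob_space (nu (tail_system l \<sigma>) s j)"
    using prob_space_restr_to_subalg[OF subalgebra_tail[OF j] prob_space_walk[OF st j]]
    by (simp add: tail_system_def)
  show "sets (nu (tail_system l \<sigma>) s j) = sets (base (tail_system l \<sigma>))"
    by (simp add: sets_tail[OF j] sets_tail[of 0 0, simplified])
next
  show "act (tail_system l \<sigma>) g \<in> base (tail_system l \<sigma>) \<rightarrow>\<^sub>M base (tail_system l \<sigma>)" for g
    using measurable_path_act_tail by simp
  show "act (tail_system l \<sigma>) 0 \<omega> = \<omega>" for \<omega> by simp
  show "act (tail_system l \<sigma>) (g + h) \<omega> = act (tail_system l \<sigma>) g (act (tail_system l \<sigma>) h \<omega>)" for g h \<omega>
    by (simp add: path_act_add)
next
  fix n i T assume i: "i < ldim l n" and "T \<in> sets (base (tail_system l \<sigma>))"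
  then have T: "T \<in> tail_sets l" by (simp add: sets_tail[of 0 0, simplified])
  then have "T \<in> future l n" by (simp add: tail_sets_future)
  then show "emeasure (nu (tail_system l \<sigma>) n i) T = (\<Sum>j<l n. \<integral>\<^sup>+g. \<sigma> n i j g *
      emeasure (translate (tail_system l \<sigma>) g (nu (tail_system l \<sigma>) (Suc n) j)) T \<partial>count_space UNIV)"
    using walk_stationary[OF st i] emeasure_translate_tail[OF _ T, of _ "Suc n"]
    by (simp add: sets_tail(3)[OF i T])
qed

end

section \<open>Ratios of transition probabilities\<close>

lemma rn_ennreal:
  fixes \<sigma> :: "('g::{group_add,countable}) mseq"
  assumes X: "sigma_system l \<sigma> X" and sp: "spread l \<sigma>" and i: "i < ldim l s"
  shows "AE x in base X. ennreal (enn2real (rn X g s i x)) = rn X g s i x"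
  using rn_finite[OF X sp i, of g] by eventually_elim (simp add: less_top)

lemma rn_integral:
  fixes \<sigma> :: "('g::{group_add,countable}) mseq"
  assumes X: "sigma_system l \<sigma> X" and sp: "spread l \<sigma>" and i: "i < ldim l s"
  shows "integrable (base X) (\<lambda>x. enn2real (rn X g s i x))"
    and "A \<in> sets (base X) \<Longrightarrow>
      (\<integral>x. enn2real (rn X g s i x) * indicator A x \<partial>base X) = measure (translate X g (nu X s i)) A"
proof -
  interpret T: prob_space "translate X g (nu X s i)"
    by (rule prob_space_translate[OF X sys_prob[OF X i] sys_sets[OF X i]])
  have *: "(\<integral>\<^sup>+x. ennreal (enn2real (rn X g s i x) * indicator A x) \<partial>base X) = emeasure (translate X g (nu X s i)) A"
    if A: "A \<in> sets (base X)" for A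
  proof -
    have "(\<integral>\<^sup>+x. ennreal (enn2real (rn X g s i x) * indicator A x) \<partial>base X) = (\<integral>\<^sup>+x\<in>A. rn X g s i x \<partial>base X)"
    proof (rule nn_integral_cong_AE)
      show "AE x in base X. ennreal (enn2real (rn X g s i x) * indicator A x) = rn X g s i x * indicator A x"
        using rn_ennreal[OF X sp i, of g] by eventually_elim (auto split: split_indicator)
    qed
    then show ?thesis by (simp add: emeasure_translate_rn[OF X sp i A])
  qed
  show "integrable (base X) (\<lambda>x. enn2real (rn X g s i x))"
  proof (rule integrableI_nonneg)
    have "(\<integral>\<^sup>+x. ennreal (enn2real (rn X g s i x)) \<partial>base X) =
        (\<integral>\<^sup>+x. ennreal (enn2real (rn X g s i x) * indicator (space (base X)) x) \<partial>base X)"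
      by (intro nn_integral_cong) simp
    then show "(\<integral>\<^sup>+x. ennreal (enn2real (rn X g s i x)) \<partial>base X) < \<infinity>"
      using *[of "space (base X)"] by (simp add: T.emeasure_eq_measure)
  qed auto
  show "(\<integral>x. enn2real (rn X g s i x) * indicator A x \<partial>base X) = measure (translate X g (nu X s i)) A"
    if A: "A \<in> sets (base X)"
    by (subst integral_eq_nn_integral) (use A *[OF A] in \<open>auto simp: measure_def\<close>)
qed

lemma
  fixes l :: "nat \<Rightarrow> nat"
  shows sets_sigma_future [simp]: "sets (sigma (path_space l) (future l n :: (nat \<Rightarrow> nat \<times> 'g) set set)) = future l n"
    and space_sigma_future [simp]: "space (sigma (path_space l) (future l n :: (nat \<Rightarrow> nat \<times> 'g) set set)) = path_space l"
proof -
  interpret F: sigma_algebra "path_space l" "future l n :: (nat \<Rightarrow> nat \<times> 'g) set set" by (rule sigma_algebra_future)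
  show "sets (sigma (path_space l) (future l n :: (nat \<Rightarrow> nat \<times> 'g) set set)) = future l n"
    unfolding sets_measure_of[OF F.space_closed] by (rule F.sigma_sets_eq)
  show "space (sigma (path_space l) (future l n :: (nat \<Rightarrow> nat \<times> 'g) set set)) = path_space l"
    using F.space_closed by (rule space_measure_of)
qed

text \<open>Ratios of transition probabilities. They are the derivatives of the law of the position
  at time n of a walk with another start, translated by g, with respect to that of the walk
  that defines the base measure. The value 0 before the start of the walk is immaterial.\<close>

definition martin :: "(nat \<Rightarrow> nat) \<Rightarrow> 'g::group_add mseq \<Rightarrow> 'g \<Rightarrow> nat \<Rightarrow> nat \<Rightarrow> nat \<Rightarrow> nat \<times> 'g \<Rightarrow> real" where
  "martin l \<sigma> g s i n v = (if s \<le> n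
     then enn2real (tprod l \<sigma> s n i (fst v) (- g + snd v)) / enn2real (tprod l \<sigma> 0 n 0 (fst v) (snd v)) else 0)"

context
  fixes l :: "nat \<Rightarrow> nat" and \<sigma> :: "'g::{group_add,countable} mseq"
  assumes st: "stochastic_sequence l \<sigma>" and sp: "spread l \<sigma>"
begin

lemma tprod_finite:
  assumes "i < ldim l s" "s \<le> n" "k < l n"
  shows "tprod l \<sigma> s n i k h < top"
  using tprod_le_1[OF st assms, of h] ennreal_one_less_top by (rule le_less_trans)

lemma tprod_real:
  assumes "i < ldim l s" "s \<le> n" "k < l n"
  shows "ennreal (enn2real (tprod l \<sigma> s n i k h)) = tprod l \<sigma> s n i k h"
  using tprod_finite[OF assms, of h] by simp

lemma tprod_real_pos: "k < l n \<Longrightarrow> 0 < enn2real (tprod l \<sigma> 0 n 0 k h)"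
  using tprod_pos[OF sp, of k n h] tprod_finite[of 0 0 n k h]
  by (simp add: enn2real_positive_iff)

lemma martin_nonneg: "0 \<le> martin l \<sigma> g s i n v"
  by (simp add: martin_def)

lemma martin_mult:
  assumes i: "i < ldim l s" and "s \<le> n" and v: "v \<in> Vset l n"
  shows "ennreal (martin l \<sigma> g s i n v) * tprod l \<sigma> 0 n 0 (fst v) (snd v) = tprod l \<sigma> s n i (fst v) (- g + snd v)"
proof -
  have k: "fst v < l n" using v by (simp add: Vset_def mem_Times_iff)
  have "ennreal (martin l \<sigma> g s i n v) * tprod l \<sigma> 0 n 0 (fst v) (snd v) =
      ennreal (martin l \<sigma> g s i n v) * ennreal (enn2real (tprod l \<sigma> 0 n 0 (fst v) (snd v)))"
    using k by (simp add: tprod_real)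
  also have "\<dots> = ennreal (martin l \<sigma> g s i n v * enn2real (tprod l \<sigma> 0 n 0 (fst v) (snd v)))"
    by (simp add: ennreal_mult martin_nonneg)
  also have "martin l \<sigma> g s i n v * enn2real (tprod l \<sigma> 0 n 0 (fst v) (snd v)) = enn2real (tprod l \<sigma> s n i (fst v) (- g + snd v))"
    using tprod_real_pos[OF k, of "snd v"] \<open>s \<le> n\<close> by (simp add: martin_def)
  finally show ?thesis using i k \<open>s \<le> n\<close> by (simp add: tprod_real)
qed

text \<open>The walk that defines the base measure may first go to the translated starting point, which
  happens with a positive probability; its inverse bounds the ratios.\<close>

lemma martin_bounded:
  assumes i: "i < l s"
  shows "\<exists>C\<ge>0. \<forall>n. \<forall>v\<in>Vset l n. martin l \<sigma> g (Suc s) i n v \<le> C"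
proof (intro exI conjI allI ballI)
  let ?c = "enn2real (tprod l \<sigma> 0 s 0 i g)"
  have c: "0 < ?c" by (rule tprod_real_pos[OF i])
  then show "0 \<le> 1 / ?c" by simp
  fix n and v :: "nat \<times> 'g" assume v: "v \<in> Vset l n"
  then have k: "fst v < l n" by (simp add: Vset_def mem_Times_iff)
  show "martin l \<sigma> g (Suc s) i n v \<le> 1 / ?c"
  proof (cases "Suc s \<le> n")
    case True
    then have "tprod l \<sigma> 0 s 0 i g * tprod l \<sigma> (Suc s) n i (fst v) (- g + snd v) \<le> tprod l \<sigma> 0 n 0 (fst v) (snd v)"
      using tprod_lower_bound[of i l s n, OF i] by simp
    then have "enn2real (tprod l \<sigma> 0 s 0 i g * tprod l \<sigma> (Suc s) n i (fst v) (- g + snd v)) \<le> enn2real (tprod l \<sigma> 0 n 0 (fst v) (snd v))"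
      using tprod_finite[of 0 0 n "fst v" "snd v"] k by (intro enn2real_mono) auto
    then show ?thesis
      using True c tprod_real_pos[OF k, of "snd v"] by (simp add: martin_def enn2real_mult field_simps)
  qed (use c in \<open>simp add: martin_def\<close>)
qed

lemma measurable_position:
  assumes "m \<le> n"
  shows "(\<lambda>\<omega>. f (\<omega> n) :: real) \<in> borel_measurable (sigma (path_space l) (future l m))"
proof (rule measurableI)
  fix A :: "real set"
  have "(\<lambda>\<omega>. f (\<omega> n)) -` A \<inter> space (sigma (path_space l) (future l m)) = {\<omega> \<in> path_space l. \<omega> n \<in> f -` A}"
    by auto
  then show "(\<lambda>\<omega>. f (\<omega> n)) -` A \<inter> space (sigma (path_space l) (future l m)) \<in> sets (sigma (path_space l) (future l m))"
    using future_basic[OF assms, of l "f -` A"] by simp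
qed simp

lemma measurable_position_walk:
  assumes "j < ldim l s"
  shows "(\<lambda>\<omega>. f (\<omega> n) :: real) \<in> borel_measurable (walk l \<sigma> s j)"
  by (rule measurable_from_subalg[OF subalgebra_future[OF st assms] measurable_position[OF le_refl]])

text \<open>The ratio at time n is the derivative, on the events from time n on, of the law of the
  translated walk.\<close>

lemma martin_density:
  assumes i: "i < ldim l s" and n: "s \<le> n" and T: "T \<in> future l n"
  shows "emeasure (walk l \<sigma> s i) (path_act g -` T \<inter> path_space l) =
    (\<integral>\<^sup>+\<omega>\<in>T. ennreal (martin l \<sigma> g s i n (\<omega> n)) \<partial>walk l \<sigma> 0 0)"
proof -
  let ?P = "walk l \<sigma> 0 0" and ?W = "\<lambda>k h. emeasure (walk l \<sigma> (Suc n) k) (path_act h -` T \<inter> path_space l)"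
  have 0: "0 < ldim l 0" by simp
  interpret F: sigma_algebra "path_space l" "future l n :: (nat \<Rightarrow> nat \<times> 'g) set set" by (rule sigma_algebra_future)
  have B: "{\<omega> \<in> path_space l. \<omega> n = v} \<inter> T \<in> sets ?P" for v
  proof -
    have "{\<omega> \<in> path_space l. \<omega> n = v} \<in> future l n" using future_basic[of n n l "{v}"] by simp
    then have "{\<omega> \<in> path_space l. \<omega> n = v} \<inter> T \<in> future l n" using T by blast
    then show ?thesis by (rule future_sets_walk[OF st 0])
  qed
  have "(\<integral>\<^sup>+\<omega>\<in>T. ennreal (martin l \<sigma> g s i n (\<omega> n)) \<partial>?P) =
    (\<integral>\<^sup>+\<omega>. \<integral>\<^sup>+v. ennreal (martin l \<sigma> g s i n v) * indicator ({\<omega> \<in> path_space l. \<omega> n = v} \<inter> T) \<omega> \<partial>coord_space l n \<partial>?P)"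
  proof (rule nn_integral_cong)
    fix \<omega> assume "\<omega> \<in> space ?P"
    then have \<omega>: "\<omega> \<in> path_space l" by (simp add: space_walk[OF st 0])
    have "(\<integral>\<^sup>+v. ennreal (martin l \<sigma> g s i n v) * indicator ({\<omega> \<in> path_space l. \<omega> n = v} \<inter> T) \<omega> \<partial>coord_space l n) =
        (\<integral>\<^sup>+v. (ennreal (martin l \<sigma> g s i n (\<omega> n)) * indicator T \<omega>) * indicator {\<omega> n} v \<partial>coord_space l n)"
      using \<omega> by (intro nn_integral_cong) (auto split: split_indicator)
    also have "\<dots> = ennreal (martin l \<sigma> g s i n (\<omega> n)) * indicator T \<omega>"
      using path_spaceD[OF \<omega>, of n] by (subst nn_integral_indicator_singleton) auto
    finally show "ennreal (martin l \<sigma> g s i n (\<omega> n)) * indicator T \<omega> =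
      (\<integral>\<^sup>+v. ennreal (martin l \<sigma> g s i n v) * indicator ({\<omega> \<in> path_space l. \<omega> n = v} \<inter> T) \<omega> \<partial>coord_space l n)" by simp
  qed
  also have "\<dots> = (\<integral>\<^sup>+v. \<integral>\<^sup>+\<omega>. ennreal (martin l \<sigma> g s i n v) * indicator ({\<omega> \<in> path_space l. \<omega> n = v} \<inter> T) \<omega> \<partial>?P \<partial>coord_space l n)"
    by (rule nn_integral_count_space_nn_integral) (use B in auto)
  also have "\<dots> = (\<integral>\<^sup>+v. tprod l \<sigma> s n i (fst v) (- g + snd v) * ?W (fst v) (snd v) \<partial>coord_space l n)"
  proof (rule nn_integral_cong)
    fix v :: "nat \<times> 'g" assume "v \<in> space (coord_space l n)"
    then have v: "v \<in> Vset l n" by simp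
    have "(\<integral>\<^sup>+\<omega>. ennreal (martin l \<sigma> g s i n v) * indicator ({\<omega> \<in> path_space l. \<omega> n = v} \<inter> T) \<omega> \<partial>?P) =
        ennreal (martin l \<sigma> g s i n v) * (tprod l \<sigma> 0 n 0 (fst v) (snd v) * ?W (fst v) (snd v))"
      using B[of v] walk_tprod_at[OF st 0 le0 T v] by (simp add: nn_integral_cmult_indicator)
    also have "\<dots> = tprod l \<sigma> s n i (fst v) (- g + snd v) * ?W (fst v) (snd v)"
      using martin_mult[OF i n v, of g] by (simp add: mult.assoc[symmetric])
    finally show "(\<integral>\<^sup>+\<omega>. ennreal (martin l \<sigma> g s i n v) * indicator ({\<omega> \<in> path_space l. \<omega> n = v} \<inter> T) \<omega> \<partial>?P) =
      tprod l \<sigma> s n i (fst v) (- g + snd v) * ?W (fst v) (snd v)" .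
  qed
  also have "\<dots> = (\<Sum>k<l n. \<integral>\<^sup>+h. tprod l \<sigma> s n i k (- g + h) * ?W k h \<partial>count_space UNIV)"
    by (simp add: nn_integral_Vset)
  also have "\<dots> = (\<Sum>k<l n. \<integral>\<^sup>+h. tprod l \<sigma> s n i k h * ?W k (g + h) \<partial>count_space UNIV)"
  proof (rule sum.cong[OF refl])
    fix k
    show "(\<integral>\<^sup>+h. tprod l \<sigma> s n i k (- g + h) * ?W k h \<partial>count_space UNIV) =
        (\<integral>\<^sup>+h. tprod l \<sigma> s n i k h * ?W k (g + h) \<partial>count_space UNIV)"
      using nn_integral_translate[of "\<lambda>h. tprod l \<sigma> s n i k (- g + h) * ?W k h" g]
      by (simp add: add.assoc[symmetric])
  qed
  also have "\<dots> = emeasure (walk l \<sigma> s i) (path_act g -` T \<inter> path_space l)"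
  proof -
    have "path_act h -` (path_act g -` T \<inter> path_space l) \<inter> path_space l = path_act (g + h) -` T \<inter> path_space l" for h
      by (auto simp: path_act_add)
    then show ?thesis using walk_tprod[OF st i n path_act_future[OF T], of g] by simp
  qed
  finally show ?thesis ..
qed

lemma martin_integral:
  assumes i: "i < ldim l s" and n: "s \<le> n"
    and \<phi>: "\<phi> \<in> borel_measurable (sigma (path_space l) (future l n))"
  shows "(\<integral>\<omega>. martin l \<sigma> g s i n (\<omega> n) * \<phi> \<omega> \<partial>walk l \<sigma> 0 0) = (\<integral>\<omega>. \<phi> (path_act g \<omega>) \<partial>walk l \<sigma> s i)"
proof -
  let ?F = "sigma (path_space l) (future l n) :: (nat \<Rightarrow> nat \<times> 'g) measure"
  have 0: "0 < ldim l 0" by simp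
  note sub = subalgebra_future[OF st 0, of n]
  have F: "sets ?F = future l n" "space ?F = path_space l" by simp_all
  have act: "path_act g \<in> walk l \<sigma> s i \<rightarrow>\<^sub>M ?F"
    by (rule measurableI) (use path_act_sets_walk[OF st i] in \<open>auto simp: F space_walk[OF st i]\<close>)
  let ?K = "\<lambda>\<omega>. martin l \<sigma> g s i n (\<omega> n)"
  have K: "?K \<in> borel_measurable ?F" by (rule measurable_position[OF le_refl])
  have K': "?K \<in> borel_measurable (restr_to_subalg (walk l \<sigma> 0 0) ?F)" and \<phi>': "\<phi> \<in> borel_measurable (restr_to_subalg (walk l \<sigma> 0 0) ?F)"
    using K \<phi> by (simp_all add: measurable_in_subalg[OF sub])
  have D: "density (restr_to_subalg (walk l \<sigma> 0 0) ?F) ?K = distr (walk l \<sigma> s i) ?F (path_act g)"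
  proof (rule measure_eqI)
    show "sets (density (restr_to_subalg (walk l \<sigma> 0 0) ?F) ?K) = sets (distr (walk l \<sigma> s i) ?F (path_act g))"
      by (simp add: sets_restr_to_subalg[OF sub])
    fix T assume "T \<in> sets (density (restr_to_subalg (walk l \<sigma> 0 0) ?F) ?K)"
    then have T: "T \<in> future l n" by (simp add: sets_restr_to_subalg[OF sub] F)
    have "emeasure (density (restr_to_subalg (walk l \<sigma> 0 0) ?F) ?K) T =
        (\<integral>\<^sup>+\<omega>\<in>T. ennreal (?K \<omega>) \<partial>restr_to_subalg (walk l \<sigma> 0 0) ?F)"
      using K' T by (intro emeasure_density) (auto simp: sets_restr_to_subalg[OF sub] F)
    also have "\<dots> = (\<integral>\<^sup>+\<omega>\<in>T. ennreal (?K \<omega>) \<partial>walk l \<sigma> 0 0)"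
      by (rule nn_integral_subalgebra2[OF sub borel_measurable_times_ennreal[OF
            measurable_compose[OF K measurable_ennreal] borel_measurable_indicator]]) (simp add: T)
    also have "\<dots> = emeasure (walk l \<sigma> s i) (path_act g -` T \<inter> path_space l)"
      by (rule martin_density[OF i n T, symmetric])
    also have "\<dots> = emeasure (distr (walk l \<sigma> s i) ?F (path_act g)) T"
      using act T by (subst emeasure_distr) (auto simp: F space_walk[OF st i])
    finally show "emeasure (density (restr_to_subalg (walk l \<sigma> 0 0) ?F) ?K) T = emeasure (distr (walk l \<sigma> s i) ?F (path_act g)) T" .
  qed
  have "(\<integral>\<omega>. \<phi> (path_act g \<omega>) \<partial>walk l \<sigma> s i) = (\<integral>\<omega>. \<phi> \<omega> \<partial>distr (walk l \<sigma> s i) ?F (path_act g))"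
    by (rule integral_distr[OF act \<phi>, symmetric])
  also have "\<dots> = (\<integral>\<omega>. ?K \<omega> * \<phi> \<omega> \<partial>restr_to_subalg (walk l \<sigma> 0 0) ?F)"
    using K' \<phi>' by (subst D[symmetric], subst integral_density) (auto simp: martin_nonneg)
  also have "\<dots> = (\<integral>\<omega>. ?K \<omega> * \<phi> \<omega> \<partial>walk l \<sigma> 0 0)"
    by (rule integral_subalgebra2[OF sub borel_measurable_times[OF K \<phi>]])
  finally show ?thesis ..
qed

end

section \<open>Tail sets and derivatives\<close>

lemma base_tail: "base (tail_system l \<sigma>) = restr_to_subalg (walk l \<sigma> 0 0) (sigma (path_space l) (tail_sets l))"
  by (simp add: tail_system_def)

lemma
  fixes l :: "nat \<Rightarrow> nat"
  shows sets_sigma_tail [simp]: "sets (sigma (path_space l) (tail_sets l :: (nat \<Rightarrow> nat \<times> 'g) set set)) = tail_sets l"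
    and space_sigma_tail [simp]: "space (sigma (path_space l) (tail_sets l :: (nat \<Rightarrow> nat \<times> 'g) set set)) = path_space l"
proof -
  interpret F: sigma_algebra "path_space l" "tail_sets l :: (nat \<Rightarrow> nat \<times> 'g) set set" by (rule sigma_algebra_tail)
  show "sets (sigma (path_space l) (tail_sets l :: (nat \<Rightarrow> nat \<times> 'g) set set)) = tail_sets l"
    unfolding sets_measure_of[OF F.space_closed] by (rule F.sigma_sets_eq)
  show "space (sigma (path_space l) (tail_sets l :: (nat \<Rightarrow> nat \<times> 'g) set set)) = path_space l"
    using F.space_closed by (rule space_measure_of)
qed

lemma lim_offset: "lim (\<lambda>k. X (k + n)) = lim (X :: nat \<Rightarrow> real)"
proof -
  have "(\<lambda>k. X (k + n)) \<longlonglongrightarrow> L \<longleftrightarrow> X \<longlonglongrightarrow> L" for L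
    using LIMSEQ_ignore_initial_segment[of X L n] LIMSEQ_offset[of X n L] by blast
  then show ?thesis by (simp add: lim_def)
qed

context
  fixes l :: "nat \<Rightarrow> nat" and \<sigma> :: "'g::{group_add,countable} mseq"
  assumes st: "stochastic_sequence l \<sigma>" and sp: "spread l \<sigma>"
begin

context
  fixes g :: 'g and s i assumes i: "i < l s"
begin

private abbreviation "P \<equiv> walk l \<sigma> 0 0"
private abbreviation "K \<equiv> \<lambda>n (\<omega> :: nat \<Rightarrow> nat \<times> 'g). martin l \<sigma> g (Suc s) i n (\<omega> n)"

private lemma prob_P: "prob_space P"
  by (rule prob_space_walk[OF st]) simp

private lemma K_meas: "K n \<in> borel_measurable P"
  by (rule measurable_position_walk[OF st sp]) simp

private lemma K_bound: "\<exists>C\<ge>0. \<forall>n. \<forall>\<omega>\<in>space P. \<bar>K n \<omega>\<bar> \<le> C"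
proof -
  obtain C where C: "C \<ge> 0" "\<And>n v. v \<in> Vset l n \<Longrightarrow> martin l \<sigma> g (Suc s) i n v \<le> C"
    using martin_bounded[OF st sp i, of g] by blast
  have "\<bar>K n \<omega>\<bar> \<le> C" if "\<omega> \<in> space P" for n \<omega>
    using C(2)[OF path_spaceD[of \<omega> l n]] that martin_nonneg[OF st sp] by (simp add: space_walk[OF st])
  then show ?thesis using C(1) by blast
qed

private lemma K_int: "integrable P (K n)" "integrable P (\<lambda>\<omega>. K m \<omega> * K n \<omega>)" "integrable P (\<lambda>\<omega>. (K m \<omega> - K n \<omega>)\<^sup>2)"
proof -
  interpret prob_space P by (rule prob_P)
  obtain C where C: "C \<ge> 0" "\<And>n \<omega>. \<omega> \<in> space P \<Longrightarrow> \<bar>K n \<omega>\<bar> \<le> C" using K_bound by blast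
  show 1: "integrable P (K n)" for n
    by (rule integrable_const_bound[where B=C]) (use C K_meas in auto)
  show 2: "integrable P (\<lambda>\<omega>. K m \<omega> * K n \<omega>)" for m n
  proof (rule integrable_const_bound[where B="C * C"])
    show "AE \<omega> in P. norm (K m \<omega> * K n \<omega>) \<le> C * C"
      by (intro AE_I2) (use C in \<open>auto simp: abs_mult intro!: mult_mono\<close>)
  qed (intro borel_measurable_times K_meas)
  have "(\<lambda>\<omega>. (K m \<omega> - K n \<omega>)\<^sup>2) = (\<lambda>\<omega>. K m \<omega> * K m \<omega> - 2 * (K m \<omega> * K n \<omega>) + K n \<omega> * K n \<omega>)"
    by (auto simp: power2_eq_square algebra_simps)
  then show "integrable P (\<lambda>\<omega>. (K m \<omega> - K n \<omega>)\<^sup>2)"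
    using 2 by simp
qed

text \<open>The ratios along the walk form a reverse martingale, which the orthogonality of its
  increments makes convergent in mean.\<close>

private lemma K_orth:
  assumes "Suc s \<le> m" "m \<le> n"
  shows "(\<integral>\<omega>. (K m \<omega> - K n \<omega>)\<^sup>2 \<partial>P) = (\<integral>\<omega>. K m \<omega> * K m \<omega> \<partial>P) - (\<integral>\<omega>. K n \<omega> * K n \<omega> \<partial>P)"
proof -
  have i': "i < ldim l (Suc s)" using i by simp
  \<comment> \<open>The ratio at the later time depends only on the future of both times, on which both ratios are
    densities of the same measure.\<close>
  have "(\<integral>\<omega>. K m \<omega> * K n \<omega> \<partial>P) = (\<integral>\<omega>. K n (path_act g \<omega>) \<partial>walk l \<sigma> (Suc s) i)"
    by (rule martin_integral[OF st sp i' assms(1) measurable_position[OF st sp assms(2)]])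
  also have "\<dots> = (\<integral>\<omega>. K n \<omega> * K n \<omega> \<partial>P)"
    by (rule martin_integral[OF st sp i' _ measurable_position[OF st sp le_refl], symmetric]) (use assms in simp)
  finally have eq: "(\<integral>\<omega>. K m \<omega> * K n \<omega> \<partial>P) = (\<integral>\<omega>. K n \<omega> * K n \<omega> \<partial>P)" .
  have "(\<integral>\<omega>. (K m \<omega> - K n \<omega>)\<^sup>2 \<partial>P) = (\<integral>\<omega>. K m \<omega> * K m \<omega> - 2 * (K m \<omega> * K n \<omega>) + K n \<omega> * K n \<omega> \<partial>P)"
    by (simp add: power2_eq_square algebra_simps)
  also have "\<dots> = (\<integral>\<omega>. K m \<omega> * K m \<omega> \<partial>P) - 2 * (\<integral>\<omega>. K m \<omega> * K n \<omega> \<partial>P) + (\<integral>\<omega>. K n \<omega> * K n \<omega> \<partial>P)"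
    using K_int(2) by simp
  finally show ?thesis by (simp add: eq)
qed

private lemma K_Cauchy:
  assumes "0 < e"
  shows "\<exists>N. \<forall>m\<ge>N. \<forall>n\<ge>N. (\<integral>\<omega>. norm (K m \<omega> - K n \<omega>) \<partial>P) < e"
proof -
  interpret prob_space P by (rule prob_P)
  define a where "a k = (\<integral>\<omega>. K (Suc s + k) \<omega> * K (Suc s + k) \<omega> \<partial>P)" for k
  have "a n \<le> a m" if "m \<le> n" for m n
  proof -
    have "0 \<le> (\<integral>\<omega>. (K (Suc s + m) \<omega> - K (Suc s + n) \<omega>)\<^sup>2 \<partial>P)" by simp
    also have "\<dots> = a m - a n" unfolding a_def by (rule K_orth) (use that in auto)
    finally show ?thesis by simp
  qed
  then have dec: "decseq a" by (simp add: decseq_def)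
  have "0 \<le> a k" for k unfolding a_def by simp
  then obtain L where L: "a \<longlonglongrightarrow> L" using decseq_convergent[OF dec] by metis
  have "\<forall>\<^sub>F k in sequentially. a k < L + e\<^sup>2" using order_tendstoD(2)[OF L] assms by simp
  then obtain M where M: "a M < L + e\<^sup>2" by (auto simp: eventually_sequentially)
  have aL: "L \<le> a k" for k by (rule decseq_ge[OF dec L])
  have le: "(\<integral>\<omega>. norm (K m \<omega> - K n \<omega>) \<partial>P) < e" if mn: "Suc s + M \<le> m" "m \<le> n" for m n
  proof -
    have "(\<integral>\<omega>. (K m \<omega> - K n \<omega>)\<^sup>2 \<partial>P) = a (m - Suc s) - a (n - Suc s)"
      unfolding a_def using mn by (subst K_orth) auto
    also have "\<dots> \<le> a M - L"
      by (rule diff_mono[OF decseqD[OF dec] aL]) (use mn in linarith)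
    finally have sq: "(\<integral>\<omega>. (K m \<omega> - K n \<omega>)\<^sup>2 \<partial>P) < e\<^sup>2" using M by simp
    \<comment> \<open>an elementary substitute for the inequality of Cauchy and Schwarz\<close>
    have "(\<integral>\<omega>. norm (K m \<omega> - K n \<omega>) \<partial>P) \<le> (\<integral>\<omega>. (K m \<omega> - K n \<omega>)\<^sup>2 / (2 * e) + e / 2 \<partial>P)"
    proof (rule integral_mono)
      fix \<omega>
      have "0 \<le> (\<bar>K m \<omega> - K n \<omega>\<bar> - e)\<^sup>2" by simp
      then have "2 * e * \<bar>K m \<omega> - K n \<omega>\<bar> \<le> (K m \<omega> - K n \<omega>)\<^sup>2 + e\<^sup>2"
        by (simp add: power2_diff algebra_simps)
      then show "norm (K m \<omega> - K n \<omega>) \<le> (K m \<omega> - K n \<omega>)\<^sup>2 / (2 * e) + e / 2"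
        using assms by (simp add: field_simps power2_eq_square)
    qed (use K_int in auto)
    also have "\<dots> = (\<integral>\<omega>. (K m \<omega> - K n \<omega>)\<^sup>2 \<partial>P) / (2 * e) + e / 2"
      using K_int(3)[of m n] by (simp add: prob_space)
    also have "\<dots> < e\<^sup>2 / (2 * e) + e / 2"
      using sq assms by (simp add: divide_strict_right_mono)
    also have "\<dots> = e" using assms by (simp add: power2_eq_square)
    finally show ?thesis .
  qed
  show ?thesis
  proof (intro exI[of _ "Suc s + M"] allI impI)
    fix m n assume "Suc s + M \<le> m" "Suc s + M \<le> n"
    then show "(\<integral>\<omega>. norm (K m \<omega> - K n \<omega>) \<partial>P) < e"
      using le[of m n] le[of n m] by (cases "m \<le> n") (auto simp: abs_minus_commute)
  qed
qed

text \<open>An almost sure limit along a subsequence is tail measurable and has the integrals over tail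
  sets that characterize the derivative.\<close>

lemma martin_tendsto_rn:
  "(\<lambda>n. \<integral>\<omega>. \<bar>K n \<omega> - enn2real (rn (tail_system l \<sigma>) g (Suc s) i \<omega>)\<bar> \<partial>P) \<longlonglongrightarrow> 0"
proof -
  interpret prob_space P by (rule prob_P)
  let ?T = "sigma (path_space l) (tail_sets l) :: (nat \<Rightarrow> nat \<times> 'g) measure"
  let ?X = "tail_system l \<sigma>"
  have 0: "0 < ldim l 0" and i': "i < ldim l (Suc s)" using i by simp_all
  note sub = subalgebra_tail[OF st 0]
  note X = sigma_system_tail[OF st]
  obtain C where C: "C \<ge> 0" "\<And>n \<omega>. \<omega> \<in> space P \<Longrightarrow> \<bar>K n \<omega>\<bar> \<le> C" using K_bound by blast
  obtain r where r: "strict_mono r" "AE \<omega> in P. Cauchy (\<lambda>k. K (r k) \<omega>)"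
    by (rule cauchy_L1_AE_cauchy_subseq[where M=P and s=K, OF K_int(1) K_Cauchy]) (assumption, rule that)
  define f where "f \<omega> = lim (\<lambda>k. K (r k) \<omega>)" for \<omega>
  have conv: "AE \<omega> in P. (\<lambda>k. K (r k) \<omega>) \<longlonglongrightarrow> f \<omega>"
    using r(2) by eventually_elim (simp add: f_def Cauchy_convergent_iff convergent_LIMSEQ_iff)
  have f_tail: "f \<in> borel_measurable ?T"
  proof (rule measurableI)
    fix A :: "real set" assume A: "A \<in> sets borel"
    have "f -` A \<inter> path_space l \<in> future l n" for n
    proof -
      let ?F = "sigma (path_space l) (future l n) :: (nat \<Rightarrow> nat \<times> 'g) measure"
      have "(\<lambda>\<omega>. lim (\<lambda>k. K (r (k + n)) \<omega>)) \<in> borel_measurable ?F"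
      proof (rule borel_measurable_lim_metric)
        fix k
        have "n \<le> r (k + n)" using strict_mono_imp_increasing[OF r(1), of "k + n"] by simp
        then show "K (r (k + n)) \<in> borel_measurable ?F" by (rule measurable_position[OF st sp])
      qed
      moreover have "(\<lambda>\<omega>. lim (\<lambda>k. K (r (k + n)) \<omega>)) = f"
        using lim_offset[of "\<lambda>k. K (r k) _" n] by (simp add: f_def fun_eq_iff)
      ultimately show ?thesis using measurable_sets[of f ?F borel A] A by simp
    qed
    then have "f -` A \<inter> path_space l \<in> tail_sets l" unfolding tail_sets_future by blast
    then show "f -` A \<inter> space ?T \<in> sets ?T" by simp
  qed simp
  have f_P: "f \<in> borel_measurable P" by (rule measurable_from_subalg[OF sub f_tail])
  have f_bd: "AE \<omega> in P. 0 \<le> f \<omega> \<and> f \<omega> \<le> C"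
    using conv AE_space
  proof eventually_elim
    case (elim \<omega>)
    have "0 \<le> f \<omega>" by (rule LIMSEQ_le_const[OF elim(1)]) (use martin_nonneg[OF st sp] in auto)
    moreover have "f \<omega> \<le> C"
    proof (rule LIMSEQ_le_const2[OF elim(1)], intro exI allI impI)
      show "K (r k) \<omega> \<le> C" for k using C(2)[OF elim(2), of "r k"] by simp
    qed
    ultimately show ?case ..
  qed
  have f_int: "integrable P f"
    by (rule integrable_const_bound[where B=C]) (use f_bd f_P in auto)
  have f_T: "(\<integral>\<omega>. f \<omega> * indicator T \<omega> \<partial>P) = measure (walk l \<sigma> (Suc s) i) (path_act g -` T \<inter> path_space l)"
    if T: "T \<in> tail_sets l" for T
  proof -
    have TP: "T \<in> sets P" using T future_sets_walk[OF st 0, of T 0] by (auto simp: tail_sets_future)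
    have "(\<lambda>k. \<integral>\<omega>. K (r k) \<omega> * indicator T \<omega> \<partial>P) \<longlonglongrightarrow> (\<integral>\<omega>. f \<omega> * indicator T \<omega> \<partial>P)"
    proof (rule integral_dominated_convergence[where w="\<lambda>_. C"])
      show "AE \<omega> in P. (\<lambda>k. K (r k) \<omega> * indicator T \<omega>) \<longlonglongrightarrow> f \<omega> * indicator T \<omega>"
        using conv by eventually_elim (intro tendsto_intros)
      show "AE \<omega> in P. norm (K (r k) \<omega> * indicator T \<omega>) \<le> C" for k
        by (intro AE_I2) (use C in \<open>auto split: split_indicator\<close>)
    qed (use f_P K_meas TP in auto)
    moreover have "(\<lambda>k. \<integral>\<omega>. K (r k) \<omega> * indicator T \<omega> \<partial>P) \<longlonglongrightarrow> measure (walk l \<sigma> (Suc s) i) (path_act g -` T \<inter> path_space l)"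
    proof (rule tendsto_eventually, rule eventually_sequentiallyI)
      fix k assume "Suc s \<le> k"
      then have rk: "Suc s \<le> r k" using strict_mono_imp_increasing[OF r(1), of k] by simp
      have Tr: "T \<in> future l (r k)" using T by (auto simp: tail_sets_future)
      have "(\<integral>\<omega>. K (r k) \<omega> * indicator T \<omega> \<partial>P) = (\<integral>\<omega>. indicator T (path_act g \<omega>) \<partial>walk l \<sigma> (Suc s) i)"
        by (rule martin_integral[OF st sp i' rk], rule borel_measurable_indicator) (use Tr in simp)
      also have "\<dots> = (\<integral>\<omega>. indicator (path_act g -` T \<inter> path_space l) \<omega> \<partial>walk l \<sigma> (Suc s) i)"
        by (rule Bochner_Integration.integral_cong) (auto simp: space_walk[OF st i'] split: split_indicator)
      also have "\<dots> = measure (walk l \<sigma> (Suc s) i) (path_act g -` T \<inter> path_space l)"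
        using path_act_sets_walk[OF st i' Tr, of g] by simp
      finally show "(\<integral>\<omega>. K (r k) \<omega> * indicator T \<omega> \<partial>P) = measure (walk l \<sigma> (Suc s) i) (path_act g -` T \<inter> path_space l)" .
    qed
    ultimately show ?thesis by (rule LIMSEQ_unique)
  qed
  have "AE \<omega> in base ?X. ennreal (f \<omega>) = rn ?X g (Suc s) i \<omega>"
  proof (rule rn_unique[OF X sp i'])
    show "(\<lambda>\<omega>. ennreal (f \<omega>)) \<in> borel_measurable (base ?X)"
      unfolding base_tail using measurable_in_subalg[OF sub f_tail] by simp
    fix T assume "T \<in> sets (base ?X)"
    then have T: "T \<in> tail_sets l" by (simp add: sets_tail[OF st 0])
    interpret W: prob_space "walk l \<sigma> (Suc s) i" by (rule prob_space_walk[OF st i'])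
    have "(\<integral>\<^sup>+\<omega>\<in>T. ennreal (f \<omega>) \<partial>base ?X) = (\<integral>\<^sup>+\<omega>\<in>T. ennreal (f \<omega>) \<partial>P)"
      unfolding base_tail
      by (rule nn_integral_subalgebra2[OF sub borel_measurable_times_ennreal[OF
            measurable_compose[OF f_tail measurable_ennreal] borel_measurable_indicator]]) (simp add: T)
    also have "\<dots> = (\<integral>\<^sup>+\<omega>. ennreal (f \<omega> * indicator T \<omega>) \<partial>P)"
      by (intro nn_integral_cong) (auto split: split_indicator)
    also have "\<dots> = ennreal (\<integral>\<omega>. f \<omega> * indicator T \<omega> \<partial>P)"
    proof (rule nn_integral_eq_integral)
      have "T \<in> sets P" using T future_sets_walk[OF st 0, of T 0] by (auto simp: tail_sets_future)
      then show "integrable P (\<lambda>\<omega>. f \<omega> * indicator T \<omega>)" using f_int by (rule integrable_real_mult_indicator)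
      show "AE \<omega> in P. 0 \<le> f \<omega> * indicator T \<omega>" using f_bd by eventually_elim (auto split: split_indicator)
    qed
    also have "\<dots> = emeasure (translate ?X g (nu ?X (Suc s) i)) T"
      by (simp add: f_T[OF T] emeasure_translate_tail[OF st i' T] W.emeasure_eq_measure)
    finally show "emeasure (translate ?X g (nu ?X (Suc s) i)) T = (\<integral>\<^sup>+\<omega>\<in>T. ennreal (f \<omega>) \<partial>base ?X)" by simp
  qed
  then have "AE \<omega> in P. ennreal (f \<omega>) = rn ?X g (Suc s) i \<omega>"
    unfolding base_tail by (rule AE_restr_to_subalg[OF sub])
  then have fR: "AE \<omega> in P. enn2real (rn ?X g (Suc s) i \<omega>) = f \<omega>"
    using f_bd by eventually_elim (metis enn2real_ennreal)
  have "(\<lambda>k. \<integral>\<omega>. \<bar>K (r k) \<omega> - f \<omega>\<bar> \<partial>P) \<longlonglongrightarrow> (\<integral>\<omega>. 0 \<partial>P)"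
  proof (rule integral_dominated_convergence[where w="\<lambda>_. 2 * C"])
    show "AE \<omega> in P. (\<lambda>k. \<bar>K (r k) \<omega> - f \<omega>\<bar>) \<longlonglongrightarrow> 0"
      using conv by eventually_elim (simp add: tendsto_rabs_zero_iff LIM_zero_iff)
    show "AE \<omega> in P. norm \<bar>K (r k) \<omega> - f \<omega>\<bar> \<le> 2 * C" for k
      using f_bd AE_space by eventually_elim (use C(2)[of _ "r k"] in \<open>force simp: abs_le_iff\<close>)
  qed (use f_P K_meas in auto)
  then have lim0: "(\<lambda>k. \<integral>\<omega>. \<bar>K (r k) \<omega> - f \<omega>\<bar> \<partial>P) \<longlonglongrightarrow> 0" by simp
  have "(\<lambda>n. \<integral>\<omega>. \<bar>K n \<omega> - f \<omega>\<bar> \<partial>P) \<longlonglongrightarrow> 0"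
  proof (rule LIMSEQ_I)
    fix e :: real assume "0 < e"
    then obtain N where N: "\<And>m n. N \<le> m \<Longrightarrow> N \<le> n \<Longrightarrow> (\<integral>\<omega>. norm (K m \<omega> - K n \<omega>) \<partial>P) < e / 2"
      using K_Cauchy[of "e / 2"] by auto
    have "\<forall>\<^sub>F k in sequentially. (\<integral>\<omega>. \<bar>K (r k) \<omega> - f \<omega>\<bar> \<partial>P) < e / 2"
      using order_tendstoD(2)[OF lim0, of "e / 2"] \<open>0 < e\<close> by simp
    then obtain M where M: "\<And>k. M \<le> k \<Longrightarrow> (\<integral>\<omega>. \<bar>K (r k) \<omega> - f \<omega>\<bar> \<partial>P) < e / 2"
      unfolding eventually_sequentially by blast
    define k where "k = max M N"
    have k: "N \<le> k" "(\<integral>\<omega>. \<bar>K (r k) \<omega> - f \<omega>\<bar> \<partial>P) < e / 2"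
      using M[of k] by (auto simp: k_def)
    have rk: "N \<le> r k" using strict_mono_imp_increasing[OF r(1), of k] k by simp
    show "\<exists>N. \<forall>n\<ge>N. norm ((\<integral>\<omega>. \<bar>K n \<omega> - f \<omega>\<bar> \<partial>P) - 0) < e"
    proof (intro exI[of _ N] allI impI)
      fix n assume n: "N \<le> n"
      have "(\<integral>\<omega>. \<bar>K n \<omega> - f \<omega>\<bar> \<partial>P) \<le> (\<integral>\<omega>. norm (K n \<omega> - K (r k) \<omega>) + \<bar>K (r k) \<omega> - f \<omega>\<bar> \<partial>P)"
        by (rule integral_mono) (use K_int f_int in auto)
      also have "\<dots> = (\<integral>\<omega>. norm (K n \<omega> - K (r k) \<omega>) \<partial>P) + (\<integral>\<omega>. \<bar>K (r k) \<omega> - f \<omega>\<bar> \<partial>P)"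
        by (rule Bochner_Integration.integral_add) (use K_int f_int in auto)
      also have "\<dots> < e" using N[OF n rk] k(2) by simp
      finally show "norm ((\<integral>\<omega>. \<bar>K n \<omega> - f \<omega>\<bar> \<partial>P) - 0) < e" by simp
    qed
  qed
  moreover have "(\<integral>\<omega>. \<bar>K n \<omega> - enn2real (rn ?X g (Suc s) i \<omega>)\<bar> \<partial>P) = (\<integral>\<omega>. \<bar>K n \<omega> - f \<omega>\<bar> \<partial>P)" for n
  proof (rule integral_cong_AE)
    have "rn ?X g (Suc s) i \<in> borel_measurable P"
    proof -
      have "rn ?X g (Suc s) i \<in> borel_measurable ?T"
        using measurable_rn[of ?X g "Suc s" i] unfolding base_tail
        by (simp add: measurable_cong_sets[OF sets_restr_to_subalg[OF sub] refl])
      then show ?thesis by (rule measurable_from_subalg[OF sub])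
    qed
    then show "(\<lambda>\<omega>. \<bar>K n \<omega> - enn2real (rn ?X g (Suc s) i \<omega>)\<bar>) \<in> borel_measurable P"
      using K_meas by measurable
    show "(\<lambda>\<omega>. \<bar>K n \<omega> - f \<omega>\<bar>) \<in> borel_measurable P" using K_meas f_P by measurable
    show "AE \<omega> in P. \<bar>K n \<omega> - enn2real (rn ?X g (Suc s) i \<omega>)\<bar> = \<bar>K n \<omega> - f \<omega>\<bar>"
      using fR by eventually_elim simp
  qed
  ultimately show ?thesis by simp
qed

end

text \<open>The derivatives generate the tail sets modulo null sets: a tail set and its conditional
  expectation given the derivatives have the same integral against every derivative, hence,
  by the Markov property, over every cylinder.\<close>

theorem tail_sets_generated_by_rn:
  assumes T: "T \<in> tail_sets l"
  shows "\<exists>C\<in>sets borel. AE \<omega> in base (tail_system l \<sigma>). \<omega> \<in> T \<longleftrightarrow> rn_map l (tail_system l \<sigma>) \<omega> \<in> C"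
proof -
  let ?X = "tail_system l \<sigma>" and ?T = "sigma (path_space l) (tail_sets l) :: (nat \<Rightarrow> nat \<times> 'g) measure"
  let ?P = "walk l \<sigma> 0 0" and ?\<Phi> = "rn_map l (tail_system l \<sigma>)"
  define M where "M = base ?X"
  define F where "F = vimage_algebra (path_space l) ?\<Phi> borel"
  have 0: "0 < ldim l 0" by simp
  note X = sigma_system_tail[OF st]
  note sub = subalgebra_tail[OF st 0]
  interpret P: prob_space ?P by (rule prob_space_walk[OF st 0])
  interpret M: prob_space M unfolding M_def by (rule sys_prob_base[OF X])
  have sM: "sets M = tail_sets l" and spM: "space M = path_space l"
    by (simp_all add: M_def sets_tail[OF st 0])
  have MT: "M = restr_to_subalg ?P ?T" by (simp add: M_def base_tail)
  have mM: "measurable M N = measurable ?T N" for N :: "'z measure"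
    by (rule measurable_cong_sets) (simp_all add: sM)
  have \<Phi>: "?\<Phi> \<in> M \<rightarrow>\<^sub>M borel" unfolding M_def by (rule measurable_rn_map)
  have spF: "space F = path_space l" by (simp add: F_def)
  have sF: "sets F = {?\<Phi> -` C \<inter> path_space l | C. C \<in> sets borel}"
    unfolding F_def by (rule sets_vimage_algebra2) auto
  have subF: "subalgebra M F"
    unfolding subalgebra_def spF spM sF using measurable_sets[OF \<Phi>] by (auto simp: spM)
  interpret F: finite_measure_subalgebra M F
    by unfold_locales (rule subF)
  have TM: "T \<in> sets M" using T by (simp add: sM)
  have ind_int: "integrable M (indicator T :: _ \<Rightarrow> real)" using TM by (simp add: M.emeasure_eq_measure)
  define \<phi> where "\<phi> = real_cond_exp M F (indicator T)"
  have \<phi>F: "\<phi> \<in> borel_measurable F" unfolding \<phi>_def by (rule borel_measurable_cond_exp)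
  have \<phi>M: "\<phi> \<in> borel_measurable M" by (rule measurable_from_subalg[OF subF \<phi>F])
  have \<phi>_int: "integrable M \<phi>" unfolding \<phi>_def using ind_int by (rule F.real_cond_exp_int(1))
  have \<phi>T: "\<phi> \<in> borel_measurable ?T" using \<phi>M by (simp add: mM)
  have \<phi>P_int: "integrable ?P \<phi>" using \<phi>_int unfolding MT by (rule integrable_from_subalg[OF sub])
  have TP: "T \<in> sets ?P" using T future_sets_walk[OF st 0, of T 0] by (auto simp: tail_sets_future)
  define \<psi> where "\<psi> \<omega> = indicator T \<omega> - \<phi> \<omega>" for \<omega>
  have \<psi>_int: "integrable ?P \<psi>"
    unfolding \<psi>_def using TP \<phi>P_int by (intro Bochner_Integration.integrable_diff) (simp_all add: P.emeasure_eq_measure)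
  have \<psi>T: "\<psi> \<in> borel_measurable ?T"
    unfolding \<psi>_def using \<phi>T T by (intro borel_measurable_diff borel_measurable_indicator) simp_all
  \<comment> \<open>\<psi> is the difference of the tail set and its conditional expectation given the derivatives,
    so it is orthogonal to each of them.\<close>
  have R: "(\<integral>\<omega>. \<psi> \<omega> * enn2real (rn ?X h s k \<omega>) \<partial>M) = 0 \<and> integrable M (\<lambda>\<omega>. \<psi> \<omega> * enn2real (rn ?X h s k \<omega>))"
    if k: "k < ldim l s" for h s k
  proof -
    let ?R = "\<lambda>\<omega>. enn2real (rn ?X h s k \<omega>)"
    have RF: "?R \<in> borel_measurable F"
    proof -
      have "?\<Phi> \<in> F \<rightarrow>\<^sub>M borel" unfolding F_def by (rule measurable_vimage_algebra1) simp
      from measurable_compose[OF this measurable_product_coordinates[of "rn_index h s k"]]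
      show ?thesis by (simp add: rn_map_index k)
    qed
    have RI: "integrable M ?R" unfolding M_def by (rule rn_integral(1)[OF X sp k])
    have RT: "integrable M (\<lambda>\<omega>. ?R \<omega> * indicator T \<omega>)"
      using TM RI by (rule integrable_real_mult_indicator)
    have "indicator T \<in> borel_measurable M" using TM by simp
    note c = F.real_cond_exp_intg[OF RT RF this]
    have "(\<lambda>\<omega>. \<psi> \<omega> * ?R \<omega>) = (\<lambda>\<omega>. ?R \<omega> * indicator T \<omega> - ?R \<omega> * \<phi> \<omega>)"
      by (auto simp: \<psi>_def algebra_simps)
    then show ?thesis using c RT by (simp add: \<phi>_def)
  qed
  have cyl0: "(\<integral>\<omega>. \<psi> \<omega> * indicator (cyl l 0 m x) \<omega> \<partial>?P) = 0" if x: "x \<in> path_space l" for m x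
  proof (cases m)
    case 0
    have "AE \<omega> in M. rn ?X 0 0 0 \<omega> = 1" unfolding M_def by (rule rn_zero[OF X sp])
    then have "(\<integral>\<omega>. \<psi> \<omega> * enn2real (rn ?X 0 0 0 \<omega>) \<partial>M) = (\<integral>\<omega>. \<psi> \<omega> \<partial>M)"
      by (intro integral_cong_AE) (use \<psi>T measurable_rn[of ?X 0 0 0] in \<open>auto simp: mM[symmetric] M_def[symmetric]\<close>)
    then have "(\<integral>\<omega>. \<psi> \<omega> \<partial>M) = 0" using R[of 0 0 0] by simp
    then have "(\<integral>\<omega>. \<psi> \<omega> \<partial>?P) = 0" unfolding MT using integral_subalgebra2[OF sub \<psi>T] by simp
    moreover have "(\<integral>\<omega>. \<psi> \<omega> * indicator (cyl l 0 m x) \<omega> \<partial>?P) = (\<integral>\<omega>. \<psi> \<omega> \<partial>?P)"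
      by (rule Bochner_Integration.integral_cong) (auto simp: 0 cyl_def space_walk[OF st])
    ultimately show ?thesis by simp
  next
    case (Suc n)
    let ?A = "cyl l 0 (Suc n) x" and ?k = "fst (x n)" and ?h = "snd (x n)"
    have k: "?k < ldim l (Suc n)" using path_spaceD[OF x, of n] by (simp add: Vset_def mem_Times_iff)
    let ?R = "\<lambda>\<omega>. enn2real (rn ?X ?h (Suc n) ?k \<omega>)"
    interpret W: prob_space "walk l \<sigma> (Suc n) ?k" by (rule prob_space_walk[OF st k])
    interpret FT: finite_measure_subalgebra ?P ?T by unfold_locales (rule sub)
    have A: "?A \<in> sets ?P" by (rule sets_cyl[OF st 0 x])
    have RM: "?R \<in> borel_measurable ?T"
      using measurable_rn[of ?X ?h "Suc n" ?k] by (simp add: mM[symmetric] M_def[symmetric])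
    have RI: "integrable ?P ?R"
      using rn_integral(1)[OF X sp k, of ?h] unfolding M_def[symmetric] MT by (rule integrable_from_subalg[OF sub])
    \<comment> \<open>Given the tail, a cylinder has a conditional expectation that is a multiple of a derivative.\<close>
    have "AE \<omega> in ?P. real_cond_exp ?P ?T (indicator ?A) \<omega> = P.prob ?A * ?R \<omega>"
    proof (rule FT.real_cond_exp_charact)
      fix S assume "S \<in> sets ?T"
      then have S: "S \<in> tail_sets l" by simp
      then have SF: "S \<in> future l n" by (simp add: tail_sets_future)
      have SP: "S \<in> sets ?P" by (rule future_sets_walk[OF st 0 SF])
      have "(\<integral>\<omega>. ?R \<omega> * indicator S \<omega> \<partial>?P) = (\<integral>\<omega>. ?R \<omega> * indicator S \<omega> \<partial>M)"
        unfolding MT by (rule integral_subalgebra2[OF sub, symmetric])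
          (use RM S in \<open>intro borel_measurable_times borel_measurable_indicator; simp\<close>)
      also have "\<dots> = measure (translate ?X ?h (nu ?X (Suc n) ?k)) S"
        unfolding M_def by (rule rn_integral(2)[OF X sp k]) (use S in \<open>simp add: sets_tail[OF st 0]\<close>)
      also have "\<dots> = W.prob (path_act ?h -` S \<inter> path_space l)"
        by (simp add: measure_def emeasure_translate_tail[OF st k S])
      finally have "P.prob ?A * (\<integral>\<omega>. ?R \<omega> * indicator S \<omega> \<partial>?P) = P.prob ?A * W.prob (path_act ?h -` S \<inter> path_space l)" by simp
      also have "\<dots> = P.prob (?A \<inter> S)"
        using walk_markov[OF st 0 le0 x SF] unfolding P.emeasure_eq_measure W.emeasure_eq_measure
        by (simp add: ennreal_mult[symmetric])
      finally have "P.prob ?A * (\<integral>\<omega>. ?R \<omega> * indicator S \<omega> \<partial>?P) = P.prob (?A \<inter> S)" .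
      moreover have "(\<integral>\<omega>. indicator S \<omega> * indicator ?A \<omega> \<partial>?P) = P.prob (?A \<inter> S)"
      proof -
        have "(\<lambda>\<omega>. indicator S \<omega> * indicator ?A \<omega> :: real) = indicator (?A \<inter> S)"
          by (auto simp: fun_eq_iff split: split_indicator)
        then show ?thesis using A SP by simp
      qed
      ultimately show "(\<integral>\<omega>\<in>S. indicator ?A \<omega> \<partial>?P) = (\<integral>\<omega>\<in>S. P.prob ?A * ?R \<omega> \<partial>?P)"
        by (simp add: set_lebesgue_integral_def mult.left_commute mult.commute[of _ "indicator S _"])
    qed (use A RI RM in \<open>auto simp: P.emeasure_eq_measure\<close>)
    note ce = this
    have "integrable ?P (\<lambda>\<omega>. \<psi> \<omega> * indicator ?A \<omega>)" using A \<psi>_int by (rule integrable_real_mult_indicator)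
    moreover have "indicator ?A \<in> borel_measurable ?P" using A by simp
    ultimately have "(\<integral>\<omega>. \<psi> \<omega> * indicator ?A \<omega> \<partial>?P) = (\<integral>\<omega>. \<psi> \<omega> * real_cond_exp ?P ?T (indicator ?A) \<omega> \<partial>?P)"
      by (intro FT.real_cond_exp_intg(2)[symmetric] \<psi>T)
    also have "\<dots> = (\<integral>\<omega>. P.prob ?A * (\<psi> \<omega> * ?R \<omega>) \<partial>?P)"
    proof (rule integral_cong_AE)
      show "(\<lambda>\<omega>. \<psi> \<omega> * real_cond_exp ?P ?T (indicator ?A) \<omega>) \<in> borel_measurable ?P"
        by (rule borel_measurable_times[OF measurable_from_subalg[OF sub \<psi>T] borel_measurable_cond_exp2])
      show "(\<lambda>\<omega>. P.prob ?A * (\<psi> \<omega> * ?R \<omega>)) \<in> borel_measurable ?P"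
        by (intro borel_measurable_times borel_measurable_const measurable_from_subalg[OF sub \<psi>T] measurable_from_subalg[OF sub RM])
      show "AE \<omega> in ?P. \<psi> \<omega> * real_cond_exp ?P ?T (indicator ?A) \<omega> = P.prob ?A * (\<psi> \<omega> * ?R \<omega>)"
        using ce by eventually_elim simp
    qed
    also have "\<dots> = P.prob ?A * (\<integral>\<omega>. \<psi> \<omega> * ?R \<omega> \<partial>?P)" by simp
    also have "(\<integral>\<omega>. \<psi> \<omega> * ?R \<omega> \<partial>?P) = (\<integral>\<omega>. \<psi> \<omega> * ?R \<omega> \<partial>M)"
      unfolding MT by (rule integral_subalgebra2[OF sub borel_measurable_times[OF \<psi>T RM], symmetric])
    also have "\<dots> = 0" using R[OF k] by simp
    finally show ?thesis by (simp add: Suc)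
  qed
  have all: "(\<integral>\<omega>. \<psi> \<omega> * indicator A \<omega> \<partial>?P) = 0" if "A \<in> future l 0" for A
  proof -
    have fut: "future l 0 = sigma_sets (path_space l) (insert {} {cyl l 0 m x | m x. 0 \<le> m \<and> (x :: nat \<Rightarrow> nat \<times> 'g) \<in> path_space l})"
      by (rule future_eq_cyl) (rule stochastic_sequenceD(1)[OF st])
    have A: "A \<in> sigma_sets (path_space l) (insert {} {cyl l 0 m x | m x. 0 \<le> m \<and> x \<in> path_space l})"
      using that by (simp only: fut)
    show ?thesis
    proof (rule sigma_sets_induct_disjoint[OF cyl_Int_stable _ A])
      show "insert {} {cyl l 0 m x | m x. 0 \<le> m \<and> x \<in> path_space l} \<subseteq> Pow (path_space l)"
        by (auto simp: cyl_def)
      fix A :: "(nat \<Rightarrow> nat \<times> 'g) set" assume "A \<in> insert {} {cyl l 0 m x | m x. 0 \<le> m \<and> x \<in> path_space l}"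
      then show "(\<integral>\<omega>. \<psi> \<omega> * indicator A \<omega> \<partial>?P) = 0" using cyl0 by auto
    next
      fix A :: "(nat \<Rightarrow> nat \<times> 'g) set"
      assume "A \<in> sigma_sets (path_space l) (insert {} {cyl l 0 m x | m x. 0 \<le> m \<and> x \<in> path_space l})"
        and IH: "(\<integral>\<omega>. \<psi> \<omega> * indicator A \<omega> \<partial>?P) = 0"
      then have A: "A \<in> sets ?P" unfolding fut[symmetric] using future_sets_walk[OF st 0] by blast
      have x: "(\<lambda>_. (0, 0)) \<in> path_space l"
        using stochastic_sequenceD(1)[OF st] by (auto simp: path_space_def Vset_def)
      have "(\<integral>\<omega>. \<psi> \<omega> * indicator (path_space l - A) \<omega> \<partial>?P) =
          (\<integral>\<omega>. \<psi> \<omega> * indicator (cyl l 0 0 (\<lambda>_. (0, 0))) \<omega> - \<psi> \<omega> * indicator A \<omega> \<partial>?P)"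
        by (rule Bochner_Integration.integral_cong) (auto simp: cyl_def space_walk[OF st] split: split_indicator)
      also have "\<dots> = 0"
        using integrable_real_mult_indicator[OF A \<psi>_int] integrable_real_mult_indicator[OF sets_cyl[OF st 0 x] \<psi>_int]
        by (simp add: IH cyl0[OF x])
      finally show "(\<integral>\<omega>. \<psi> \<omega> * indicator (path_space l - A) \<omega> \<partial>?P) = 0" .
    next
      fix A :: "nat \<Rightarrow> (nat \<Rightarrow> nat \<times> 'g) set"
      assume dis: "disjoint_family A"
        and "range A \<subseteq> sigma_sets (path_space l) (insert {} {cyl l 0 m x | m x. 0 \<le> m \<and> x \<in> path_space l})"
        and IH: "\<And>k. (\<integral>\<omega>. \<psi> \<omega> * indicator (A k) \<omega> \<partial>?P) = 0"
      then have A: "A k \<in> sets ?P" for k unfolding fut[symmetric] using future_sets_walk[OF st 0] by blast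
      have "(LINT \<omega>:(\<Union>k. A k)|?P. \<psi> \<omega>) = (\<Sum>k. (LINT \<omega>:(A k)|?P. \<psi> \<omega>))"
      proof (rule lebesgue_integral_countable_add)
        show "A i \<inter> A j = {}" if "i \<noteq> j" for i j using dis that by (auto simp: disjoint_family_on_def)
        show "set_integrable ?P (\<Union>k. A k) \<psi>"
          unfolding set_integrable_def using A \<psi>_int by (intro integrable_mult_indicator) auto
      qed (rule A)
      then show "(\<integral>\<omega>. \<psi> \<omega> * indicator (\<Union> (range A)) \<omega> \<partial>?P) = 0"
        using IH by (simp add: set_lebesgue_integral_def mult.commute)
    qed simp
  qed
  have futP: "future l 0 = sets ?P"
  proof
    show "future l 0 \<subseteq> sets ?P" using future_sets_walk[OF st 0] by blast
    interpret S: sigma_algebra "path_space l" "future l 0 :: (nat \<Rightarrow> nat \<times> 'g) set set" by (rule sigma_algebra_future)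
    have "sets ?P = sigma_sets (path_space l) {{\<omega> \<in> path_space l. \<omega> k \<in> A} | k A. k \<in> UNIV \<and> A \<in> sets (coord_space l k :: (nat \<times> 'g) measure)}"
      unfolding sets_walk[OF st 0] sets_PiM_single by (simp add: path_space_def)
    also have "\<dots> \<subseteq> future l 0"
      by (rule S.sigma_sets_subset) (use future_basic[of 0] in blast)
    finally show "sets ?P \<subseteq> future l 0" .
  qed
  have "AE \<omega> in ?P. \<psi> \<omega> = 0"
  proof (rule density_unique_real[OF \<psi>_int])
    show "integrable ?P (\<lambda>_. 0 :: real)" by simp
    show "set_lebesgue_integral ?P A \<psi> = (LINT \<omega>:A|?P. 0)" if "A \<in> sets ?P" for A
      using all[of A] that by (simp add: futP set_lebesgue_integral_def mult.commute)
  qed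
  then have "AE \<omega> in M. \<psi> \<omega> = 0"
    unfolding MT
  proof (rule AE_restr_to_subalg2[OF sub])
    have "{\<omega> \<in> space ?T. \<psi> \<omega> = 0} \<in> sets ?T" using \<psi>T by measurable
    then show "Measurable.pred ?T (\<lambda>\<omega>. \<psi> \<omega> = 0)" by (simp add: pred_def)
  qed
  \<comment> \<open>The conditional expectation is almost surely 0 or 1, so the threshold 1/2 recovers the set.\<close>
  have "{\<omega> \<in> space F. \<phi> \<omega> > 1/2} \<in> sets F" using \<phi>F by measurable
  then obtain C where C: "C \<in> sets borel" "{\<omega> \<in> path_space l. \<phi> \<omega> > 1/2} = ?\<Phi> -` C \<inter> path_space l"
    unfolding sF spF by blast
  have "AE \<omega> in M. \<omega> \<in> T \<longleftrightarrow> ?\<Phi> \<omega> \<in> C"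
    using \<open>AE \<omega> in M. \<psi> \<omega> = 0\<close> AE_space
  proof eventually_elim
    case (elim \<omega>)
    have "\<phi> \<omega> = indicator T \<omega>" using elim(1) by (simp add: \<psi>_def)
    moreover have "\<phi> \<omega> > 1/2 \<longleftrightarrow> ?\<Phi> \<omega> \<in> C" using C(2) elim(2) by (auto simp: spM set_eq_iff)
    ultimately show ?case by (auto split: split_indicator_asm)
  qed
  then show ?thesis using C(1) unfolding M_def by blast
qed

end

section \<open>Ultralimits of probability spaces\<close>

text \<open>Ultralimits of a constant family of sets, along an ultrafilter on the parameters that tends to 1.\<close>

locale ul =
  fixes U :: "real filter" and E :: "'e set"
  assumes ultra: "ultrafilter U"
    and ev_params: "eventually (\<lambda>a. a \<in> params) U"
    and tendsto_1: "((\<lambda>a. a) \<longlongrightarrow> 1) U"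
    and E_ne: "E \<noteq> {}"
begin

lemma U_bot [simp]: "U \<noteq> bot"
  using ultra by (simp add: ultrafilter_def)

lemma ultraD: "\<not> eventually P U \<Longrightarrow> eventually (\<lambda>a. \<not> P a) U"
  using ultra unfolding ultrafilter_def by blast

lemma ev_not_iff: "eventually (\<lambda>a. \<not> P a) U \<longleftrightarrow> \<not> eventually P U"
proof
  assume n: "eventually (\<lambda>a. \<not> P a) U"
  show "\<not> eventually P U"
  proof
    assume "eventually P U"
    with n have "eventually (\<lambda>a. False) U" by eventually_elim simp
    then show False by simp
  qed
qed (rule ultraD)

text \<open>Bounded functions converge along an ultrafilter.\<close>

lemma bounded_tendsto_Lim:
  fixes f :: "real \<Rightarrow> real"
  assumes "\<And>a. a \<in> params \<Longrightarrow> \<bar>f a\<bar> \<le> C"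
  shows "(f \<longlongrightarrow> Lim U f) U"
proof -
  have b: "eventually (\<lambda>a. \<bar>f a\<bar> \<le> C) U" using ev_params by eventually_elim (rule assms)
  define S where "S = {c. eventually (\<lambda>a. c \<le> f a) U}"
  have "- C \<in> S" unfolding S_def using b by (auto elim: eventually_mono)
  have up: "c \<le> C" if "c \<in> S" for c
  proof -
    have "eventually (\<lambda>a. c \<le> f a \<and> \<bar>f a\<bar> \<le> C) U" using that b by (simp add: S_def eventually_conj_iff)
    then obtain a where "c \<le> f a" "\<bar>f a\<bar> \<le> C" using eventually_happens'[OF U_bot] by blast
    then show ?thesis by simp
  qed
  have "(f \<longlongrightarrow> Sup S) U"
  proof (rule order_tendstoI)
    fix c assume "c < Sup S"
    then obtain c' where "c' \<in> S" "c < c'" using less_cSupE[of c S] \<open>- C \<in> S\<close> by blast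
    then show "eventually (\<lambda>a. c < f a) U" by (auto simp: S_def elim: eventually_mono)
  next
    fix c assume c: "Sup S < c"
    have "c \<notin> S"
      using c cSup_upper[of c S] up by (force intro: bdd_aboveI)
    then show "eventually (\<lambda>a. f a < c) U"
      using ultraD[of "\<lambda>a. c \<le> f a"] by (simp add: S_def not_le)
  qed
  then show ?thesis using tendsto_Lim[OF U_bot] by metis
qed

text \<open>The class of a family of points.\<close>

definition cls :: "(real \<Rightarrow> 'e) \<Rightarrow> (real \<Rightarrow> 'e) set" where
  "cls x = ul_eq U E `` {x}"

abbreviation "fam \<equiv> params \<rightarrow>\<^sub>E E"

text \<open>The families of sets that define the generating sets of the ultralimit.\<close>

abbreviation "internal \<equiv> {A :: real \<Rightarrow> 'e set. \<forall>a. A a \<subseteq> E}"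

lemma mem_cls: "x \<in> fam \<Longrightarrow> y \<in> cls x \<longleftrightarrow> y \<in> fam \<and> eventually (\<lambda>a. x a = y a) U"
  by (simp add: cls_def ul_eq_def)

lemma cls_self: "x \<in> fam \<Longrightarrow> x \<in> cls x"
  by (simp add: mem_cls)

lemma cls_points: "x \<in> fam \<Longrightarrow> cls x \<in> ul_points U E"
  unfolding ul_points_def cls_def by (rule quotientI)

lemma pointsE:
  assumes "c \<in> ul_points U E"
  obtains x where "x \<in> fam" "c = cls x"
  using assms unfolding ul_points_def cls_def by (auto elim: quotientE)

lemma cls_mem_ul_set: "x \<in> fam \<Longrightarrow> cls x \<in> ul_set U E A \<longleftrightarrow> eventually (\<lambda>a. x a \<in> A a) U"
proof
  assume x: "x \<in> fam" and "cls x \<in> ul_set U E A"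
  then obtain y where y: "eventually (\<lambda>a. x a = y a) U" "eventually (\<lambda>a. y a \<in> A a) U"
    by (auto simp: ul_set_def mem_cls)
  show "eventually (\<lambda>a. x a \<in> A a) U" using y by eventually_elim simp
qed (auto simp: ul_set_def cls_points intro!: bexI[of _ x] cls_self)

lemma ul_set_points: "ul_set U E A \<subseteq> ul_points U E"
  by (auto simp: ul_set_def)

lemma ul_set_eqI:
  assumes "S \<subseteq> ul_points U E" and "\<And>x. x \<in> fam \<Longrightarrow> cls x \<in> S \<longleftrightarrow> eventually (\<lambda>a. x a \<in> A a) U"
  shows "S = ul_set U E A"
proof (rule set_eqI)
  fix c
  show "c \<in> S \<longleftrightarrow> c \<in> ul_set U E A"
  proof (cases "c \<in> ul_points U E")
    case True
    then obtain x where "x \<in> fam" "c = cls x" by (rule pointsE)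
    then show ?thesis using assms(2) cls_mem_ul_set by simp
  next
    case False
    then show ?thesis using assms(1) ul_set_points by blast
  qed
qed

lemma ul_set_Int: "ul_set U E A \<inter> ul_set U E B = ul_set U E (\<lambda>a. A a \<inter> B a)"
  by (rule ul_set_eqI) (use ul_set_points[of A] in \<open>auto simp: cls_mem_ul_set eventually_conj_iff\<close>)

lemma ul_set_Compl: "ul_points U E - ul_set U E A = ul_set U E (\<lambda>a. E - A a)"
proof (rule ul_set_eqI)
  fix x assume x: "x \<in> fam"
  have "eventually (\<lambda>a. x a \<in> E) U" using ev_params by eventually_elim (use x in auto)
  then have "eventually (\<lambda>a. x a \<in> E - A a) U \<longleftrightarrow> eventually (\<lambda>a. x a \<notin> A a) U"
    by (simp add: eventually_conj_iff)
  then show "cls x \<in> ul_points U E - ul_set U E A \<longleftrightarrow> eventually (\<lambda>a. x a \<in> E - A a) U"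
    using x by (simp add: cls_mem_ul_set cls_points ev_not_iff)
qed auto

lemma ul_set_empty: "ul_set U E (\<lambda>a. {}) = {}"
  by (rule ul_set_eqI[symmetric]) auto

lemma ul_set_full: "ul_set U E (\<lambda>a. E) = ul_points U E"
  using ul_set_Compl[of "\<lambda>a. {}"] by (simp add: ul_set_empty)

text \<open>Countably many internal sets with the finite intersection property have a common point.
  The bound on the index, which tends to infinity as the parameter tends to 1, makes the choice
  of the point a finite matter for each single parameter.\<close>

lemma saturation:
  fixes A :: "nat \<Rightarrow> real \<Rightarrow> 'e set"
  assumes A: "\<And>n a. A n a \<subseteq> E" and fip: "\<And>n. eventually (\<lambda>a. (\<Inter>k\<le>n. A k a) \<noteq> {}) U"
  shows "\<exists>x\<in>fam. \<forall>n. eventually (\<lambda>a. x a \<in> A n a) U"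
proof -
  define J where "J a = {n. real n < 1 / (1 - a) \<and> (\<Inter>k\<le>n. A k a) \<noteq> {}}" for a
  have "\<exists>y\<in>E. \<forall>n\<in>J a. y \<in> A n a" for a
  proof (cases "J a = {}")
    case True
    then show ?thesis using E_ne by auto
  next
    case False
    have "J a \<subseteq> {n. n < nat \<lceil>1 / (1 - a)\<rceil>}" by (auto simp: J_def) linarith
    then have fin: "finite (J a)" by (rule finite_subset) simp
    then have "Max (J a) \<in> J a" using False by (rule Max_in)
    then obtain y where y: "y \<in> (\<Inter>k\<le>Max (J a). A k a)" by (auto simp: J_def)
    have "y \<in> A n a" if "n \<in> J a" for n using y Max_ge[OF fin that] by auto
    moreover have "y \<in> E" using y A by blast
    ultimately show ?thesis by blast
  qed
  then obtain y where y: "\<And>a. y a \<in> E" "\<And>a n. n \<in> J a \<Longrightarrow> y a \<in> A n a" by metis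
  define x where "x = restrict y params"
  have "eventually (\<lambda>a. x a \<in> A n a) U" for n
  proof -
    have "eventually (\<lambda>a. 1 - 1 / (real n + 1) < a) U"
      using order_tendstoD(1)[OF tendsto_1, of "1 - 1 / (real n + 1)"] by simp
    then show ?thesis
      using fip[of n] ev_params
    proof eventually_elim
      case (elim a)
      have "1 - a < 1 / (real n + 1)" "0 < 1 - a" using elim by auto
      then have "real n + 1 < 1 / (1 - a)" by (simp add: field_simps)
      then have "n \<in> J a" using elim(2) by (simp add: J_def)
      then show ?case using y(2) elim(3) by (simp add: x_def)
    qed
  qed
  moreover have "x \<in> fam" using y(1) by (auto simp: x_def)
  ultimately show ?thesis by blast
qed

lemma ul_set_empty_iff:
  assumes "\<And>a. A a \<subseteq> E"
  shows "ul_set U E A = {} \<longleftrightarrow> eventually (\<lambda>a. A a = {}) U"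
proof
  assume e: "ul_set U E A = {}"
  show "eventually (\<lambda>a. A a = {}) U"
  proof (rule ccontr)
    assume "\<not> ?thesis"
    then have "eventually (\<lambda>a. A a \<noteq> {}) U" by (rule ultraD)
    then have "\<exists>x\<in>fam. \<forall>n::nat. eventually (\<lambda>a. x a \<in> A a) U"
      by (intro saturation[of "\<lambda>n. A"]) (use assms in auto)
    then show False using e cls_mem_ul_set by blast
  qed
next
  assume "eventually (\<lambda>a. A a = {}) U"
  then have "\<not> eventually (\<lambda>a. x a \<in> A a) U" for x
    unfolding ev_not_iff[symmetric] by eventually_elim simp
  then have "ul_set U E (\<lambda>a. {}) = ul_set U E A"
    by (intro ul_set_eqI ul_set_points) (simp add: ul_set_empty)
  then show "ul_set U E A = {}" by (simp add: ul_set_empty)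
qed

lemma ul_set_eq_iff:
  assumes "A \<in> internal" "B \<in> internal" "ul_set U E A = ul_set U E B"
  shows "eventually (\<lambda>a. A a = B a) U"
proof -
  have "ul_set U E A \<inter> (ul_points U E - ul_set U E B) = {}" "ul_set U E B \<inter> (ul_points U E - ul_set U E A) = {}"
    using assms(3) by auto
  then have "eventually (\<lambda>a. A a \<inter> (E - B a) = {}) U" "eventually (\<lambda>a. B a \<inter> (E - A a) = {}) U"
    unfolding ul_set_Compl ul_set_Int by (subst (asm) ul_set_empty_iff; use assms in blast)+
  then show ?thesis by eventually_elim (use assms in blast)
qed

lemma ul_Int_stable: "Int_stable (ul_set U E ` internal)"
proof (rule Int_stableI)
  fix S T assume "S \<in> ul_set U E ` internal" "T \<in> ul_set U E ` internal"
  then obtain A B where "A \<in> internal" "B \<in> internal" "S = ul_set U E A" "T = ul_set U E B" by blast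
  then have "S \<inter> T = ul_set U E (\<lambda>a. A a \<inter> B a)" "(\<lambda>a. A a \<inter> B a) \<in> internal" by (auto simp: ul_set_Int)
  then show "S \<inter> T \<in> ul_set U E ` internal" by blast
qed

lemma ul_generator_sub: "ul_set U E ` internal \<subseteq> Pow (ul_points U E)"
  using ul_set_points by blast

lemma ul_algebra: "algebra (ul_points U E) (ul_set U E ` internal)"
  unfolding algebra_iff_Int
proof (intro conjI ballI)
  show "{} \<in> ul_set U E ` internal" using ul_set_empty by (auto intro!: image_eqI[of _ _ "\<lambda>a. {}"])
  show "ul_points U E - S \<in> ul_set U E ` internal" if "S \<in> ul_set U E ` internal" for S
    using that by (auto simp: ul_set_Compl intro!: imageI)
  show "S \<inter> T \<in> ul_set U E ` internal" if "S \<in> ul_set U E ` internal" "T \<in> ul_set U E ` internal" for S T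
    using that ul_Int_stable unfolding Int_stable_def by blast
qed (rule ul_generator_sub)

lemma sets_ul_measure: "sets (ul_measure U E \<eta>) = sigma_sets (ul_points U E) (ul_set U E ` internal)"
  unfolding ul_measure_def by (rule sets_extend_measure) (rule ul_generator_sub)

lemma space_ul_measure: "space (ul_measure U E \<eta>) = ul_points U E"
  unfolding ul_measure_def by (rule space_extend_measure) (rule ul_generator_sub)

lemma ul_set_sets: "A \<in> internal \<Longrightarrow> ul_set U E A \<in> sets (ul_measure U E \<eta>)"
  unfolding sets_ul_measure by (intro sigma_sets.Basic imageI)

end

text \<open>A family of probability measures for which all sets are measurable. Their ultralimit exists
  by the extension theorem of Caratheodory: a decreasing sequence of internal sets with empty
  intersection is eventually empty, by saturation, so continuity at the empty set holds trivially.\<close>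

locale ul_prob = ul U E for U and E :: "'e set" +
  fixes \<eta> :: "real \<Rightarrow> 'e measure"
  assumes prob_\<eta>: "\<And>a. a \<in> params \<Longrightarrow> prob_space (\<eta> a)"
    and sets_\<eta>: "\<And>a. a \<in> params \<Longrightarrow> sets (\<eta> a) = Pow E"
begin

lemma space_\<eta>: "a \<in> params \<Longrightarrow> space (\<eta> a) = E"
  using sets_eq_imp_space_eq[of "\<eta> a" "count_space E"] sets_\<eta>[of a] by simp

text \<open>The limit of the measures of a family of sets.\<close>

definition lim_meas :: "(real \<Rightarrow> 'e set) \<Rightarrow> real" where
  "lim_meas A = Lim U (\<lambda>a. measure (\<eta> a) (A a))"

lemma lim_meas: "((\<lambda>a. measure (\<eta> a) (A a)) \<longlongrightarrow> lim_meas A) U"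
  unfolding lim_meas_def
  by (rule bounded_tendsto_Lim[where C=1]) (use prob_\<eta> prob_space.prob_le_1 in fastforce)

lemma lim_meas_cong: "eventually (\<lambda>a. A a = B a) U \<Longrightarrow> lim_meas A = lim_meas B"
proof -
  assume "eventually (\<lambda>a. A a = B a) U"
  then have "eventually (\<lambda>a. measure (\<eta> a) (A a) = measure (\<eta> a) (B a)) U" by eventually_elim simp
  then have "((\<lambda>a. measure (\<eta> a) (B a)) \<longlongrightarrow> lim_meas A) U"
    by (rule Lim_transform_eventually[OF lim_meas])
  then show ?thesis by (rule tendsto_unique[OF U_bot _ lim_meas])
qed

lemma lim_meas_nonneg: "0 \<le> lim_meas A"
  by (rule tendsto_lowerbound[OF lim_meas]) auto

lemma emeasure_lim: "Lim U (\<lambda>a. emeasure (\<eta> a) (A a)) = ennreal (lim_meas A)"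
proof (rule tendsto_Lim[OF U_bot])
  have "eventually (\<lambda>a. ennreal (measure (\<eta> a) (A a)) = emeasure (\<eta> a) (A a)) U"
    using ev_params
    by eventually_elim (metis finite_measure.emeasure_eq_measure prob_\<eta> prob_space.finite_measure)
  then show "((\<lambda>a. emeasure (\<eta> a) (A a)) \<longlongrightarrow> ennreal (lim_meas A)) U"
    by (rule Lim_transform_eventually[OF tendsto_ennrealI[OF lim_meas]])
qed

lemma lim_meas_disjoint:
  assumes "A \<in> internal" "B \<in> internal" "eventually (\<lambda>a. A a \<inter> B a = {}) U"
  shows "lim_meas (\<lambda>a. A a \<union> B a) = lim_meas A + lim_meas B"
proof -
  have "eventually (\<lambda>a. measure (\<eta> a) (A a) + measure (\<eta> a) (B a) = measure (\<eta> a) (A a \<union> B a)) U"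
    using ev_params assms(3)
  proof eventually_elim
    case (elim a)
    interpret prob_space "\<eta> a" using elim(1) by (rule prob_\<eta>)
    show ?case using finite_measure_Union[of "A a" "B a"] elim assms sets_\<eta>[of a] by auto
  qed
  then have "((\<lambda>a. measure (\<eta> a) (A a \<union> B a)) \<longlongrightarrow> lim_meas A + lim_meas B) U"
    by (rule Lim_transform_eventually[OF tendsto_add[OF lim_meas lim_meas]])
  then show ?thesis by (rule tendsto_unique[OF U_bot lim_meas])
qed

lemma emeasure_ul_set:
  assumes A: "A \<in> internal"
  shows "emeasure (ul_measure U E \<eta>) (ul_set U E A) = ennreal (lim_meas A)"
proof -
  interpret alg: algebra "ul_points U E" "ul_set U E ` internal" by (rule ul_algebra)
  define f where "f S = ennreal (lim_meas (SOME A. A \<in> internal \<and> ul_set U E A = S))" for S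
  have f: "f (ul_set U E B) = ennreal (lim_meas B)" if B: "B \<in> internal" for B
  proof -
    let ?B = "SOME A. A \<in> internal \<and> ul_set U E A = ul_set U E B"
    have "?B \<in> internal \<and> ul_set U E ?B = ul_set U E B" by (rule someI[of _ B]) (use B in simp)
    then have "eventually (\<lambda>a. ?B a = B a) U" using B by (intro ul_set_eq_iff) auto
    then show ?thesis unfolding f_def by (simp add: lim_meas_cong)
  qed
  have empty: "f {} = 0"
  proof -
    have "f (ul_set U E (\<lambda>a. {})) = ennreal (lim_meas (\<lambda>a. {}))" by (rule f) simp
    moreover have "lim_meas (\<lambda>a. {}) = 0" unfolding lim_meas_def by (simp add: tendsto_Lim)
    ultimately show ?thesis by (simp add: ul_set_empty)
  qed
  have "\<exists>\<mu>. (\<forall>S\<in>ul_set U E ` internal. \<mu> S = f S) \<and> measure_space (ul_points U E) (sigma_sets (ul_points U E) (ul_set U E ` internal)) \<mu>"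
  proof (rule alg.caratheodory_empty_continuous)
    show "positive (ul_set U E ` internal) f" using empty by (simp add: positive_def)
    show "additive (ul_set U E ` internal) f"
      unfolding additive_def
    proof (intro ballI impI)
      fix S T assume "S \<in> ul_set U E ` internal" "T \<in> ul_set U E ` internal" and dis: "S \<inter> T = {}"
      then obtain A B where AB: "A \<in> internal" "B \<in> internal" "S = ul_set U E A" "T = ul_set U E B" by blast
      have ev: "eventually (\<lambda>a. A a \<inter> B a = {}) U"
        using dis AB(1,2) unfolding AB(3,4) ul_set_Int by (subst (asm) ul_set_empty_iff) auto
      have "S \<union> T = ul_points U E - ((ul_points U E - S) \<inter> (ul_points U E - T))"
        using ul_set_points AB(3,4) by blast
      also have "\<dots> = ul_set U E (\<lambda>a. E - ((E - A a) \<inter> (E - B a)))"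
        unfolding AB(3,4) ul_set_Compl ul_set_Int ..
      also have "(\<lambda>a. E - ((E - A a) \<inter> (E - B a))) = (\<lambda>a. A a \<union> B a)" using AB(1,2) by blast
      finally have "S \<union> T = ul_set U E (\<lambda>a. A a \<union> B a)" .
      then show "f (S \<union> T) = f S + f T"
        using AB f lim_meas_disjoint[OF AB(1,2) ev] f[of "\<lambda>a. A a \<union> B a"]
        by (simp add: ennreal_plus lim_meas_nonneg)
    qed
    show "f S \<noteq> \<infinity>" if "S \<in> ul_set U E ` internal" for S using that f by auto
    fix S :: "nat \<Rightarrow> _" assume S: "range S \<subseteq> ul_set U E ` internal" "decseq S" "(\<Inter>n. S n) = {}"
    then have "\<forall>n. \<exists>A. A \<in> internal \<and> S n = ul_set U E A" by blast
    then obtain A where A: "\<And>n. A n \<in> internal" "\<And>n. S n = ul_set U E (A n)" by metis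
    have "\<exists>n. S n = {}"
    proof (rule ccontr)
      assume ne: "\<not> ?thesis"
      have "eventually (\<lambda>a. (\<Inter>k\<le>n. A k a) \<noteq> {}) U" for n
      proof -
        obtain c where c: "c \<in> S n" using ne by blast
        then have "c \<in> ul_points U E" using A(2) ul_set_points by blast
        then obtain x where x: "x \<in> fam" "c = cls x" by (rule pointsE)
        have "eventually (\<lambda>a. x a \<in> A k a) U" if "k \<le> n" for k
          using c decseqD[OF S(2) that] x cls_mem_ul_set[OF x(1)] A(2) by blast
        then have "eventually (\<lambda>a. \<forall>k\<in>{..n}. x a \<in> A k a) U" by (intro eventually_ball_finite) auto
        then show ?thesis by eventually_elim blast
      qed
      then obtain x where x: "x \<in> fam" "\<And>n. eventually (\<lambda>a. x a \<in> A n a) U"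
        using saturation[of A] A(1) by blast
      then have "cls x \<in> S n" for n using cls_mem_ul_set A(2) by blast
      then show False using S(3) by blast
    qed
    then obtain n where n: "S n = {}" ..
    show "(\<lambda>i. f (S i)) \<longlonglongrightarrow> 0"
    proof (rule tendsto_eventually, rule eventually_sequentiallyI[of n])
      fix i assume "n \<le> i"
      then have "S i = {}" using decseqD[OF S(2)] n by blast
      then show "f (S i) = 0" using empty by simp
    qed
  qed
  then obtain \<mu> where \<mu>: "\<And>S. S \<in> ul_set U E ` internal \<Longrightarrow> \<mu> S = f S"
      "measure_space (ul_points U E) (sigma_sets (ul_points U E) (ul_set U E ` internal)) \<mu>" by blast
  have "emeasure (ul_measure U E \<eta>) (ul_set U E A) = Lim U (\<lambda>a. emeasure (\<eta> a) (A a))"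
  proof (rule emeasure_extend_measure[OF ul_measure_def])
    show "\<mu> (ul_set U E i) = Lim U (\<lambda>a. emeasure (\<eta> a) (i a))" if "i \<in> internal" for i
      using that \<mu>(1) f by (simp add: emeasure_lim)
    show "positive (sets (ul_measure U E \<eta>)) \<mu>" "countably_additive (sets (ul_measure U E \<eta>)) \<mu>"
      using \<mu>(2) by (simp_all add: measure_space_def sets_ul_measure)
  qed (use A ul_generator_sub in auto)
  then show ?thesis by (simp add: emeasure_lim)
qed

lemma prob_space_ul: "prob_space (ul_measure U E \<eta>)"
proof
  have "emeasure (ul_measure U E \<eta>) (ul_set U E (\<lambda>a. E)) = ennreal (lim_meas (\<lambda>a. E))"
    by (rule emeasure_ul_set) simp
  moreover have "lim_meas (\<lambda>a. E) = 1"
  proof -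
    have "eventually (\<lambda>a. 1 = measure (\<eta> a) E) U"
      using ev_params by eventually_elim (metis prob_\<eta> prob_space.prob_space space_\<eta>)
    then have "((\<lambda>a. measure (\<eta> a) E) \<longlongrightarrow> 1) U"
      by (rule Lim_transform_eventually[OF tendsto_const])
    then show ?thesis by (rule tendsto_unique[OF U_bot lim_meas])
  qed
  ultimately show "emeasure (ul_measure U E \<eta>) (space (ul_measure U E \<eta>)) = 1"
    by (simp add: ul_set_full space_ul_measure)
qed

lemma measure_ul_tendsto:
  assumes A: "A \<in> internal"
  shows "((\<lambda>a. measure (\<eta> a) (A a)) \<longlongrightarrow> measure (ul_measure U E \<eta>) (ul_set U E A)) U"
  using lim_meas[of A] lim_meas_nonneg by (simp add: measure_def emeasure_ul_set[OF A])

end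

text \<open>The ultralimit of a bounded family of functions, as a function on classes. The choice of
  the representative does not matter.\<close>

definition ul_fun :: "real filter \<Rightarrow> (real \<Rightarrow> 'e \<Rightarrow> real) \<Rightarrow> (real \<Rightarrow> 'e) set \<Rightarrow> real" where
  "ul_fun U k c = Lim U (\<lambda>a. k a ((SOME x. x \<in> c) a))"

text \<open>A value between 0 and N times e is approximated within e by a sum of N indicators of
  superlevel sets.\<close>

lemma step_approx:
  fixes v C :: real
  assumes "0 \<le> v" "v \<le> C" "C = real N * e" "0 < e"
  shows "(\<Sum>i=1..N. e * of_bool (real i * e < v)) \<in> {v - e..v}"
proof -
  define S where "S = {i\<in>{1..N}. real i * e < v}"
  have fin: "finite S" by (simp add: S_def)
  define j where "j = Max (insert 0 S)"
  have j: "j \<in> insert 0 S" unfolding j_def by (rule Max_in) (use fin in auto)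
  have jv: "real j * e \<le> v" using j assms(1) by (auto simp: S_def)
  have "S = {1..j}"
  proof
    show "S \<subseteq> {1..j}" using fin by (auto simp: j_def S_def intro!: Max_ge)
    show "{1..j} \<subseteq> S"
    proof
      fix i assume i: "i \<in> {1..j}"
      then have jS: "j \<in> S" using j by auto
      have "real i * e \<le> real j * e" using i assms(4) by (intro mult_right_mono) auto
      then show "i \<in> S" using i jS by (auto simp: S_def)
    qed
  qed
  have "(\<Sum>i=1..N. e * of_bool (real i * e < v)) = (\<Sum>i\<in>S. e)"
    unfolding S_def by (rule sum.mono_neutral_cong_right) auto
  also have "\<dots> = real j * e" unfolding \<open>S = {1..j}\<close> by simp
  finally have eq: "(\<Sum>i=1..N. e * of_bool (real i * e < v)) = real j * e" .
  have "v \<le> real (Suc j) * e"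
  proof (cases "Suc j \<le> N")
    case True
    have "Suc j \<notin> S" using \<open>S = {1..j}\<close> by simp
    then show ?thesis using True by (auto simp: S_def)
  next
    case False
    then have "real N * e \<le> real (Suc j) * e" using assms(4) by (intro mult_right_mono) auto
    then show ?thesis using assms(2,3) by simp
  qed
  then show ?thesis using jv unfolding eq by (simp add: algebra_simps)
qed

context ul
begin

lemma ul_fun_cls:
  assumes "\<And>a x. a \<in> params \<Longrightarrow> x \<in> E \<Longrightarrow> \<bar>k a x\<bar> \<le> C" and x: "x \<in> fam"
  shows "((\<lambda>a. k a (x a)) \<longlongrightarrow> ul_fun U k (cls x)) U"
proof -
  let ?y = "SOME y. y \<in> cls x"
  have "?y \<in> cls x" using someI[of "\<lambda>y. y \<in> cls x" x] cls_self[OF x] by blast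
  then have y: "?y \<in> fam" "eventually (\<lambda>a. x a = ?y a) U" using x by (auto simp: mem_cls)
  have "((\<lambda>a. k a (?y a)) \<longlongrightarrow> ul_fun U k (cls x)) U"
    unfolding ul_fun_def by (rule bounded_tendsto_Lim[where C=C]) (use assms(1) y(1) in \<open>auto simp: PiE_iff\<close>)
  moreover have "eventually (\<lambda>a. k a (?y a) = k a (x a)) U" using y(2) by eventually_elim simp
  ultimately show ?thesis by (rule Lim_transform_eventually)
qed

lemma ul_fun_range:
  assumes k: "\<And>a x. a \<in> params \<Longrightarrow> x \<in> E \<Longrightarrow> 0 \<le> k a x \<and> k a x \<le> C" and c: "c \<in> ul_points U E"
  shows "0 \<le> ul_fun U k c" "ul_fun U k c \<le> C"
proof -
  obtain x where x: "x \<in> fam" "c = cls x" using c by (rule pointsE)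
  have t: "((\<lambda>a. k a (x a)) \<longlongrightarrow> ul_fun U k (cls x)) U"
    by (rule ul_fun_cls[where C=C]) (use k x in \<open>auto simp: abs_le_iff intro: order_trans[of _ 0]\<close>)
  have "eventually (\<lambda>a. 0 \<le> k a (x a) \<and> k a (x a) \<le> C) U"
    using ev_params by eventually_elim (use k x in \<open>auto simp: PiE_iff\<close>)
  then show "0 \<le> ul_fun U k c" "ul_fun U k c \<le> C"
    using tendsto_lowerbound[OF t, of 0] tendsto_upperbound[OF t, of C] x(2) by (auto simp: eventually_conj_iff)
qed

lemma measurable_ul_fun:
  assumes k: "\<And>a x. a \<in> params \<Longrightarrow> x \<in> E \<Longrightarrow> 0 \<le> k a x \<and> k a x \<le> C"
  shows "ul_fun U k \<in> borel_measurable (ul_measure U E \<eta>)"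
  unfolding borel_measurable_iff_greater
proof
  fix c
  let ?A = "\<lambda>n a. {x\<in>E. c + 1 / real (Suc n) < k a x}"
  have "ul_fun U k p > c \<longleftrightarrow> p \<in> (\<Union>n. ul_set U E (?A n))" if p: "p \<in> ul_points U E" for p
  proof -
    obtain x where x: "x \<in> fam" "p = cls x" using p by (rule pointsE)
    have t: "((\<lambda>a. k a (x a)) \<longlongrightarrow> ul_fun U k p) U"
      unfolding x(2) by (rule ul_fun_cls[where C=C]) (use k x in \<open>auto simp: abs_le_iff intro: order_trans[of _ 0]\<close>)
    have xE: "eventually (\<lambda>a. x a \<in> E) U" using ev_params by eventually_elim (use x in auto)
    show ?thesis
    proof
      assume "c < ul_fun U k p"
      then obtain n where "1 / real (Suc n) < ul_fun U k p - c"
        using reals_Archimedean[of "ul_fun U k p - c"] by (auto simp: inverse_eq_divide)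
      then have "c + 1 / real (Suc n) < ul_fun U k p" by simp
      then have "eventually (\<lambda>a. c + 1 / real (Suc n) < k a (x a)) U" using order_tendstoD(1)[OF t] by blast
      then have "eventually (\<lambda>a. x a \<in> ?A n a) U" using xE by eventually_elim simp
      then have "p \<in> ul_set U E (?A n)" unfolding x(2) by (rule cls_mem_ul_set[OF x(1), THEN iffD2])
      then show "p \<in> (\<Union>n. ul_set U E (?A n))" by (rule UN_I[OF UNIV_I])
    next
      assume "p \<in> (\<Union>n. ul_set U E (?A n))"
      then obtain n where "p \<in> ul_set U E (?A n)" by (rule UN_E)
      then have "eventually (\<lambda>a. x a \<in> ?A n a) U" unfolding x(2) by (rule cls_mem_ul_set[OF x(1), THEN iffD1])
      then have "eventually (\<lambda>a. c + 1 / real (Suc n) \<le> k a (x a)) U" by eventually_elim simp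
      then have "c + 1 / real (Suc n) \<le> ul_fun U k p" by (rule tendsto_lowerbound[OF t _ U_bot])
      moreover have "0 < 1 / real (Suc n)" by simp
      ultimately show "c < ul_fun U k p" by linarith
    qed
  qed
  then have "{p \<in> space (ul_measure U E \<eta>). c < ul_fun U k p} = (\<Union>n. ul_set U E (?A n))"
    using ul_set_points by (auto simp: space_ul_measure)
  also have "\<dots> \<in> sets (ul_measure U E \<eta>)"
    by (intro sets.countable_UN) (use ul_set_sets in auto)
  finally show "{p \<in> space (ul_measure U E \<eta>). c < ul_fun U k p} \<in> sets (ul_measure U E \<eta>)" .
qed

end

context ul_prob
begin

text \<open>Ultralimits commute with the integral of uniformly bounded functions. For the step functions in
  superlevel sets this is the definition of the ultralimit measure.\<close>

theorem ul_integral_tendsto: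
  assumes k: "\<And>a x. a \<in> params \<Longrightarrow> x \<in> E \<Longrightarrow> 0 \<le> k a x \<and> k a x \<le> C"
  shows "((\<lambda>a. \<integral>x. k a x \<partial>\<eta> a) \<longlongrightarrow> (\<integral>c. ul_fun U k c \<partial>ul_measure U E \<eta>)) U"
proof -
  let ?\<nu> = "ul_measure U E \<eta>" and ?F = "ul_fun U k"
  interpret N: prob_space ?\<nu> by (rule prob_space_ul)
  have "(1::real) / 2 < 3 / 4 \<and> (3::real) / 4 < 1" by simp
  then have C0: "0 \<le> C" using k[of "3/4"] E_ne by (force intro: order_trans)
  have int_k: "integrable (\<eta> a) (k a)" if a: "a \<in> params" for a
  proof -
    interpret prob_space "\<eta> a" using a by (rule prob_\<eta>)
    have "sets (\<eta> a) = sets (count_space E)" by (simp add: sets_\<eta>[OF a])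
    then have "k a \<in> borel_measurable (\<eta> a)"
      by (simp add: measurable_cong_sets[of "\<eta> a" "count_space E" borel borel])
    then show ?thesis
      by (intro integrable_const_bound[where B=C]) (use k[OF a] in \<open>auto simp: space_\<eta>[OF a]\<close>)
  qed
  have int_F: "integrable ?\<nu> ?F"
    by (rule N.integrable_const_bound[where B=C])
       (use ul_fun_range[of k C] k measurable_ul_fun[of k C] in \<open>auto simp: space_ul_measure\<close>)
  have approx: "eventually (\<lambda>a. \<bar>(\<integral>x. k a x \<partial>\<eta> a) - (\<integral>c. ?F c \<partial>?\<nu>)\<bar> < 3 * e) U"
    if e: "0 < e" "Ca = real n * e" "C \<le> Ca" for e n and Ca :: real
  proof -
    let ?A = "\<lambda>i a. {x\<in>E. real i * e < k a x}"
    have A: "?A i \<in> internal" for i by auto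
    let ?q = "\<lambda>c. \<Sum>i=1..n. e * indicator (ul_set U E (?A i)) c"
    have q_range: "?q c \<in> {?F c - e..?F c}" if c: "c \<in> ul_points U E" for c
    proof -
      obtain x where x: "x \<in> fam" "c = cls x" using c by (rule pointsE)
      have t: "((\<lambda>a. k a (x a)) \<longlongrightarrow> ?F c) U"
        unfolding x(2) by (rule ul_fun_cls[where C=C]) (use k x in \<open>auto simp: abs_le_iff intro: order_trans[of _ 0]\<close>)
      have "eventually (\<lambda>a. of_bool (real i * e < k a (x a)) = (indicator (ul_set U E (?A i)) c :: real)) U" for i
      proof -
        have xE: "eventually (\<lambda>a. x a \<in> E) U" using ev_params by eventually_elim (use x in auto)
        show ?thesis
        proof (cases "c \<in> ul_set U E (?A i)")
          case True
          then have "eventually (\<lambda>a. x a \<in> ?A i a) U"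
            unfolding x(2) by (rule cls_mem_ul_set[OF x(1), THEN iffD1])
          then show ?thesis by eventually_elim (use True in simp)
        next
          case False
          then have "\<not> eventually (\<lambda>a. x a \<in> ?A i a) U"
            unfolding x(2) using cls_mem_ul_set[OF x(1), of "?A i"] by blast
          then have "eventually (\<lambda>a. x a \<notin> ?A i a) U" by (rule ultraD)
          then show ?thesis using xE by eventually_elim (use False in simp)
        qed
      qed
      then have "eventually (\<lambda>a. \<forall>i\<in>{1..n}. of_bool (real i * e < k a (x a)) = (indicator (ul_set U E (?A i)) c :: real)) U"
        by (intro eventually_ball_finite) auto
      then have "eventually (\<lambda>a. k a (x a) - e \<le> ?q c \<and> ?q c \<le> k a (x a)) U"
        using ev_params
      proof eventually_elim
        case (elim a)
        have "x a \<in> E" using x(1) elim(2) by auto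
        then have "(\<Sum>i=1..n. e * of_bool (real i * e < k a (x a))) \<in> {k a (x a) - e..k a (x a)}"
          using k[OF elim(2)] e by (intro step_approx[where C=Ca]) (auto intro: order_trans)
        then show ?case using elim(1) by simp
      qed
      then have "?F c - e \<le> ?q c" "?q c \<le> ?F c"
        using tendsto_upperbound[OF tendsto_diff[OF t tendsto_const[of e]], of "?q c"] tendsto_lowerbound[OF t, of "?q c"]
        by (auto simp: eventually_conj_iff)
      then show ?thesis by simp
    qed
    have int_q: "integrable ?\<nu> ?q"
      by (intro Bochner_Integration.integrable_sum integrable_mult_right) (use ul_set_sets[OF A] in \<open>simp add: N.emeasure_eq_measure\<close>)
    have q1: "(\<integral>c. ?q c \<partial>?\<nu>) \<le> (\<integral>c. ?F c \<partial>?\<nu>)"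
      by (rule integral_mono[OF int_q int_F]) (use q_range in \<open>simp add: space_ul_measure\<close>)
    have q2: "(\<integral>c. ?F c - e \<partial>?\<nu>) \<le> (\<integral>c. ?q c \<partial>?\<nu>)"
      by (rule integral_mono[OF _ int_q]) (use q_range int_F in \<open>auto simp: space_ul_measure\<close>)
    have q2': "(\<integral>c. ?F c \<partial>?\<nu>) - e \<le> (\<integral>c. ?q c \<partial>?\<nu>)"
      using q2 int_F by (simp add: N.prob_space)
    have q3: "(\<integral>c. ?q c \<partial>?\<nu>) = (\<Sum>i=1..n. e * measure ?\<nu> (ul_set U E (?A i)))"
      using ul_set_sets[OF A] by (subst Bochner_Integration.integral_sum) (auto simp: N.emeasure_eq_measure)
    have "((\<lambda>a. \<Sum>i=1..n. e * measure (\<eta> a) (?A i a)) \<longlongrightarrow> (\<Sum>i=1..n. e * measure ?\<nu> (ul_set U E (?A i)))) U"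
      by (intro tendsto_sum tendsto_mult tendsto_const measure_ul_tendsto A)
    then have "eventually (\<lambda>a. dist (\<Sum>i=1..n. e * measure (\<eta> a) (?A i a)) (\<Sum>i=1..n. e * measure ?\<nu> (ul_set U E (?A i))) < e) U"
      using e(1) by (rule tendstoD)
    then show ?thesis
      using ev_params
    proof eventually_elim
      case (elim a)
      interpret prob_space "\<eta> a" using elim(2) by (rule prob_\<eta>)
      have Aa: "?A i a \<in> sets (\<eta> a)" for i using sets_\<eta>[OF elim(2)] by auto
      let ?qa = "\<lambda>x. \<Sum>i=1..n. e * indicator (?A i a) x"
      have qa: "?qa x \<in> {k a x - e..k a x}" if "x \<in> E" for x
      proof -
        have "(\<Sum>i=1..n. e * of_bool (real i * e < k a x)) \<in> {k a x - e..k a x}"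
          using k[OF elim(2) that] e by (intro step_approx[where C=Ca]) (auto intro: order_trans)
        moreover have "(\<Sum>i=1..n. e * of_bool (real i * e < k a x)) = ?qa x"
          using that by (intro sum.cong) auto
        ultimately show ?thesis by (simp only:)
      qed
      have int_qa: "integrable (\<eta> a) ?qa"
        by (intro Bochner_Integration.integrable_sum integrable_mult_right) (use Aa in \<open>simp add: emeasure_eq_measure\<close>)
      have 1: "(\<integral>x. ?qa x \<partial>\<eta> a) \<le> (\<integral>x. k a x \<partial>\<eta> a)"
        by (rule integral_mono[OF int_qa int_k[OF elim(2)]]) (use qa in \<open>simp add: space_\<eta>[OF elim(2)]\<close>)
      have "(\<integral>x. k a x - e \<partial>\<eta> a) \<le> (\<integral>x. ?qa x \<partial>\<eta> a)"
        by (rule integral_mono[OF _ int_qa]) (use qa int_k[OF elim(2)] in \<open>auto simp: space_\<eta>[OF elim(2)]\<close>)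
      then have 2: "(\<integral>x. k a x \<partial>\<eta> a) - e \<le> (\<integral>x. ?qa x \<partial>\<eta> a)"
        using int_k[OF elim(2)] by (simp add: prob_space)
      have 3: "(\<integral>x. ?qa x \<partial>\<eta> a) = (\<Sum>i=1..n. e * measure (\<eta> a) (?A i a))"
        using Aa by (subst Bochner_Integration.integral_sum) (auto simp: emeasure_eq_measure)
      show ?case using 1 2 q1 q2' elim(1) unfolding 3 q3 dist_real_def by linarith
    qed
  qed
  show ?thesis
  proof (rule tendstoI)
    fix e :: real assume e: "0 < e"
    obtain n where n: "C < real n * (e / 3)" using reals_Archimedean3[of "e / 3"] e by auto
    have "eventually (\<lambda>a. \<bar>(\<integral>x. k a x \<partial>\<eta> a) - (\<integral>c. ?F c \<partial>?\<nu>)\<bar> < 3 * (e / 3)) U"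
      by (rule approx[of "e / 3" "real n * (e / 3)" n]) (use n e in auto)
    then show "eventually (\<lambda>a. dist (\<integral>x. k a x \<partial>\<eta> a) (\<integral>c. ?F c \<partial>?\<nu>) < e) U"
      by (simp add: dist_real_def)
  qed
qed

end

section \<open>The ultralimit system\<close>

lemma nn_integral_Eset:
  fixes f :: "nat \<times> nat \<times> 'g \<Rightarrow> ennreal"
  shows "(\<integral>\<^sup>+e. f e \<partial>count_space (Eset l)) = (\<Sum>n. \<integral>\<^sup>+v. f (n, v) \<partial>count_space (Vset l n))"
proof -
  have "(\<integral>\<^sup>+e. f e \<partial>count_space (Eset l)) = (\<integral>\<^sup>+e. f e * indicator (Eset l) e \<partial>count_space UNIV)"
    by (rule nn_integral_count_space_indicator) simp
  also have "\<dots> = (\<integral>\<^sup>+n. \<integral>\<^sup>+v. f (n, v) * indicator (Eset l) (n, v) \<partial>count_space UNIV \<partial>count_space UNIV)"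
    by (rule nn_integral_fst_count_space[symmetric])
  also have "\<dots> = (\<integral>\<^sup>+n. \<integral>\<^sup>+v. f (n, v) * indicator (Vset l n) v \<partial>count_space UNIV \<partial>count_space UNIV)"
    by (intro nn_integral_cong) (auto simp: Vset_def Eset_def split: split_indicator)
  also have "\<dots> = (\<integral>\<^sup>+n. \<integral>\<^sup>+v. f (n, v) \<partial>count_space (Vset l n) \<partial>count_space UNIV)"
    by (subst nn_integral_count_space_indicator) simp_all
  finally show ?thesis by (simp add: nn_integral_count_space_nat)
qed

lemma nn_integral_Vset_translate:
  fixes f :: "nat \<times> 'g::group_add \<Rightarrow> ennreal"
  shows "(\<integral>\<^sup>+v. f (fst v, g + snd v) \<partial>count_space (Vset l n)) = (\<integral>\<^sup>+v. f v \<partial>count_space (Vset l n))"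
  using nn_integral_translate[of "\<lambda>h. f (_, h)" g] by (simp add: nn_integral_Vset)

lemma sets_abel [simp]: "sets (abel_measure l \<sigma> s r a) = Pow (Eset l)"
  by (simp add: abel_measure_def)

lemma space_abel [simp]: "space (abel_measure l \<sigma> s r a) = Eset l"
  by (simp add: abel_measure_def)

lemma nn_integral_abel:
  fixes \<sigma> :: "'g::group_add mseq"
  assumes a: "a \<in> params"
  shows "(\<integral>\<^sup>+e. f e \<partial>abel_measure l \<sigma> s r a) = (\<Sum>n. if s \<le> n
    then ennreal ((1 - a) / a ^ s * a ^ n) * (\<integral>\<^sup>+v. tprod l \<sigma> s n r (fst v) (snd v) * f (n, v) \<partial>count_space (Vset l n)) else 0)"
proof -
  let ?d = "\<lambda>(n, j, g). if s \<le> n then ennreal ((1 - a) / a ^ s * a ^ n) * mprod l \<sigma> s (n - s) r j g else 0"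
  have "(\<integral>\<^sup>+e. f e \<partial>abel_measure l \<sigma> s r a) = (\<integral>\<^sup>+e. ?d e * f e \<partial>count_space (Eset l))"
    unfolding abel_measure_def by (rule nn_integral_density) simp_all
  also have "\<dots> = (\<Sum>n. \<integral>\<^sup>+v. ?d (n, v) * f (n, v) \<partial>count_space (Vset l n))"
    by (rule nn_integral_Eset)
  also have "\<dots> = (\<Sum>n. if s \<le> n
    then ennreal ((1 - a) / a ^ s * a ^ n) * (\<integral>\<^sup>+v. tprod l \<sigma> s n r (fst v) (snd v) * f (n, v) \<partial>count_space (Vset l n)) else 0)"
  proof (intro suminf_cong)
    fix n
    show "(\<integral>\<^sup>+v. ?d (n, v) * f (n, v) \<partial>count_space (Vset l n)) = (if s \<le> n
      then ennreal ((1 - a) / a ^ s * a ^ n) * (\<integral>\<^sup>+v. tprod l \<sigma> s n r (fst v) (snd v) * f (n, v) \<partial>count_space (Vset l n)) else 0)"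
      by (simp add: case_prod_beta tprod_def nn_integral_cmult mult.assoc)
  qed
  finally show ?thesis .
qed

lemma emeasure_abel:
  fixes \<sigma> :: "'g::group_add mseq"
  assumes a: "a \<in> params" and A: "A \<subseteq> Eset l"
  shows "emeasure (abel_measure l \<sigma> s r a) A = (\<Sum>n. if s \<le> n
    then ennreal ((1 - a) / a ^ s * a ^ n) * (\<integral>\<^sup>+v. tprod l \<sigma> s n r (fst v) (snd v) * indicator A (n, v) \<partial>count_space (Vset l n)) else 0)"
  using nn_integral_abel[OF a, where f="indicator A" and l=l and \<sigma>=\<sigma> and s=s and r=r] A by simp

lemma abel_weights: "a \<in> params \<Longrightarrow> (\<Sum>n. if s \<le> n then ennreal ((1 - a) / a ^ s * a ^ n) else 0) = 1"
proof -
  assume a: "a \<in> params"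
  have "(\<Sum>n. if s \<le> n then ennreal ((1 - a) / a ^ s * a ^ n) else 0) =
      (\<Sum>n. if s \<le> n + s then ennreal ((1 - a) / a ^ s * a ^ (n + s)) else 0) + (\<Sum>n<s. if s \<le> n then ennreal ((1 - a) / a ^ s * a ^ n) else 0)"
    by (rule suminf_offset) simp
  also have "\<dots> = (\<Sum>n. ennreal ((1 - a) * a ^ n))"
    using a by (simp add: power_add)
  also have "\<dots> = ennreal (\<Sum>n. (1 - a) * a ^ n)"
    using a by (intro suminf_ennreal2 summable_mult summable_geometric) auto
  also have "(\<Sum>n. (1 - a) * a ^ n) = (1 - a) * (\<Sum>n. a ^ n)"
    using a by (intro suminf_mult summable_geometric) auto
  also have "\<dots> = 1" using a by (simp add: suminf_geometric)
  finally show ?thesis by simp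
qed

lemma prob_space_abel:
  fixes \<sigma> :: "'g::group_add mseq"
  assumes st: "stochastic_sequence l \<sigma>" and r: "r < ldim l s" and a: "a \<in> params"
  shows "prob_space (abel_measure l \<sigma> s r a)"
proof
  have "(\<integral>\<^sup>+v. tprod l \<sigma> s n r (fst v) (snd v) * indicator (Eset l) (n, v) \<partial>count_space (Vset l n)) = 1" if "s \<le> n" for n
  proof -
    have "(\<integral>\<^sup>+v. tprod l \<sigma> s n r (fst v) (snd v) * indicator (Eset l) (n, v) \<partial>count_space (Vset l n)) =
        (\<integral>\<^sup>+v. tprod l \<sigma> s n r (fst v) (snd v) \<partial>count_space (Vset l n))"
      by (intro nn_integral_cong) (auto simp: Eset_def Vset_def split: split_indicator)
    then show ?thesis using tprod_total[OF st r that] by (simp add: nn_integral_Vset)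
  qed
  then have "emeasure (abel_measure l \<sigma> s r a) (Eset l) = (\<Sum>n. if s \<le> n then ennreal ((1 - a) / a ^ s * a ^ n) else 0)"
    unfolding emeasure_abel[OF a order_refl] by (intro suminf_cong) simp
  then show "emeasure (abel_measure l \<sigma> s r a) (space (abel_measure l \<sigma> s r a)) = 1"
    by (simp add: abel_weights[OF a])
qed

lemma Eact_Eset [simp]: "Eact g e \<in> Eset l \<longleftrightarrow> e \<in> Eset l"
  by (cases e) (simp add: Eact_def Eset_def)

lemma Eact_pair: "Eact g (n, v) = (n, fst v, g + snd v)"
  by (cases v) (simp add: Eact_def)

lemma Eact_add: "Eact (g + h) e = Eact g (Eact h e)"
  by (cases e) (simp add: Eact_def add.assoc)

lemma Eact_0 [simp]: "Eact 0 e = e"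
  by (cases e) (simp add: Eact_def)

text \<open>The Abel averages are stationary up to the term of the first level, whose weight tends
  to 0.\<close>

lemma abel_stationary:
  fixes \<sigma> :: "'g::group_add mseq"
  assumes a: "a \<in> params" and A: "A \<subseteq> Eset l" and i: "i < ldim l n"
  shows "emeasure (abel_measure l \<sigma> n i a) A =
    ennreal (1 - a) * (\<integral>\<^sup>+v. \<sigma> n i (fst v) (snd v) * indicator A (n, v) \<partial>count_space (Vset l n)) +
    ennreal a * (\<integral>\<^sup>+v. \<sigma> n i (fst v) (snd v) *
      emeasure (abel_measure l \<sigma> (Suc n) (fst v) a) (Eact (snd v) -` A \<inter> Eset l) \<partial>count_space (Vset l n))"
proof -
  have a0: "0 < a" "a < 1" using a by auto
  let ?W = "\<lambda>s r m B. \<integral>\<^sup>+v. tprod l \<sigma> s m r (fst v) (snd v) * indicator B (m, v) \<partial>count_space (Vset l m)"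
  let ?B = "\<lambda>g. Eact g -` A \<inter> Eset l"
  have W: "?W n i m A = (\<integral>\<^sup>+v. \<sigma> n i (fst v) (snd v) * ?W (Suc n) (fst v) m (?B (snd v)) \<partial>count_space (Vset l n))"
    if m: "n < m" for m
  proof -
    have "(\<integral>\<^sup>+v. \<sigma> n i (fst v) (snd v) * ?W (Suc n) (fst v) m (?B (snd v)) \<partial>count_space (Vset l n)) =
      (\<Sum>j<l n. \<integral>\<^sup>+h. \<sigma> n i j h * (\<Sum>k<l m. \<integral>\<^sup>+u. tprod l \<sigma> (Suc n) m j k u * indicator A (m, k, h + u) \<partial>count_space UNIV) \<partial>count_space UNIV)"
    proof -
      have "?W (Suc n) j m (?B h) = (\<Sum>k<l m. \<integral>\<^sup>+u. tprod l \<sigma> (Suc n) m j k u * indicator A (m, k, h + u) \<partial>count_space UNIV)" for j h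
        unfolding nn_integral_Vset
        by (intro sum.cong refl nn_integral_cong) (auto simp: Eact_pair Eset_def split: split_indicator)
      then show ?thesis by (simp add: nn_integral_Vset[where l=l and n=n])
    qed
    also have "\<dots> = (\<Sum>k<l m. \<integral>\<^sup>+v. (\<Sum>j<l n. \<integral>\<^sup>+h. \<sigma> n i j h * tprod l \<sigma> (Suc n) m j k (- h + v) \<partial>count_space UNIV) *
        indicator A (m, k, v) \<partial>count_space UNIV)"
      by (rule convolution_assoc[where F="\<lambda>k v. indicator A (m, k, v)"])
    also have "\<dots> = ?W n i m A"
      by (simp add: nn_integral_Vset mconv_def tprod_split[OF order_refl m])
    finally show ?thesis ..
  qed
  have "emeasure (abel_measure l \<sigma> n i a) A = (\<Sum>m. (if m = n then ennreal (1 - a) * ?W n i n A else 0) +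
      (if Suc n \<le> m then ennreal ((1 - a) / a ^ n * a ^ m) * ?W n i m A else 0))"
    unfolding emeasure_abel[OF a A]
  proof (intro suminf_cong)
    fix m
    show "(if n \<le> m then ennreal ((1 - a) / a ^ n * a ^ m) * ?W n i m A else 0) =
        (if m = n then ennreal (1 - a) * ?W n i n A else 0) +
        (if Suc n \<le> m then ennreal ((1 - a) / a ^ n * a ^ m) * ?W n i m A else 0)"
      using a0 by (cases "m = n") auto
  qed
  also have "\<dots> = (\<Sum>m. if m = n then ennreal (1 - a) * ?W n i n A else 0) +
      (\<Sum>m. if Suc n \<le> m then ennreal ((1 - a) / a ^ n * a ^ m) * ?W n i m A else 0)"
    by (rule suminf_add[symmetric]) auto
  also have "(\<Sum>m. if m = n then ennreal (1 - a) * ?W n i n A else 0) = ennreal (1 - a) * ?W n i n A"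
    by (subst suminf_finite[of "{n}"]) auto
  also have "(\<Sum>m. if Suc n \<le> m then ennreal ((1 - a) / a ^ n * a ^ m) * ?W n i m A else 0) =
      (\<Sum>m. \<integral>\<^sup>+v. ennreal a * (\<sigma> n i (fst v) (snd v) * (if Suc n \<le> m then ennreal ((1 - a) / a ^ Suc n * a ^ m) *
        ?W (Suc n) (fst v) m (?B (snd v)) else 0)) \<partial>count_space (Vset l n))"
  proof (intro suminf_cong)
    fix m
    have e: "ennreal ((1 - a) / a ^ n * a ^ m) = ennreal a * ennreal ((1 - a) / a ^ Suc n * a ^ m)"
      using a0 by (subst ennreal_mult[symmetric]) (auto simp: field_simps)
    show "(if Suc n \<le> m then ennreal ((1 - a) / a ^ n * a ^ m) * ?W n i m A else 0) =
      (\<integral>\<^sup>+v. ennreal a * (\<sigma> n i (fst v) (snd v) * (if Suc n \<le> m then ennreal ((1 - a) / a ^ Suc n * a ^ m) *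
        ?W (Suc n) (fst v) m (?B (snd v)) else 0)) \<partial>count_space (Vset l n))"
    proof (cases "Suc n \<le> m")
      case True
      then have "(if Suc n \<le> m then ennreal ((1 - a) / a ^ n * a ^ m) * ?W n i m A else 0) =
          (ennreal a * ennreal ((1 - a) / a ^ Suc n * a ^ m)) *
          (\<integral>\<^sup>+v. \<sigma> n i (fst v) (snd v) * ?W (Suc n) (fst v) m (?B (snd v)) \<partial>count_space (Vset l n))"
        using W[of m] e by simp
      also have "\<dots> = (\<integral>\<^sup>+v. (ennreal a * ennreal ((1 - a) / a ^ Suc n * a ^ m)) *
          (\<sigma> n i (fst v) (snd v) * ?W (Suc n) (fst v) m (?B (snd v))) \<partial>count_space (Vset l n))"
        by (rule nn_integral_cmult[symmetric]) simp
      finally show ?thesis using True by (simp add: ac_simps)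
    qed simp
  qed
  also have "\<dots> = (\<integral>\<^sup>+v. (\<Sum>m. ennreal a * (\<sigma> n i (fst v) (snd v) * (if Suc n \<le> m then ennreal ((1 - a) / a ^ Suc n * a ^ m) *
        ?W (Suc n) (fst v) m (?B (snd v)) else 0))) \<partial>count_space (Vset l n))"
    by (rule nn_integral_suminf[symmetric]) simp
  also have "\<dots> = (\<integral>\<^sup>+v. ennreal a * (\<sigma> n i (fst v) (snd v) *
      emeasure (abel_measure l \<sigma> (Suc n) (fst v) a) (?B (snd v))) \<partial>count_space (Vset l n))"
    by (intro nn_integral_cong) (simp add: emeasure_abel[OF a] ennreal_suminf_cmult)
  also have "\<dots> = ennreal a * (\<integral>\<^sup>+v. \<sigma> n i (fst v) (snd v) *
      emeasure (abel_measure l \<sigma> (Suc n) (fst v) a) (?B (snd v)) \<partial>count_space (Vset l n))"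
    by (rule nn_integral_cmult) simp
  finally show ?thesis by simp
qed

text \<open>Bounded convergence along any filter, for a probability measure on a countable set.\<close>

lemma tendsto_integral_countable:
  fixes u :: "'a \<Rightarrow> 'v \<Rightarrow> real"
  assumes Q: "prob_space Q" and sets: "sets Q = Pow V" and V: "countable V"
    and bd: "eventually (\<lambda>a. \<forall>v\<in>V. \<bar>u a v\<bar> \<le> 1) F" and bd': "\<And>v. v \<in> V \<Longrightarrow> \<bar>u' v\<bar> \<le> 1"
    and lim: "\<And>v. v \<in> V \<Longrightarrow> ((\<lambda>a. u a v) \<longlongrightarrow> u' v) F"
  shows "((\<lambda>a. \<integral>v. u a v \<partial>Q) \<longlongrightarrow> (\<integral>v. u' v \<partial>Q)) F"
proof -
  interpret Q: prob_space Q by (rule Q)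
  have sQ: "sets Q = sets (count_space V)" using sets by simp
  have space: "space Q = V" using sets_eq_imp_space_eq[OF sQ] by simp
  have meas: "f \<in> borel_measurable Q" for f :: "'v \<Rightarrow> real" by (simp add: measurable_cong_sets[OF sQ refl])
  have int: "integrable Q f" if "\<And>v. v \<in> V \<Longrightarrow> \<bar>f v\<bar> \<le> B" for f :: "'v \<Rightarrow> real" and B
    by (rule Q.integrable_const_bound[where B=B]) (use that meas in \<open>auto simp: space\<close>)
  have Vne: "V \<noteq> {}" using Q.not_empty space by simp
  show ?thesis
  proof (rule tendstoI)
    fix e :: real assume e: "0 < e"
    define S where "S k = from_nat_into V ` {..k}" for k :: nat
    have SV: "S k \<subseteq> V" for k unfolding S_def using from_nat_into[OF Vne] by blast
    have "incseq S" unfolding incseq_def S_def by (intro allI impI image_mono) auto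
    moreover have "(\<Union>k. S k) = V"
    proof
      show "V \<subseteq> (\<Union>k. S k)"
      proof
        fix v assume "v \<in> V"
        then obtain k where "from_nat_into V k = v" using from_nat_into_surj[OF V] by blast
        then show "v \<in> (\<Union>k. S k)" unfolding S_def by blast
      qed
    qed (use SV in blast)
    ultimately have "(\<lambda>k. Q.prob (S k)) \<longlonglongrightarrow> Q.prob V"
      using Q.finite_Lim_measure_incseq[of S] SV sets by auto
    then have "(\<lambda>k. Q.prob (S k)) \<longlonglongrightarrow> 1" using Q.prob_space space by simp
    then have "eventually (\<lambda>k. 1 - e / 6 < Q.prob (S k)) sequentially"
      using e by (intro order_tendstoD(1)) auto
    then obtain k where k: "1 - e / 6 < Q.prob (S k)" by (auto simp: eventually_sequentially)
    have fin: "finite (S k)" by (simp add: S_def)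
    have Sset: "S k \<in> sets Q" using SV sets by blast
    have rest: "Q.prob (V - S k) < e / 6"
      using Q.prob_compl[OF Sset] k space by simp
    have "eventually (\<lambda>a. \<forall>v\<in>S k. dist (u a v) (u' v) < e / 3) F"
      using fin by (intro eventually_ball_finite ballI tendstoD[OF lim]) (use SV e in auto)
    then show "eventually (\<lambda>a. dist (\<integral>v. u a v \<partial>Q) (\<integral>v. u' v \<partial>Q) < e) F"
      using bd
    proof eventually_elim
      case (elim a)
      have iu: "integrable Q (u a)" by (rule int) (use elim(2) in auto)
      have iu': "integrable Q u'" by (rule int) (rule bd')
      have iI: "integrable Q (indicator (V - S k) :: 'v \<Rightarrow> real)"
        by (rule int[of "indicator (V - S k)" 1]) (auto split: split_indicator)
      have ii: "integrable Q (\<lambda>v. e / 3 + 2 * indicator (V - S k) v)"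
        by (intro Bochner_Integration.integrable_add integrable_mult_right iI) simp
      have "\<bar>(\<integral>v. u a v \<partial>Q) - (\<integral>v. u' v \<partial>Q)\<bar> = \<bar>\<integral>v. u a v - u' v \<partial>Q\<bar>" using iu iu' by simp
      also have "\<dots> \<le> (\<integral>v. \<bar>u a v - u' v\<bar> \<partial>Q)" by (rule integral_abs_bound)
      also have "\<dots> \<le> (\<integral>v. e / 3 + 2 * indicator (V - S k) v \<partial>Q)"
      proof (rule integral_mono[OF _ ii])
        fix v assume "v \<in> space Q"
        then have v: "v \<in> V" by (simp add: space)
        show "\<bar>u a v - u' v\<bar> \<le> e / 3 + 2 * indicator (V - S k) v"
        proof (cases "v \<in> S k")
          case True
          then show ?thesis using elim(1) by (auto simp: dist_real_def intro: less_imp_le)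
        next
          case False
          have "\<bar>u a v\<bar> \<le> 1" "\<bar>u' v\<bar> \<le> 1" using elim(2) bd' v by auto
          then show ?thesis using False v e by simp
        qed
      qed (use iu iu' in auto)
      also have "\<dots> = e / 3 + 2 * Q.prob (V - S k)"
      proof -
        have "V - S k \<in> sets Q" using sets by blast
        then show ?thesis
          using iI by (subst Bochner_Integration.integral_add) (auto simp: Q.prob_space)
      qed
      also have "\<dots> < e" using rest e by simp
      finally show "dist (\<integral>v. u a v \<partial>Q) (\<integral>v. u' v \<partial>Q) < e" by (simp add: dist_real_def)
    qed
  qed
qed

text \<open>The setting of the theorem, without the assumptions on the support of the measures.\<close>

locale ul_sys =
  fixes U :: "real filter" and l :: "nat \<Rightarrow> nat" and \<sigma> :: "'g::{group_add,countable} mseq"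
  assumes st: "stochastic_sequence l \<sigma>"
    and U_ultra: "ultrafilter U"
    and U_params: "eventually (\<lambda>a. a \<in> params) U"
    and U_tendsto: "((\<lambda>a. a) \<longlongrightarrow> 1) U"
begin

sublocale ul U "Eset l :: (nat \<times> nat \<times> 'g) set"
proof
  have "(0, 0, 0) \<in> (Eset l :: (nat \<times> nat \<times> 'g) set)"
    using stochastic_sequenceD(1)[OF st] by (simp add: Eset_def)
  then show "(Eset l :: (nat \<times> nat \<times> 'g) set) \<noteq> {}" by blast
qed (rule U_ultra U_params U_tendsto)+

abbreviation "X \<equiv> ul_system U l \<sigma>"

text \<open>The action on families of points.\<close>

abbreviation "move g (x :: real \<Rightarrow> nat \<times> nat \<times> 'g) \<equiv> (\<lambda>a\<in>params. Eact g (x a))"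

lemma nu_X: "nu X s r = ul_measure U (Eset l) (abel_measure l \<sigma> s r)"
  by (simp add: ul_system_def)

lemma ul_prob_abel:
  assumes r: "r < ldim l s"
  shows "ul_prob U (Eset l) (abel_measure l \<sigma> s r)"
proof (rule ul_prob.intro[OF ul_axioms], rule ul_prob_axioms.intro)
  fix a :: real assume a: "a \<in> params"
  show "prob_space (abel_measure l \<sigma> s r a)" by (rule prob_space_abel[OF st r a])
qed (rule sets_abel)

lemma move_fam: "x \<in> fam \<Longrightarrow> move g x \<in> fam"
  by (auto simp: PiE_iff)

lemma act_cls:
  assumes x: "x \<in> fam"
  shows "act X g (cls x) = cls (move g x)"
proof (rule set_eqI)
  fix z
  have "z \<in> act X g (cls x) \<longleftrightarrow> (\<exists>y\<in>cls x. move g y \<in> fam \<and> z \<in> fam \<and> eventually (\<lambda>a. move g y a = z a) U)"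
    by (auto simp: ul_system_def ul_eq_def)
  also have "\<dots> \<longleftrightarrow> z \<in> fam \<and> eventually (\<lambda>a. move g x a = z a) U"
  proof
    assume "\<exists>y\<in>cls x. move g y \<in> fam \<and> z \<in> fam \<and> eventually (\<lambda>a. move g y a = z a) U"
    then obtain y where y: "y \<in> cls x" "z \<in> fam" "eventually (\<lambda>a. move g y a = z a) U" by blast
    have "eventually (\<lambda>a. x a = y a) U" using y(1) x by (simp add: mem_cls)
    with y(3) have "eventually (\<lambda>a. move g x a = z a) U" by eventually_elim (auto simp: restrict_def split: if_splits)
    then show "z \<in> fam \<and> eventually (\<lambda>a. move g x a = z a) U" using y(2) by simp
  next
    assume "z \<in> fam \<and> eventually (\<lambda>a. move g x a = z a) U"
    then show "\<exists>y\<in>cls x. move g y \<in> fam \<and> z \<in> fam \<and> eventually (\<lambda>a. move g y a = z a) U"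
      by (intro bexI[of _ x] conjI move_fam[OF x] cls_self[OF x]) (erule conjunct1, erule conjunct2)
  qed
  also have "\<dots> \<longleftrightarrow> z \<in> cls (move g x)" by (simp only: mem_cls[OF move_fam[OF x]])
  finally show "z \<in> act X g (cls x) \<longleftrightarrow> z \<in> cls (move g x)" .
qed

lemma act_points: "c \<in> ul_points U (Eset l) \<Longrightarrow> act X g c \<in> ul_points U (Eset l)"
  by (metis act_cls cls_points move_fam pointsE)

lemma act_vimage:
  "act X g -` ul_set U (Eset l) A \<inter> ul_points U (Eset l) = ul_set U (Eset l) (\<lambda>a. Eact g -` A a \<inter> Eset l)"
proof (rule ul_set_eqI)
  fix x assume x: "x \<in> fam"
  have "eventually (\<lambda>a. move g x a \<in> A a) U \<longleftrightarrow> eventually (\<lambda>a. x a \<in> Eact g -` A a \<inter> Eset l) U"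
  proof (rule eventually_cong[OF ev_params])
    show "move g x a \<in> A a \<longleftrightarrow> x a \<in> Eact g -` A a \<inter> Eset l" if "a \<in> params" for a
      using that x by (auto simp: PiE_iff)
  qed
  then show "cls x \<in> act X g -` ul_set U (Eset l) A \<inter> ul_points U (Eset l) \<longleftrightarrow>
      eventually (\<lambda>a. x a \<in> Eact g -` A a \<inter> Eset l) U"
    using x cls_mem_ul_set[OF move_fam[OF x]] by (simp add: act_cls cls_points)
qed auto

lemma space_X: "space (nu X s r) = ul_points U (Eset l)"
  by (simp add: nu_X space_ul_measure)

lemma sets_X: "sets (nu X s r) = sigma_sets (ul_points U (Eset l)) (ul_set U (Eset l) ` internal)"
  by (simp add: nu_X sets_ul_measure)

lemma measurable_act: "act X g \<in> base X \<rightarrow>\<^sub>M base X"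
proof (rule measurable_sigma_sets[OF sets_X ul_generator_sub])
  show "act X g \<in> space (base X) \<rightarrow> ul_points U (Eset l)" using act_points by (auto simp: space_X)
  fix S assume "S \<in> ul_set U (Eset l) ` internal"
  then obtain A where A: "S = ul_set U (Eset l) A" by blast
  have "act X g -` S \<inter> space (base X) = ul_set U (Eset l) (\<lambda>a. Eact g -` A a \<inter> Eset l)"
    unfolding A space_X by (rule act_vimage)
  also have "\<dots> \<in> sets (base X)" unfolding nu_X by (rule ul_set_sets) auto
  finally show "act X g -` S \<inter> space (base X) \<in> sets (base X)" .
qed

lemma measurable_act_nu: "act X g \<in> nu X s r \<rightarrow>\<^sub>M base X"
  using measurable_act[of g] measurable_cong_sets[of "nu X s r" "base X" "base X" "base X"] by (simp add: sets_X)

lemma emeasure_translate_ul: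
  assumes A: "A \<in> internal"
  shows "emeasure (translate X g (nu X s r)) (ul_set U (Eset l) A) =
    emeasure (nu X s r) (ul_set U (Eset l) (\<lambda>a. Eact g -` A a \<inter> Eset l))"
  unfolding translate_def
  by (subst emeasure_distr[OF measurable_act_nu])
     (use A ul_set_sets in \<open>auto simp: nu_X space_ul_measure act_vimage\<close>)

text \<open>A measure on the ultralimit is determined by its values on internal sets.\<close>

lemma ul_measure_eqI:
  assumes "sets M = sets (base X)" "sets N = sets (base X)" "finite_measure M"
    and "\<And>A. A \<in> internal \<Longrightarrow> emeasure M (ul_set U (Eset l) A) = emeasure N (ul_set U (Eset l) A)"
  shows "M = N"
proof (rule measure_eqI_generator_eq[OF ul_Int_stable ul_generator_sub, where A="\<lambda>_. ul_points U (Eset l)"])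
  show "range (\<lambda>_. ul_points U (Eset l)) \<subseteq> ul_set U (Eset l) ` internal"
    using ul_set_full by (auto intro!: image_eqI[where x="\<lambda>a. Eset l"])
  show "emeasure M (ul_points U (Eset l)) \<noteq> \<infinity>"
    using assms(3) by (simp add: finite_measure.emeasure_eq_measure)
qed (use assms in \<open>auto simp: sets_X\<close>)

text \<open>Both sides of stationarity are probability measures, so it is enough to compare internal
  sets. There it is the limit of the recursion for Abel averages; the limit passes
  through the sum over the group by bounded convergence.\<close>

lemma ul_stationary:
  assumes i: "i < ldim l n" and S: "S \<in> sets (base X)"
  shows "emeasure (nu X n i) S = (\<Sum>j<l n. \<integral>\<^sup>+g. \<sigma> n i j g * emeasure (translate X g (nu X (Suc n) j)) S \<partial>count_space UNIV)"
proof -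
  let ?V = "Vset l n :: (nat \<times> 'g) set"
  define Q where "Q = density (count_space ?V) (\<lambda>v. \<sigma> n i (fst v) (snd v))"
  define N where "N v = translate X (snd v) (nu X (Suc n) (fst v))" for v :: "nat \<times> 'g"
  have Qint: "(\<integral>\<^sup>+v. f v \<partial>Q) = (\<integral>\<^sup>+v. \<sigma> n i (fst v) (snd v) * f v \<partial>count_space ?V)" for f
    unfolding Q_def by (rule nn_integral_density) simp_all
  have sQ: "sets Q = Pow ?V" and spQ: "space Q = ?V" by (simp_all add: Q_def)
  have Q: "prob_space Q"
  proof
    have "emeasure Q (space Q) = (\<integral>\<^sup>+v. 1 \<partial>Q)" by simp
    also have "\<dots> = (\<Sum>j<l n. \<integral>\<^sup>+h. \<sigma> n i j h * 1 \<partial>count_space UNIV)"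
      by (simp only: Qint nn_integral_Vset fst_conv snd_conv)
    also have "\<dots> = 1" using stochastic_sequenceD(2)[OF st i] by simp
    finally show "emeasure Q (space Q) = 1" .
  qed
  interpret Q: prob_space Q by (rule Q)
  have mQ: "f \<in> Q \<rightarrow>\<^sub>M K \<longleftrightarrow> f \<in> ?V \<rightarrow> space K" for f :: "nat \<times> 'g \<Rightarrow> 'z" and K
    using measurable_cong_sets[of Q "count_space ?V" K K] by (simp add: sQ)
  have sN: "sets (N v) = sets (base X)" for v by (simp add: N_def)
  have pX: "prob_space (nu X s r)" if "r < ldim l s" for s r
    unfolding nu_X using ul_prob.prob_space_ul[OF ul_prob_abel[OF that]] .
  have pN: "prob_space (N v)" if "v \<in> ?V" for v
    unfolding N_def translate_def
    by (rule prob_space.prob_space_distr[OF pX measurable_act_nu]) (use that in \<open>auto simp: Vset_def\<close>)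
  have N_meas: "N \<in> Q \<rightarrow>\<^sub>M subprob_algebra (base X)"
    unfolding mQ using pN sN by (auto simp: space_subprob_algebra intro: prob_space_imp_subprob_space)
  have bindN: "emeasure (Q \<bind> N) T = (\<integral>\<^sup>+v. emeasure (N v) T \<partial>Q)" if "T \<in> sets (base X)" for T
    by (rule emeasure_bind[OF Q.not_empty N_meas that])
  have "nu X n i = Q \<bind> N"
  proof (rule ul_measure_eqI)
    show "sets (nu X n i) = sets (base X)" by (simp add: sets_X)
    show "sets (Q \<bind> N) = sets (base X)" by (rule sets_bind[OF sN Q.not_empty])
    show "finite_measure (nu X n i)" using pX[OF i] by (rule prob_space.finite_measure)
    fix A :: "real \<Rightarrow> (nat \<times> nat \<times> 'g) set" assume A: "A \<in> internal"
    let ?B = "\<lambda>g a. Eact g -` A a \<inter> Eset l"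
    define u where "u a v = measure (abel_measure l \<sigma> (Suc n) (fst v) a) (?B (snd v) a)" for a v
    define u' where "u' v = measure (nu X (Suc n) (fst v)) (ul_set U (Eset l) (?B (snd v)))" for v
    have AS: "ul_set U (Eset l) A \<in> sets (base X)" unfolding nu_X using A by (rule ul_set_sets)
    have u_bd: "\<bar>u a v\<bar> \<le> 1" if "a \<in> params" "v \<in> ?V" for a v
      unfolding u_def using prob_space.prob_le_1[OF prob_space_abel[OF st _ that(1), of "fst v" "Suc n"]] that(2)
      by (auto simp: Vset_def)
    have u'_bd: "\<bar>u' v\<bar> \<le> 1" if "v \<in> ?V" for v
      unfolding u'_def using prob_space.prob_le_1[OF pX[of "fst v" "Suc n"]] that by (auto simp: Vset_def)
    have lim_u: "((\<lambda>a. u a v) \<longlongrightarrow> u' v) U" if "v \<in> ?V" for v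
      unfolding u_def u'_def nu_X
      by (rule ul_prob.measure_ul_tendsto[OF ul_prob_abel]) (use that in \<open>auto simp: Vset_def\<close>)
    have lim1: "((\<lambda>a. \<integral>v. u a v \<partial>Q) \<longlongrightarrow> (\<integral>v. u' v \<partial>Q)) U"
    proof (rule tendsto_integral_countable[OF Q sQ])
      show "eventually (\<lambda>a. \<forall>v\<in>?V. \<bar>u a v\<bar> \<le> 1) U"
        using ev_params by eventually_elim (use u_bd in blast)
    qed (use u'_bd lim_u in auto)
    define c where "c a = measure Q {v\<in>?V. (n, v) \<in> A a}" for a
    have avg: "measure (abel_measure l \<sigma> n i a) (A a) = (1 - a) * c a + a * (\<integral>v. u a v \<partial>Q)" if a: "a \<in> params" for a
    proof -
      interpret Ab: prob_space "abel_measure l \<sigma> n i a" by (rule prob_space_abel[OF st i a])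
      have "(\<integral>\<^sup>+v. \<sigma> n i (fst v) (snd v) * indicator (A a) (n, v) \<partial>count_space ?V) = (\<integral>\<^sup>+v. indicator {v\<in>?V. (n, v) \<in> A a} v \<partial>Q)"
        unfolding Qint by (intro nn_integral_cong) (auto split: split_indicator)
      also have "\<dots> = ennreal (c a)"
        unfolding c_def by (subst nn_integral_indicator) (auto simp: sQ Q.emeasure_eq_measure)
      finally have 1: "(\<integral>\<^sup>+v. \<sigma> n i (fst v) (snd v) * indicator (A a) (n, v) \<partial>count_space ?V) = ennreal (c a)" .
      have "(\<integral>\<^sup>+v. \<sigma> n i (fst v) (snd v) * emeasure (abel_measure l \<sigma> (Suc n) (fst v) a) (?B (snd v) a) \<partial>count_space ?V) =
          (\<integral>\<^sup>+v. ennreal (u a v) \<partial>Q)"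
        unfolding Qint
      proof (rule nn_integral_cong)
        fix v assume "v \<in> space (count_space ?V)"
        then have "fst v < ldim l (Suc n)" by (auto simp: Vset_def)
        then interpret Av: prob_space "abel_measure l \<sigma> (Suc n) (fst v) a" by (rule prob_space_abel[OF st _ a])
        show "\<sigma> n i (fst v) (snd v) * emeasure (abel_measure l \<sigma> (Suc n) (fst v) a) (?B (snd v) a) =
            \<sigma> n i (fst v) (snd v) * ennreal (u a v)"
          by (simp add: u_def Av.emeasure_eq_measure)
      qed
      also have "\<dots> = ennreal (\<integral>v. u a v \<partial>Q)"
      proof (rule nn_integral_eq_integral)
        show "integrable Q (u a)"
          by (rule Q.integrable_const_bound[where B=1]) (use u_bd[OF a] in \<open>auto simp: spQ mQ\<close>)
      qed (simp add: u_def)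
      finally have 2: "(\<integral>\<^sup>+v. \<sigma> n i (fst v) (snd v) * emeasure (abel_measure l \<sigma> (Suc n) (fst v) a) (?B (snd v) a) \<partial>count_space ?V) =
          ennreal (\<integral>v. u a v \<partial>Q)" .
      have u0: "0 \<le> (\<integral>v. u a v \<partial>Q)" by (simp add: u_def)
      have "ennreal (measure (abel_measure l \<sigma> n i a) (A a)) = ennreal (1 - a) * ennreal (c a) + ennreal a * ennreal (\<integral>v. u a v \<partial>Q)"
        using abel_stationary[OF a _ i, where A="A a" and \<sigma>=\<sigma>] A 1 2 by (simp add: Ab.emeasure_eq_measure)
      also have "\<dots> = ennreal ((1 - a) * c a + a * (\<integral>v. u a v \<partial>Q))"
        using a u0 by (simp add: ennreal_mult[symmetric] ennreal_plus[symmetric] c_def del: ennreal_plus)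
      finally show ?thesis
        using a u0 by (subst (asm) ennreal_inj) (auto simp: c_def)
    qed
    have "((\<lambda>a. (1 - a) * c a) \<longlongrightarrow> 0) U"
    proof (rule tendsto_sandwich[where f="\<lambda>_. 0" and h="\<lambda>a. 1 - a"])
      show "eventually (\<lambda>a. 0 \<le> (1 - a) * c a) U"
        using ev_params by eventually_elim (simp add: c_def)
      show "eventually (\<lambda>a. (1 - a) * c a \<le> 1 - a) U"
        using ev_params by eventually_elim (simp add: c_def mult_left_le)
      show "((\<lambda>a. 1 - a) \<longlongrightarrow> 0) U" using tendsto_diff[OF tendsto_const tendsto_1, of 1] by simp
    qed simp
    then have "((\<lambda>a. (1 - a) * c a + a * (\<integral>v. u a v \<partial>Q)) \<longlongrightarrow> 0 + 1 * (\<integral>v. u' v \<partial>Q)) U"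
      by (intro tendsto_add tendsto_mult tendsto_1 lim1)
    moreover have "eventually (\<lambda>a. (1 - a) * c a + a * (\<integral>v. u a v \<partial>Q) = measure (abel_measure l \<sigma> n i a) (A a)) U"
      using ev_params by eventually_elim (simp add: avg)
    ultimately have "((\<lambda>a. measure (abel_measure l \<sigma> n i a) (A a)) \<longlongrightarrow> 0 + 1 * (\<integral>v. u' v \<partial>Q)) U"
      by (rule Lim_transform_eventually)
    moreover have "((\<lambda>a. measure (abel_measure l \<sigma> n i a) (A a)) \<longlongrightarrow> measure (nu X n i) (ul_set U (Eset l) A)) U"
      unfolding nu_X by (rule ul_prob.measure_ul_tendsto[OF ul_prob_abel[OF i] A])
    ultimately have eq: "measure (nu X n i) (ul_set U (Eset l) A) = (\<integral>v. u' v \<partial>Q)"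
      using tendsto_unique[OF U_bot] by fastforce
    have "emeasure (Q \<bind> N) (ul_set U (Eset l) A) = (\<integral>\<^sup>+v. ennreal (u' v) \<partial>Q)"
      unfolding bindN[OF AS]
    proof (rule nn_integral_cong)
      fix v assume "v \<in> space Q"
      then have "fst v < ldim l (Suc n)" by (auto simp: Vset_def spQ)
      then interpret Av: prob_space "nu X (Suc n) (fst v)" by (rule pX)
      show "emeasure (N v) (ul_set U (Eset l) A) = ennreal (u' v)"
        unfolding N_def emeasure_translate_ul[OF A] u'_def by (rule Av.emeasure_eq_measure)
    qed
    also have "\<dots> = ennreal (\<integral>v. u' v \<partial>Q)"
    proof (rule nn_integral_eq_integral)
      show "integrable Q u'"
        by (rule Q.integrable_const_bound[where B=1]) (use u'_bd in \<open>auto simp: spQ mQ\<close>)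
    qed (simp add: u'_def)
    finally show "emeasure (nu X n i) (ul_set U (Eset l) A) = emeasure (Q \<bind> N) (ul_set U (Eset l) A)"
      using eq finite_measure.emeasure_eq_measure[OF prob_space.finite_measure[OF pX[OF i]]] by simp
  qed
  then show ?thesis
    using bindN[OF S] by (simp add: Qint nn_integral_Vset N_def)
qed

theorem sigma_system_ul: "sigma_system l \<sigma> X"
  unfolding sigma_system_def
proof (intro conjI allI impI ballI)
  fix s j assume j: "j < ldim l s"
  show "prob_space (nu X s j)"
    unfolding nu_X using ul_prob.prob_space_ul[OF ul_prob_abel[OF j]] .
  show "sets (nu X s j) = sets (base X)" by (simp add: sets_X)
next
  show "act X g \<in> base X \<rightarrow>\<^sub>M base X" for g by (rule measurable_act)
  show "act X 0 c = c" if c: "c \<in> space (base X)" for c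
  proof -
    obtain x where x: "x \<in> fam" "c = cls x" using c[unfolded space_X] by (rule pointsE)
    have "move 0 x = x" using x(1) by (auto simp: fun_eq_iff PiE_iff extensional_def)
    then show ?thesis using x by (simp add: act_cls)
  qed
  show "act X (g + h) c = act X g (act X h c)" if c: "c \<in> space (base X)" for g h c
  proof -
    obtain x where x: "x \<in> fam" "c = cls x" using c[unfolded space_X] by (rule pointsE)
    have "move (g + h) x = move g (move h x)" by (auto simp: fun_eq_iff Eact_add)
    then show ?thesis
      by (simp only: x(2) act_cls[OF x(1)] act_cls[OF move_fam[OF x(1)]])
  qed
qed (rule ul_stationary)

text \<open>The density of a translated measure of a positive level is the ultralimit of the ratios of
  transition probabilities.\<close>

text \<open>The ratio at a point of the underlying set, as a family of functions that does not depend on the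
  parameter.\<close>

abbreviation ratio :: "'g \<Rightarrow> nat \<Rightarrow> nat \<Rightarrow> real \<Rightarrow> nat \<times> nat \<times> 'g \<Rightarrow> real" where
  "ratio g s i a e \<equiv> martin l \<sigma> g s i (fst e) (snd e)"

lemma abel_density:
  assumes sp: "spread l \<sigma>" and a: "a \<in> params" and i: "i < ldim l s" and A: "A \<subseteq> Eset l"
  shows "emeasure (abel_measure l \<sigma> s i a) (Eact g -` A \<inter> Eset l) =
    ennreal (1 / a ^ s) * (\<integral>\<^sup>+e. ennreal (ratio g s i a e) * indicator A e \<partial>abel_measure l \<sigma> 0 0 a)"
proof -
  have a0: "0 < a" "a < 1" using a by auto
  let ?B = "Eact g -` A \<inter> Eset l"
  have W: "(\<integral>\<^sup>+v. tprod l \<sigma> s n i (fst v) (snd v) * indicator ?B (n, v) \<partial>count_space (Vset l n)) =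
      (\<integral>\<^sup>+v. tprod l \<sigma> 0 n 0 (fst v) (snd v) * (ennreal (martin l \<sigma> g s i n v) * indicator A (n, v)) \<partial>count_space (Vset l n))"
    if n: "s \<le> n" for n
  proof -
    have "(\<integral>\<^sup>+v. tprod l \<sigma> s n i (fst v) (snd v) * indicator ?B (n, v) \<partial>count_space (Vset l n)) =
        (\<integral>\<^sup>+v. tprod l \<sigma> s n i (fst v) (- g + (g + snd v)) * indicator A (n, fst v, g + snd v) \<partial>count_space (Vset l n))"
      by (intro nn_integral_cong) (auto simp: Eact_pair Eset_def Vset_def add.assoc[symmetric] split: split_indicator)
    also have "\<dots> = (\<integral>\<^sup>+v. tprod l \<sigma> s n i (fst v) (- g + snd v) * indicator A (n, v) \<partial>count_space (Vset l n))"
      using nn_integral_Vset_translate[where f="\<lambda>v. tprod l \<sigma> s n i (fst v) (- g + snd v) * indicator A (n, v)" and g=g and l=l and n=n] by simp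
    also have "\<dots> = (\<integral>\<^sup>+v. tprod l \<sigma> 0 n 0 (fst v) (snd v) * (ennreal (martin l \<sigma> g s i n v) * indicator A (n, v)) \<partial>count_space (Vset l n))"
    proof (rule nn_integral_cong)
      fix v assume "v \<in> space (count_space (Vset l n :: (nat \<times> 'g) set))"
      then have "v \<in> Vset l n" by simp
      from martin_mult[OF st sp i n this, of g]
      show "tprod l \<sigma> s n i (fst v) (- g + snd v) * indicator A (n, v) =
          tprod l \<sigma> 0 n 0 (fst v) (snd v) * (ennreal (martin l \<sigma> g s i n v) * indicator A (n, v))"
        by (simp add: mult.assoc[symmetric] mult.commute[of "tprod l \<sigma> 0 n 0 (fst v) (snd v)"])
    qed
    finally show ?thesis .
  qed
  have "emeasure (abel_measure l \<sigma> s i a) ?B = (\<Sum>n. if s \<le> n then ennreal ((1 - a) / a ^ s * a ^ n) *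
      (\<integral>\<^sup>+v. tprod l \<sigma> s n i (fst v) (snd v) * indicator ?B (n, v) \<partial>count_space (Vset l n)) else 0)"
    by (rule emeasure_abel[OF a]) simp
  also have "\<dots> = (\<Sum>n. ennreal (1 / a ^ s) * (ennreal ((1 - a) * a ^ n) *
      (\<integral>\<^sup>+v. tprod l \<sigma> 0 n 0 (fst v) (snd v) * (ennreal (martin l \<sigma> g s i n v) * indicator A (n, v)) \<partial>count_space (Vset l n))))"
  proof (intro suminf_cong)
    fix n
    show "(if s \<le> n then ennreal ((1 - a) / a ^ s * a ^ n) *
      (\<integral>\<^sup>+v. tprod l \<sigma> s n i (fst v) (snd v) * indicator ?B (n, v) \<partial>count_space (Vset l n)) else 0) =
      ennreal (1 / a ^ s) * (ennreal ((1 - a) * a ^ n) *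
      (\<integral>\<^sup>+v. tprod l \<sigma> 0 n 0 (fst v) (snd v) * (ennreal (martin l \<sigma> g s i n v) * indicator A (n, v)) \<partial>count_space (Vset l n)))"
    proof (cases "s \<le> n")
      case True
      have "ennreal ((1 - a) / a ^ s * a ^ n) = ennreal (1 / a ^ s) * ennreal ((1 - a) * a ^ n)"
        using a0 by (subst ennreal_mult[symmetric]) auto
      then show ?thesis using True W[OF True] by (simp only: if_True mult.assoc)
    next
      case False
      then show ?thesis by (simp add: martin_def)
    qed
  qed
  also have "\<dots> = ennreal (1 / a ^ s) * (\<integral>\<^sup>+e. ennreal (ratio g s i a e) * indicator A e \<partial>abel_measure l \<sigma> 0 0 a)"
    by (simp add: nn_integral_abel[OF a])
  finally show ?thesis .
qed

lemma rn_ul: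
  assumes sp: "spread l \<sigma>" and i: "i < l s"
  shows "AE c in base X. enn2real (rn X g (Suc s) i c) = ul_fun U (ratio g (Suc s) i) c"
proof -
  have i': "i < ldim l (Suc s)" using i by simp
  obtain C where C: "C \<ge> 0" "\<And>n v. v \<in> Vset l n \<Longrightarrow> martin l \<sigma> g (Suc s) i n v \<le> C"
    using martin_bounded[OF st sp i, of g] by blast
  have k: "0 \<le> ratio g (Suc s) i a e \<and> ratio g (Suc s) i a e \<le> C" if "e \<in> Eset l" for a e
    using that C(2)[of "snd e" "fst e"] martin_nonneg[OF st sp] by (auto simp: Eset_def Vset_def)
  interpret P0: ul_prob U "Eset l" "abel_measure l \<sigma> 0 0" by (rule ul_prob_abel) simp
  interpret Ps: ul_prob U "Eset l" "abel_measure l \<sigma> (Suc s) i" by (rule ul_prob_abel[OF i'])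
  interpret B: prob_space "base X" by (rule sys_prob_base[OF sigma_system_ul])
  let ?F = "ul_fun U (ratio g (Suc s) i)"
  have F_meas: "?F \<in> borel_measurable (base X)"
    unfolding nu_X by (rule measurable_ul_fun[where C=C]) (use k in blast)
  have F_range: "0 \<le> ?F c" "?F c \<le> C" if "c \<in> space (base X)" for c
    using ul_fun_range[of "ratio g (Suc s) i" C c] k that by (auto simp: space_X)
  have "translate X g (nu X (Suc s) i) = density (base X) (\<lambda>c. ennreal (?F c))"
  proof (rule ul_measure_eqI)
    show "finite_measure (translate X g (nu X (Suc s) i))"
      by (rule prob_space.finite_measure[OF prob_space_translate[OF sigma_system_ul sys_prob[OF sigma_system_ul i'] sys_sets[OF sigma_system_ul i']]])
    fix A :: "real \<Rightarrow> (nat \<times> nat \<times> 'g) set" assume A: "A \<in> internal"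
    let ?S = "ul_set U (Eset l) A" and ?B = "\<lambda>a. Eact g -` A a \<inter> Eset l"
    let ?k = "\<lambda>a e. ratio g (Suc s) i a e * indicator (A a) e"
    have S: "?S \<in> sets (base X)" unfolding nu_X using A by (rule ul_set_sets)
    have k': "0 \<le> ?k a e \<and> ?k a e \<le> C" if "e \<in> Eset l" for a e
      using k[OF that] C(1) by (auto split: split_indicator)
    have int: "((\<lambda>a. \<integral>e. ?k a e \<partial>abel_measure l \<sigma> 0 0 a) \<longlongrightarrow> (\<integral>c. ul_fun U ?k c \<partial>base X)) U"
      unfolding nu_X by (rule P0.ul_integral_tendsto[where C=C]) (use k' in blast)
    have Fk: "ul_fun U ?k c = ?F c * indicator ?S c" if "c \<in> space (base X)" for c
    proof -
      obtain x where x: "x \<in> fam" "c = cls x" using \<open>c \<in> space (base X)\<close>[unfolded space_X] by (rule pointsE)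
      have xE: "x a \<in> Eset l" if "a \<in> params" for a using x(1) that by auto
      have t: "((\<lambda>a. ratio g (Suc s) i a (x a)) \<longlongrightarrow> ?F c) U"
        unfolding x(2) by (rule ul_fun_cls[where C=C, OF _ x(1)]) (use k in fastforce)
      have t': "((\<lambda>a. ?k a (x a)) \<longlongrightarrow> ul_fun U ?k c) U"
        unfolding x(2) by (rule ul_fun_cls[where C=C, OF _ x(1)]) (use k' in fastforce)
      have "eventually (\<lambda>a. ratio g (Suc s) i a (x a) * indicator ?S c = ?k a (x a)) U"
      proof (cases "c \<in> ?S")
        case True
        then have "eventually (\<lambda>a. x a \<in> A a) U" unfolding x(2) by (rule cls_mem_ul_set[OF x(1), THEN iffD1])
        then show ?thesis by eventually_elim (use True in simp)
      next
        case False
        then have "\<not> eventually (\<lambda>a. x a \<in> A a) U" unfolding x(2) using cls_mem_ul_set[OF x(1), of A] by blast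
        then have "eventually (\<lambda>a. x a \<notin> A a) U" by (rule ultraD)
        then show ?thesis by eventually_elim (use False in simp)
      qed
      then have "((\<lambda>a. ?k a (x a)) \<longlongrightarrow> ?F c * indicator ?S c) U"
        by (rule Lim_transform_eventually[OF tendsto_mult[OF t tendsto_const]])
      then show ?thesis using t' tendsto_unique[OF U_bot] by blast
    qed
    have intF: "(\<integral>c. ul_fun U ?k c \<partial>base X) = (\<integral>c. ?F c * indicator ?S c \<partial>base X)"
      by (rule Bochner_Integration.integral_cong) (use Fk in auto)
    have avg: "measure (abel_measure l \<sigma> (Suc s) i a) (?B a) = 1 / a ^ Suc s * (\<integral>e. ?k a e \<partial>abel_measure l \<sigma> 0 0 a)"
      if a: "a \<in> params" for a
    proof -
      interpret Ab: prob_space "abel_measure l \<sigma> (Suc s) i a" by (rule prob_space_abel[OF st i' a])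
      interpret A0: prob_space "abel_measure l \<sigma> 0 0 a" by (rule prob_space_abel[OF st _ a]) simp
      have "?k a \<in> borel_measurable (abel_measure l \<sigma> 0 0 a)"
        by (simp add: measurable_cong_sets[of "abel_measure l \<sigma> 0 0 a" "count_space (Eset l)" borel borel])
      then have ik: "integrable (abel_measure l \<sigma> 0 0 a) (?k a)"
        by (intro A0.integrable_const_bound[where B=C]) (use k' in auto)
      have k0: "0 \<le> (\<integral>e. ?k a e \<partial>abel_measure l \<sigma> 0 0 a)"
        by (intro Bochner_Integration.integral_nonneg_AE AE_I2) (use k' in auto)
      have "(\<integral>\<^sup>+e. ennreal (ratio g (Suc s) i a e) * indicator (A a) e \<partial>abel_measure l \<sigma> 0 0 a) =
          (\<integral>\<^sup>+e. ennreal (?k a e) \<partial>abel_measure l \<sigma> 0 0 a)"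
        by (intro nn_integral_cong) (auto split: split_indicator)
      also have "\<dots> = ennreal (\<integral>e. ?k a e \<partial>abel_measure l \<sigma> 0 0 a)"
        by (rule nn_integral_eq_integral[OF ik]) (use k' in \<open>auto intro!: AE_I2\<close>)
      finally have "ennreal (measure (abel_measure l \<sigma> (Suc s) i a) (?B a)) = ennreal (1 / a ^ Suc s) * ennreal (\<integral>e. ?k a e \<partial>abel_measure l \<sigma> 0 0 a)"
        using abel_density[OF sp a i', of "A a" g] A by (simp add: Ab.emeasure_eq_measure)
      also have "\<dots> = ennreal (1 / a ^ Suc s * (\<integral>e. ?k a e \<partial>abel_measure l \<sigma> 0 0 a))"
        using a k0 by (intro ennreal_mult[symmetric]) auto
      finally show ?thesis using a k0 by (subst (asm) ennreal_inj) auto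
    qed
    have "((\<lambda>a. 1 / a ^ Suc s * (\<integral>e. ?k a e \<partial>abel_measure l \<sigma> 0 0 a)) \<longlongrightarrow> 1 / 1 ^ Suc s * (\<integral>c. ?F c * indicator ?S c \<partial>base X)) U"
      using int unfolding intF by (intro tendsto_mult tendsto_divide tendsto_power tendsto_1 tendsto_const) auto
    moreover have "eventually (\<lambda>a. 1 / a ^ Suc s * (\<integral>e. ?k a e \<partial>abel_measure l \<sigma> 0 0 a) = measure (abel_measure l \<sigma> (Suc s) i a) (?B a)) U"
      using ev_params by eventually_elim (simp add: avg)
    ultimately have "((\<lambda>a. measure (abel_measure l \<sigma> (Suc s) i a) (?B a)) \<longlongrightarrow> 1 / 1 ^ Suc s * (\<integral>c. ?F c * indicator ?S c \<partial>base X)) U"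
      by (rule Lim_transform_eventually)
    moreover have "((\<lambda>a. measure (abel_measure l \<sigma> (Suc s) i a) (?B a)) \<longlongrightarrow> measure (nu X (Suc s) i) (ul_set U (Eset l) ?B)) U"
      unfolding nu_X by (rule Ps.measure_ul_tendsto) auto
    ultimately have eq: "measure (nu X (Suc s) i) (ul_set U (Eset l) ?B) = (\<integral>c. ?F c * indicator ?S c \<partial>base X)"
      using tendsto_unique[OF U_bot] by fastforce
    have iF: "integrable (base X) (\<lambda>c. ?F c * indicator ?S c)"
      by (intro integrable_real_mult_indicator S B.integrable_const_bound[where B=C] F_meas) (use F_range in auto)
    have "emeasure (translate X g (nu X (Suc s) i)) ?S = emeasure (nu X (Suc s) i) (ul_set U (Eset l) ?B)"
      by (rule emeasure_translate_ul[OF A])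
    also have "\<dots> = ennreal (\<integral>c. ?F c * indicator ?S c \<partial>base X)"
      using finite_measure.emeasure_eq_measure[OF prob_space.finite_measure[OF sys_prob[OF sigma_system_ul i']]] eq by simp
    also have "\<dots> = (\<integral>\<^sup>+c. ennreal (?F c * indicator ?S c) \<partial>base X)"
      by (rule nn_integral_eq_integral[OF iF, symmetric]) (use F_range in \<open>auto intro!: AE_I2 mult_nonneg_nonneg\<close>)
    also have "\<dots> = (\<integral>\<^sup>+c\<in>?S. ennreal (?F c) \<partial>base X)"
      by (intro nn_integral_cong) (auto split: split_indicator)
    also have "\<dots> = emeasure (density (base X) (\<lambda>c. ennreal (?F c))) ?S"
      using F_meas S by (intro emeasure_density[symmetric]) auto
    finally show "emeasure (translate X g (nu X (Suc s) i)) ?S = emeasure (density (base X) (\<lambda>c. ennreal (?F c))) ?S" .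
  qed simp_all
  then have "AE c in base X. ennreal (?F c) = rn X g (Suc s) i c"
    unfolding rn_def
    using F_meas by (intro sigma_finite_measure.RN_deriv_unique prob_space_imp_sigma_finite B.prob_space_axioms) auto
  then show ?thesis
    using AE_space by eventually_elim (metis F_range(1) enn2real_ennreal)
qed

end

section \<open>The common law of the derivatives\<close>

text \<open>Continuous approximations of the indicator function of the positive numbers.\<close>

definition ramp :: "nat \<Rightarrow> real \<Rightarrow> real" where
  "ramp m x = min 1 (max 0 (real m * x))"

lemma ramp_range: "0 \<le> ramp m x" "ramp m x \<le> 1"
  by (simp_all add: ramp_def)

lemma ramp_lipschitz: "\<bar>ramp m x - ramp m y\<bar> \<le> real m * \<bar>x - y\<bar>"
proof -
  have "\<bar>ramp m x - ramp m y\<bar> \<le> \<bar>real m * x - real m * y\<bar>" unfolding ramp_def by linarith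
  also have "\<dots> = real m * \<bar>x - y\<bar>" by (simp add: right_diff_distrib[symmetric] abs_mult)
  finally show ?thesis .
qed

lemma continuous_ramp: "continuous_on UNIV (ramp m)"
  unfolding ramp_def by (intro continuous_intros)

lemma tendsto_ramp: "(f \<longlongrightarrow> x) F \<Longrightarrow> ((\<lambda>a. ramp m (f a)) \<longlongrightarrow> ramp m x) F"
  unfolding ramp_def by (intro tendsto_intros)

lemma measurable_ramp [measurable]: "ramp m \<in> borel_measurable borel"
  by (rule borel_measurable_continuous_onI[OF continuous_ramp])

lemma ramp_tendsto_indicator: "(\<lambda>m. ramp m x) \<longlonglongrightarrow> indicator {0<..} x"
proof (cases "0 < x")
  case True
  then obtain M where M: "1 < real M * x" using reals_Archimedean3 by blast
  have "ramp m x = 1" if "M \<le> m" for m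
  proof -
    have "real M * x \<le> real m * x" using that True by (intro mult_right_mono) auto
    then show ?thesis using M by (simp add: ramp_def)
  qed
  then have "(\<lambda>m. ramp m x) \<longlonglongrightarrow> 1" by (intro tendsto_eventually eventually_sequentiallyI[of M])
  then show ?thesis using True by simp
next
  case False
  then have "ramp m x = 0" for m by (simp add: ramp_def mult_nonneg_nonpos)
  then show ?thesis using False by simp
qed

text \<open>A law on the space of sequences is determined by the integrals of finite products of ramps in the
  coordinates, which approximate the indicators of an intersection-stable generator.\<close>

lemma law_eqI:
  fixes M N :: "(nat \<Rightarrow> real) measure"
  assumes M: "prob_space M" "sets M = sets borel" and N: "prob_space N" "sets N = sets borel"
    and eq: "\<And>J c m. finite J \<Longrightarrow> (\<integral>z. (\<Prod>n\<in>J. ramp m (z n - c n)) \<partial>M) = (\<integral>z. (\<Prod>n\<in>J. ramp m (z n - c n)) \<partial>N)"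
  shows "M = N"
proof -
  define box where "box J c = {z :: nat \<Rightarrow> real. \<forall>n\<in>J. c n < z n}" for J c
  let ?G = "{box J c | J c. finite J}"
  have coord: "(\<lambda>z :: nat \<Rightarrow> real. z n) \<in> borel_measurable borel" for n by (rule measurable_product_coordinates)
  have box_sets: "box J c \<in> sets borel" if "finite J" for J c
  proof -
    have "{z \<in> space borel. \<forall>n\<in>J. c n < z n} \<in> sets borel"
    proof (rule sets.sets_Collect_finite_All[OF _ that])
      show "{z \<in> space borel. c n < z n} \<in> sets borel" for n :: nat
        using borel_measurable_less[OF borel_measurable_const coord[of n], of "c n"] by simp
    qed
    then show ?thesis by (simp add: box_def)
  qed
  have lim: "(\<lambda>m. \<integral>z. (\<Prod>n\<in>J. ramp m (z n - c n)) \<partial>K) \<longlonglongrightarrow> measure K (box J c)"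
    if J: "finite J" and K: "prob_space K" "sets K = sets borel" for J c K
  proof -
    interpret K: prob_space K by (rule K(1))
    have mK: "borel_measurable K = borel_measurable borel" by (rule measurable_cong_sets[OF K(2) refl])
    have "(\<lambda>m. \<integral>z. (\<Prod>n\<in>J. ramp m (z n - c n)) \<partial>K) \<longlonglongrightarrow> (\<integral>z. indicator (box J c) z \<partial>K)"
    proof (rule integral_dominated_convergence[where w="\<lambda>_. 1"])
      show "indicator (box J c) \<in> borel_measurable K"
        by (rule borel_measurable_indicator) (simp add: K(2) box_sets[OF J])
      show "(\<lambda>z. \<Prod>n\<in>J. ramp m (z n - c n)) \<in> borel_measurable K" for m
        unfolding mK
        by (intro borel_measurable_prod measurable_compose[OF _ measurable_ramp] borel_measurable_diff coord borel_measurable_const)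
      show "AE z in K. (\<lambda>m. \<Prod>n\<in>J. ramp m (z n - c n)) \<longlonglongrightarrow> indicator (box J c) z"
      proof (rule AE_I2)
        fix z
        have "(\<lambda>m. \<Prod>n\<in>J. ramp m (z n - c n)) \<longlonglongrightarrow> (\<Prod>n\<in>J. indicator {0<..} (z n - c n))"
          by (intro tendsto_prod ramp_tendsto_indicator)
        also have "(\<Prod>n\<in>J. indicator {0<..} (z n - c n)) = (indicator (box J c) z :: real)"
        proof (cases "z \<in> box J c")
          case True
          then show ?thesis by (auto simp: box_def intro!: prod.neutral)
        next
          case False
          then obtain n where "n \<in> J" "\<not> c n < z n" by (auto simp: box_def)
          then show ?thesis using False J by (auto intro!: prod_zero bexI[of _ n])
        qed
        finally show "(\<lambda>m. \<Prod>n\<in>J. ramp m (z n - c n)) \<longlonglongrightarrow> indicator (box J c) z" .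
      qed
      show "AE z in K. norm (\<Prod>n\<in>J. ramp m (z n - c n)) \<le> 1" for m
        by (intro AE_I2) (simp add: abs_prod, intro prod_le_1, use ramp_range in auto)
    qed simp
    then show ?thesis using box_sets[OF J] by (simp add: K(2))
  qed
  have boxes: "emeasure M S = emeasure N S" if SG: "S \<in> ?G" for S
  proof -
    obtain J c where S: "S = box J c" "finite J" using SG by blast
    have "measure M S = measure N S"
      unfolding S(1) using lim[OF S(2) M, of c] lim[OF S(2) N, of c] eq[OF S(2), of _ c] by (auto intro: LIMSEQ_unique)
    then show ?thesis
      using M(1) N(1) by (simp add: finite_measure.emeasure_eq_measure prob_space.finite_measure)
  qed
  have G: "sets borel = sigma_sets UNIV ?G"
  proof
    show "sigma_sets UNIV ?G \<subseteq> sets borel"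
      using sets.sigma_sets_subset[of ?G "borel :: (nat \<Rightarrow> real) measure"] box_sets by auto
    have sp: "space (sigma UNIV ?G) = UNIV" by (rule space_measure_of) simp
    have st: "sets (sigma UNIV ?G) = sigma_sets UNIV ?G" by (rule sets_measure_of) simp
    have "(\<lambda>z :: nat \<Rightarrow> real. z n) \<in> borel_measurable (sigma UNIV ?G)" for n
      unfolding borel_measurable_iff_greater
    proof
      fix a
      have "{z \<in> space (sigma UNIV ?G). a < z n} = box {n} (\<lambda>_. a)" by (simp add: box_def sp)
      also have "\<dots> \<in> ?G" by blast
      finally show "{z \<in> space (sigma UNIV ?G). a < z n} \<in> sets (sigma UNIV ?G)" unfolding st by (rule sigma_sets.Basic)
    qed
    then have "(\<lambda>z. z) \<in> sigma UNIV ?G \<rightarrow>\<^sub>M (borel :: (nat \<Rightarrow> real) measure)"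
      by (rule measurable_coordinatewise_then_product)
    from measurable_sets[OF this] show "sets borel \<subseteq> sigma_sets UNIV ?G" by (auto simp: sp st)
  qed
  show ?thesis
  proof (rule measure_eqI_generator_eq[of ?G UNIV])
    show "Int_stable ?G"
    proof (rule Int_stableI)
      fix S T assume "S \<in> ?G" "T \<in> ?G"
      then obtain J c J' c' where S: "S = box J c" "finite J" and T: "T = box J' c'" "finite J'" by blast
      define d where "d n = (if n \<in> J then if n \<in> J' then max (c n) (c' n) else c n else c' n)" for n
      have "S \<inter> T = box (J \<union> J') d"
        unfolding S(1) T(1) box_def d_def by (auto split: if_splits)
      then show "S \<inter> T \<in> ?G" using S(2) T(2) by blast
    qed
    show "range (\<lambda>_ :: nat. UNIV) \<subseteq> ?G" using exI[of _ "{}"] by (auto simp: box_def)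
    show "emeasure M UNIV \<noteq> \<infinity>" using M(1) by (simp add: finite_measure.emeasure_eq_measure prob_space.finite_measure)
  qed (use boxes M(2) N(2) G in auto)
qed

text \<open>Abel summation of a convergent sequence along the ultrafilter.\<close>

lemma (in ul) abel_tendsto:
  fixes u :: "nat \<Rightarrow> real"
  assumes u: "\<And>n. \<bar>u n\<bar> \<le> 1" and lim: "u \<longlonglongrightarrow> c"
  shows "((\<lambda>a. \<Sum>n. (1 - a) * a ^ n * u n) \<longlongrightarrow> c) U"
proof (rule tendstoI)
  fix e :: real assume e: "0 < e"
  have c1: "\<bar>c\<bar> \<le> 1" by (rule LIMSEQ_le_const2[OF tendsto_rabs[OF lim]]) (use u in auto)
  obtain K where K: "\<And>n. K \<le> n \<Longrightarrow> \<bar>u n - c\<bar> < e / 2"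
    using LIMSEQ_D[OF lim, of "e / 2"] e by (auto simp: real_norm_def)
  have "((\<lambda>a. (1 - a) * (2 * real K)) \<longlongrightarrow> (1 - 1) * (2 * real K)) U"
    by (intro tendsto_intros tendsto_1)
  then have "eventually (\<lambda>a. (1 - a) * (2 * real K) < e / 2) U"
    using e by (intro order_tendstoD(2)) auto
  then show "eventually (\<lambda>a. dist (\<Sum>n. (1 - a) * a ^ n * u n) c < e) U"
    using ev_params
  proof eventually_elim
    case (elim a)
    then have a: "0 < a" "a < 1" by auto
    have sg: "summable (\<lambda>n. (1 - a) * a ^ n)" and s1: "(\<Sum>n. (1 - a) * a ^ n) = 1"
      using a summable_geometric[of a] suminf_geometric[of a] by (auto simp: suminf_mult intro: summable_mult)
    have su: "summable (\<lambda>n. (1 - a) * a ^ n * u n)"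
      by (rule summable_comparison_test'[OF sg]) (use a u in \<open>auto simp: abs_mult mult_left_le\<close>)
    have scu: "summable (\<lambda>n. (1 - a) * a ^ n * (u n - c))"
      using summable_diff[OF su summable_mult2[OF sg, of c]] by (simp add: algebra_simps)
    have sabs: "summable (\<lambda>n. \<bar>(1 - a) * a ^ n * (u n - c)\<bar>)"
    proof (rule summable_comparison_test'[OF summable_mult2[OF sg, of 2]])
      fix n :: nat
      have "\<bar>u n - c\<bar> \<le> 2" using u[of n] c1 by linarith
      then show "norm \<bar>(1 - a) * a ^ n * (u n - c)\<bar> \<le> (1 - a) * a ^ n * 2"
        using a by (auto simp: abs_mult intro!: mult_left_mono)
    qed
    have "(\<Sum>n. (1 - a) * a ^ n * u n) - c = (\<Sum>n. (1 - a) * a ^ n * u n) - (\<Sum>n. (1 - a) * a ^ n * c)"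
      using suminf_mult2[OF sg, of c] s1 by simp
    also have "\<dots> = (\<Sum>n. (1 - a) * a ^ n * (u n - c))"
      using suminf_diff[OF su summable_mult2[OF sg, of c]] by (simp add: algebra_simps)
    finally have "\<bar>(\<Sum>n. (1 - a) * a ^ n * u n) - c\<bar> \<le> (\<Sum>n. \<bar>(1 - a) * a ^ n * (u n - c)\<bar>)"
      using summable_rabs[OF sabs] by simp
    also have "\<dots> = (\<Sum>n. \<bar>(1 - a) * a ^ (n + K) * (u (n + K) - c)\<bar>) + (\<Sum>n<K. \<bar>(1 - a) * a ^ n * (u n - c)\<bar>)"
      by (rule suminf_split_initial_segment[OF sabs])
    also have "(\<Sum>n. \<bar>(1 - a) * a ^ (n + K) * (u (n + K) - c)\<bar>) \<le> (\<Sum>n. (1 - a) * a ^ n * (e / 2))"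
    proof (rule suminf_le)
      fix n
      have "a ^ (n + K) \<le> a ^ n" using a by (intro power_decreasing) auto
      then show "\<bar>(1 - a) * a ^ (n + K) * (u (n + K) - c)\<bar> \<le> (1 - a) * a ^ n * (e / 2)"
        using a K[of "n + K"] by (auto simp: abs_mult intro!: mult_mono)
    qed (use sabs sg in \<open>auto intro: summable_ignore_initial_segment summable_mult2\<close>)
    also have "\<dots> = e / 2" using suminf_mult2[OF sg, of "e / 2"] s1 by simp
    also have "(\<Sum>n<K. \<bar>(1 - a) * a ^ n * (u n - c)\<bar>) \<le> (\<Sum>n<K. (1 - a) * 2)"
    proof (rule sum_mono)
      fix n
      have "\<bar>u n - c\<bar> \<le> 2" using u[of n] c1 by linarith
      moreover have "a ^ n \<le> 1" using a by (intro power_le_one) auto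
      ultimately have "a ^ n * \<bar>u n - c\<bar> \<le> 1 * 2" using a by (intro mult_mono) auto
      then have le: "a ^ n * \<bar>u n - c\<bar> \<le> 2" by simp
      have "\<bar>(1 - a) * a ^ n * (u n - c)\<bar> = (1 - a) * (a ^ n * \<bar>u n - c\<bar>)"
        using a by (simp add: abs_mult)
      also have "\<dots> \<le> (1 - a) * 2" using a by (intro mult_left_mono le) auto
      finally show "\<bar>(1 - a) * a ^ n * (u n - c)\<bar> \<le> (1 - a) * 2" .
    qed
    also have "(\<Sum>n<K. (1 - a) * 2) < e / 2" using elim(1) by (simp add: algebra_simps)
    finally show "dist (\<Sum>n. (1 - a) * a ^ n * u n) c < e" by (simp add: dist_real_def)
  qed
qed

lemma walk_position:
  fixes \<sigma> :: "'g::{group_add,countable} mseq"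
  assumes st: "stochastic_sequence l \<sigma>"
  shows "(\<integral>\<^sup>+\<omega>. f (\<omega> m) \<partial>walk l \<sigma> 0 0) = (\<integral>\<^sup>+v. tprod l \<sigma> 0 m 0 (fst v) (snd v) * f v \<partial>count_space (Vset l m))"
proof -
  let ?P = "walk l \<sigma> 0 0"
  have 0: "0 < ldim l 0" by simp
  have c: "(\<lambda>\<omega>. \<omega> m) \<in> ?P \<rightarrow>\<^sub>M coord_space l m"
    unfolding measurable_cong_sets[OF sets_walk[OF st 0] refl] by simp
  have "distr ?P (coord_space l m) (\<lambda>\<omega>. \<omega> m) = density (coord_space l m) (\<lambda>v. tprod l \<sigma> 0 m 0 (fst v) (snd v))"
  proof (rule measure_eqI_countable)
    fix v :: "nat \<times> 'g" assume v: "v \<in> Vset l m"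
    have k: "fst v < ldim l (Suc m)" using v by (simp add: Vset_def mem_Times_iff)
    interpret W: prob_space "walk l \<sigma> (Suc m) (fst v)" by (rule prob_space_walk[OF st k])
    interpret F: sigma_algebra "path_space l" "future l m :: (nat \<Rightarrow> nat \<times> 'g) set set" by (rule sigma_algebra_future)
    have "emeasure (distr ?P (coord_space l m) (\<lambda>\<omega>. \<omega> m)) {v} = emeasure ?P ({\<omega> \<in> path_space l. \<omega> m = v} \<inter> path_space l)"
      using v by (subst emeasure_distr[OF c]) (auto simp: space_walk[OF st 0] intro!: arg_cong[where f="emeasure ?P"])
    also have "\<dots> = tprod l \<sigma> 0 m 0 (fst v) (snd v)"
    proof -
      have "path_act (snd v) -` path_space l \<inter> path_space l = space (walk l \<sigma> (Suc m) (fst v))"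
        by (auto simp: space_walk[OF st k])
      then show ?thesis
        using walk_tprod_at[OF st 0 le0 F.top v] W.emeasure_space_1 by simp
    qed
    also have "\<dots> = emeasure (density (coord_space l m) (\<lambda>v. tprod l \<sigma> 0 m 0 (fst v) (snd v))) {v}"
      using v by (subst emeasure_density) (auto simp: nn_integral_indicator_singleton)
    finally show "emeasure (distr ?P (coord_space l m) (\<lambda>\<omega>. \<omega> m)) {v} =
      emeasure (density (coord_space l m) (\<lambda>v. tprod l \<sigma> 0 m 0 (fst v) (snd v))) {v}" .
  qed auto
  then have "(\<integral>\<^sup>+v. f v \<partial>distr ?P (coord_space l m) (\<lambda>\<omega>. \<omega> m)) =
      (\<integral>\<^sup>+v. f v \<partial>density (coord_space l m) (\<lambda>v. tprod l \<sigma> 0 m 0 (fst v) (snd v)))" by simp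
  then show ?thesis by (simp add: nn_integral_distr[OF c] nn_integral_density)
qed

text \<open>The integral of a function against an Abel average is the Abel mean of its integrals along
  the walk.\<close>

lemma abel_integral:
  fixes \<sigma> :: "'g::{group_add,countable} mseq"
  assumes st: "stochastic_sequence l \<sigma>" and a: "a \<in> params"
    and f: "\<And>e. 0 \<le> f e \<and> f e \<le> (1::real)"
  shows "(\<integral>e. f e \<partial>abel_measure l \<sigma> 0 0 a) = (\<Sum>m. (1 - a) * a ^ m * (\<integral>\<omega>. f (m, \<omega> m) \<partial>walk l \<sigma> 0 0))"
proof -
  let ?P = "walk l \<sigma> 0 0"
  have 0: "0 < ldim l 0" by simp
  interpret P: prob_space ?P by (rule prob_space_walk[OF st 0])
  have a0: "0 < a" "a < 1" using a by auto
  define u where "u m = (\<integral>\<omega>. f (m, \<omega> m) \<partial>?P)" for m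
  have meas: "(\<lambda>\<omega>. f (m, \<omega> m)) \<in> borel_measurable ?P" for m
  proof -
    have c: "(\<lambda>\<omega>. \<omega> m) \<in> ?P \<rightarrow>\<^sub>M coord_space l m"
      unfolding measurable_cong_sets[OF sets_walk[OF st 0] refl] by simp
    show ?thesis by (rule measurable_compose[OF c]) simp
  qed
  have int: "integrable ?P (\<lambda>\<omega>. f (m, \<omega> m))" for m
    by (rule P.integrable_const_bound[where B=1]) (use f meas in auto)
  have u: "ennreal (u m) = (\<integral>\<^sup>+\<omega>. ennreal (f (m, \<omega> m)) \<partial>?P)" for m
    unfolding u_def using f by (intro nn_integral_eq_integral[OF int, symmetric]) auto
  have u0: "0 \<le> u m" "u m \<le> 1" for m
  proof -
    show "0 \<le> u m" unfolding u_def using f by simp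
    have "u m \<le> (\<integral>\<omega>. 1 \<partial>?P)" unfolding u_def by (rule integral_mono[OF int]) (use f in auto)
    then show "u m \<le> 1" by (simp add: P.prob_space)
  qed
  have s: "summable (\<lambda>m. (1 - a) * a ^ m * u m)"
  proof (rule summable_comparison_test')
    show "summable (\<lambda>m. (1 - a) * a ^ m)" using a0 by (intro summable_mult summable_geometric) auto
    show "norm ((1 - a) * a ^ m * u m) \<le> (1 - a) * a ^ m" if "0 \<le> m" for m
      using a0 u0[of m] by (auto simp: abs_mult mult_left_le)
  qed
  have "(\<integral>e. f e \<partial>abel_measure l \<sigma> 0 0 a) = enn2real (\<integral>\<^sup>+e. ennreal (f e) \<partial>abel_measure l \<sigma> 0 0 a)"
  proof (rule integral_eq_nn_integral)
    show "f \<in> borel_measurable (abel_measure l \<sigma> 0 0 a)"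
      by (simp add: measurable_cong_sets[of "abel_measure l \<sigma> 0 0 a" "count_space (Eset l)" borel borel])
  qed (use f in auto)
  also have "(\<integral>\<^sup>+e. ennreal (f e) \<partial>abel_measure l \<sigma> 0 0 a) = (\<Sum>m. ennreal ((1 - a) * a ^ m * u m))"
  proof -
    have "(\<integral>\<^sup>+v. tprod l \<sigma> 0 m 0 (fst v) (snd v) * ennreal (f (m, v)) \<partial>coord_space l m) = ennreal (u m)" for m
      using walk_position[OF st, of "\<lambda>v. ennreal (f (m, v))" m] u by simp
    then show ?thesis
      using a0 u0 by (simp add: nn_integral_abel[OF a] ennreal_mult)
  qed
  also have "\<dots> = ennreal (\<Sum>m. (1 - a) * a ^ m * u m)"
    using a0 u0 s by (intro suminf_ennreal2) auto
  finally show ?thesis using a0 u0 s by (simp add: u_def suminf_nonneg)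
qed

lemma measurable_nn_integral_countable:
  fixes f :: "'k::countable \<Rightarrow> 'x \<Rightarrow> ennreal"
  assumes f: "\<And>k. f k \<in> borel_measurable M"
  shows "(\<lambda>x. \<integral>\<^sup>+k. f k x \<partial>count_space UNIV) \<in> borel_measurable M"
proof -
  have "(\<integral>\<^sup>+k. g k \<partial>count_space UNIV) = (\<Sum>n. g (from_nat n) * indicator (range (to_nat :: 'k \<Rightarrow> nat)) n)" for g :: "'k \<Rightarrow> ennreal"
  proof -
    have "bij_betw (to_nat :: 'k \<Rightarrow> nat) UNIV (range (to_nat :: 'k \<Rightarrow> nat))" unfolding bij_betw_def by simp
    from nn_integral_bij_count_space[OF this, of "\<lambda>n. g (from_nat n)"]
    have "(\<integral>\<^sup>+k. g k \<partial>count_space UNIV) = (\<integral>\<^sup>+n. g (from_nat n) \<partial>count_space (range (to_nat :: 'k \<Rightarrow> nat)))" by simp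
    also have "\<dots> = (\<integral>\<^sup>+n. g (from_nat n) * indicator (range (to_nat :: 'k \<Rightarrow> nat)) n \<partial>count_space UNIV)"
      by (rule nn_integral_count_space_indicator) simp
    finally show ?thesis by (simp add: nn_integral_count_space_nat)
  qed
  then show ?thesis using f by simp
qed

text \<open>The derivatives of the measures of positive level determine those of the base measure, by
  stationarity. Only the former are bounded, so laws are compared through them.\<close>

text \<open>The list of derivatives with those of level 0 replaced by 0.\<close>

definition rn_map_pos :: "(nat \<Rightarrow> nat) \<Rightarrow> ('g::countable, 'x) gsystem \<Rightarrow> 'x \<Rightarrow> nat \<Rightarrow> real" where
  "rn_map_pos l X x n = (case from_nat n :: 'g \<times> nat \<times> nat of (g, s, i) \<Rightarrow> if s = 0 then 0 else rn_map l X x n)"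

text \<open>The derivatives of level 0, recomputed from those of level 1 by stationarity.\<close>

definition rn_complete :: "(nat \<Rightarrow> nat) \<Rightarrow> 'g::{group_add,countable} mseq \<Rightarrow> (nat \<Rightarrow> real) \<Rightarrow> nat \<Rightarrow> real" where
  "rn_complete l \<sigma> z n = (case from_nat n :: 'g \<times> nat \<times> nat of (g, s, i) \<Rightarrow>
     if s = 0 then (if i = 0 then enn2real (\<Sum>j<l 0. \<integral>\<^sup>+k. \<sigma> 0 0 j k * ennreal (z (rn_index (g + k) (Suc 0) j)) \<partial>count_space UNIV) else 0)
     else z n)"

lemma measurable_rn_map_pos:
  fixes X :: "('g::countable, 'x) gsystem"
  shows "rn_map_pos l X \<in> base X \<rightarrow>\<^sub>M borel"
proof (rule measurable_coordinatewise_then_product)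
  fix n
  obtain k :: 'g and s i :: nat where n: "from_nat n = (k, s, i)" by (cases "from_nat n :: 'g \<times> nat \<times> nat") auto
  have "(\<lambda>x. rn_map l X x n) \<in> borel_measurable (base X)"
    by (rule measurable_compose[OF measurable_rn_map measurable_product_coordinates])
  then show "(\<lambda>x. rn_map_pos l X x n) \<in> borel_measurable (base X)"
    by (simp add: rn_map_pos_def n)
qed

lemma measurable_rn_complete:
  fixes \<sigma> :: "'g::{group_add,countable} mseq"
  shows "rn_complete l \<sigma> \<in> borel \<rightarrow>\<^sub>M borel"
proof (rule measurable_coordinatewise_then_product)
  fix n
  obtain g :: 'g and s i :: nat where n: "from_nat n = (g, s, i)" by (cases "from_nat n :: 'g \<times> nat \<times> nat") auto
  have c: "(\<lambda>z :: nat \<Rightarrow> real. z m) \<in> borel_measurable borel" for m by (rule measurable_product_coordinates)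
  have "(\<lambda>z. enn2real (\<Sum>j<l 0. \<integral>\<^sup>+k. \<sigma> 0 0 j k * ennreal (z (rn_index (g + k) (Suc 0) j)) \<partial>count_space UNIV)) \<in> borel_measurable borel"
  proof (rule borel_measurable_enn2real, rule borel_measurable_sum)
    fix j
    show "(\<lambda>z. \<integral>\<^sup>+k. \<sigma> 0 0 j k * ennreal (z (rn_index (g + k) (Suc 0) j)) \<partial>count_space UNIV) \<in> borel_measurable borel"
      by (rule measurable_nn_integral_countable)
         (intro borel_measurable_times_ennreal borel_measurable_const measurable_compose[OF c measurable_ennreal])
  qed
  then show "(\<lambda>z. rn_complete l \<sigma> z n) \<in> borel_measurable borel"
    using c[of n] by (cases "s = 0"; cases "i = 0") (simp_all add: rn_complete_def n)
qed

context
  fixes l :: "nat \<Rightarrow> nat" and \<sigma> :: "('g::{group_add,countable}) mseq" and X :: "('g, 'x) gsystem"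
  assumes X: "sigma_system l \<sigma> X" and sp: "spread l \<sigma>"
begin

lemma rn_level_0:
  "AE x in base X. (\<Sum>j<l 0. \<integral>\<^sup>+k. \<sigma> 0 0 j k * rn X (g + k) (Suc 0) j x \<partial>count_space UNIV) = rn X g 0 0 x"
proof (rule rn_unique[OF X sp])
  show "(\<lambda>x. \<Sum>j<l 0. \<integral>\<^sup>+k. \<sigma> 0 0 j k * rn X (g + k) (Suc 0) j x \<partial>count_space UNIV) \<in> borel_measurable (base X)"
    by (intro borel_measurable_sum measurable_nn_integral_countable borel_measurable_times_ennreal borel_measurable_const measurable_rn)
  fix A assume A: "A \<in> sets (base X)"
  have m: "(\<lambda>x. rn X (g + k) (Suc 0) j x * indicator A x) \<in> borel_measurable (base X)" for k j
    using A by (intro borel_measurable_times_ennreal measurable_rn borel_measurable_indicator)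
  have "(\<integral>\<^sup>+x\<in>A. (\<Sum>j<l 0. \<integral>\<^sup>+k. \<sigma> 0 0 j k * rn X (g + k) (Suc 0) j x \<partial>count_space UNIV) \<partial>base X) =
      (\<integral>\<^sup>+x. (\<Sum>j<l 0. \<integral>\<^sup>+k. \<sigma> 0 0 j k * (rn X (g + k) (Suc 0) j x * indicator A x) \<partial>count_space UNIV) \<partial>base X)"
    by (intro nn_integral_cong) (simp add: sum_distrib_right nn_integral_multc[symmetric] mult.assoc)
  also have "\<dots> = (\<Sum>j<l 0. \<integral>\<^sup>+x. (\<integral>\<^sup>+k. \<sigma> 0 0 j k * (rn X (g + k) (Suc 0) j x * indicator A x) \<partial>count_space UNIV) \<partial>base X)"
    by (rule nn_integral_sum)
       (intro measurable_nn_integral_countable borel_measurable_times_ennreal[OF borel_measurable_const m])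
  also have "\<dots> = (\<Sum>j<l 0. \<integral>\<^sup>+k. (\<integral>\<^sup>+x. \<sigma> 0 0 j k * (rn X (g + k) (Suc 0) j x * indicator A x) \<partial>base X) \<partial>count_space UNIV)"
    by (intro sum.cong refl nn_integral_count_space_nn_integral borel_measurable_times_ennreal[OF borel_measurable_const m]) simp
  also have "\<dots> = (\<Sum>j<l 0. \<integral>\<^sup>+k. \<sigma> 0 0 j k * emeasure (translate X (g + k) (nu X (Suc 0) j)) A \<partial>count_space UNIV)"
  proof (intro sum.cong refl)
    fix j assume "j \<in> {..<l 0}"
    then have j: "j < ldim l (Suc 0)" by simp
    show "(\<integral>\<^sup>+k. (\<integral>\<^sup>+x. \<sigma> 0 0 j k * (rn X (g + k) (Suc 0) j x * indicator A x) \<partial>base X) \<partial>count_space UNIV) =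
        (\<integral>\<^sup>+k. \<sigma> 0 0 j k * emeasure (translate X (g + k) (nu X (Suc 0) j)) A \<partial>count_space UNIV)"
      by (rule nn_integral_cong) (simp add: nn_integral_cmult[OF m] emeasure_translate_rn[OF X sp j A])
  qed
  also have "\<dots> = emeasure (translate X g (nu X 0 0)) A"
    by (rule stationary_translate[OF X _ A, symmetric]) simp
  finally show "emeasure (translate X g (nu X 0 0)) A =
    (\<integral>\<^sup>+x\<in>A. (\<Sum>j<l 0. \<integral>\<^sup>+k. \<sigma> 0 0 j k * rn X (g + k) (Suc 0) j x \<partial>count_space UNIV) \<partial>base X)" by simp
qed simp

lemma rn_map_complete: "AE x in base X. rn_map l X x = rn_complete l \<sigma> (rn_map_pos l X x)"
proof -
  have 1: "AE x in base X. \<forall>g. (\<Sum>j<l 0. \<integral>\<^sup>+k. \<sigma> 0 0 j k * rn X (g + k) (Suc 0) j x \<partial>count_space UNIV) = rn X g 0 0 x"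
    unfolding AE_all_countable by (intro allI rn_level_0)
  have 2: "AE x in base X. \<forall>g. \<forall>j. j < l 0 \<longrightarrow> ennreal (enn2real (rn X g (Suc 0) j x)) = rn X g (Suc 0) j x"
    unfolding AE_all_countable by (intro allI AE_impI rn_ennreal[OF X sp]) simp
  show ?thesis
    using 1 2
  proof eventually_elim
    case (elim x)
    show ?case
    proof
      fix n
      obtain g :: 'g and s i :: nat where n: "from_nat n = (g, s, i)" by (cases "from_nat n :: 'g \<times> nat \<times> nat") auto
      have z: "rn_map_pos l X x (rn_index (g + k) (Suc 0) j) = enn2real (rn X (g + k) (Suc 0) j x)" if "j < l 0" for k j
        using that by (simp add: rn_map_pos_def rn_map_def rn_index_def)
      have "(\<Sum>j<l 0. \<integral>\<^sup>+k. \<sigma> 0 0 j k * ennreal (rn_map_pos l X x (rn_index (g + k) (Suc 0) j)) \<partial>count_space UNIV) = rn X g 0 0 x"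
        using elim z by simp
      then show "rn_map l X x n = rn_complete l \<sigma> (rn_map_pos l X x) n"
        by (cases "s = 0") (simp_all add: rn_complete_def rn_map_pos_def rn_map_def n)
    qed
  qed
qed

lemma law_rn_map_complete:
  "distr (base X) borel (rn_map l X) = distr (distr (base X) borel (rn_map_pos l X)) borel (rn_complete l \<sigma>)"
proof -
  have "distr (base X) borel (rn_map l X) = distr (base X) borel (rn_complete l \<sigma> \<circ> rn_map_pos l X)"
    using rn_map_complete measurable_rn_map[of l X] measurable_comp[OF measurable_rn_map_pos[of l X] measurable_rn_complete[of l \<sigma>]]
    by (intro distr_cong_AE) simp_all
  then show ?thesis by (simp add: distr_distr[OF measurable_rn_complete measurable_rn_map_pos])
qed

text \<open>The derivative of the untranslated measure is a coordinate, so the law of the derivatives under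
  the base measure determines their law under the other measures.\<close>

lemma law_rn_map_level:
  assumes j: "j < ldim l s"
  shows "distr (nu X s j) borel (rn_map l X) =
    density (distr (base X) borel (rn_map l X)) (\<lambda>z. ennreal (z (rn_index (0::'g) s j)))"
proof (rule measure_eqI)
  fix C assume "C \<in> sets (distr (nu X s j) borel (rn_map l X))"
  then have C: "C \<in> sets borel" by simp
  let ?A = "rn_map l X -` C \<inter> space (base X)"
  have \<Phi>: "rn_map l X \<in> base X \<rightarrow>\<^sub>M borel" by (rule measurable_rn_map)
  have A: "?A \<in> sets (base X)" using \<Phi> C by (rule measurable_sets)
  have f: "(\<lambda>z :: nat \<Rightarrow> real. ennreal (z (rn_index (0::'g) s j))) \<in> borel_measurable borel"
    by (rule measurable_compose[OF measurable_product_coordinates measurable_ennreal])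
  have "emeasure (distr (nu X s j) borel (rn_map l X)) C = emeasure (nu X s j) ?A"
    using \<Phi> C by (simp add: emeasure_distr measurable_sys_nu[OF X j] sys_space[OF X j])
  also have "\<dots> = (\<integral>\<^sup>+x\<in>?A. rn X 0 s j x \<partial>base X)"
    using emeasure_translate_rn[OF X sp j A, of 0] translate_0[OF X sys_sets[OF X j]] by simp
  also have "\<dots> = (\<integral>\<^sup>+x. ennreal (rn_map l X x (rn_index (0::'g) s j)) * indicator C (rn_map l X x) \<partial>base X)"
  proof (rule nn_integral_cong_AE)
    show "AE x in base X. rn X 0 s j x * indicator ?A x = ennreal (rn_map l X x (rn_index (0::'g) s j)) * indicator C (rn_map l X x)"
      using rn_ennreal[OF X sp j, of 0] AE_space
      by eventually_elim (auto simp: rn_map_index j split: split_indicator)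
  qed
  also have "\<dots> = (\<integral>\<^sup>+z. ennreal (z (rn_index (0::'g) s j)) * indicator C z \<partial>distr (base X) borel (rn_map l X))"
    using f C by (intro nn_integral_distr[OF \<Phi>, symmetric]) (simp add: borel_measurable_times_ennreal)
  also have "\<dots> = emeasure (density (distr (base X) borel (rn_map l X)) (\<lambda>z. ennreal (z (rn_index (0::'g) s j)))) C"
    using f C by (intro emeasure_density[symmetric]) simp_all
  finally show "emeasure (distr (nu X s j) borel (rn_map l X)) C =
    emeasure (density (distr (base X) borel (rn_map l X)) (\<lambda>z. ennreal (z (rn_index (0::'g) s j)))) C" .
qed simp

end

context ul_sys
begin

abbreviation "T \<equiv> tail_system l \<sigma>"

text \<open>The ratio that corresponds to a coordinate of the list of derivatives.\<close>

definition coord_ratio :: "nat \<Rightarrow> nat \<times> nat \<times> 'g \<Rightarrow> real" where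
  "coord_ratio n e = (case from_nat n :: 'g \<times> nat \<times> nat of (g, s, i) \<Rightarrow>
     if s = 0 \<or> \<not> i < ldim l s then 0 else martin l \<sigma> g s i (fst e) (snd e))"

context
  assumes sp: "spread l \<sigma>"
begin

lemma coord_ratio_bounded: "\<exists>C\<ge>0. \<forall>e\<in>Eset l. 0 \<le> coord_ratio n e \<and> coord_ratio n e \<le> C"
proof -
  obtain g :: 'g and s i :: nat where n: "from_nat n = (g, s, i)" by (cases "from_nat n :: 'g \<times> nat \<times> nat") auto
  show ?thesis
  proof (cases "s = 0 \<or> \<not> i < ldim l s")
    case True
    then show ?thesis by (auto simp: coord_ratio_def n)
  next
    case False
    then obtain s' where s: "s = Suc s'" "i < l s'" by (cases s) auto
    obtain C where C: "C \<ge> 0" "\<And>n v. v \<in> Vset l n \<Longrightarrow> martin l \<sigma> g (Suc s') i n v \<le> C"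
      using martin_bounded[OF st sp s(2), of g] by blast
    have "0 \<le> coord_ratio n e \<and> coord_ratio n e \<le> C" if "e \<in> Eset l" for e
      using that C(2)[of "snd e" "fst e"] martin_nonneg[OF st sp] s by (auto simp: coord_ratio_def n Eset_def Vset_def)
    then show ?thesis using C(1) by blast
  qed
qed

lemma rn_map_pos_ul: "AE c in base X. rn_map_pos l X c n = ul_fun U (\<lambda>a. coord_ratio n) c"
proof -
  obtain g :: 'g and s i :: nat where n: "from_nat n = (g, s, i)" by (cases "from_nat n :: 'g \<times> nat \<times> nat") auto
  show ?thesis
  proof (cases "s = 0 \<or> \<not> i < ldim l s")
    case True
    then have "ul_fun U (\<lambda>a. coord_ratio n) c = 0" for c
      by (auto simp: coord_ratio_def n ul_fun_def intro: tendsto_Lim[OF U_bot tendsto_const])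
    then show ?thesis using True by (auto simp: rn_map_pos_def rn_map_def n)
  next
    case False
    then obtain s' where s: "s = Suc s'" "i < l s'" by (cases s) auto
    have "(\<lambda>a. coord_ratio n) = ratio g (Suc s') i" by (intro ext) (simp add: coord_ratio_def n s)
    then show ?thesis using rn_ul[OF sp s(2), of g] s by (simp add: rn_map_pos_def rn_map_def n)
  qed
qed

lemma rn_map_pos_tail:
  shows "(\<lambda>m. \<integral>\<omega>. \<bar>coord_ratio n (m, \<omega> m) - rn_map_pos l T \<omega> n\<bar> \<partial>walk l \<sigma> 0 0) \<longlonglongrightarrow> 0"
    and "integrable (walk l \<sigma> 0 0) (\<lambda>\<omega>. rn_map_pos l T \<omega> n)"
proof -
  have 0: "0 < ldim l 0" by simp
  obtain g :: 'g and s i :: nat where n: "from_nat n = (g, s, i)" by (cases "from_nat n :: 'g \<times> nat \<times> nat") auto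
  have "(\<lambda>m. \<integral>\<omega>. \<bar>coord_ratio n (m, \<omega> m) - rn_map_pos l T \<omega> n\<bar> \<partial>walk l \<sigma> 0 0) \<longlonglongrightarrow> 0 \<and>
      integrable (walk l \<sigma> 0 0) (\<lambda>\<omega>. rn_map_pos l T \<omega> n)"
  proof (cases "s = 0 \<or> \<not> i < ldim l s")
    case True
    then have "coord_ratio n e = 0" "rn_map_pos l T \<omega> n = 0" for e \<omega>
      by (auto simp: coord_ratio_def rn_map_pos_def rn_map_def n)
    then show ?thesis by simp
  next
    case False
    then obtain s' where s: "s = Suc s'" "i < l s'" by (cases s) auto
    have e: "coord_ratio n (m, v) = martin l \<sigma> g (Suc s') i m v" "rn_map_pos l T \<omega> n = enn2real (rn T g (Suc s') i \<omega>)" for m v \<omega>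
      using s by (auto simp: coord_ratio_def rn_map_pos_def rn_map_def n)
    have "integrable (base T) (\<lambda>\<omega>. enn2real (rn T g (Suc s') i \<omega>))"
      by (rule rn_integral(1)[OF sigma_system_tail[OF st] sp]) (use s in simp)
    then have "integrable (walk l \<sigma> 0 0) (\<lambda>\<omega>. enn2real (rn T g (Suc s') i \<omega>))"
      unfolding base_tail by (rule integrable_from_subalg[OF subalgebra_tail[OF st 0]])
    then show ?thesis using martin_tendsto_rn[OF st sp s(2), of g] by (simp add: e)
  qed
  then show "(\<lambda>m. \<integral>\<omega>. \<bar>coord_ratio n (m, \<omega> m) - rn_map_pos l T \<omega> n\<bar> \<partial>walk l \<sigma> 0 0) \<longlonglongrightarrow> 0"
    and "integrable (walk l \<sigma> 0 0) (\<lambda>\<omega>. rn_map_pos l T \<omega> n)" by auto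
qed

text \<open>Test functions of the derivatives have the same mean in both systems: on the ultralimit it is
  the limit of the Abel means of what converges to the mean on the tail.\<close>

lemma law_rn_map_pos: "distr (base X) borel (rn_map_pos l X) = distr (base T) borel (rn_map_pos l T)"
proof (rule law_eqI)
  let ?P = "walk l \<sigma> 0 0"
  have 0: "0 < ldim l 0" by simp
  note sub = subalgebra_tail[OF st 0]
  note mX = measurable_rn_map_pos[of l X] and mT = measurable_rn_map_pos[of l T]
  interpret P: prob_space ?P by (rule prob_space_walk[OF st 0])
  interpret P0: ul_prob U "Eset l" "abel_measure l \<sigma> 0 0" by (rule ul_prob_abel[OF 0])
  show "prob_space (distr (base X) borel (rn_map_pos l X))"
    by (rule prob_space.prob_space_distr[OF sys_prob_base[OF sigma_system_ul] mX])
  show "prob_space (distr (base T) borel (rn_map_pos l T))"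
    by (rule prob_space.prob_space_distr[OF sys_prob_base[OF sigma_system_tail[OF st]] mT])
  fix J :: "nat set" and c :: "nat \<Rightarrow> real" and m assume J: "finite J"
  define h where "h z = (\<Prod>n\<in>J. ramp m (z n - c n))" for z :: "nat \<Rightarrow> real"
  have h_meas: "h \<in> borel_measurable borel"
    unfolding h_def
    by (intro borel_measurable_prod measurable_compose[OF _ measurable_ramp] borel_measurable_diff measurable_product_coordinates borel_measurable_const)
  have h_range: "0 \<le> h z" "h z \<le> 1" for z
    unfolding h_def by (auto intro!: prod_nonneg prod_le_1 simp: ramp_range)
  define k where "k e = h (\<lambda>n. coord_ratio n e)" for e
  have k: "0 \<le> k e \<and> k e \<le> 1" for e unfolding k_def using h_range by simp
  have ulk: "ul_fun U (\<lambda>a. k) p = h (\<lambda>n. ul_fun U (\<lambda>a. coord_ratio n) p)" if p: "p \<in> ul_points U (Eset l)" for p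
  proof -
    obtain x where x: "x \<in> fam" "p = cls x" using p by (rule pointsE)
    have t: "((\<lambda>a. coord_ratio n (x a)) \<longlongrightarrow> ul_fun U (\<lambda>a. coord_ratio n) p) U" for n
    proof -
      obtain C where "\<forall>e\<in>Eset l. 0 \<le> coord_ratio n e \<and> coord_ratio n e \<le> C" using coord_ratio_bounded by blast
      then show ?thesis unfolding x(2) by (intro ul_fun_cls[where C=C, OF _ x(1)]) auto
    qed
    have "((\<lambda>a. k (x a)) \<longlongrightarrow> h (\<lambda>n. ul_fun U (\<lambda>a. coord_ratio n) p)) U"
      unfolding k_def h_def by (intro tendsto_prod tendsto_ramp tendsto_diff t tendsto_const)
    moreover have "((\<lambda>a. k (x a)) \<longlongrightarrow> ul_fun U (\<lambda>a. k) p) U"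
      unfolding x(2) by (rule ul_fun_cls[where C=1, OF _ x(1)]) (use k in auto)
    ultimately show ?thesis using tendsto_unique[OF U_bot] by blast
  qed
  have "(\<integral>z. h z \<partial>distr (base X) borel (rn_map_pos l X)) = (\<integral>p. h (rn_map_pos l X p) \<partial>base X)"
    by (rule integral_distr[OF mX h_meas])
  also have "\<dots> = (\<integral>p. ul_fun U (\<lambda>a. k) p \<partial>base X)"
  proof (rule integral_cong_AE)
    show "(\<lambda>p. h (rn_map_pos l X p)) \<in> borel_measurable (base X)" by (rule measurable_compose[OF mX h_meas])
    show "ul_fun U (\<lambda>a. k) \<in> borel_measurable (base X)"
      unfolding nu_X by (rule measurable_ul_fun[where C=1]) (rule k)
    have "AE p in base X. \<forall>n. rn_map_pos l X p n = ul_fun U (\<lambda>a. coord_ratio n) p"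
      unfolding AE_all_countable by (intro allI rn_map_pos_ul)
    then show "AE p in base X. h (rn_map_pos l X p) = ul_fun U (\<lambda>a. k) p"
      using AE_space by eventually_elim (simp add: ulk space_X h_def)
  qed
  finally have X_eq: "(\<integral>z. h z \<partial>distr (base X) borel (rn_map_pos l X)) = (\<integral>p. ul_fun U (\<lambda>a. k) p \<partial>base X)" .
  have lim1: "((\<lambda>a. \<integral>e. k e \<partial>abel_measure l \<sigma> 0 0 a) \<longlongrightarrow> (\<integral>z. h z \<partial>distr (base X) borel (rn_map_pos l X))) U"
  proof -
    have "((\<lambda>a. \<integral>e. k e \<partial>abel_measure l \<sigma> 0 0 a) \<longlongrightarrow> (\<integral>p. ul_fun U (\<lambda>a. k) p \<partial>base X)) U"
      unfolding nu_X by (rule P0.ul_integral_tendsto[where C=1]) (rule k)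
    then show ?thesis by (simp only: X_eq)
  qed
  define u where "u j = (\<integral>\<omega>. k (j, \<omega> j) \<partial>?P)" for j
  define w where "w = (\<integral>\<omega>. h (rn_map_pos l T \<omega>) \<partial>?P)"
  have posm: "(\<lambda>\<omega>. f (j, \<omega> j)) \<in> borel_measurable ?P" for f :: "nat \<times> nat \<times> 'g \<Rightarrow> real" and j
    by (rule measurable_position_walk[OF st sp 0, of "\<lambda>v. f (j, v)"])
  have mTT: "rn_map_pos l T \<in> sigma (path_space l) (tail_sets l) \<rightarrow>\<^sub>M borel"
    using mT unfolding base_tail by (simp add: measurable_cong_sets[OF sets_restr_to_subalg[OF sub] refl])
  have hT: "(\<lambda>\<omega>. h (rn_map_pos l T \<omega>)) \<in> borel_measurable (sigma (path_space l) (tail_sets l))"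
    by (rule measurable_compose[OF mTT h_meas])
  have int_k: "integrable ?P (\<lambda>\<omega>. k (j, \<omega> j))" for j
    by (rule P.integrable_const_bound[where B=1]) (use k posm in auto)
  have int_h: "integrable ?P (\<lambda>\<omega>. h (rn_map_pos l T \<omega>))"
    by (rule P.integrable_const_bound[where B=1]) (use h_range measurable_from_subalg[OF sub hT] in auto)
  have int_c: "integrable ?P (\<lambda>\<omega>. \<bar>coord_ratio n (j, \<omega> j) - rn_map_pos l T \<omega> n\<bar>)" for n j
  proof -
    obtain C where C: "\<forall>e\<in>Eset l. 0 \<le> coord_ratio n e \<and> coord_ratio n e \<le> C" using coord_ratio_bounded by blast
    have "AE \<omega> in ?P. norm (coord_ratio n (j, \<omega> j)) \<le> C"
    proof (rule AE_I2)
      fix \<omega> assume "\<omega> \<in> space ?P"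
      then have "\<omega> j \<in> Vset l j" using path_spaceD by (simp add: space_walk[OF st 0])
      then have "(j, \<omega> j) \<in> Eset l" by (auto simp: Eset_def Vset_def)
      then show "norm (coord_ratio n (j, \<omega> j)) \<le> C" using C by auto
    qed
    then have "integrable ?P (\<lambda>\<omega>. coord_ratio n (j, \<omega> j))"
      by (rule P.integrable_const_bound) (rule posm)
    then show ?thesis
      by (intro integrable_abs Bochner_Integration.integrable_diff rn_map_pos_tail(2))
  qed
  have "u \<longlonglongrightarrow> w"
  proof -
    have bound: "\<bar>u j - w\<bar> \<le> (\<Sum>n\<in>J. real m * (\<integral>\<omega>. \<bar>coord_ratio n (j, \<omega> j) - rn_map_pos l T \<omega> n\<bar> \<partial>?P))" for j
    proof -
      have "\<bar>u j - w\<bar> = \<bar>\<integral>\<omega>. k (j, \<omega> j) - h (rn_map_pos l T \<omega>) \<partial>?P\<bar>"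
        unfolding u_def w_def using int_k int_h by simp
      also have "\<dots> \<le> (\<integral>\<omega>. \<bar>k (j, \<omega> j) - h (rn_map_pos l T \<omega>)\<bar> \<partial>?P)" by (rule integral_abs_bound)
      also have "\<dots> \<le> (\<integral>\<omega>. (\<Sum>n\<in>J. real m * \<bar>coord_ratio n (j, \<omega> j) - rn_map_pos l T \<omega> n\<bar>) \<partial>?P)"
      proof (rule integral_mono)
        fix \<omega>
        have "norm (k (j, \<omega> j) - h (rn_map_pos l T \<omega>)) \<le>
            (\<Sum>n\<in>J. norm (ramp m (coord_ratio n (j, \<omega> j) - c n) - ramp m (rn_map_pos l T \<omega> n - c n)))"
          unfolding k_def h_def by (rule norm_prod_diff) (simp_all add: ramp_range)
        also have "\<dots> \<le> (\<Sum>n\<in>J. real m * \<bar>coord_ratio n (j, \<omega> j) - rn_map_pos l T \<omega> n\<bar>)"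
        proof (rule sum_mono)
          fix n
          show "norm (ramp m (coord_ratio n (j, \<omega> j) - c n) - ramp m (rn_map_pos l T \<omega> n - c n)) \<le>
              real m * \<bar>coord_ratio n (j, \<omega> j) - rn_map_pos l T \<omega> n\<bar>"
            using ramp_lipschitz[of m "coord_ratio n (j, \<omega> j) - c n" "rn_map_pos l T \<omega> n - c n"] by simp
        qed
        finally show "\<bar>k (j, \<omega> j) - h (rn_map_pos l T \<omega>)\<bar> \<le> (\<Sum>n\<in>J. real m * \<bar>coord_ratio n (j, \<omega> j) - rn_map_pos l T \<omega> n\<bar>)" by simp
      next
        show "integrable ?P (\<lambda>\<omega>. \<bar>k (j, \<omega> j) - h (rn_map_pos l T \<omega>)\<bar>)"
          by (intro integrable_abs Bochner_Integration.integrable_diff int_k int_h)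
        show "integrable ?P (\<lambda>\<omega>. \<Sum>n\<in>J. real m * \<bar>coord_ratio n (j, \<omega> j) - rn_map_pos l T \<omega> n\<bar>)"
          by (intro Bochner_Integration.integrable_sum integrable_mult_right int_c)
      qed
      also have "\<dots> = (\<Sum>n\<in>J. real m * (\<integral>\<omega>. \<bar>coord_ratio n (j, \<omega> j) - rn_map_pos l T \<omega> n\<bar> \<partial>?P))"
        by (subst Bochner_Integration.integral_sum) (auto intro: int_c)
      finally show ?thesis .
    qed
    have "(\<lambda>j. \<Sum>n\<in>J. real m * (\<integral>\<omega>. \<bar>coord_ratio n (j, \<omega> j) - rn_map_pos l T \<omega> n\<bar> \<partial>?P)) \<longlonglongrightarrow> (\<Sum>n\<in>J. real m * 0)"
      by (intro tendsto_sum tendsto_mult tendsto_const rn_map_pos_tail(1))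
    then have "(\<lambda>j. \<Sum>n\<in>J. real m * (\<integral>\<omega>. \<bar>coord_ratio n (j, \<omega> j) - rn_map_pos l T \<omega> n\<bar> \<partial>?P)) \<longlonglongrightarrow> 0" by simp
    then have "(\<lambda>j. u j - w) \<longlonglongrightarrow> 0"
      by (rule Lim_null_comparison[rotated]) (intro always_eventually allI, simp add: bound)
    then show ?thesis by (simp add: LIM_zero_iff)
  qed
  moreover have "\<bar>u j\<bar> \<le> 1" for j
  proof -
    have "0 \<le> u j" unfolding u_def using k by simp
    moreover have "u j \<le> (\<integral>\<omega>. 1 \<partial>?P)" unfolding u_def by (rule integral_mono[OF int_k]) (use k in auto)
    ultimately show ?thesis by (simp add: P.prob_space)
  qed
  ultimately have "((\<lambda>a. \<Sum>j. (1 - a) * a ^ j * u j) \<longlongrightarrow> w) U" by (intro abel_tendsto)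
  moreover have "eventually (\<lambda>a. (\<Sum>j. (1 - a) * a ^ j * u j) = (\<integral>e. k e \<partial>abel_measure l \<sigma> 0 0 a)) U"
    using ev_params by (rule eventually_mono) (simp add: abel_integral[OF st _ k] u_def)
  ultimately have "((\<lambda>a. \<integral>e. k e \<partial>abel_measure l \<sigma> 0 0 a) \<longlongrightarrow> w) U"
    by (rule Lim_transform_eventually)
  then have "(\<integral>z. h z \<partial>distr (base X) borel (rn_map_pos l X)) = w"
    using lim1 tendsto_unique[OF U_bot] by blast
  also have "w = (\<integral>\<omega>. h (rn_map_pos l T \<omega>) \<partial>base T)"
    unfolding w_def base_tail by (rule integral_subalgebra2[OF sub hT, symmetric])
  also have "\<dots> = (\<integral>z. h z \<partial>distr (base T) borel (rn_map_pos l T))"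
    by (rule integral_distr[OF mT h_meas, symmetric])
  finally show "(\<integral>z. (\<Prod>n\<in>J. ramp m (z n - c n)) \<partial>distr (base X) borel (rn_map_pos l X)) =
      (\<integral>z. (\<Prod>n\<in>J. ramp m (z n - c n)) \<partial>distr (base T) borel (rn_map_pos l T))"
    by (simp only: h_def)
qed simp_all

text \<open>The tail system extends the model of the ultralimit system, as the laws agree.\<close>

theorem tail_mp_extension: "mp_extension l \<sigma> T (rn_model l X) (rn_map l T)"
proof (rule rn_map_mp_extension[OF sigma_system_tail[OF st] sp])
  fix s j assume j: "j < ldim l s"
  have e: "distr (base X) borel (rn_map l X) = distr (base T) borel (rn_map l T)"
    unfolding law_rn_map_complete[OF sigma_system_ul sp] law_rn_map_complete[OF sigma_system_tail[OF st] sp] law_rn_map_pos ..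
  have "nu (rn_model l X) s j = distr (nu X s j) borel (rn_map l X)" by (simp add: rn_model_def)
  also have "\<dots> = distr (nu T s j) borel (rn_map l T)"
    unfolding law_rn_map_level[OF sigma_system_ul sp j] law_rn_map_level[OF sigma_system_tail[OF st] sp j] e ..
  finally show "nu (rn_model l X) s j = distr (nu T s j) borel (rn_map l T)" .
qed (simp add: rn_model_def)

end

end

section \<open>Point realization and the Poisson boundary\<close>

text \<open>A measure preserving homomorphism from the measure algebra of a standard Borel space is
  induced by a point map.\<close>

lemma measure_algebra_point_map:
  fixes M :: "'x measure" and N :: "'b measure" and \<tau> :: "'b set \<Rightarrow> 'x set"
  assumes M: "prob_space M" and N: "prob_space N" and sb: "standard_borel N"
    and \<tau>: "\<And>A. A \<in> sets N \<Longrightarrow> \<tau> A \<in> sets M"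
    and meas: "\<And>A. A \<in> sets N \<Longrightarrow> measure M (\<tau> A) = measure N A"
    and int: "\<And>A A'. A \<in> sets N \<Longrightarrow> A' \<in> sets N \<Longrightarrow> AE y in M. y \<in> \<tau> (A \<inter> A') \<longleftrightarrow> y \<in> \<tau> A \<and> y \<in> \<tau> A'"
    and compl: "\<And>A. A \<in> sets N \<Longrightarrow> AE y in M. y \<in> \<tau> (space N - A) \<longleftrightarrow> y \<notin> \<tau> A"
  shows "\<exists>p. p \<in> M \<rightarrow>\<^sub>M N \<and> (\<forall>A\<in>sets N. AE y in M. p y \<in> A \<longleftrightarrow> y \<in> \<tau> A)"
proof -
  interpret M: prob_space M by (rule M)
  interpret N: prob_space N by (rule N)
  have full: "AE y in M. y \<in> \<tau> (space N)"
  proof (rule M.AE_prob_1)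
    show "measure M (\<tau> (space N)) = 1" using meas[of "space N"] N.prob_space by simp
  qed
  have union: "AE y in M. y \<in> \<tau> (A \<union> A') \<longleftrightarrow> y \<in> \<tau> A \<or> y \<in> \<tau> A'" if A: "A \<in> sets N" "A' \<in> sets N" for A A'
  proof -
    have e: "A \<union> A' = space N - (space N - A) \<inter> (space N - A')"
      using A[THEN sets.sets_into_space] by blast
    have c: "space N - A \<in> sets N" "space N - A' \<in> sets N" "(space N - A) \<inter> (space N - A') \<in> sets N"
      using A by auto
    show ?thesis
      unfolding e using compl[OF c(3)] int[OF c(1,2)] compl[OF A(1)] compl[OF A(2)]
      by eventually_elim simp
  qed
  \<comment> \<open>Countable unions: what the image of the union contains beyond the union of the images is contained
    in the image of the part of the union outside the first n sets, whose measure tends to 0.\<close>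
  have cup: "AE y in M. y \<in> \<tau> (\<Union>n. A n) \<longleftrightarrow> (\<exists>n. y \<in> \<tau> (A n))" if A: "\<And>n. A n \<in> sets N" for A :: "nat \<Rightarrow> 'b set"
  proof -
    let ?U = "\<Union>n. A n"
    define V where "V n = (\<Union>k<n. A k)" for n
    have U: "?U \<in> sets N" and V: "V n \<in> sets N" for n using A by (auto simp: V_def)
    have 1: "AE y in M. \<forall>n. y \<in> \<tau> (A n) \<longrightarrow> y \<in> \<tau> ?U"
      unfolding AE_all_countable
    proof
      fix n
      have e: "A n \<union> ?U = ?U" by blast
      then show "AE y in M. y \<in> \<tau> (A n) \<longrightarrow> y \<in> \<tau> ?U"
        using union[OF A[of n] U] unfolding e by eventually_elim blast
    qed
    have "AE y in M. y \<notin> \<tau> {}"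
      using full compl[OF sets.top[of N]] by eventually_elim simp
    then have 2: "AE y in M. y \<in> \<tau> (V n) \<longrightarrow> (\<exists>k. y \<in> \<tau> (A k))" for n
    proof (induction n)
      case 0
      have V0: "V 0 = {}" by (simp add: V_def)
      from 0 show ?case unfolding V0 by eventually_elim blast
    next
      case (Suc n)
      have e: "V (Suc n) = V n \<union> A n" by (auto simp: V_def lessThan_Suc)
      have "AE y in M. y \<in> \<tau> (V n) \<longrightarrow> (\<exists>k. y \<in> \<tau> (A k))" by (rule Suc.IH[OF Suc.prems])
      then show ?case using union[OF V[of n] A[of n]]
        unfolding e by eventually_elim blast
    qed
    define R where "R = \<tau> ?U - (\<Union>n. \<tau> (A n))"
    have R: "R \<in> sets M" using \<tau> A U by (auto simp: R_def)
    have le: "measure M R \<le> measure N (?U - V n)" for n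
    proof -
      have d: "?U - V n \<in> sets N" using U V by blast
      have e: "V n \<union> (?U - V n) = ?U" by (auto simp: V_def)
      have "AE y in M. y \<in> R \<longrightarrow> y \<in> \<tau> (?U - V n)"
        using union[OF V[of n] d, unfolded e] 2[of n] by eventually_elim (auto simp: R_def)
      then have "measure M R \<le> measure M (\<tau> (?U - V n))"
        by (rule M.finite_measure_mono_AE) (rule \<tau>[OF d])
      then show ?thesis by (simp add: meas[OF d])
    qed
    have "(\<lambda>n. measure N (?U - V n)) \<longlonglongrightarrow> measure N (\<Inter>n. ?U - V n)"
      using U V by (intro N.finite_Lim_measure_decseq) (auto simp: decseq_def V_def)
    moreover have e: "(\<Inter>n. ?U - V n) = {}" by (auto simp: V_def)
    ultimately have "(\<lambda>n. measure N (?U - V n)) \<longlonglongrightarrow> 0" unfolding e by simp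
    then have "measure M R \<le> 0" by (rule LIMSEQ_le_const) (use le in blast)
    then have "measure M R = 0" using measure_nonneg[of M R] by linarith
    then have "AE y in M. y \<notin> R"
      using R by (simp add: AE_iff_measurable[of R] M.emeasure_eq_measure sets.sets_into_space Int_absorb2 Collect_conj_eq)
    with 1 show ?thesis by eventually_elim (auto simp: R_def)
  qed
  let ?K = "\<Pi>\<^sub>M n\<in>(UNIV::nat set). count_space (UNIV :: bool set)"
  obtain A \<kappa> where A: "\<And>n::nat. A n \<in> sets N" and \<kappa>: "\<kappa> \<in> ?K \<rightarrow>\<^sub>M N"
    and \<kappa>A: "\<And>x. x \<in> space N \<Longrightarrow> \<kappa> (\<lambda>n. x \<in> A n) = x"
    using standard_borel_coding[OF sb N.not_empty] by blast
  define \<iota> where "\<iota> x n \<longleftrightarrow> x \<in> A n" for x n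
  define \<iota>' where "\<iota>' y n \<longleftrightarrow> y \<in> \<tau> (A n)" for y n
  have into_K: "(\<lambda>x n. x \<in> B n) \<in> L \<rightarrow>\<^sub>M ?K" if "\<And>n. B n \<in> sets L" for L :: "'z measure" and B :: "nat \<Rightarrow> 'z set"
  proof (rule measurable_PiM_single')
    fix n
    show "(\<lambda>x. x \<in> B n) \<in> L \<rightarrow>\<^sub>M count_space UNIV"
      using that[of n] by (simp add: pred_sets2 pred_def[symmetric])
  qed simp
  have \<iota>: "\<iota> \<in> N \<rightarrow>\<^sub>M ?K" unfolding \<iota>_def by (rule into_K[OF A])
  have \<iota>': "\<iota>' \<in> M \<rightarrow>\<^sub>M ?K" unfolding \<iota>'_def by (rule into_K[OF \<tau>[OF A]])
  let ?E = "\<lambda>D. \<iota> -` D \<inter> space N"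
  \<comment> \<open>The sequence of truth values of membership in the images of the coding sets is a code of the
    point to be found; both sides respect complements and countable unions of sets of codes.\<close>
  have "D \<in> sets ?K \<Longrightarrow> AE y in M. \<iota>' y \<in> D \<longleftrightarrow> y \<in> \<tau> (?E D)" for D
    unfolding sets_PiM_single
  proof (induction rule: sigma_sets.induct)
    case (Basic D)
    then obtain n S where D: "D = {f. f n \<in> S}" by auto
    have An: "A n \<subseteq> space N" using A sets.sets_into_space by blast
    have c: "AE y in M. y \<in> \<tau> (space N - space N) \<longleftrightarrow> y \<notin> \<tau> (space N)" by (rule compl) simp
    have S: "?E D = (if True \<in> S then if False \<in> S then space N else A n else if False \<in> S then space N - A n else space N - space N)"
      unfolding D using An by (auto simp: \<iota>_def; metis)
    have m: "\<iota>' y \<in> D \<longleftrightarrow> (if True \<in> S then if False \<in> S then True else y \<in> \<tau> (A n) else if False \<in> S then y \<notin> \<tau> (A n) else False)" for y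
      unfolding D by (cases "y \<in> \<tau> (A n)") (simp_all add: \<iota>'_def)
    show ?case
      unfolding S m using compl[OF A[of n]] c full by eventually_elim simp
  next
    case Empty
    have "AE y in M. y \<in> \<tau> (space N - space N) \<longleftrightarrow> y \<notin> \<tau> (space N)" by (rule compl) simp
    then show ?case using full by eventually_elim simp
  next
    case (Compl D)
    have D: "?E D \<in> sets N"
      using Compl.hyps by (intro measurable_sets[OF \<iota>]) (simp add: sets_PiM_single)
    have e: "?E ((\<Pi>\<^sub>E n\<in>UNIV. space (count_space UNIV)) - D) = space N - ?E D" by auto
    show ?case unfolding e using Compl.IH compl[OF D] by eventually_elim (auto simp: PiE_iff)
  next
    case (Union D)
    have D: "?E (D n) \<in> sets N" for n
      using Union.hyps by (intro measurable_sets[OF \<iota>]) (simp add: sets_PiM_single)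
    have 1: "AE y in M. \<forall>n. \<iota>' y \<in> D n \<longleftrightarrow> y \<in> \<tau> (?E (D n))"
      unfolding AE_all_countable using Union.IH by blast
    have e: "?E (\<Union>n. D n) = (\<Union>n. ?E (D n))" by auto
    show ?case unfolding e using 1 cup[of "\<lambda>n. ?E (D n)", OF D] by eventually_elim blast
  qed
  then have key: "AE y in M. \<iota>' y \<in> D \<longleftrightarrow> y \<in> \<tau> (?E D)" if "D \<in> sets ?K" for D using that by blast
  show ?thesis
  proof (intro exI conjI ballI)
    show "\<kappa> \<circ> \<iota>' \<in> M \<rightarrow>\<^sub>M N" by (rule measurable_comp[OF \<iota>' \<kappa>])
    fix C assume C: "C \<in> sets N"
    let ?D = "\<kappa> -` C \<inter> space ?K"
    have D: "?D \<in> sets ?K" by (rule measurable_sets[OF \<kappa> C])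
    have "?E ?D = C"
    proof -
      have "x \<in> ?E ?D \<longleftrightarrow> x \<in> C" if x: "x \<in> space N" for x
      proof -
        have "\<iota> x = (\<lambda>n. x \<in> A n)" by (simp add: \<iota>_def fun_eq_iff)
        then show ?thesis using \<kappa>A[OF x] x measurable_space[OF \<iota> x] by simp
      qed
      then show ?thesis using sets.sets_into_space[OF C] by blast
    qed
    moreover have "\<iota>' y \<in> ?D \<longleftrightarrow> (\<kappa> \<circ> \<iota>') y \<in> C" for y by (simp add: space_PiM)
    ultimately show "AE y in M. (\<kappa> \<circ> \<iota>') y \<in> C \<longleftrightarrow> y \<in> \<tau> C" using key[OF D] by simp
  qed
qed

lemma Linf_isoD:
  assumes "Linf_iso l B X \<Phi>"
  shows "f \<in> Linf (base B) \<Longrightarrow> \<Phi> f \<in> Linf (base X)"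
    and "f \<in> Linf (base B) \<Longrightarrow> f' \<in> Linf (base B) \<Longrightarrow>
      (AE x in base B. f x = f' x) \<longleftrightarrow> (AE y in base X. \<Phi> f y = \<Phi> f' y)"
    and "h \<in> Linf (base X) \<Longrightarrow> \<exists>f\<in>Linf (base B). AE y in base X. \<Phi> f y = h y"
    and "f \<in> Linf (base B) \<Longrightarrow> f' \<in> Linf (base B) \<Longrightarrow> AE y in base X. \<Phi> (\<lambda>x. f x + f' x) y = \<Phi> f y + \<Phi> f' y"
    and "f \<in> Linf (base B) \<Longrightarrow> f' \<in> Linf (base B) \<Longrightarrow> AE y in base X. \<Phi> (\<lambda>x. f x * f' x) y = \<Phi> f y * \<Phi> f' y"
    and "f \<in> Linf (base B) \<Longrightarrow> AE y in base X. \<Phi> (\<lambda>x. f (act B (- g) x)) y = \<Phi> f (act X (- g) y)"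
    and "f \<in> Linf (base B) \<Longrightarrow> j < ldim l s \<Longrightarrow> (\<integral>x. f x \<partial>nu B s j) = (\<integral>y. \<Phi> f y \<partial>nu X s j)"
  using assms unfolding Linf_iso_def by simp_all

lemma integral_indicator_complex:
  assumes "finite_measure M" and A: "A \<in> sets M"
  shows "(\<integral>x. indicator A x \<partial>M) = complex_of_real (measure M A)"
proof -
  interpret finite_measure M by fact
  have "(\<integral>x. indicator A x *\<^sub>R (1::complex) \<partial>M) = measure M A *\<^sub>R 1"
    using A by (intro has_bochner_integral_integral_eq has_bochner_integral_indicator) (simp_all add: emeasure_eq_measure)
  moreover have e: "(\<lambda>x. indicator A x *\<^sub>R (1::complex)) = indicator A" by (auto simp: indicator_def)
  ultimately show ?thesis unfolding e by (simp only: scaleR_conv_of_real mult_1_right)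
qed

lemma indicator_Linf: "A \<in> sets M \<Longrightarrow> indicator A \<in> Linf M"
  unfolding Linf_def by (auto intro!: exI[of _ 1] AE_I2 borel_measurable_indicator simp: indicator_def)

text \<open>An isomorphism from the algebra of a standard Borel system yields a factor map to that system
  under which every measurable set is a preimage, up to a null set.\<close>

lemma Linf_iso_point_map:
  fixes \<sigma> :: "('g::{group_add,countable}) mseq" and X :: "('g, 'x) gsystem" and B :: "('g, 'b) gsystem"
  assumes X: "sigma_system l \<sigma> X" and B: "sigma_system l \<sigma> B" and sp: "spread l \<sigma>"
    and sb: "standard_borel (base B)" and iso: "Linf_iso l B X \<Phi>"
  shows "\<exists>p. factor_map l \<sigma> X B p \<and> (\<forall>S\<in>sets (base X). \<exists>A\<in>sets (base B). AE y in base X. y \<in> S \<longleftrightarrow> p y \<in> A)"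
proof -
  let ?M = "base X" and ?N = "base B"
  note isoD = Linf_isoD[OF iso]
  define e where "e A = \<Phi> (indicator A)" for A
  \<comment> \<open>The image of an indicator function is idempotent, hence an indicator function almost everywhere.\<close>
  define \<tau> where "\<tau> A = {y \<in> space ?M. e A y = 1}" for A
  have e_Linf: "e A \<in> Linf ?M" if "A \<in> sets ?N" for A
    unfolding e_def by (rule isoD(1)[OF indicator_Linf[OF that]])
  have \<tau>: "\<tau> A \<in> sets ?M" if "A \<in> sets ?N" for A
  proof -
    have "e A \<in> borel_measurable ?M" using e_Linf[OF that] by (simp add: Linf_def)
    then have "e A -` {1} \<inter> space ?M \<in> sets ?M" by (rule measurable_sets) simp
    moreover have "e A -` {1} \<inter> space ?M = \<tau> A" by (auto simp: \<tau>_def)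
    ultimately show ?thesis by simp
  qed
  have e_int: "AE y in ?M. e (A \<inter> A') y = e A y * e A' y" if A: "A \<in> sets ?N" "A' \<in> sets ?N" for A A'
  proof -
    have "(\<lambda>x. indicator A x * indicator A' x :: complex) = indicator (A \<inter> A')" by (auto simp: indicator_def)
    then show ?thesis using isoD(5)[OF indicator_Linf[OF A(1)] indicator_Linf[OF A(2)]] by (simp add: e_def)
  qed
  have e_01: "AE y in ?M. e A y = indicator (\<tau> A) y" if A: "A \<in> sets ?N" for A
    using e_int[OF A A] AE_space
  proof eventually_elim
    case (elim y)
    then have "e A y * (e A y - 1) = 0" by (simp add: algebra_simps)
    then show ?case using elim by (auto simp: \<tau>_def indicator_def)
  qed
  have meas: "emeasure (nu X s j) (\<tau> A) = emeasure (nu B s j) A" if A: "A \<in> sets ?N" and j: "j < ldim l s" for A s j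
  proof -
    interpret XP: prob_space "nu X s j" by (rule sys_prob[OF X j])
    interpret BP: prob_space "nu B s j" by (rule sys_prob[OF B j])
    have sA: "A \<in> sets (nu B s j)" "\<tau> A \<in> sets (nu X s j)"
      using A \<tau>[OF A] by (simp_all add: sys_sets[OF B j] sys_sets[OF X j])
    have "complex_of_real (measure (nu B s j) A) = (\<integral>x. indicator A x \<partial>nu B s j)"
      by (rule integral_indicator_complex[OF BP.finite_measure_axioms sA(1), symmetric])
    also have "\<dots> = (\<integral>y. e A y \<partial>nu X s j)" unfolding e_def by (rule isoD(7)[OF indicator_Linf[OF A] j])
    also have "\<dots> = (\<integral>y. indicator (\<tau> A) y \<partial>nu X s j)"
    proof (rule integral_cong_AE)
      have "e A \<in> borel_measurable ?M" using e_Linf[OF A] by (simp add: Linf_def)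
      then show "e A \<in> borel_measurable (nu X s j)" by (simp only: measurable_sys_nu[OF X j])
      show "AE y in nu X s j. e A y = indicator (\<tau> A) y" by (rule sys_AE_nu[OF X sp j e_01[OF A]])
    qed (use sA in simp)
    also have "\<dots> = complex_of_real (measure (nu X s j) (\<tau> A))"
      by (rule integral_indicator_complex[OF XP.finite_measure_axioms sA(2)])
    finally show ?thesis by (simp add: XP.emeasure_eq_measure BP.emeasure_eq_measure)
  qed
  have meas0: "measure ?M (\<tau> A) = measure ?N A" if "A \<in> sets ?N" for A
    using meas[OF that, of 0 0] by (simp add: measure_def)
  interpret MP: prob_space ?M by (rule sys_prob_base[OF X])
  interpret NP: prob_space ?N by (rule sys_prob_base[OF B])
  have "AE y in ?M. y \<in> \<tau> (space ?N)"
    by (rule MP.AE_prob_1) (simp add: meas0 NP.prob_space)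
  then have e_full: "AE y in ?M. e (space ?N) y = 1"
    by (rule AE_mp) (rule AE_I2, simp add: \<tau>_def)
  obtain p where p: "p \<in> ?M \<rightarrow>\<^sub>M ?N" and p\<tau>: "\<And>A. A \<in> sets ?N \<Longrightarrow> AE y in ?M. p y \<in> A \<longleftrightarrow> y \<in> \<tau> A"
  proof -
    have "\<exists>p. p \<in> ?M \<rightarrow>\<^sub>M ?N \<and> (\<forall>A\<in>sets ?N. AE y in ?M. p y \<in> A \<longleftrightarrow> y \<in> \<tau> A)"
    proof (rule measure_algebra_point_map[OF MP.prob_space_axioms NP.prob_space_axioms sb \<tau> meas0])
      fix A A' assume A: "A \<in> sets ?N" "A' \<in> sets ?N"
      then have i: "A \<inter> A' \<in> sets ?N" by blast
      show "AE y in ?M. y \<in> \<tau> (A \<inter> A') \<longleftrightarrow> y \<in> \<tau> A \<and> y \<in> \<tau> A'"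
        using e_int[OF A] e_01[OF A(1)] e_01[OF A(2)] e_01[OF i]
      proof eventually_elim
        case (elim y)
        then show ?case
          by (cases "y \<in> \<tau> A"; cases "y \<in> \<tau> A'"; cases "y \<in> \<tau> (A \<inter> A')") simp_all
      qed
    next
      fix A assume A: "A \<in> sets ?N"
      then have c: "space ?N - A \<in> sets ?N" by blast
      have "(AE x in ?N. indicator A x + indicator (space ?N - A) x = (indicator (space ?N) x :: complex))"
        by (rule AE_I2) (auto simp: indicator_def)
      moreover have "(\<lambda>x. indicator A x + indicator (space ?N - A) x :: complex) \<in> Linf ?N"
        using A c unfolding Linf_def
        by (auto intro!: exI[of _ 1] AE_I2 borel_measurable_add borel_measurable_indicator simp: indicator_def)
      ultimately have "AE y in ?M. \<Phi> (\<lambda>x. indicator A x + indicator (space ?N - A) x) y = e (space ?N) y"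
        unfolding e_def by (subst isoD(2)[symmetric]) (auto intro: indicator_Linf)
      then show "AE y in ?M. y \<in> \<tau> (space ?N - A) \<longleftrightarrow> y \<notin> \<tau> A"
        using isoD(4)[OF indicator_Linf[OF A] indicator_Linf[OF c]] e_full e_01[OF A] e_01[OF c]
        by eventually_elim (auto simp: e_def indicator_def split: if_splits)
    qed
    then show thesis using that by blast
  qed
  have "factor_map l \<sigma> X B p"
    unfolding factor_map_def
  proof (intro conjI allI impI X B p)
    fix g
    obtain A where A: "\<And>n::nat. A n \<in> sets ?N"
      and sep: "\<And>x y. x \<in> space ?N \<Longrightarrow> y \<in> space ?N \<Longrightarrow> (\<forall>n. x \<in> A n \<longleftrightarrow> y \<in> A n) \<Longrightarrow> x = y"
      using standard_borel_separating[OF sb NP.not_empty] by blast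
    have aX: "act X g \<in> ?M \<rightarrow>\<^sub>M ?M" and aB: "act B g \<in> ?N \<rightarrow>\<^sub>M ?N"
      using X B by (auto simp: sigma_system_def)
    have "AE y in ?M. \<forall>n. act B g (p y) \<in> A n \<longleftrightarrow> p (act X g y) \<in> A n"
      unfolding AE_all_countable
    proof
      fix n
      let ?A = "act B g -` A n \<inter> space ?N"
      have A': "?A \<in> sets ?N" by (rule measurable_sets[OF aB A])
      have "(\<lambda>x. indicator (A n) (act B g x)) \<in> borel_measurable ?N"
        by (rule measurable_compose[OF aB borel_measurable_indicator[OF A]])
      then have L: "(\<lambda>x. indicator (A n) (act B g x) :: complex) \<in> Linf ?N"
        unfolding Linf_def by (auto intro!: exI[of _ 1] AE_I2 simp: indicator_def)
      have "AE x in ?N. indicator (A n) (act B g x) = (indicator ?A x :: complex)"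
        by (rule AE_I2) (auto simp: indicator_def)
      then have "AE y in ?M. \<Phi> (\<lambda>x. indicator (A n) (act B g x)) y = e ?A y"
        unfolding e_def by (subst isoD(2)[symmetric, OF L indicator_Linf[OF A']])
      moreover have "AE y in ?M. \<Phi> (\<lambda>x. indicator (A n) (act B g x)) y = e (A n) (act X g y)"
        using isoD(6)[OF indicator_Linf[OF A[of n]], of "- g"] by (simp add: e_def)
      ultimately show "AE y in ?M. act B g (p y) \<in> A n \<longleftrightarrow> p (act X g y) \<in> A n"
        using p\<tau>[OF A'] sys_AE_act[OF X sp p\<tau>[OF A[of n]], of g] AE_space
      proof eventually_elim
        case (elim y)
        have "act B g (p y) \<in> A n \<longleftrightarrow> p y \<in> ?A" using measurable_space[OF p elim(5)] by simp
        also have "\<dots> \<longleftrightarrow> e ?A y = 1" using elim by (simp add: \<tau>_def)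
        also have "\<dots> \<longleftrightarrow> e (A n) (act X g y) = 1" using elim by simp
        also have "\<dots> \<longleftrightarrow> p (act X g y) \<in> A n" using elim measurable_space[OF aX elim(5)] by (simp add: \<tau>_def)
        finally show ?case .
      qed
    qed
    then show "AE y in ?M. p (act X g y) = act B g (p y)"
      using AE_space
    proof eventually_elim
      case (elim y)
      show ?case
      proof (rule sep)
        show "p (act X g y) \<in> space ?N" by (rule measurable_space[OF p measurable_space[OF aX elim(2)]])
        show "act B g (p y) \<in> space ?N" by (rule measurable_space[OF aB measurable_space[OF p elim(2)]])
      qed (use elim in simp)
    qed
  next
    fix s j assume j: "j < ldim l s"
    show "distr (nu X s j) ?N p = nu B s j"
    proof (rule measure_eqI)
      fix A assume "A \<in> sets (distr (nu X s j) ?N p)"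
      then have A: "A \<in> sets ?N" by simp
      have pm: "p \<in> nu X s j \<rightarrow>\<^sub>M ?N" using p by (simp only: measurable_sys_nu[OF X j])
      have "emeasure (distr (nu X s j) ?N p) A = emeasure (nu X s j) (p -` A \<inter> space (nu X s j))"
        by (rule emeasure_distr[OF pm A])
      also have "\<dots> = emeasure (nu X s j) (\<tau> A)"
      proof (rule emeasure_eq_AE)
        show "AE y in nu X s j. y \<in> p -` A \<inter> space (nu X s j) \<longleftrightarrow> y \<in> \<tau> A"
          using sys_AE_nu[OF X sp j p\<tau>[OF A]] AE_space by eventually_elim simp
        show "p -` A \<inter> space (nu X s j) \<in> sets (nu X s j)" by (rule measurable_sets[OF pm A])
        show "\<tau> A \<in> sets (nu X s j)" using \<tau>[OF A] by (simp add: sys_sets[OF X j])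
      qed
      finally show "emeasure (distr (nu X s j) ?N p) A = emeasure (nu B s j) A"
        by (simp add: meas[OF A j])
    qed (simp add: sys_sets[OF B j])
  qed
  moreover have "\<exists>A\<in>sets ?N. AE y in ?M. y \<in> S \<longleftrightarrow> p y \<in> A" if S: "S \<in> sets ?M" for S
  proof -
    obtain f where f: "f \<in> Linf ?N" and fS: "AE y in ?M. \<Phi> f y = indicator S y"
      using isoD(3)[OF indicator_Linf[OF S]] by blast
    have fm: "f \<in> borel_measurable ?N" using f by (simp add: Linf_def)
    let ?A = "f -` {1} \<inter> space ?N"
    have A: "?A \<in> sets ?N" by (rule measurable_sets[OF fm]) simp
    obtain C where C: "AE x in ?N. norm (f x) \<le> C" using f by (auto simp: Linf_def)
    have "AE x in ?N. norm (f x * f x) \<le> C * C"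
      using C by eventually_elim (simp add: norm_mult mult_mono')
    then have ff: "(\<lambda>x. f x * f x) \<in> Linf ?N" using fm by (auto simp: Linf_def intro!: borel_measurable_times)
    have "AE y in ?M. \<Phi> (\<lambda>x. f x * f x) y = \<Phi> f y"
      using isoD(5)[OF f f] fS by eventually_elim (simp add: indicator_def)
    then have "AE x in ?N. f x * f x = f x" by (subst isoD(2)[OF ff f])
    then have "AE x in ?N. f x = indicator ?A x"
      using AE_space
    proof eventually_elim
      case (elim x)
      then have "f x * (f x - 1) = 0" by (simp add: algebra_simps)
      then show ?case using elim by (auto simp: indicator_def)
    qed
    then have "AE y in ?M. \<Phi> f y = e ?A y"
      unfolding e_def by (subst (asm) isoD(2)[OF f indicator_Linf[OF A]])
    then have "AE y in ?M. y \<in> S \<longleftrightarrow> p y \<in> ?A"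
      using fS p\<tau>[OF A] AE_space
    proof eventually_elim
      case (elim y)
      have "p y \<in> ?A \<longleftrightarrow> e ?A y = 1" using elim by (simp add: \<tau>_def)
      also have "\<dots> \<longleftrightarrow> y \<in> S" using elim(1)[symmetric] elim(2) by (simp add: indicator_def)
      finally show ?case by simp
    qed
    then show ?thesis using A by blast
  qed
  ultimately show ?thesis by blast
qed

text \<open>Conversely, composition with such a factor map is an isomorphism of algebras.\<close>

lemma Linf_iso_factor_map:
  fixes \<sigma> :: "('g::{group_add,countable}) mseq" and X :: "('g, 'x) gsystem" and W :: "('g, 'w) gsystem"
  assumes f: "factor_map l \<sigma> X W \<pi>" and sp: "spread l \<sigma>"
    and gen: "\<And>S. S \<in> sets (base X) \<Longrightarrow> \<exists>C\<in>sets (base W). AE x in base X. x \<in> S \<longleftrightarrow> \<pi> x \<in> C"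
  shows "Linf_iso l W X (\<lambda>f x. f (\<pi> x))"
proof -
  let ?M = "base X" and ?N = "base W"
  note fD = factor_mapD[OF f]
  have d: "distr ?M ?N \<pi> = ?N" by (rule fD(5)) simp
  have AE_iff: "(AE y in ?N. Q y) \<longleftrightarrow> (AE x in ?M. Q (\<pi> x))" if "{y \<in> space ?N. Q y} \<in> sets ?N" for Q
    using AE_distr_iff[OF fD(3) that] unfolding d .
  show ?thesis
    unfolding Linf_iso_def
  proof (intro conjI ballI allI impI)
    fix h assume "h \<in> Linf ?N"
    then have h: "h \<in> borel_measurable ?N" "\<exists>C. AE x in ?N. norm (h x) \<le> C" by (auto simp: Linf_def)
    then obtain C where "AE x in ?N. norm (h x) \<le> C" by blast
    from factor_map_AE[OF f this]
    show "(\<lambda>x. h (\<pi> x)) \<in> Linf ?M" using measurable_compose[OF fD(3) h(1)] by (auto simp: Linf_def)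
    fix g
    show "AE y in ?M. h (act W (- g) (\<pi> y)) = h (\<pi> (act X (- g) y))"
      using fD(4)[of "- g"] by eventually_elim simp
  next
    fix h h' assume "h \<in> Linf ?N" "h' \<in> Linf ?N"
    then have "h \<in> borel_measurable ?N" "h' \<in> borel_measurable ?N" by (auto simp: Linf_def)
    then have "{y \<in> space ?N. h y = h' y} \<in> sets ?N" by (rule measurable_eq_standard_borel[OF standard_borel_borel])
    then show "(AE x in ?N. h x = h' x) \<longleftrightarrow> (AE y in ?M. h (\<pi> y) = h' (\<pi> y))" by (rule AE_iff)
  next
    fix h assume "h \<in> Linf ?M"
    then have h: "h \<in> borel_measurable ?M" "\<exists>C. AE x in ?M. norm (h x) \<le> C" by (auto simp: Linf_def)
    obtain r where r: "r \<in> borel_measurable ?N" "AE x in ?M. r (\<pi> x) = h x"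
    proof (rule AE_factorization[OF standard_borel_borel _ h(1) fD(3)])
      fix A :: "complex set" assume "A \<in> sets borel"
      then have "h -` A \<inter> space ?M \<in> sets ?M" by (rule measurable_sets[OF h(1)])
      from gen[OF this] obtain C where C: "C \<in> sets ?N" "AE x in ?M. x \<in> h -` A \<inter> space ?M \<longleftrightarrow> \<pi> x \<in> C" by blast
      have "AE x in ?M. h x \<in> A \<longleftrightarrow> \<pi> x \<in> C" using C(2) AE_space by eventually_elim simp
      then show "\<exists>C\<in>sets ?N. AE x in ?M. h x \<in> A \<longleftrightarrow> \<pi> x \<in> C" using C(1) by blast
    qed (simp, rule that)
    obtain C where "AE x in ?M. norm (h x) \<le> C" using h(2) by blast
    with r(2) have 1: "AE x in ?M. norm (r (\<pi> x)) \<le> C" by eventually_elim simp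
    have "{y \<in> space ?N. norm (r y) \<le> C} \<in> sets ?N" using r(1) by measurable
    from AE_iff[OF this] 1 have "AE y in ?N. norm (r y) \<le> C" by simp
    then have "r \<in> Linf ?N" using r(1) by (auto simp: Linf_def)
    then show "\<exists>f\<in>Linf ?N. AE y in ?M. f (\<pi> y) = h y" using r(2) by blast
  next
    fix h s j assume "h \<in> Linf ?N" and j: "j < ldim l s"
    then have h: "h \<in> borel_measurable ?N" by (simp add: Linf_def)
    have "\<pi> \<in> nu X s j \<rightarrow>\<^sub>M ?N" using fD(3) by (simp only: measurable_sys_nu[OF fD(1) j])
    from integral_distr[OF this h] show "(\<integral>x. h x \<partial>nu W s j) = (\<integral>y. h (\<pi> y) \<partial>nu X s j)"
      by (simp add: fD(5)[OF j])
  qed simp_all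
qed

context ul_sys
begin

context
  assumes sp: "spread l \<sigma>"
begin

lemma tail_generated:
  assumes "S \<in> sets (base T)"
  shows "\<exists>C\<in>sets (base (rn_model l X)). AE x in base T. x \<in> S \<longleftrightarrow> rn_map l T x \<in> C"
proof -
  have "S \<in> tail_sets l" using assms by (simp add: sets_tail[OF st])
  then show ?thesis using tail_sets_generated_by_rn[OF st sp, of S] by (simp add: rn_model_def)
qed

lemma factor_map_tail: "factor_map l \<sigma> T (rn_model l X) (rn_map l T)"
  using tail_mp_extension[OF sp] by (simp add: mp_extension_def)

lemma poisson_boundary_rn_model: "poisson_boundary l \<sigma> (rn_model l X)"
  unfolding poisson_boundary_def
  using factor_mapD(2)[OF factor_map_tail] standard_borel_rn_model
    Linf_iso_factor_map[OF factor_map_tail sp tail_generated] by blast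

lemma poisson_boundary_iso:
  fixes B :: "('g, 'b) gsystem"
  assumes "poisson_boundary l \<sigma> B"
  shows "system_iso l \<sigma> (rn_model l X) B"
proof -
  obtain \<Phi> where B: "sigma_system l \<sigma> B" and sb: "standard_borel (base B)" and iso: "Linf_iso l B T \<Phi>"
    using assms by (auto simp: poisson_boundary_def)
  obtain p where p: "factor_map l \<sigma> T B p"
    and gen: "\<And>S. S \<in> sets (base T) \<Longrightarrow> \<exists>A\<in>sets (base B). AE y in base T. y \<in> S \<longleftrightarrow> p y \<in> A"
    using Linf_iso_point_map[OF sigma_system_tail[OF st] B sp sb iso] by blast
  show ?thesis
  proof (rule system_iso_same_sets[OF p factor_map_tail sp sb standard_borel_rn_model])
    fix A assume "A \<in> sets (base B)"
    then have "p -` A \<inter> space (base T) \<in> sets (base T)" by (rule measurable_sets[OF factor_mapD(3)[OF p]])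
    from tail_generated[OF this] obtain C where C: "C \<in> sets (base (rn_model l X))"
      "AE x in base T. x \<in> p -` A \<inter> space (base T) \<longleftrightarrow> rn_map l T x \<in> C" by blast
    have "AE x in base T. p x \<in> A \<longleftrightarrow> rn_map l T x \<in> C" using C(2) AE_space by eventually_elim simp
    then show "\<exists>C\<in>sets (base (rn_model l X)). AE x in base T. p x \<in> A \<longleftrightarrow> rn_map l T x \<in> C" using C(1) by blast
  next
    fix C assume "C \<in> sets (base (rn_model l X))"
    then have "rn_map l T -` C \<inter> space (base T) \<in> sets (base T)"
      by (rule measurable_sets[OF factor_mapD(3)[OF factor_map_tail]])
    from gen[OF this] obtain A where A: "A \<in> sets (base B)"
      "AE x in base T. x \<in> rn_map l T -` C \<inter> space (base T) \<longleftrightarrow> p x \<in> A" by blast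
    have "AE x in base T. rn_map l T x \<in> C \<longleftrightarrow> p x \<in> A" using A(2) AE_space by eventually_elim simp
    then show "\<exists>A\<in>sets (base B). AE x in base T. rn_map l T x \<in> C \<longleftrightarrow> p x \<in> A" using A(1) by blast
  qed
qed

end

end

theorem theorem3p1p9:
  fixes l :: "nat \<Rightarrow> nat"
    and \<sigma> :: "nat \<Rightarrow> nat \<Rightarrow> nat \<Rightarrow> 'g::{group_add, countable} \<Rightarrow> ennreal"
    and U :: "real filter"
  assumes "stochastic_sequence l \<sigma>"
    and "\<forall>j<l 0. \<forall>g. 0 < \<sigma> 0 0 j g"
    and "no_zero_column l \<sigma>"
    and "ultrafilter U"
    and "eventually (\<lambda>a. a \<in> {1/2<..<1}) U"
    and "((\<lambda>a. a) \<longlongrightarrow> 1) U"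
  shows "(\<exists>B :: ('g, nat \<Rightarrow> real) gsystem. poisson_boundary l \<sigma> B) \<and>
    (\<exists>Z :: ('g, nat \<Rightarrow> real) gsystem. rn_factor l \<sigma> (ul_system U l \<sigma>) Z) \<and>
    (\<forall>(B :: ('g, 'b) gsystem) (Z :: ('g, 'z) gsystem).
       poisson_boundary l \<sigma> B \<longrightarrow> rn_factor l \<sigma> (ul_system U l \<sigma>) Z \<longrightarrow> system_iso l \<sigma> B Z)"
proof -
  interpret ul_sys U l \<sigma> by unfold_locales (rule assms)+
  have sp: "spread l \<sigma>" using assms(2,3) by (simp add: spread_def)
  show ?thesis
  proof (intro conjI allI impI)
    show "\<exists>B :: ('g, nat \<Rightarrow> real) gsystem. poisson_boundary l \<sigma> B"
      using poisson_boundary_rn_model[OF sp] by blast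
    show "\<exists>Z :: ('g, nat \<Rightarrow> real) gsystem. rn_factor l \<sigma> (ul_system U l \<sigma>) Z"
      using rn_factor_rn_model[OF sigma_system_ul sp] by blast
    fix B :: "('g, 'b) gsystem" and Z :: "('g, 'z) gsystem"
    assume B: "poisson_boundary l \<sigma> B" and Z: "rn_factor l \<sigma> (ul_system U l \<sigma>) Z"
    show "system_iso l \<sigma> B Z"
      by (rule system_iso_trans[OF system_iso_sym[OF poisson_boundary_iso[OF sp B]]
            rn_factor_unique[OF sigma_system_ul sp Z]])
  qed
qed

end
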